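(* Let $\Pi=\{\mathcal H_0\oplus\mathcal H_1,\Gamma_0,\Gamma_1\}$ be a decomposing $D$-triplet for $L$. Then for every collection $\tau=\{\tau_+,\tau_-\}\in\widetilde R(\mathcal H_0,\mathcal H_1)$ the corresponding Green function $G_\tau$ (defined in the context) admits the representation $$G_\tau(x,t,\lambda)=Y_0(x,\lambda)\big(\Omega_\tau(\lambda)+\tfrac12\,\mathrm{sgn}(t-x)J_{H^n}\big)Y_0^*(t,\overline\lambda),\qquad\lambda\in\mathbb C_+\cup\mathbb C_-,$$ where $Y_0(\cdot,\lambda):\Delta\to[H^n\oplus H^n,H]$ is the operator solution of $l[y]-\lambda y=0$ with $\widetilde Y_0(0,\lambda)=I_{H^n\oplus H^n}$, $J_{H^n}=\begin{pmatrix}0&-I_{H^n}\\ I_{H^n}&0\end{pmatrix}$, and $\Omega_\tau:\mathbb C_+\cup\mathbb C_-\to[H^n\oplus H^n]$ is the operator function associated with $\tau$ in the context.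
   Context: **Setting.** $[X,Y]$ is the set of bounded linear operators from a Hilbert space $X$ to a Hilbert space $Y$, $[X]=[X,X]$; for $T\in[X,Y]$, $0\in\rho(T)$ means $T^{-1}\in[Y,X]$. $\mathbb C_\pm$ are the open upper/lower half-planes. $\Delta=[0,b\rangle$ with $0<b\le\infty$ (if $b<\infty$, $b$ may or may not belong to $\Delta$), $H$ is a separable complex Hilbert space ($\dim H\le\infty$), $D=d/dt$, and $$l[y]=\sum_{k=1}^n(-1)^k\Big(D^k(p_{n-k}D^ky)-\tfrac i2\big[D^{k-1}(q_{n-k}^*D^ky)+D^k(q_{n-k}D^{k-1}y)\big]\Big)+p_ny$$ with sufficiently smooth coefficients $p_k,q_k:\Delta\to[H]$, $p_k(t)=p_k^*(t)$, $0\in\rho(p_0(t))$. Quasi-derivatives: $y^{[k]}=D^ky$ ($0\le k\le n-1$), $y^{[n]}=p_0D^ny-\frac i2q_0D^{n-1}y$, $y^{[n+k]}=-Dy^{[n+k-1]}+p_kD^{n-k}y+\frac i2(q_{k-1}^*D^{n-k+1}y-q_kD^{n-k-1}y)$ ($1\le k\le n-1$), $y^{[2n]}=-Dy^{[2n-1]}+p_ny+\frac i2q_{n-1}^*Dy=l[y]$; the same formulas apply to operator functions $Y:\Delta\to[\mathcal K,H]$. Put $y^{(1)}(t)=(y^{[0]}(t),\dots,y^{[n-1]}(t))$, $y^{(2)}(t)=(y^{[2n-1]}(t),\dots,y^{[n]}(t))$ (columns, in $H^n$, resp. $[\mathcal K,H^n]$), $\widetilde y(t)=\{y^{(1)}(t),y^{(2)}(t)\}$.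 An operator solution of $l[y]-\lambda y=0$ is a $[\mathcal K,H]$-valued solution $Y$; it is uniquely determined by $\widetilde Y(0)\in[\mathcal K,H^n\oplus H^n]$, which may be arbitrary. $\mathfrak H=L_2(\Delta;H)$. The maximal operator $L$ has domain $\mathcal D=\{y\in\mathfrak H:\ y^{[k]}\ (0\le k\le2n-2)$ continuously differentiable, $y^{[2n-1]}$ (locally) absolutely continuous, $l[y]\in\mathfrak H\}$ and $Ly=l[y]$. Put $[y,z](t)=(y^{(1)}(t),z^{(2)}(t))-(y^{(2)}(t),z^{(1)}(t))$, $[y,z](b)=\lim_{t\uparrow b}[y,z](t)$. The minimal operator $L_0$ is the restriction of $L$ to $\{y\in\mathcal D:\widetilde y(0)=0,\ [y,z](b)=0\ \forall z\in\mathcal D\}$; $L_0^*=L$. $\mathfrak N_\lambda(L_0)=\mathrm{Ker}(L-\lambda)$. **Decomposing $D$-triplet.** $\mathcal H_1'$ is a subspace of a Hilbert space $\mathcal H_0'$, $\mathcal H_2'=\mathcal H_0'\ominus\mathcal H_1'$, $P_2'$ is the orthoprojector in $\mathcal H_0'$ onto $\mathcal H_2'$, $\Gamma_j':\mathcal D\to\mathcal H_j'$ ($j=0,1$) are linear, $\mathcal H_j=H^n\oplus\mathcal H_j'$, $\Gamma_0y=\{y^{(2)}(0),\Gamma_0'y\}$, $\Gamma_1y=\{-y^{(1)}(0),\Gamma_1'y\}$. $\Pi=\{\mathcal H_0\oplus\mathcal H_1,\Gamma_0,\Gamma_1\}$ is a decomposing $D$-triplet for $L$ if $(\Gamma_0'\;\Gamma_1')^\top:\mathcal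 D\to\mathcal H_0'\oplus\mathcal H_1'$ is surjective and $[y,z](b)=(\Gamma_1'y,\Gamma_0'z)-(\Gamma_0'y,\Gamma_1'z)+i(P_2'\Gamma_0'y,P_2'\Gamma_0'z)$, $y,z\in\mathcal D$. Put $\mathcal H_2=\mathcal H_0\ominus\mathcal H_1$ and let $P_j$ be the orthoprojector in $\mathcal H_0$ onto $\mathcal H_j$, $j=1,2$. **$\gamma$-fields, Weyl functions.** $\gamma_+(\lambda)=(\Gamma_0\upharpoonright\mathfrak N_\lambda(L_0))^{-1}\in[\mathcal H_0,\mathfrak H]$ ($\lambda\in\mathbb C_+$), $\gamma_-(z)=(P_1\Gamma_0\upharpoonright\mathfrak N_z(L_0))^{-1}\in[\mathcal H_1,\mathfrak H]$ ($z\in\mathbb C_-$); $M_+(\lambda)\in[\mathcal H_0,\mathcal H_1]$, $M_-(z)\in[\mathcal H_1,\mathcal H_0]$ are defined by $\Gamma_1y=M_+(\lambda)\Gamma_0y$ ($y\in\mathfrak N_\lambda(L_0)$, $\lambda\in\mathbb C_+$) and $(\Gamma_1+iP_2\Gamma_0)y=M_-(z)P_1\Gamma_0y$ ($y\in\mathfrak N_z(L_0)$, $z\in\mathbb C_-$). $Z_+(\cdot,\lambda):\Delta\to[\mathcal H_0,H]$ and $Z_-(\cdot,z):\Delta\to[\mathcal H_1,H]$ are the operator solutions with $Z_+(t,\lambda)h_0=(\gamma_+(\lambda)h_0)(t)$, $Z_-(t,z)h_1=(\gamma_-(z)h_1)(t)$. $Z_0(t,\lambda)=Z_\pm(t,\lambda)$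 for $\lambda\in\mathbb C_\pm$. **Class $\widetilde R(\mathcal H_0,\mathcal H_1)$.** It consists of collections $\tau=\{\tau_+,\tau_-\}$, $\tau_+(\lambda)=\{(C_0(\lambda),C_1(\lambda));\mathcal K_+\}$ ($\lambda\in\mathbb C_+$), $\tau_-(\lambda)=\{(D_0(\lambda),D_1(\lambda));\mathcal K_-\}$ ($\lambda\in\mathbb C_-$), of (equivalence classes of) holomorphic operator pairs $C_j(\lambda)\in[\mathcal H_j,\mathcal K_+]$, $D_j(\lambda)\in[\mathcal H_j,\mathcal K_-]$ with $(C_0\;C_1)$ and $(D_0\;D_1)$ surjective such that, with $C_0=(C_{01}\;C_{02})$, $D_0=(D_{01}\;D_{02})$ relative to $\mathcal H_0=\mathcal H_1\oplus\mathcal H_2$: $2\mathrm{Im}(C_1C_{01}^* )(\lambda)+C_{02}(\lambda)C_{02}^*(\lambda)\ge0$, $0\in\rho(C_0(\lambda)-iC_1(\lambda)P_1)$ for $\lambda\in\mathbb C_+$; $2\mathrm{Im}(D_1D_{01}^* )(\lambda)+D_{02}(\lambda)D_{02}^*(\lambda)\le0$, $0\in\rho(D_{01}(\lambda)+iD_1(\lambda))$ for $\lambda\in\mathbb C_-$; $C_1(\lambda)D_{01}^*(\overline\lambda)-C_{01}(\lambda)D_1^*(\overline\lambda)+iC_{02}(\lambda)D_{02}^*(\overline\lambda)=0$ for $\lambda\in\mathbb C_+$. Pairs differing by left multiplication by a holomorphic family of isomorphisms are identified; a pair is identified with the linear relation $\{\{h_0,h_1\}:C_0(\lambda)h_0+C_1(\lambda)h_1=0\}$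 (resp. with $D_j$). **Green function.** Put $\hat C_2=C_0\upharpoonright H^n$, $\hat C_1=C_1\upharpoonright H^n$, $\hat D_2=D_0\upharpoonright H^n$, $\hat D_1=D_1\upharpoonright H^n$, $\widetilde D_1(\lambda)=D_0(\lambda)\upharpoonright\mathcal H_1$, $\widetilde D_0(\lambda)=D_1(\lambda)P_1+iD_0(\lambda)P_2$. Let $Y_\tau(\cdot,\lambda)$ be the operator solution of $l[y]-\lambda y=0$ with $\widetilde Y_\tau(0,\lambda)=(-\hat D_2^*(\overline\lambda)\;\;\hat D_1^*(\overline\lambda))^\top(\widetilde D_1^*(\overline\lambda)-M_+(\lambda)\widetilde D_0^*(\overline\lambda))^{-1}\in[\mathcal H_1,H^n\oplus H^n]$ for $\lambda\in\mathbb C_+$, and $\widetilde Y_\tau(0,\lambda)=(-\hat C_2^*(\overline\lambda)\;\;\hat C_1^*(\overline\lambda))^\top(C_0^*(\overline\lambda)-M_-(\lambda)C_1^*(\overline\lambda))^{-1}\in[\mathcal H_0,H^n\oplus H^n]$ for $\lambda\in\mathbb C_-$ (the inverses exist and are bounded). Then $G_\tau(x,t,\lambda)=Z_0(x,\lambda)Y_\tau^*(t,\overline\lambda)$ for $x>t$ and $G_\tau(x,t,\lambda)=Y_\tau(x,\lambda)Z_0^*(t,\overline\lambda)$ for $x<t$. **The function $\Omega_\tau$.** For $\lambda\in\mathbb C_+$ one has $(\tau_+(\lambda)+M_+(\lambda))^{-1}\in[\mathcal H_1,\mathcal H_0]$ (as a linear relation; it equals $-(C_0(\lambda)-C_1(\lambda)M_+(\lambda))^{-1}C_1(\lambda)$).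 Put, omitting $\lambda$, $$\widetilde\Omega_{\tau+}(\lambda)=\begin{pmatrix}M_+-M_+(\tau_++M_+)^{-1}M_+&-\frac12I_{\mathcal H_1}+M_+(\tau_++M_+)^{-1}\\ -\frac12I_{\mathcal H_0}+(\tau_++M_+)^{-1}M_+&-(\tau_++M_+)^{-1}\end{pmatrix}:\mathcal H_0\oplus\mathcal H_1\to\mathcal H_1\oplus\mathcal H_0,\ \lambda\in\mathbb C_+,$$ $\widetilde\Omega_{\tau-}(\lambda)=(\widetilde\Omega_{\tau+}(\overline\lambda))^*$, $\lambda\in\mathbb C_-$. Since $H^n\oplus H^n$ is a subspace of both $\mathcal H_0\oplus\mathcal H_1$ and $\mathcal H_1\oplus\mathcal H_0$, define $\Omega_\tau(\lambda)=P_{H^n\oplus H^n}\widetilde\Omega_{\tau\pm}(\lambda)\upharpoonright(H^n\oplus H^n)$ for $\lambda\in\mathbb C_\pm$. *)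

theory Defs
  imports "HOL-Analysis.Analysis"
begin

section \<open>Complex Hilbert spaces\<close>

class complex_normed_vector = real_normed_vector +
  fixes scaleC :: "complex \<Rightarrow> 'a \<Rightarrow> 'a"  (infixr "*\<^sub>C" 75)
  assumes scaleC_add_right: "a *\<^sub>C (x + y) = a *\<^sub>C x + a *\<^sub>C y"
    and scaleC_add_left: "(a + b) *\<^sub>C x = a *\<^sub>C x + b *\<^sub>C x"
    and scaleC_scaleC: "a *\<^sub>C b *\<^sub>C x = (a * b) *\<^sub>C x"
    and scaleR_scaleC: "r *\<^sub>R x = complex_of_real r *\<^sub>C x"
    and norm_scaleC: "norm (a *\<^sub>C x) = cmod a * norm x"

text \<open>The inner product is linear in the first argument.  Its real part is the inner product of
  \<^class>\<open>real_inner\<close>, so that norm and topology are the usual ones, and positivity of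
  \<open>cinner\<close> is inherited from there.\<close>

class complex_hilbert_space = complex_normed_vector + real_inner + complete_space +
  fixes cinner :: "'a \<Rightarrow> 'a \<Rightarrow> complex"
  assumes cinner_commute: "cinner x y = cnj (cinner y x)"
    and cinner_add_left: "cinner (x + y) z = cinner x z + cinner y z"
    and cinner_scaleC_left: "cinner (a *\<^sub>C x) y = a * cinner x y"
    and inner_eq_Re_cinner: "inner x y = Re (cinner x y)"

instantiation complex :: complex_hilbert_space
begin
definition scaleC_complex :: "complex \<Rightarrow> complex \<Rightarrow> complex" where "scaleC_complex a x = a * x"
definition cinner_complex :: "complex \<Rightarrow> complex \<Rightarrow> complex" where "cinner_complex x y = x * cnj y"
instance
  by standard
    (auto simp: scaleC_complex_def cinner_complex_def algebra_simps scaleR_conv_of_real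
      norm_mult inner_complex_def)
end

instantiation prod :: (complex_normed_vector, complex_normed_vector) complex_normed_vector
begin
definition scaleC_prod :: "complex \<Rightarrow> 'a \<times> 'b \<Rightarrow> 'a \<times> 'b"
  where "scaleC_prod a x = (a *\<^sub>C fst x, a *\<^sub>C snd x)"
instance
proof
  fix a b :: complex and r :: real and x y :: "'a \<times> 'b"
  show "a *\<^sub>C (x + y) = a *\<^sub>C x + a *\<^sub>C y" "(a + b) *\<^sub>C x = a *\<^sub>C x + b *\<^sub>C x"
    "a *\<^sub>C b *\<^sub>C x = (a * b) *\<^sub>C x"
    by (auto simp: scaleC_prod_def scaleC_add_right scaleC_add_left scaleC_scaleC)
  show "r *\<^sub>R x = complex_of_real r *\<^sub>C x"
    by (auto simp: scaleC_prod_def scaleR_prod_def scaleR_scaleC)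
  show "norm (a *\<^sub>C x) = cmod a * norm x"
    by (auto simp: scaleC_prod_def norm_prod_def norm_scaleC power_mult_distrib
        distrib_left[symmetric] real_sqrt_mult)
qed
end

instantiation prod :: (complex_hilbert_space, complex_hilbert_space) complex_hilbert_space
begin
definition cinner_prod :: "'a \<times> 'b \<Rightarrow> 'a \<times> 'b \<Rightarrow> complex"
  where "cinner_prod x y = cinner (fst x) (fst y) + cinner (snd x) (snd y)"
instance
proof
  fix a :: complex and x y z :: "'a \<times> 'b"
  show "cinner x y = cnj (cinner y x)"
    by (simp add: cinner_prod_def cinner_commute[symmetric])
  show "cinner (x + y) z = cinner x z + cinner y z"
    by (simp add: cinner_prod_def cinner_add_left)
  show "cinner (a *\<^sub>C x) y = a * cinner x y"
    by (simp add: cinner_prod_def scaleC_prod_def cinner_scaleC_left distrib_left)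
  show "inner x y = Re (cinner x y)"
    by (simp add: cinner_prod_def inner_prod_def inner_eq_Re_cinner)
qed
end

instantiation vec :: (complex_normed_vector, finite) complex_normed_vector
begin
definition scaleC_vec :: "complex \<Rightarrow> 'a ^ 'b \<Rightarrow> 'a ^ 'b"
  where "scaleC_vec a x = (\<chi> i. a *\<^sub>C x $ i)"
instance
proof
  fix a b :: complex and r :: real and x y :: "'a ^ 'b"
  show "a *\<^sub>C (x + y) = a *\<^sub>C x + a *\<^sub>C y" "(a + b) *\<^sub>C x = a *\<^sub>C x + b *\<^sub>C x"
    "a *\<^sub>C b *\<^sub>C x = (a * b) *\<^sub>C x"
    by (auto simp: vec_eq_iff scaleC_vec_def scaleC_add_right scaleC_add_left scaleC_scaleC)
  show "r *\<^sub>R x = complex_of_real r *\<^sub>C x"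
    by (auto simp: vec_eq_iff scaleC_vec_def scaleR_scaleC)
  show "norm (a *\<^sub>C x) = cmod a * norm x"
    by (simp add: scaleC_vec_def norm_vec_def norm_scaleC L2_set_right_distrib)
qed
end

instantiation vec :: (complex_hilbert_space, finite) complex_hilbert_space
begin
definition cinner_vec :: "'a ^ 'b \<Rightarrow> 'a ^ 'b \<Rightarrow> complex"
  where "cinner_vec x y = (\<Sum>i\<in>UNIV. cinner (x $ i) (y $ i))"
instance
proof
  fix a :: complex and x y z :: "'a ^ 'b"
  show "cinner x y = cnj (cinner y x)"
    by (simp add: cinner_vec_def cinner_commute[symmetric])
  show "cinner (x + y) z = cinner x z + cinner y z"
    by (simp add: cinner_vec_def cinner_add_left sum.distrib)
  show "cinner (a *\<^sub>C x) y = a * cinner x y"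
    by (simp add: cinner_vec_def scaleC_vec_def cinner_scaleC_left sum_distrib_left)
  show "inner x y = Re (cinner x y)"
    by (simp add: cinner_vec_def inner_vec_def inner_eq_Re_cinner)
qed
end


section \<open>Bounded operators between complex spaces\<close>

definition bounded_clinear :: "('a::complex_normed_vector \<Rightarrow> 'b::complex_normed_vector) \<Rightarrow> bool"
  where "bounded_clinear f \<longleftrightarrow> bounded_linear f \<and> (\<forall>c x. f (c *\<^sub>C x) = c *\<^sub>C f x)"

lemma scaleC_zero_right [simp]: "a *\<^sub>C (0::'a::complex_normed_vector) = 0"
  using scaleC_add_right[of a 0 "0::'a"] by simp

lemma bounded_linear_scaleC: "bounded_linear (\<lambda>x::'a::complex_normed_vector. a *\<^sub>C x)"
  by (rule bounded_linear_intro[where K = "cmod a"])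
    (simp_all add: scaleC_add_right scaleR_scaleC scaleC_scaleC norm_scaleC mult.commute)

lemma bounded_clinear_zero: "bounded_clinear (\<lambda>x. 0)"
  by (simp add: bounded_clinear_def bounded_linear_zero)

lemma bounded_clinear_add:
  "bounded_clinear f \<Longrightarrow> bounded_clinear g \<Longrightarrow> bounded_clinear (\<lambda>x. f x + g x)"
  by (simp add: bounded_clinear_def bounded_linear_add scaleC_add_right)

lemma bounded_clinear_minus: "bounded_clinear f \<Longrightarrow> bounded_clinear (\<lambda>x. - f x)"
  unfolding bounded_clinear_def
  by (metis add.inverse_unique add.right_inverse bounded_linear_minus scaleC_add_right
      scaleC_zero_right)

lemma bounded_clinear_diff:
  "bounded_clinear f \<Longrightarrow> bounded_clinear g \<Longrightarrow> bounded_clinear (\<lambda>x. f x - g x)"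
  using bounded_clinear_add[OF _ bounded_clinear_minus, of f g] by simp

lemma bounded_clinear_scaleC: "bounded_clinear f \<Longrightarrow> bounded_clinear (\<lambda>x. a *\<^sub>C f x)"
  unfolding bounded_clinear_def
  by (auto simp: scaleC_scaleC mult.commute
      intro: bounded_linear_compose[OF bounded_linear_scaleC])

lemma bounded_clinear_scaleR: "bounded_clinear f \<Longrightarrow> bounded_clinear (\<lambda>x. r *\<^sub>R f x)"
  unfolding scaleR_scaleC by (rule bounded_clinear_scaleC)

lemma bounded_clinear_compose:
  "bounded_clinear f \<Longrightarrow> bounded_clinear g \<Longrightarrow> bounded_clinear (\<lambda>x. f (g x))"
  by (auto simp: bounded_clinear_def intro: bounded_linear_compose)

lemma bounded_clinear_Pair:
  "bounded_clinear f \<Longrightarrow> bounded_clinear g \<Longrightarrow> bounded_clinear (\<lambda>x. (f x, g x))"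
  by (auto simp: bounded_clinear_def scaleC_prod_def intro: bounded_linear_Pair)

lemma bounded_linear_vec_lambda:
  assumes "\<And>i. bounded_linear (f i)"
  shows "bounded_linear (\<lambda>x. \<chi> i. f i x)"
proof -
  have "\<exists>K. \<forall>x. norm (f i x) \<le> norm x * K" for i
    using assms[of i] by (auto simp: bounded_linear_def bounded_linear_axioms_def)
  then obtain K where K: "\<And>i x. norm (f i x) \<le> norm x * K i" by metis
  show ?thesis
  proof (rule bounded_linear_intro[where K = "\<Sum>i\<in>UNIV. K i"])
    fix x y r
    show "(\<chi> i. f i (x + y)) = (\<chi> i. f i x) + (\<chi> i. f i y)"
      by (simp add: vec_eq_iff linear_add[OF bounded_linear.linear[OF assms]])
    show "(\<chi> i. f i (r *\<^sub>R x)) = r *\<^sub>R (\<chi> i. f i x)"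
      by (simp add: vec_eq_iff linear_scale[OF bounded_linear.linear[OF assms]])
    have "norm (\<chi> i. f i x) \<le> (\<Sum>i\<in>UNIV. norm (f i x))"
      unfolding norm_vec_def by (rule order_trans[OF L2_set_le_sum]) auto
    also have "\<dots> \<le> (\<Sum>i\<in>UNIV. norm x * K i)"
      by (rule sum_mono) (rule K)
    finally show "norm (\<chi> i. f i x) \<le> norm x * (\<Sum>i\<in>UNIV. K i)"
      by (simp add: sum_distrib_left)
  qed
qed

text \<open>\<open>'a \<Rightarrow>\<^sub>B 'b\<close> is the space of bounded complex-linear operators with the operator norm, in the style
  of \<^typ>\<open>'a \<Rightarrow>\<^sub>L 'b\<close>.\<close>

typedef (overloaded) ('a, 'b) cblinfun  ("(_ /\<Rightarrow>\<^sub>B _)" [15, 14] 14) =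
  "{f :: 'a::complex_normed_vector \<Rightarrow> 'b::complex_normed_vector. bounded_clinear f}"
  morphisms cblinfun_apply CBlinfun
  using bounded_clinear_zero by blast

declare [[coercion
  "cblinfun_apply :: ('a::complex_normed_vector \<Rightarrow>\<^sub>B 'b::complex_normed_vector) \<Rightarrow> 'a \<Rightarrow> 'b"]]

setup_lifting type_definition_cblinfun

lemma cblinfun_eqI: "(\<And>x. cblinfun_apply A x = cblinfun_apply B x) \<Longrightarrow> A = B"
  by transfer auto

instantiation cblinfun :: (complex_normed_vector, complex_normed_vector) complex_normed_vector
begin

lift_definition zero_cblinfun :: "'a \<Rightarrow>\<^sub>B 'b" is "\<lambda>x. 0"
  by (rule bounded_clinear_zero)

lift_definition plus_cblinfun :: "'a \<Rightarrow>\<^sub>B 'b \<Rightarrow> 'a \<Rightarrow>\<^sub>B 'b \<Rightarrow> 'a \<Rightarrow>\<^sub>B 'b" is "\<lambda>f g x. f x + g x"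
  by (rule bounded_clinear_add)

lift_definition minus_cblinfun :: "'a \<Rightarrow>\<^sub>B 'b \<Rightarrow> 'a \<Rightarrow>\<^sub>B 'b \<Rightarrow> 'a \<Rightarrow>\<^sub>B 'b" is "\<lambda>f g x. f x - g x"
  by (rule bounded_clinear_diff)

lift_definition uminus_cblinfun :: "'a \<Rightarrow>\<^sub>B 'b \<Rightarrow> 'a \<Rightarrow>\<^sub>B 'b" is "\<lambda>f x. - f x"
  by (rule bounded_clinear_minus)

lift_definition scaleR_cblinfun :: "real \<Rightarrow> 'a \<Rightarrow>\<^sub>B 'b \<Rightarrow> 'a \<Rightarrow>\<^sub>B 'b" is "\<lambda>r f x. r *\<^sub>R f x"
  by (rule bounded_clinear_scaleR)

lift_definition scaleC_cblinfun :: "complex \<Rightarrow> 'a \<Rightarrow>\<^sub>B 'b \<Rightarrow> 'a \<Rightarrow>\<^sub>B 'b" is "\<lambda>a f x. a *\<^sub>C f x"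
  by (rule bounded_clinear_scaleC)

lift_definition norm_cblinfun :: "'a \<Rightarrow>\<^sub>B 'b \<Rightarrow> real" is onorm .

definition dist_cblinfun :: "'a \<Rightarrow>\<^sub>B 'b \<Rightarrow> 'a \<Rightarrow>\<^sub>B 'b \<Rightarrow> real"
  where "dist_cblinfun A B = norm (A - B)"

definition sgn_cblinfun :: "'a \<Rightarrow>\<^sub>B 'b \<Rightarrow> 'a \<Rightarrow>\<^sub>B 'b"
  where "sgn_cblinfun A = scaleR (inverse (norm A)) A"

definition uniformity_cblinfun :: "(('a \<Rightarrow>\<^sub>B 'b) \<times> ('a \<Rightarrow>\<^sub>B 'b)) filter"
  where "uniformity_cblinfun = (INF e\<in>{0<..}. principal {(x, y). dist x y < e})"

definition open_cblinfun :: "('a \<Rightarrow>\<^sub>B 'b) set \<Rightarrow> bool"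
  where "open_cblinfun S = (\<forall>x\<in>S. \<forall>\<^sub>F (x', y) in uniformity. x' = x \<longrightarrow> y \<in> S)"

instance
proof
  fix A B C :: "'a \<Rightarrow>\<^sub>B 'b" and r s :: real and a b :: complex
  show "A + B + C = A + (B + C)" "A + B = B + A" "0 + A = A" "- A + A = 0" "A - B = A + - B"
    "r *\<^sub>R (A + B) = r *\<^sub>R A + r *\<^sub>R B" "(r + s) *\<^sub>R A = r *\<^sub>R A + s *\<^sub>R A"
    "r *\<^sub>R s *\<^sub>R A = (r * s) *\<^sub>R A" "1 *\<^sub>R A = A"
    by (transfer, simp add: algebra_simps)+
  show "dist A B = norm (A - B)" by (rule dist_cblinfun_def)
  show "sgn A = inverse (norm A) *\<^sub>R A" by (rule sgn_cblinfun_def)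
  show "(uniformity :: (('a \<Rightarrow>\<^sub>B 'b) \<times> ('a \<Rightarrow>\<^sub>B 'b)) filter)
      = (INF e\<in>{0<..}. principal {(x, y). dist x y < e})"
    by (rule uniformity_cblinfun_def)
  show "open U = (\<forall>x\<in>U. \<forall>\<^sub>F (x', y) in uniformity. x' = x \<longrightarrow> y \<in> U)"
    for U :: "('a \<Rightarrow>\<^sub>B 'b) set"
    by (rule open_cblinfun_def)
  show "(norm A = 0) = (A = 0)"
    by transfer (auto simp: bounded_clinear_def onorm_eq_0)
  show "norm (A + B) \<le> norm A + norm B"
    by transfer (auto simp: bounded_clinear_def intro: onorm_triangle)
  show "norm (r *\<^sub>R A) = \<bar>r\<bar> * norm A"
    by transfer (auto simp: bounded_clinear_def onorm_scaleR)
  show "a *\<^sub>C (A + B) = a *\<^sub>C A + a *\<^sub>C B" "(a + b) *\<^sub>C A = a *\<^sub>C A + b *\<^sub>C A"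
    "a *\<^sub>C b *\<^sub>C A = (a * b) *\<^sub>C A" "r *\<^sub>R A = complex_of_real r *\<^sub>C A"
    by (transfer, simp add: scaleC_add_right scaleC_add_left scaleC_scaleC scaleR_scaleC)+
  have "norm (a *\<^sub>C A) = norm (cmod a *\<^sub>R A)"
    by transfer (simp add: onorm_def norm_scaleC)
  also have "\<dots> = \<bar>cmod a\<bar> * norm A"
    by transfer (auto simp: bounded_clinear_def onorm_scaleR)
  finally show "norm (a *\<^sub>C A) = cmod a * norm A" by simp
qed

end

lift_definition id_op :: "'a::complex_normed_vector \<Rightarrow>\<^sub>B 'a" is "\<lambda>x. x"
  by (simp add: bounded_clinear_def bounded_linear_ident)

lift_definition comp_op ::
  "('b::complex_normed_vector \<Rightarrow>\<^sub>B 'c::complex_normed_vector) \<Rightarrow> ('a::complex_normed_vector \<Rightarrow>\<^sub>B 'b)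
    \<Rightarrow> ('a \<Rightarrow>\<^sub>B 'c)"  (infixl "o\<^sub>C" 72)
  is "\<lambda>f g x. f (g x)"
  by (rule bounded_clinear_compose)

lift_definition fst_op :: "('a::complex_normed_vector \<times> 'b::complex_normed_vector) \<Rightarrow>\<^sub>B 'a" is fst
  by (simp add: bounded_clinear_def bounded_linear_fst scaleC_prod_def)

lift_definition snd_op :: "('a::complex_normed_vector \<times> 'b::complex_normed_vector) \<Rightarrow>\<^sub>B 'b" is snd
  by (simp add: bounded_clinear_def bounded_linear_snd scaleC_prod_def)

text \<open>Column \<open>(A B)\<^sup>T\<close>, row \<open>(A B)\<close> and two-by-two block operators, and the column of a family indexed
  by \<open>'n\<close>.\<close>

lift_definition col_op ::
  "('a::complex_normed_vector \<Rightarrow>\<^sub>B 'b::complex_normed_vector) \<Rightarrow> ('a \<Rightarrow>\<^sub>B 'c::complex_normed_vector)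
    \<Rightarrow> ('a \<Rightarrow>\<^sub>B 'b \<times> 'c)"
  is "\<lambda>f g x. (f x, g x)"
  by (rule bounded_clinear_Pair)

definition row_op ::
  "('a::complex_normed_vector \<Rightarrow>\<^sub>B 'c::complex_normed_vector) \<Rightarrow> ('b::complex_normed_vector \<Rightarrow>\<^sub>B 'c)
    \<Rightarrow> ('a \<times> 'b \<Rightarrow>\<^sub>B 'c)"
  where "row_op A B = A o\<^sub>C fst_op + B o\<^sub>C snd_op"

definition block_op ::
  "('a::complex_normed_vector \<Rightarrow>\<^sub>B 'c::complex_normed_vector) \<Rightarrow> ('b::complex_normed_vector \<Rightarrow>\<^sub>B 'c)
    \<Rightarrow> ('a \<Rightarrow>\<^sub>B 'd::complex_normed_vector) \<Rightarrow> ('b \<Rightarrow>\<^sub>B 'd) \<Rightarrow> ('a \<times> 'b \<Rightarrow>\<^sub>B 'c \<times> 'd)"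
  where "block_op A B C D = col_op (row_op A B) (row_op C D)"

lift_definition vec_op ::
  "('n::finite \<Rightarrow> ('a::complex_normed_vector \<Rightarrow>\<^sub>B 'b::complex_normed_vector)) \<Rightarrow> ('a \<Rightarrow>\<^sub>B 'b ^ 'n)"
  is "\<lambda>f x. \<chi> i. f i x"
  by (auto simp: bounded_clinear_def scaleC_vec_def vec_eq_iff intro: bounded_linear_vec_lambda)

definition adj ::
  "('a::complex_hilbert_space \<Rightarrow>\<^sub>B 'b::complex_hilbert_space) \<Rightarrow> ('b \<Rightarrow>\<^sub>B 'a)"
  where "adj A = (THE B :: 'b \<Rightarrow>\<^sub>B 'a. \<forall>x y. cinner (A x) y = cinner x (B y))"

definition Im_op :: "('a::complex_hilbert_space \<Rightarrow>\<^sub>B 'a) \<Rightarrow> ('a \<Rightarrow>\<^sub>B 'a)"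
  where "Im_op A = (1 / (2 * \<i>)) *\<^sub>C (A - adj A)"

definition nonneg_op :: "('a::complex_hilbert_space \<Rightarrow>\<^sub>B 'a) \<Rightarrow> bool"
  where "nonneg_op A \<longleftrightarrow> (\<forall>x. cinner (A x) x \<in> \<real> \<and> 0 \<le> Re (cinner (A x) x))"

definition isometric_op :: "('a::complex_hilbert_space \<Rightarrow>\<^sub>B 'b::complex_hilbert_space) \<Rightarrow> bool"
  where "isometric_op V \<longleftrightarrow> (\<forall>x y. cinner (V x) (V y) = cinner x y)"

text \<open>\<open>is_inverse_op A B\<close>: \<open>B\<close> is the bounded inverse of \<open>A\<close>; \<open>boundedly_invertible A\<close> is
  \<open>0 \<in> \<rho>(A)\<close>.\<close>

definition is_inverse_op ::
  "('a::complex_normed_vector \<Rightarrow>\<^sub>B 'b::complex_normed_vector) \<Rightarrow> ('b \<Rightarrow>\<^sub>B 'a) \<Rightarrow> bool"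
  where "is_inverse_op A B \<longleftrightarrow> B o\<^sub>C A = id_op \<and> A o\<^sub>C B = id_op"

definition boundedly_invertible ::
  "('a::complex_normed_vector \<Rightarrow>\<^sub>B 'b::complex_normed_vector) \<Rightarrow> bool"
  where "boundedly_invertible A \<longleftrightarrow> (\<exists>B. is_inverse_op A B)"

definition inverse_op ::
  "('a::complex_normed_vector \<Rightarrow>\<^sub>B 'b::complex_normed_vector) \<Rightarrow> ('b \<Rightarrow>\<^sub>B 'a)"
  where "inverse_op A = (THE B. is_inverse_op A B)"

definition holomorphic_fun_on :: "(complex \<Rightarrow> 'a::complex_normed_vector) \<Rightarrow> complex set \<Rightarrow> bool"
  where "holomorphic_fun_on f S \<longleftrightarrow>
    (\<forall>z\<in>S. \<exists>D. ((\<lambda>w. inverse (w - z) *\<^sub>C (f w - f z)) \<longlongrightarrow> D) (at z within S))"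

text \<open>A linear relation is a set of pairs; \<open>op_of_relation R\<close> is the bounded operator with graph
  \<open>R\<close>, and \<open>relation_plus_op R M\<close> is the sum of \<open>R\<close> and the graph of \<open>M\<close>.\<close>

definition op_of_relation ::
  "('a::complex_normed_vector \<times> 'b::complex_normed_vector) set \<Rightarrow> ('a \<Rightarrow>\<^sub>B 'b)"
  where "op_of_relation R = (THE A :: 'a \<Rightarrow>\<^sub>B 'b. \<forall>x y. (x, y) \<in> R \<longleftrightarrow> y = A x)"

definition relation_plus_op ::
  "('a \<times> 'b) set \<Rightarrow> ('a::complex_normed_vector \<Rightarrow>\<^sub>B 'b::complex_normed_vector) \<Rightarrow> ('a \<times> 'b) set"
  where "relation_plus_op R M = {(x, y + M x) | x y. (x, y) \<in> R}"


section \<open>The differential expression\<close>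

text \<open>A half-line or interval \<open>\<Delta> = [0, b\<rangle>\<close> with the coefficients \<open>p\<^sub>k\<close>, \<open>q\<^sub>k\<close>.  The index type \<open>'n\<close>
  fixes \<open>n\<close> as \<open>CARD('n)\<close>, where \<open>2n\<close> is the order of the expression, and \<open>H\<^sup>n\<close> is \<open>'h ^ 'n\<close>;
  the component \<open>order_type\<close> only carries this type.  Values of the coefficients outside
  \<open>\<Delta>\<close>, or for \<open>k\<close> beyond \<open>n\<close> (resp. \<open>n - 1\<close>), are irrelevant.\<close>

record (overloaded) ('h, 'n) diff_expr =
  interval :: "real set"
  endpoint :: ereal
  pcoeff :: "nat \<Rightarrow> real \<Rightarrow> ('h, 'h) cblinfun"
  qcoeff :: "nat \<Rightarrow> real \<Rightarrow> ('h, 'h) cblinfun"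
  order_type :: "'n itself"

definition half_order :: "('h, 'n::finite) diff_expr \<Rightarrow> nat"
  where "half_order E = CARD('n)"

text \<open>Derivatives relative to \<open>\<Delta>\<close> are one-sided at the end points belonging to \<open>\<Delta>\<close>.\<close>

definition deriv_on :: "real set \<Rightarrow> (real \<Rightarrow> 'v::real_normed_vector) \<Rightarrow> real \<Rightarrow> 'v"
  where "deriv_on \<Delta> f t = vector_derivative f (at t within \<Delta>)"

definition Ck_on :: "nat \<Rightarrow> real set \<Rightarrow> (real \<Rightarrow> 'v::real_normed_vector) \<Rightarrow> bool"
  where "Ck_on m \<Delta> f \<longleftrightarrow>
    (\<forall>j<m. (deriv_on \<Delta> ^^ j) f differentiable_on \<Delta>) \<and> continuous_on \<Delta> ((deriv_on \<Delta> ^^ m) f)"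

definition regular_diff_expr :: "('h::complex_hilbert_space, 'n::finite) diff_expr \<Rightarrow> bool"
  where "regular_diff_expr E \<longleftrightarrow>
    0 < endpoint E \<and>
    {t. 0 \<le> t \<and> ereal t < endpoint E} \<subseteq> interval E \<and>
    interval E \<subseteq> {t. 0 \<le> t \<and> ereal t \<le> endpoint E} \<and>
    (\<forall>k\<le>half_order E. Ck_on (half_order E - k) (interval E) (pcoeff E k)) \<and>
    (\<forall>k<half_order E. Ck_on (half_order E - k) (interval E) (qcoeff E k)) \<and>
    (\<forall>k\<le>half_order E. \<forall>t\<in>interval E. adj (pcoeff E k t) = pcoeff E k t) \<and>
    (\<forall>t\<in>interval E. boundedly_invertible (pcoeff E 0 t))"

text \<open>The quasi-derivatives are defined for \<open>H\<close>-valued and for operator-valued functions by the same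
  formulas; \<open>act\<close> is the action of a coefficient on a value, i.e. \<^const>\<open>cblinfun_apply\<close> in the
  first case and composition \<^term>\<open>comp_op\<close> in the second.  \<open>upper_quasi_deriv act E y j\<close> is
  \<open>y\<^sup>[\<^sup>n\<^sup>+\<^sup>j\<^sup>]\<close>; for \<open>n + j = 2n\<close> the term with \<open>q\<^sub>n\<close> is absent.\<close>

primrec upper_quasi_deriv ::
  "(('h::complex_hilbert_space \<Rightarrow>\<^sub>B 'h) \<Rightarrow> 'v \<Rightarrow> 'v::complex_normed_vector) \<Rightarrow> ('h, 'n::finite) diff_expr
    \<Rightarrow> (real \<Rightarrow> 'v) \<Rightarrow> nat \<Rightarrow> real \<Rightarrow> 'v"
where
  "upper_quasi_deriv act E y 0 = (\<lambda>t.
     let n = half_order E; D = deriv_on (interval E) in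
       act (pcoeff E 0 t) ((D ^^ n) y t) - (\<i> / 2) *\<^sub>C act (qcoeff E 0 t) ((D ^^ (n - 1)) y t))"
| "upper_quasi_deriv act E y (Suc j) = (\<lambda>t.
     let n = half_order E; D = deriv_on (interval E); k = Suc j in
       - D (upper_quasi_deriv act E y j) t + act (pcoeff E k t) ((D ^^ (n - k)) y t)
       + (\<i> / 2) *\<^sub>C
         (act (adj (qcoeff E (k - 1) t)) ((D ^^ (n - k + 1)) y t)
          - (if k < n then act (qcoeff E k t) ((D ^^ (n - k - 1)) y t) else 0)))"

definition quasi_deriv ::
  "(('h::complex_hilbert_space \<Rightarrow>\<^sub>B 'h) \<Rightarrow> 'v \<Rightarrow> 'v::complex_normed_vector) \<Rightarrow> ('h, 'n::finite) diff_expr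
    \<Rightarrow> (real \<Rightarrow> 'v) \<Rightarrow> nat \<Rightarrow> real \<Rightarrow> 'v"
  where "quasi_deriv act E y k =
    (if k < half_order E then (deriv_on (interval E) ^^ k) y
     else upper_quasi_deriv act E y (k - half_order E))"

abbreviation qderiv ::
  "('h::complex_hilbert_space, 'n::finite) diff_expr \<Rightarrow> (real \<Rightarrow> 'h) \<Rightarrow> nat \<Rightarrow> real \<Rightarrow> 'h"
  where "qderiv \<equiv> quasi_deriv cblinfun_apply"

abbreviation op_qderiv ::
  "('h::complex_hilbert_space, 'n::finite) diff_expr \<Rightarrow> (real \<Rightarrow> ('k::complex_normed_vector \<Rightarrow>\<^sub>B 'h))
    \<Rightarrow> nat \<Rightarrow> real \<Rightarrow> ('k \<Rightarrow>\<^sub>B 'h)"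
  where "op_qderiv \<equiv> quasi_deriv comp_op"

text \<open>The quasi-derivative of order \<open>2n\<close> is the quasi-differential form of the formally selfadjoint expression
  \<open>\<Sum>k=1..n. (-1)\<^sup>k (D\<^sup>k (p\<^bsub>n-k\<^esub> D\<^sup>k y) - \<i>/2 (D\<^bsup>k-1\<^esup> (q\<^sup>*\<^bsub>n-k\<^esub> D\<^sup>k y) + D\<^sup>k (q\<^bsub>n-k\<^esub> D\<^bsup>k-1\<^esup> y))) + p\<^sub>n y\<close>.\<close>

definition lexpr ::
  "('h::complex_hilbert_space, 'n::finite) diff_expr \<Rightarrow> (real \<Rightarrow> 'h) \<Rightarrow> real \<Rightarrow> 'h"
  where "lexpr E y = qderiv E y (2 * half_order E)"

text \<open>Zero-based position of an index in the linearly ordered type \<open>'n\<close>: \<open>y\<^sup>(\<^sup>1\<^sup>)\<close> lists the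
  quasi-derivatives of orders \<open>0, \<dots>, n - 1\<close>, and \<open>y\<^sup>(\<^sup>2\<^sup>)\<close> those of orders \<open>2n - 1, \<dots>, n\<close>.\<close>

definition pos :: "'n::{finite,linorder} \<Rightarrow> nat"
  where "pos i = card {j. j < i}"

definition vec1 ::
  "('h::complex_hilbert_space, 'n::{finite,linorder}) diff_expr \<Rightarrow> (real \<Rightarrow> 'h) \<Rightarrow> real \<Rightarrow> ('h, 'n) vec"
  where "vec1 E y t = (\<chi> i. qderiv E y (pos i) t)"

definition vec2 ::
  "('h::complex_hilbert_space, 'n::{finite,linorder}) diff_expr \<Rightarrow> (real \<Rightarrow> 'h) \<Rightarrow> real \<Rightarrow> ('h, 'n) vec"
  where "vec2 E y t = (\<chi> i. qderiv E y (2 * half_order E - 1 - pos i) t)"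

definition op_tilde ::
  "('h::complex_hilbert_space, 'n::{finite,linorder}) diff_expr
    \<Rightarrow> (real \<Rightarrow> ('k::complex_normed_vector \<Rightarrow>\<^sub>B 'h)) \<Rightarrow> real \<Rightarrow> ('k \<Rightarrow>\<^sub>B ('h, 'n) vec \<times> ('h, 'n) vec)"
  where "op_tilde E Y t =
    col_op (vec_op (\<lambda>i. op_qderiv E Y (pos i) t))
           (vec_op (\<lambda>i. op_qderiv E Y (2 * half_order E - 1 - pos i) t))"

text \<open>Functions on \<open>\<Delta>\<close> are represented by functions on the real line vanishing off \<open>\<Delta>\<close>.\<close>

definition op_solution ::
  "('h::complex_hilbert_space, 'n::finite) diff_expr \<Rightarrow> complex
    \<Rightarrow> (real \<Rightarrow> ('k::complex_normed_vector \<Rightarrow>\<^sub>B 'h)) \<Rightarrow> bool"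
  where "op_solution E z Y \<longleftrightarrow>
    (\<forall>k<2 * half_order E. op_qderiv E Y k differentiable_on interval E) \<and>
    (\<forall>t\<in>interval E. op_qderiv E Y (2 * half_order E) t = z *\<^sub>C Y t) \<and>
    (\<forall>t. t \<notin> interval E \<longrightarrow> Y t = 0)"

definition op_solution_with_init ::
  "('h::complex_hilbert_space, 'n::{finite,linorder}) diff_expr \<Rightarrow> complex
    \<Rightarrow> ('k::complex_normed_vector \<Rightarrow>\<^sub>B ('h, 'n) vec \<times> ('h, 'n) vec) \<Rightarrow> real \<Rightarrow> ('k \<Rightarrow>\<^sub>B 'h)"
  where "op_solution_with_init E z A = (THE Y. op_solution E z Y \<and> op_tilde E Y 0 = A)"

definition abs_continuous_on :: "real \<Rightarrow> real \<Rightarrow> (real \<Rightarrow> 'v::real_normed_vector) \<Rightarrow> bool"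
  where "abs_continuous_on a c f \<longleftrightarrow>
    (\<forall>\<epsilon>>0. \<exists>\<delta>>0. \<forall>(N::nat) u v.
      (\<forall>i<N. a \<le> u i \<and> u i \<le> v i \<and> v i \<le> c) \<and>
      disjoint_family_on (\<lambda>i. {u i<..<v i}) {..<N} \<and>
      (\<Sum>i<N. v i - u i) < \<delta>
      \<longrightarrow> (\<Sum>i<N. norm (f (v i) - f (u i))) < \<epsilon>)"

definition square_integrable :: "real set \<Rightarrow> (real \<Rightarrow> 'h::real_normed_vector) \<Rightarrow> bool"
  where "square_integrable \<Delta> f \<longleftrightarrow>
    f \<in> borel_measurable (lebesgue_on \<Delta>) \<and> integrable (lebesgue_on \<Delta>) (\<lambda>t. (norm (f t))\<^sup>2)"

definition max_domain :: "('h::complex_hilbert_space, 'n::finite) diff_expr \<Rightarrow> (real \<Rightarrow> 'h) set"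
  where "max_domain E = {y.
    (\<forall>t. t \<notin> interval E \<longrightarrow> y t = 0) \<and>
    square_integrable (interval E) y \<and>
    (\<forall>k\<le>2 * half_order E - 2. Ck_on 1 (interval E) (qderiv E y k)) \<and>
    (\<forall>c\<in>interval E. abs_continuous_on 0 c (qderiv E y (2 * half_order E - 1))) \<and>
    square_integrable (interval E) (lexpr E y)}"

text \<open>\<open>defect_space E z\<close> is \<open>\<NN>\<^sub>z(L\<^sub>0) = Ker (L - z)\<close>; the equation is one in \<open>L\<^sub>2(\<Delta>; H)\<close>.\<close>

definition defect_space ::
  "('h::complex_hilbert_space, 'n::finite) diff_expr \<Rightarrow> complex \<Rightarrow> (real \<Rightarrow> 'h) set"
  where "defect_space E z =
    {y \<in> max_domain E. AE t in lebesgue_on (interval E). lexpr E y t = z *\<^sub>C y t}"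

definition bracket ::
  "('h::complex_hilbert_space, 'n::{finite,linorder}) diff_expr
    \<Rightarrow> (real \<Rightarrow> 'h) \<Rightarrow> (real \<Rightarrow> 'h) \<Rightarrow> real \<Rightarrow> complex"
  where "bracket E y z t = cinner (vec1 E y t) (vec2 E z t) - cinner (vec2 E y t) (vec1 E z t)"

definition to_endpoint :: "('h, 'n) diff_expr \<Rightarrow> real filter"
  where "to_endpoint E =
    (if endpoint E = \<infinity> then at_top else at_left (real_of_ereal (endpoint E)))"


section \<open>Decomposing \<open>D\<close>-triplets\<close>

text \<open>The subspace \<open>\<H>\<^sub>1'\<close> of \<open>\<H>\<^sub>0'\<close> is the type \<open>'k1\<close> together with its inclusion map \<open>incl\<close>, an
  isometry into \<open>'k0\<close>.  Accordingly \<open>\<H>\<^sub>0\<close> is \<^typ>\<open>('h, 'n) vec \<times> 'k0\<close>, \<open>\<H>\<^sub>1\<close> is \<^typ>\<open>('h, 'n) vec \<times> 'k1\<close>, and for an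
  inclusion \<open>V\<close> the orthoprojectors are \<open>V\<^sup>*\<close> (as an operator onto the subspace) and
  \<open>I - V V\<^sup>*\<close> (as an operator in the whole space).\<close>

record (overloaded) ('h, 'k0, 'k1) triplet =
  incl :: "('k1, 'k0) cblinfun"
  Gamma0' :: "(real \<Rightarrow> 'h) \<Rightarrow> 'k0"
  Gamma1' :: "(real \<Rightarrow> 'h) \<Rightarrow> 'k1"

abbreviation (input) proj_onto ::
  "('b::complex_hilbert_space \<Rightarrow>\<^sub>B 'a::complex_hilbert_space) \<Rightarrow> ('a \<Rightarrow>\<^sub>B 'b)"
  where "proj_onto V \<equiv> adj V"

definition proj_compl ::
  "('b::complex_hilbert_space \<Rightarrow>\<^sub>B 'a::complex_hilbert_space) \<Rightarrow> ('a \<Rightarrow>\<^sub>B 'a)"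
  where "proj_compl V = id_op - V o\<^sub>C proj_onto V"

definition clinear_fun_on ::
  "(real \<Rightarrow> 'h::complex_normed_vector) set \<Rightarrow> ((real \<Rightarrow> 'h) \<Rightarrow> 'k::complex_normed_vector) \<Rightarrow> bool"
  where "clinear_fun_on S G \<longleftrightarrow>
    (\<forall>y\<in>S. \<forall>z\<in>S. G (\<lambda>t. y t + z t) = G y + G z) \<and>
    (\<forall>a. \<forall>y\<in>S. G (\<lambda>t. a *\<^sub>C y t) = a *\<^sub>C G y)"

definition decomposing_D_triplet ::
  "('h::complex_hilbert_space, 'n::{finite,linorder}) diff_expr
    \<Rightarrow> ('h, 'k0::complex_hilbert_space, 'k1::complex_hilbert_space) triplet \<Rightarrow> bool"
  where "decomposing_D_triplet E T \<longleftrightarrow>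
    isometric_op (incl T) \<and>
    clinear_fun_on (max_domain E) (Gamma0' T) \<and>
    clinear_fun_on (max_domain E) (Gamma1' T) \<and>
    (\<lambda>y. (Gamma0' T y, Gamma1' T y)) ` max_domain E = UNIV \<and>
    (\<forall>y\<in>max_domain E. \<forall>z\<in>max_domain E.
      (bracket E y z \<longlongrightarrow>
         cinner (incl T (Gamma1' T y)) (Gamma0' T z)
         - cinner (Gamma0' T y) (incl T (Gamma1' T z))
         + \<i> * cinner (proj_compl (incl T) (Gamma0' T y)) (proj_compl (incl T) (Gamma0' T z)))
        (to_endpoint E))"

definition Gamma0 ::
  "('h::complex_hilbert_space, 'n::{finite,linorder}) diff_expr \<Rightarrow> ('h, 'k0, 'k1) triplet
    \<Rightarrow> (real \<Rightarrow> 'h) \<Rightarrow> ('h, 'n) vec \<times> 'k0"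
  where "Gamma0 E T y = (vec2 E y 0, Gamma0' T y)"

definition Gamma1 ::
  "('h::complex_hilbert_space, 'n::{finite,linorder}) diff_expr \<Rightarrow> ('h, 'k0, 'k1) triplet
    \<Rightarrow> (real \<Rightarrow> 'h) \<Rightarrow> ('h, 'n) vec \<times> 'k1"
  where "Gamma1 E T y = (- vec1 E y 0, Gamma1' T y)"

definition incl_H ::
  "('h::complex_hilbert_space, 'n::finite) diff_expr
    \<Rightarrow> ('h, 'k0::complex_hilbert_space, 'k1::complex_hilbert_space) triplet
    \<Rightarrow> (('h, 'n) vec \<times> 'k1 \<Rightarrow>\<^sub>B ('h, 'n) vec \<times> 'k0)"
  where "incl_H E T = block_op id_op 0 0 (incl T)"


section \<open>Gamma-fields and Weyl functions\<close>

text \<open>The inverses, definite descriptions and \<^const>\<open>CBlinfun\<close> below involve no existence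
  assumptions: for a decomposing \<open>D\<close>-triplet the restrictions being inverted are bijective onto
  \<open>\<H>\<^sub>0\<close> (\<open>Im z > 0\<close>), resp. \<open>\<H>\<^sub>1\<close> (\<open>Im z < 0\<close>), and the operators are bounded.\<close>

definition gamma_plus ::
  "('h::complex_hilbert_space, 'n::{finite,linorder}) diff_expr
    \<Rightarrow> ('h, 'k0::complex_hilbert_space, 'k1::complex_hilbert_space) triplet
    \<Rightarrow> complex \<Rightarrow> ('h, 'n) vec \<times> 'k0 \<Rightarrow> real \<Rightarrow> 'h"
  where "gamma_plus E T z = inv_into (defect_space E z) (Gamma0 E T)"

definition gamma_minus ::
  "('h::complex_hilbert_space, 'n::{finite,linorder}) diff_expr
    \<Rightarrow> ('h, 'k0::complex_hilbert_space, 'k1::complex_hilbert_space) triplet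
    \<Rightarrow> complex \<Rightarrow> ('h, 'n) vec \<times> 'k1 \<Rightarrow> real \<Rightarrow> 'h"
  where "gamma_minus E T z =
    inv_into (defect_space E z) (\<lambda>y. proj_onto (incl_H E T) (Gamma0 E T y))"

definition M_plus ::
  "('h::complex_hilbert_space, 'n::{finite,linorder}) diff_expr
    \<Rightarrow> ('h, 'k0::complex_hilbert_space, 'k1::complex_hilbert_space) triplet
    \<Rightarrow> complex \<Rightarrow> (('h, 'n) vec \<times> 'k0 \<Rightarrow>\<^sub>B ('h, 'n) vec \<times> 'k1)"
  where "M_plus E T z = (THE M :: ('h, 'n) vec \<times> 'k0 \<Rightarrow>\<^sub>B ('h, 'n) vec \<times> 'k1.
    \<forall>y\<in>defect_space E z. Gamma1 E T y = M (Gamma0 E T y))"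

definition M_minus ::
  "('h::complex_hilbert_space, 'n::{finite,linorder}) diff_expr
    \<Rightarrow> ('h, 'k0::complex_hilbert_space, 'k1::complex_hilbert_space) triplet
    \<Rightarrow> complex \<Rightarrow> (('h, 'n) vec \<times> 'k1 \<Rightarrow>\<^sub>B ('h, 'n) vec \<times> 'k0)"
  where "M_minus E T z = (THE M :: ('h, 'n) vec \<times> 'k1 \<Rightarrow>\<^sub>B ('h, 'n) vec \<times> 'k0. \<forall>y\<in>defect_space E z.
    incl_H E T (Gamma1 E T y) + \<i> *\<^sub>C proj_compl (incl_H E T) (Gamma0 E T y)
      = M (proj_onto (incl_H E T) (Gamma0 E T y)))"

definition Z_plus ::
  "('h::complex_hilbert_space, 'n::{finite,linorder}) diff_expr
    \<Rightarrow> ('h, 'k0::complex_hilbert_space, 'k1::complex_hilbert_space) triplet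
    \<Rightarrow> real \<Rightarrow> complex \<Rightarrow> (('h, 'n) vec \<times> 'k0 \<Rightarrow>\<^sub>B 'h)"
  where "Z_plus E T t z = CBlinfun (\<lambda>h. gamma_plus E T z h t)"

definition Z_minus ::
  "('h::complex_hilbert_space, 'n::{finite,linorder}) diff_expr
    \<Rightarrow> ('h, 'k0::complex_hilbert_space, 'k1::complex_hilbert_space) triplet
    \<Rightarrow> real \<Rightarrow> complex \<Rightarrow> (('h, 'n) vec \<times> 'k1 \<Rightarrow>\<^sub>B 'h)"
  where "Z_minus E T t z = CBlinfun (\<lambda>h. gamma_minus E T z h t)"


section \<open>The class of holomorphic operator pairs\<close>

text \<open>Collections \<open>\<tau>\<close> are given by representing pairs; the members of an equivalence class differ by
  left multiplication by isomorphisms, and \<open>\<K>\<^sub>+\<close>, \<open>\<K>\<^sub>-\<close> are the types \<open>'kp\<close>, \<open>'km\<close>.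
  In \<open>R_tilde V\<close> the isometry \<open>V\<close> is the inclusion of \<open>\<H>\<^sub>1\<close> into \<open>\<H>\<^sub>0\<close>; the
  restrictions of \<open>C\<^sub>0\<close> and \<open>D\<^sub>0\<close> to \<open>\<H>\<^sub>2\<close> are extended by zero to \<open>\<H>\<^sub>0\<close>, which does not affect
  the products in which they occur.\<close>

record (overloaded) ('h0, 'h1, 'kp, 'km) pair_collection =
  C0 :: "complex \<Rightarrow> ('h0, 'kp) cblinfun"
  C1 :: "complex \<Rightarrow> ('h1, 'kp) cblinfun"
  D0 :: "complex \<Rightarrow> ('h0, 'km) cblinfun"
  D1 :: "complex \<Rightarrow> ('h1, 'km) cblinfun"

definition R_tilde ::
  "('h1::complex_hilbert_space \<Rightarrow>\<^sub>B 'h0::complex_hilbert_space)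
    \<Rightarrow> ('h0, 'h1, 'kp::complex_hilbert_space, 'km::complex_hilbert_space) pair_collection set"
  where "R_tilde V = {\<tau>.
    let C01 = (\<lambda>z. C0 \<tau> z o\<^sub>C V); C02 = (\<lambda>z. C0 \<tau> z o\<^sub>C proj_compl V);
        D01 = (\<lambda>z. D0 \<tau> z o\<^sub>C V); D02 = (\<lambda>z. D0 \<tau> z o\<^sub>C proj_compl V)
    in
      holomorphic_fun_on (C0 \<tau>) {z. 0 < Im z} \<and> holomorphic_fun_on (C1 \<tau>) {z. 0 < Im z} \<and>
      holomorphic_fun_on (D0 \<tau>) {z. Im z < 0} \<and> holomorphic_fun_on (D1 \<tau>) {z. Im z < 0} \<and>
      (\<forall>z. 0 < Im z \<longrightarrow>
        surj (row_op (C0 \<tau> z) (C1 \<tau> z)) \<and>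
        nonneg_op (2 *\<^sub>R Im_op (C1 \<tau> z o\<^sub>C adj (C01 z)) + C02 z o\<^sub>C adj (C02 z)) \<and>
        boundedly_invertible (C0 \<tau> z - \<i> *\<^sub>C (C1 \<tau> z o\<^sub>C proj_onto V))) \<and>
      (\<forall>z. Im z < 0 \<longrightarrow>
        surj (row_op (D0 \<tau> z) (D1 \<tau> z)) \<and>
        nonneg_op (- (2 *\<^sub>R Im_op (D1 \<tau> z o\<^sub>C adj (D01 z)) + D02 z o\<^sub>C adj (D02 z))) \<and>
        boundedly_invertible (D01 z + \<i> *\<^sub>C D1 \<tau> z)) \<and>
      (\<forall>z. 0 < Im z \<longrightarrow>
        C1 \<tau> z o\<^sub>C adj (D01 (cnj z)) - C01 z o\<^sub>C adj (D1 \<tau> (cnj z))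
          + \<i> *\<^sub>C (C02 z o\<^sub>C adj (D02 (cnj z))) = 0)}"

definition tau_plus ::
  "('h0::complex_normed_vector, 'h1::complex_normed_vector, 'kp::complex_normed_vector, 'km) pair_collection
    \<Rightarrow> complex \<Rightarrow> ('h0 \<times> 'h1) set"
  where "tau_plus \<tau> z = {(h0, h1). C0 \<tau> z h0 + C1 \<tau> z h1 = 0}"


section \<open>The Green function\<close>

text \<open>\<open>emb_fst\<close> embeds \<open>H\<^sup>n\<close> into \<open>\<H>\<^sub>0\<close> and \<open>\<H>\<^sub>1\<close>, so \<open>A o\<^sub>C emb_fst\<close> is the restriction of \<open>A\<close> to \<open>H\<^sup>n\<close>.\<close>

definition emb_fst :: "'a::complex_normed_vector \<Rightarrow>\<^sub>B 'a \<times> 'b::complex_normed_vector"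
  where "emb_fst = col_op id_op 0"

definition Y_tau_plus ::
  "('h::complex_hilbert_space, 'n::{finite,linorder}) diff_expr
    \<Rightarrow> ('h, 'k0::complex_hilbert_space, 'k1::complex_hilbert_space) triplet
    \<Rightarrow> (('h, 'n) vec \<times> 'k0, ('h, 'n) vec \<times> 'k1, 'kp::complex_hilbert_space, 'km::complex_hilbert_space) pair_collection
    \<Rightarrow> real \<Rightarrow> complex \<Rightarrow> (('h, 'n) vec \<times> 'k1 \<Rightarrow>\<^sub>B 'h)"
  where "Y_tau_plus E T \<tau> t z =
    (let V = incl_H E T; \<mu> = cnj z;
         D2_hat = D0 \<tau> \<mu> o\<^sub>C emb_fst; D1_hat = D1 \<tau> \<mu> o\<^sub>C emb_fst;
         D1_tilde = D0 \<tau> \<mu> o\<^sub>C V;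
         D0_tilde = D1 \<tau> \<mu> o\<^sub>C proj_onto V + \<i> *\<^sub>C (D0 \<tau> \<mu> o\<^sub>C proj_compl V)
     in op_solution_with_init E z
          (col_op (- adj D2_hat) (adj D1_hat)
            o\<^sub>C inverse_op (adj D1_tilde - M_plus E T z o\<^sub>C adj D0_tilde)) t)"

definition Y_tau_minus ::
  "('h::complex_hilbert_space, 'n::{finite,linorder}) diff_expr
    \<Rightarrow> ('h, 'k0::complex_hilbert_space, 'k1::complex_hilbert_space) triplet
    \<Rightarrow> (('h, 'n) vec \<times> 'k0, ('h, 'n) vec \<times> 'k1, 'kp::complex_hilbert_space, 'km::complex_hilbert_space) pair_collection
    \<Rightarrow> real \<Rightarrow> complex \<Rightarrow> (('h, 'n) vec \<times> 'k0 \<Rightarrow>\<^sub>B 'h)"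
  where "Y_tau_minus E T \<tau> t z =
    (let \<mu> = cnj z;
         C2_hat = C0 \<tau> \<mu> o\<^sub>C emb_fst; C1_hat = C1 \<tau> \<mu> o\<^sub>C emb_fst
     in op_solution_with_init E z
          (col_op (- adj C2_hat) (adj C1_hat)
            o\<^sub>C inverse_op (adj (C0 \<tau> \<mu>) - M_minus E T z o\<^sub>C adj (C1 \<tau> \<mu>))) t)"

text \<open>Only defined off the diagonal; the value \<open>0\<close> for \<open>x = t\<close> is a dummy.\<close>

definition green_function ::
  "('h::complex_hilbert_space, 'n::{finite,linorder}) diff_expr
    \<Rightarrow> ('h, 'k0::complex_hilbert_space, 'k1::complex_hilbert_space) triplet
    \<Rightarrow> (('h, 'n) vec \<times> 'k0, ('h, 'n) vec \<times> 'k1, 'kp::complex_hilbert_space, 'km::complex_hilbert_space) pair_collection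
    \<Rightarrow> real \<Rightarrow> real \<Rightarrow> complex \<Rightarrow> ('h \<Rightarrow>\<^sub>B 'h)"
  where "green_function E T \<tau> x t z =
    (if t < x then
       (if 0 < Im z then Z_plus E T x z o\<^sub>C adj (Y_tau_minus E T \<tau> t (cnj z))
        else Z_minus E T x z o\<^sub>C adj (Y_tau_plus E T \<tau> t (cnj z)))
     else if x < t then
       (if 0 < Im z then Y_tau_plus E T \<tau> x z o\<^sub>C adj (Z_minus E T t (cnj z))
        else Y_tau_minus E T \<tau> x z o\<^sub>C adj (Z_plus E T t (cnj z)))
     else 0)"


section \<open>The function \<open>\<Omega>\<^sub>\<tau>\<close>\<close>

definition Omega_tilde_plus ::
  "('h::complex_hilbert_space, 'n::{finite,linorder}) diff_expr
    \<Rightarrow> ('h, 'k0::complex_hilbert_space, 'k1::complex_hilbert_space) triplet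
    \<Rightarrow> (('h, 'n) vec \<times> 'k0, ('h, 'n) vec \<times> 'k1, 'kp::complex_hilbert_space, 'km) pair_collection
    \<Rightarrow> complex \<Rightarrow> ((('h, 'n) vec \<times> 'k0) \<times> (('h, 'n) vec \<times> 'k1) \<Rightarrow>\<^sub>B (('h, 'n) vec \<times> 'k1) \<times> (('h, 'n) vec \<times> 'k0))"
  where "Omega_tilde_plus E T \<tau> z =
    (let M = M_plus E T z;
         R = op_of_relation ((relation_plus_op (tau_plus \<tau> z) M)\<inverse>)
     in block_op (M - M o\<^sub>C R o\<^sub>C M) (- (1 / 2) *\<^sub>R id_op + M o\<^sub>C R)
                 (- (1 / 2) *\<^sub>R id_op + R o\<^sub>C M) (- R))"

definition Omega_tilde_minus ::
  "('h::complex_hilbert_space, 'n::{finite,linorder}) diff_expr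
    \<Rightarrow> ('h, 'k0::complex_hilbert_space, 'k1::complex_hilbert_space) triplet
    \<Rightarrow> (('h, 'n) vec \<times> 'k0, ('h, 'n) vec \<times> 'k1, 'kp::complex_hilbert_space, 'km) pair_collection
    \<Rightarrow> complex \<Rightarrow> ((('h, 'n) vec \<times> 'k1) \<times> (('h, 'n) vec \<times> 'k0) \<Rightarrow>\<^sub>B (('h, 'n) vec \<times> 'k0) \<times> (('h, 'n) vec \<times> 'k1))"
  where "Omega_tilde_minus E T \<tau> z = adj (Omega_tilde_plus E T \<tau> (cnj z))"

definition compress ::
  "(('a::complex_normed_vector \<times> 'b::complex_normed_vector) \<times> ('a \<times> 'c::complex_normed_vector)
     \<Rightarrow>\<^sub>B ('a \<times> 'c) \<times> ('a \<times> 'b)) \<Rightarrow> ('a \<times> 'a \<Rightarrow>\<^sub>B 'a \<times> 'a)"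
  where "compress A = block_op fst_op 0 0 fst_op o\<^sub>C A o\<^sub>C block_op emb_fst 0 0 emb_fst"

definition Omega ::
  "('h::complex_hilbert_space, 'n::{finite,linorder}) diff_expr
    \<Rightarrow> ('h, 'k0::complex_hilbert_space, 'k1::complex_hilbert_space) triplet
    \<Rightarrow> (('h, 'n) vec \<times> 'k0, ('h, 'n) vec \<times> 'k1, 'kp::complex_hilbert_space, 'km) pair_collection
    \<Rightarrow> complex \<Rightarrow> (('h, 'n) vec \<times> ('h, 'n) vec \<Rightarrow>\<^sub>B ('h, 'n) vec \<times> ('h, 'n) vec)"
  where "Omega E T \<tau> z =
    (if 0 < Im z then compress (Omega_tilde_plus E T \<tau> z)
     else compress (Omega_tilde_minus E T \<tau> z))"

definition Y_zero ::
  "('h::complex_hilbert_space, 'n::{finite,linorder}) diff_expr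
    \<Rightarrow> real \<Rightarrow> complex \<Rightarrow> (('h, 'n) vec \<times> ('h, 'n) vec \<Rightarrow>\<^sub>B 'h)"
  where "Y_zero E t z = op_solution_with_init E z id_op t"

definition J_op :: "'a \<times> 'a \<Rightarrow>\<^sub>B 'a \<times> 'a::complex_normed_vector"
  where "J_op = block_op 0 (- id_op) id_op 0"

end

theory Submission
 imports Defs
begin

text \<open>In terms of initial values at \<open>0\<close> both factors of the Green function are \<open>Y\<^sub>0\<close> times an operator
 built from \<open>M\<^sub>+\<close> and the pair \<open>\<tau>\<close>, so the representation is an identity between operators on
 \<open>H\<^sup>n \<oplus> H\<^sup>n\<close>; it follows from the coupling condition relating \<open>C\<^sub>j\<close> and \<open>D\<^sub>j\<close>, and the inverses
 occurring in it exist because \<open>M\<^sub>+\<close> is uniformly dissipative.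

 That \<open>M\<^sub>\<plusminus>\<close> exist is shown directly from Green's formula. A function orthogonal to the range of
 \<open>L - z\<close> on compactly supported functions is a solution for \<open>z\<^sup>*\<close>, by explicit construction of
 compactly supported solutions of inhomogeneous equations. Hence \<open>L - z\<close>, restricted by
 \<open>\<Gamma>\<^sub>0 y = 0\<close> or \<open>P\<^sub>1 \<Gamma>\<^sub>0 y = 0\<close>, has dense range, and its coercivity makes \<open>\<Gamma>\<^sub>0\<close>, resp. \<open>P\<^sub>1 \<Gamma>\<^sub>0\<close>,
 bijective on the defect spaces. Boundedness of \<open>M\<^sub>\<plusminus>\<close> is the Hellinger-Toeplitz theorem.
 Green's formula for absolutely continuous quasi-derivatives rests on the a.e. differentiability of
 absolutely continuous Hilbert space valued functions, obtained from martingale convergence of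
 dyadic slopes.\<close>

section \<open>Hilbert space operators\<close>

text \<open>The space H may be infinite-dimensional and the end point b singular, so neither
  compactness of the unit sphere nor a finite basis of solutions is at hand. Their substitute is
  \<open>observability\<close>, which bounds the L2 norm of a solution on [0, c] from below by its
  initial values. It makes a weighted Gram operator invertible, whence solutions can be steered to
  zero at c, and it shows that a defect element of norm zero vanishes identically. Null sets
  accompany the maximal operator because the last quasi-derivative of a domain element need not be
  differentiable everywhere, so that \<open>lexpr\<close> is linear only almost everywhere.
  Absolutely continuous curves are studied through their graphs (t, f t), whose chords never
  degenerate and thus have directions. In the operator algebra the delicate point is invertibility
  without dimension counting: the kernels of the pairs (C_0, C_1) and (D_0, D_1) parametrise each
  other, so a lower bound for one operator yields injectivity of the other. The half-plane Im z < 0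
  follows by taking adjoints and exchanging x and t.\<close>

instance complex_hilbert_space \<subseteq> banach ..

section \<open>Complex vector spaces and spaces of bounded operators\<close>

lemma scaleC_minus_right: "a *\<^sub>C (- x) = - (a *\<^sub>C (x::'a::complex_normed_vector))"
 using scaleC_add_right[of a x "- x"] by (simp add: eq_neg_iff_add_eq_0 add.commute)

lemma scaleC_diff_right: "a *\<^sub>C (x - y) = a *\<^sub>C x - a *\<^sub>C (y::'a::complex_normed_vector)"
 by (simp add: scaleC_add_right scaleC_minus_right flip: add_uminus_conv_diff)

lemma scaleC_one [simp]: "1 *\<^sub>C x = (x::'a::complex_normed_vector)"
 using scaleR_scaleC[of 1 x] by simp

lemma scaleC_zero_left [simp]: "0 *\<^sub>C x = (0::'a::complex_normed_vector)"
 using scaleR_scaleC[of 0 x] by simp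

lemma scaleC_minus_left: "(- a) *\<^sub>C x = - (a *\<^sub>C (x::'a::complex_normed_vector))"
 using scaleC_add_left[of a "- a" x] by (simp add: eq_neg_iff_add_eq_0 add.commute)

lemma scaleC_diff_left: "(a - b) *\<^sub>C x = a *\<^sub>C x - b *\<^sub>C (x::'a::complex_normed_vector)"
 by (simp add: scaleC_add_left scaleC_minus_left flip: add_uminus_conv_diff)

lemma fst_scaleC [simp]: "fst (a *\<^sub>C x) = a *\<^sub>C fst x"
 and snd_scaleC [simp]: "snd (a *\<^sub>C x) = a *\<^sub>C snd x"
 by (simp_all add: scaleC_prod_def)

lemma scaleC_Pair [simp]: "a *\<^sub>C (x, y) = (a *\<^sub>C x, a *\<^sub>C y)"
 by (simp add: scaleC_prod_def)

lemma vec_scaleC_component [simp]: "(a *\<^sub>C x) $ i = a *\<^sub>C (x $ i)"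
 by (simp add: scaleC_vec_def)

lemma bounded_clinear_apply: "bounded_clinear (cblinfun_apply A)"
 using cblinfun_apply[of A] by simp

lemma bounded_linear_apply: "bounded_linear (cblinfun_apply A)"
 using bounded_clinear_apply by (auto simp: bounded_clinear_def)

lemma cblinfun_apply_add [simp]: "cblinfun_apply A (x + y) = A x + A y"
 and cblinfun_apply_diff [simp]: "cblinfun_apply A (x - y) = A x - A y"
 and cblinfun_apply_minus [simp]: "cblinfun_apply A (- x) = - A x"
 and cblinfun_apply_zero [simp]: "cblinfun_apply A 0 = 0"
 and cblinfun_apply_scaleR [simp]: "cblinfun_apply A (r *\<^sub>R x) = r *\<^sub>R A x"
 and cblinfun_apply_sum: "cblinfun_apply A (sum f S) = (\<Sum>i\<in>S. A (f i))"
 using bounded_linear.linear[OF bounded_linear_apply[of A]]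
 by (auto simp: linear_add linear_diff linear_neg linear_0 linear_scale linear_sum)

lemma cblinfun_apply_scaleC [simp]: "cblinfun_apply A (c *\<^sub>C x) = c *\<^sub>C A x"
 using bounded_clinear_apply by (auto simp: bounded_clinear_def)

lemmas cblinfun_rep_eqs [simp] =
 plus_cblinfun.rep_eq minus_cblinfun.rep_eq uminus_cblinfun.rep_eq zero_cblinfun.rep_eq
 scaleC_cblinfun.rep_eq scaleR_cblinfun.rep_eq id_op.rep_eq comp_op.rep_eq fst_op.rep_eq
 snd_op.rep_eq col_op.rep_eq vec_op.rep_eq

lemma row_op_apply [simp]: "cblinfun_apply (row_op A B) x = A (fst x) + B (snd x)"
 by (simp add: row_op_def)

lemma block_op_apply [simp]:
 "cblinfun_apply (block_op A B C D) x = (A (fst x) + B (snd x), C (fst x) + D (snd x))"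
 by (simp add: block_op_def)

lemma emb_fst_apply [simp]: "cblinfun_apply emb_fst x = (x, 0)"
 by (simp add: emb_fst_def)

lemma CBlinfun_inverse_apply: "bounded_clinear f \<Longrightarrow> cblinfun_apply (CBlinfun f) = f"
 by (simp add: CBlinfun_inverse)

lemma comp_op_assoc: "A o\<^sub>C B o\<^sub>C C = A o\<^sub>C (B o\<^sub>C C)"
 by (rule cblinfun_eqI) simp

lemma comp_op_id [simp]: "A o\<^sub>C id_op = A" "id_op o\<^sub>C A = A"
 by (auto intro: cblinfun_eqI)

lemma norm_cblinfun_apply_le: "norm (cblinfun_apply A x) \<le> norm A * norm x"
 by (simp add: norm_cblinfun.rep_eq onorm[OF bounded_linear_apply])

lemma norm_cblinfun_bound: "0 \<le> b \<Longrightarrow> (\<And>x. norm (cblinfun_apply A x) \<le> b * norm x) \<Longrightarrow> norm A \<le> b"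
 by (simp add: norm_cblinfun.rep_eq onorm_bound)

lemma norm_comp_op_le: "norm (A o\<^sub>C B) \<le> norm A * norm B"
proof (rule norm_cblinfun_bound)
 fix x
 have "norm (A (B x)) \<le> norm A * (norm B * norm x)"
  by (rule order_trans[OF norm_cblinfun_apply_le])
   (auto intro: mult_left_mono norm_cblinfun_apply_le)
 then show "norm (cblinfun_apply (A o\<^sub>C B) x) \<le> norm A * norm B * norm x"
  by (simp add: mult.assoc)
qed simp

lemma bounded_bilinear_apply: "bounded_bilinear cblinfun_apply"
 by standard (auto intro!: exI[of _ 1] norm_cblinfun_apply_le)

lemma bounded_bilinear_comp_op: "bounded_bilinear comp_op"
 by standard (auto intro!: exI[of _ 1] norm_comp_op_le cblinfun_eqI)

lemma bounded_linear_cblinfunI: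
 assumes "\<And>x y. f (x + y) = f x + f y" and "\<And>c x. f (c *\<^sub>C x) = c *\<^sub>C f x"
  and "\<And>x. norm (f x) \<le> K * norm x"
 shows "bounded_clinear f"
 unfolding bounded_clinear_def
proof
 show "bounded_linear f"
  by (rule bounded_linear_intro[where K = K])
   (use assms in \<open>auto simp: scaleR_scaleC mult.commute\<close>)
qed (use assms in auto)

text \<open>A Cauchy sequence is regarded in the complete space of bounded real-linear operators,
  which carries the same norm; complex linearity passes to the limit pointwise.\<close>

instance cblinfun :: (complex_normed_vector, complex_hilbert_space) banach
proof
 fix X :: "nat \<Rightarrow> ('a \<Rightarrow>\<^sub>B 'b)"
 assume X: "Cauchy X"
 define Y where "Y n = Blinfun (cblinfun_apply (X n))" for n
 have app: "blinfun_apply (Y n) = X n" for n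
  by (simp add: Y_def bounded_linear_Blinfun_apply bounded_linear_apply)
 have nrm: "norm (Y n - Y m) = norm (X n - X m)" for n m
  unfolding norm_blinfun.rep_eq norm_cblinfun.rep_eq
  by (rule arg_cong[where f = onorm]) (auto simp: blinfun.bilinear_simps app)
 have "Cauchy Y"
  using X by (simp add: Cauchy_iff nrm)
 then obtain L where L: "Y \<longlonglongrightarrow> L"
  using Cauchy_convergent convergent_def by blast
 have Lx: "(\<lambda>n. X n x) \<longlonglongrightarrow> blinfun_apply L x" for x
  using bounded_bilinear.tendsto[OF bounded_bilinear_blinfun_apply L tendsto_const[of x]]
  by (simp add: app)
 have "bounded_clinear (blinfun_apply L)"
  unfolding bounded_clinear_def
 proof (intro conjI allI)
  fix c x
  have "(\<lambda>n. c *\<^sub>C X n x) \<longlonglongrightarrow> c *\<^sub>C blinfun_apply L x"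
   by (rule bounded_linear.tendsto[OF bounded_linear_scaleC Lx])
  with Lx[of "c *\<^sub>C x"] show "blinfun_apply L (c *\<^sub>C x) = c *\<^sub>C blinfun_apply L x"
   by (simp add: LIMSEQ_unique)
 qed (rule blinfun.bounded_linear_right)
 then have A: "cblinfun_apply (CBlinfun (blinfun_apply L)) = blinfun_apply L"
  by (rule CBlinfun_inverse_apply)
 have "norm (X n - CBlinfun (blinfun_apply L)) = norm (Y n - L)" for n
  unfolding norm_blinfun.rep_eq norm_cblinfun.rep_eq
  by (rule arg_cong[where f = onorm]) (auto simp: blinfun.bilinear_simps app A)
 with L have "X \<longlonglongrightarrow> CBlinfun (blinfun_apply L)"
  by (simp add: LIMSEQ_iff)
 then show "convergent X"
  by (auto simp: convergent_def)
qed

section \<open>The complex inner product\<close>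

lemma cinner_add_right: "cinner x (y + z) = cinner x y + cinner x z"
 by (metis cinner_add_left cinner_commute complex_cnj_add)

lemma cinner_scaleC_right: "cinner x (a *\<^sub>C y) = cnj a * cinner x y"
 by (metis cinner_commute cinner_scaleC_left complex_cnj_mult)

lemma cinner_zero_left [simp]: "cinner 0 y = 0"
 using cinner_scaleC_left[of 0 0 y] by simp

lemma cinner_zero_right [simp]: "cinner y 0 = 0"
 using cinner_scaleC_right[of y 0 0] by simp

lemma cinner_minus_left [simp]: "cinner (- x) y = - cinner x y"
 using cinner_add_left[of x "- x" y] by (simp add: eq_neg_iff_add_eq_0 add.commute)

lemma cinner_minus_right [simp]: "cinner x (- y) = - cinner x y"
 using cinner_add_right[of x y "- y"] by (simp add: eq_neg_iff_add_eq_0 add.commute)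

lemma cinner_diff_left: "cinner (x - y) z = cinner x z - cinner y z"
 by (simp add: cinner_add_left flip: add_uminus_conv_diff)

lemma cinner_diff_right: "cinner x (y - z) = cinner x y - cinner x z"
 by (simp add: cinner_add_right flip: add_uminus_conv_diff)

lemma cinner_scaleR_left: "cinner (r *\<^sub>R x) y = r *\<^sub>R cinner x y"
 by (simp add: scaleR_scaleC[where x=x] cinner_scaleC_left scaleR_conv_of_real)

lemma cinner_scaleR_right: "cinner x (r *\<^sub>R y) = r *\<^sub>R cinner x y"
 by (simp add: scaleR_scaleC[where x=y] cinner_scaleC_right scaleR_conv_of_real)

lemmas cinner_linear_simps = cinner_add_left cinner_add_right cinner_diff_left cinner_diff_right
 cinner_scaleC_left cinner_scaleC_right cinner_minus_left cinner_minus_right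

lemma cinner_self: "cinner x x = of_real ((norm x)\<^sup>2)"
proof (rule complex_eqI)
 show "Re (cinner x x) = Re (of_real ((norm x)\<^sup>2))"
  by (simp add: power2_norm_eq_inner inner_eq_Re_cinner)
 show "Im (cinner x x) = Im (of_real ((norm x)\<^sup>2))"
  using arg_cong[OF cinner_commute[of x x], of Im] by simp
qed

text \<open>A unimodular factor \<open>c\<close> rotates the product onto the positive real axis,
  where the real Cauchy-Schwarz inequality applies.\<close>

lemma cmod_cinner_le: "cmod (cinner x y) \<le> norm x * norm y"
proof (cases "cinner x y = 0")
 case False
 define c where "c = cnj (cinner x y) / cmod (cinner x y)"
 have "cmod c = 1"
  using False by (simp add: c_def norm_divide)
 have "cinner (c *\<^sub>C x) y = cmod (cinner x y)"
  using False complex_norm_square[of "cinner x y"]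
  by (simp add: cinner_scaleC_left c_def power2_eq_square mult.commute[of "cnj _"] field_simps)
 then have "cmod (cinner x y) = inner (c *\<^sub>C x) y"
  by (simp add: inner_eq_Re_cinner)
 also have "\<dots> \<le> norm (c *\<^sub>C x) * norm y"
  by (rule norm_cauchy_schwarz)
 finally show ?thesis
  by (simp add: norm_scaleC \<open>cmod c = 1\<close>)
qed simp

lemma bounded_bilinear_cinner: "bounded_bilinear cinner"
 by standard
  (auto intro!: exI[of _ 1] cmod_cinner_le
   simp: cinner_add_left cinner_add_right cinner_scaleR_left cinner_scaleR_right)

lemma cinner_eq_zero_iff [simp]: "cinner x x = 0 \<longleftrightarrow> x = 0"
 by (simp add: cinner_self)

lemma cinner_eqI: "(\<And>y. cinner x y = cinner z y) \<Longrightarrow> x = z"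
 using cinner_eq_zero_iff[of "x - z"] by (simp add: cinner_diff_left)

lemma cinner_eqI_right: "(\<And>y. cinner y x = cinner y z) \<Longrightarrow> x = z"
 using cinner_eq_zero_iff[of "x - z"] by (simp add: cinner_diff_right)

section \<open>Riesz representation and adjoints\<close>

lemma parallelogram_mid:
 fixes x y :: "'a::real_inner"
 shows "(norm (x - y))\<^sup>2 = 2 * (norm x)\<^sup>2 + 2 * (norm y)\<^sup>2 - 4 * (norm ((1/2) *\<^sub>R (x + y)))\<^sup>2"
 unfolding power2_norm_eq_inner
 by (simp add: inner_diff_left inner_diff_right inner_add_left inner_add_right
   inner_commute algebra_simps)

text \<open>If \<open>f\<close> is the product with \<open>v\<close>, then \<open>J x\<close> is the
  squared norm of \<open>x - v\<close> minus that of \<open>v\<close>; so \<open>v\<close> is sought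
  as the minimiser of \<open>J\<close>. A minimising sequence is Cauchy by the parallelogram law,
  the first variation at its limit gives Re f, and testing with \<open>\<i> *\<^sub>C h\<close>
  gives Im f.\<close>

theorem riesz_representation:
 fixes f :: "'a::complex_hilbert_space \<Rightarrow> complex"
 assumes f: "bounded_clinear f"
 obtains v where "\<And>x. f x = cinner x v"
proof -
 have bl: "bounded_linear f" and fc: "\<And>c x. f (c *\<^sub>C x) = c * f x"
  using f by (auto simp: bounded_clinear_def scaleC_complex_def)
 interpret bounded_linear f by (rule bl)
 obtain K where K: "\<And>x. cmod (f x) \<le> norm x * K" and "K > 0"
  using pos_bounded by blast
 define J where "J x = (norm x)\<^sup>2 - 2 * Re (f x)" for x
 have low: "- K\<^sup>2 \<le> J x" for x
 proof -
  have "Re (f x) \<le> norm x * K"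
   using K[of x] complex_Re_le_cmod[of "f x"] by linarith
  moreover have "0 \<le> (norm x - K)\<^sup>2" by simp
  ultimately show ?thesis by (simp add: J_def power2_eq_square algebra_simps)
 qed
 define m where "m = Inf (range J)"
 have bdd: "bdd_below (range J)"
  using low by (auto simp: bdd_below_def)
 have m_le: "m \<le> J x" for x
  unfolding m_def by (rule cInf_lower[OF _ bdd]) auto
 have "\<exists>x. J x < m + 1 / (real k + 1)" for k
  using cInf_lessD[of "range J" "m + 1 / (real k + 1)"] by (auto simp: m_def)
 then obtain X where X: "\<And>k. J (X k) < m + 1 / (real k + 1)" by metis
 have dist: "(norm (X k - X l))\<^sup>2 \<le> 2 / (real k + 1) + 2 / (real l + 1)" for k l
 proof -
  have "(norm (X k - X l))\<^sup>2 = 2 * J (X k) + 2 * J (X l) - 4 * J ((1/2) *\<^sub>R (X k + X l))"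
   unfolding parallelogram_mid[of "X k" "X l"] J_def
   by (simp add: add scaleR scaleR_conv_of_real field_simps)
  with X[of k] X[of l] m_le[of "(1/2) *\<^sub>R (X k + X l)"] show ?thesis by simp
 qed
 have "Cauchy X"
 proof (rule CauchyI)
  fix e :: real
  assume "0 < e"
  obtain N where "4 / e\<^sup>2 < real N"
   using reals_Archimedean2 by blast
  then have "4 / e\<^sup>2 < real N + 1" by linarith
  then have N: "4 / (real N + 1) < e\<^sup>2"
   using \<open>0 < e\<close> by (simp add: divide_less_eq mult.commute)
  show "\<exists>M. \<forall>m\<ge>M. \<forall>n\<ge>M. norm (X m - X n) < e"
  proof (intro exI allI impI)
   fix k l
   assume "N \<le> k" "N \<le> l"
   then have "2 / (real k + 1) \<le> 2 / (real N + 1)" "2 / (real l + 1) \<le> 2 / (real N + 1)"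
   by (auto intro!: divide_left_mono)
   with dist[of k l] N have "(norm (X k - X l))\<^sup>2 < e\<^sup>2" by simp
   then show "norm (X k - X l) < e"
   using \<open>0 < e\<close> by (simp add: power2_less_imp_less)
  qed
 qed
 then obtain v where v: "X \<longlonglongrightarrow> v"
  using Cauchy_convergent convergent_def by blast
 have "(\<lambda>k. J (X k)) \<longlonglongrightarrow> J v"
  unfolding J_def by (intro tendsto_intros tendsto v)
 moreover have "(\<lambda>k. m + 1 / (real k + 1)) \<longlonglongrightarrow> m"
  using tendsto_add[OF tendsto_const[of m] LIMSEQ_inverse_real_of_nat]
  by (simp add: inverse_eq_divide add.commute)
 ultimately have Jv: "J v \<le> m"
  by (rule LIMSEQ_le) (use X in \<open>auto intro: less_imp_le\<close>)
 have Re: "Re (f h) = Re (cinner h v)" for h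
 proof -
  define d where "d = inner h v - Re (f h)"
  have q: "0 \<le> 2 * t * d + t\<^sup>2 * (norm h)\<^sup>2" for t
  proof -
   have "J (v + t *\<^sub>R h) = J v + 2 * t * d + t\<^sup>2 * (norm h)\<^sup>2"
   unfolding J_def d_def power2_norm_eq_inner
   by (simp add: add scaleR inner_add_left inner_add_right inner_commute algebra_simps power2_eq_square)
   with Jv m_le[of "v + t *\<^sub>R h"] show ?thesis by simp
  qed
  have "d = 0"
  proof (rule ccontr)
   assume "d \<noteq> 0"
   \<comment> \<open>The summand 1 keeps the divisor positive; \<open>t = - d / p\<close> then makes
     the quadratic polynomial negative as soon as \<open>d\<close> is nonzero.\<close>
   define p where "p = (norm h)\<^sup>2 + 1"
   have p: "p > 0" by (simp add: p_def add_nonneg_pos)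
   define t where "t = - d / p"
   have "2 * t * d + t\<^sup>2 * (norm h)\<^sup>2 = 2 * t * d + t\<^sup>2 * (p - 1)"
   by (simp add: p_def)
   also have "\<dots> = - (d\<^sup>2 * (p + 1) / p\<^sup>2)"
   using p unfolding t_def by (simp add: field_simps power2_eq_square)
   also have "\<dots> < 0"
   using p \<open>d \<noteq> 0\<close> by simp
   finally show False using q[of t] by simp
  qed
  then show ?thesis by (simp add: d_def inner_eq_Re_cinner)
 qed
 have "f h = cinner h v" for h
 proof (rule complex_eqI[OF Re])
  have "Re (f (\<i> *\<^sub>C h)) = Re (cinner (\<i> *\<^sub>C h) v)" by (rule Re)
  then show "Im (f h) = Im (cinner h v)" by (simp add: fc cinner_scaleC_left)
 qed
 with that show ?thesis by blast
qed

text \<open>Riesz representation for each fixed \<open>y\<close> supplies the values of the adjoint.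
  Together with uniqueness this justifies the definite description in \<open>adj\<close>.\<close>

lemma adj_exists: "\<exists>!B :: 'b \<Rightarrow>\<^sub>B 'a. \<forall>x y. cinner (cblinfun_apply A x) y = cinner x (B y)"
 for A :: "'a::complex_hilbert_space \<Rightarrow>\<^sub>B 'b::complex_hilbert_space"
proof -
 have "\<exists>v. \<forall>x. cinner (A x) y = cinner x v" for y
 proof -
  have "bounded_clinear (\<lambda>x. cinner (A x) y)"
  proof (rule bounded_linear_cblinfunI[where K = "norm A * norm y"])
   fix x
   have "cmod (cinner (A x) y) \<le> norm A * norm x * norm y"
   by (rule order_trans[OF cmod_cinner_le mult_right_mono[OF norm_cblinfun_apply_le]]) simp
   then show "cmod (cinner (A x) y) \<le> norm A * norm y * norm x"
   by (simp add: mult.assoc mult.commute[of "norm x"])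
  qed (simp_all add: cinner_add_left cinner_scaleC_left scaleC_complex_def)
  from riesz_representation[OF this] obtain v where "\<And>x. cinner (A x) y = cinner x v" by blast
  then show ?thesis by blast
 qed
 then have "\<forall>y. \<exists>v. \<forall>x. cinner (A x) y = cinner x v" by blast
 from choice[OF this] obtain B where B: "\<And>x y. cinner (A x) y = cinner x (B y)" by blast
 have "bounded_clinear B"
 proof (rule bounded_linear_cblinfunI[where K = "norm A"])
  show "B (x + y) = B x + B y" for x y
   by (rule cinner_eqI_right) (simp add: cinner_add_right flip: B)
  show "B (c *\<^sub>C x) = c *\<^sub>C B x" for c x
   by (rule cinner_eqI_right) (simp add: cinner_scaleC_right flip: B)
  show "norm (B y) \<le> norm A * norm y" for y
  proof (cases "B y = 0")
   case False
   have "(norm (B y))\<^sup>2 = cmod (cinner (A (B y)) y)"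
   by (simp add: B cinner_self norm_power)
   also have "\<dots> \<le> norm A * norm (B y) * norm y"
   by (rule order_trans[OF cmod_cinner_le]) (intro mult_right_mono norm_cblinfun_apply_le norm_ge_zero)
   finally show ?thesis
   using False by (simp add: power2_eq_square)
  qed simp
 qed
 then have *: "\<forall>x y. cinner (A x) y = cinner x (cblinfun_apply (CBlinfun B) y)"
  by (simp add: CBlinfun_inverse_apply B)
 show ?thesis
 proof (rule ex1I)
  show "\<forall>x y. cinner (A x) y = cinner x (cblinfun_apply (CBlinfun B) y)" by fact
  show "C = CBlinfun B" if "\<forall>x y. cinner (A x) y = cinner x (cblinfun_apply C y)" for C
  proof (rule cblinfun_eqI, rule cinner_eqI_right)
   fix y x
   show "cinner x (C y) = cinner x (CBlinfun B y)"
   using that * by metis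
  qed
 qed
qed

lemma cinner_adj: "cinner (cblinfun_apply A x) y = cinner x (adj A y)"
 by (rule theI'[OF adj_exists[of A], folded adj_def, rule_format])

lemma cinner_adj': "cinner (cblinfun_apply (adj A) x) y = cinner x (A y)"
 by (metis cinner_adj cinner_commute)

lemma adj_eqI: "(\<And>x y. cinner (cblinfun_apply A x) y = cinner x (cblinfun_apply B y)) \<Longrightarrow> adj A = B"
 by (rule cblinfun_eqI, rule cinner_eqI_right) (simp flip: cinner_adj)

lemma adj_adj [simp]: "adj (adj A) = A"
 by (rule adj_eqI) (rule cinner_adj')

lemma adj_comp: "adj (A o\<^sub>C B) = adj B o\<^sub>C adj A"
 by (rule adj_eqI) (simp add: cinner_adj)

lemma adj_add: "adj (A + B) = adj A + adj B"
 and adj_diff: "adj (A - B) = adj A - adj B"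
 and adj_minus: "adj (- A) = - adj A"
 and adj_scaleC: "adj (c *\<^sub>C A) = cnj c *\<^sub>C adj A"
 and adj_scaleR: "adj (r *\<^sub>R A) = r *\<^sub>R adj A"
 by (rule adj_eqI; simp add: cinner_linear_simps cinner_scaleR_left cinner_scaleR_right cinner_adj)+

lemma adj_id [simp]: "adj id_op = id_op" and adj_zero [simp]: "adj 0 = 0"
 by (rule adj_eqI; simp)+

lemma adj_fst_op: "adj fst_op = emb_fst"
 by (rule adj_eqI) (simp add: cinner_prod_def)

lemma adj_emb_fst: "adj emb_fst = fst_op"
 by (rule adj_eqI) (simp add: cinner_prod_def)

lemma adj_col_op: "adj (col_op A B) = row_op (adj A) (adj B)"
 by (rule adj_eqI) (simp add: cinner_prod_def cinner_adj cinner_add_right)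

lemma adj_block_op: "adj (block_op A B C D) = block_op (adj A) (adj C) (adj B) (adj D)"
 by (rule adj_eqI) (simp add: cinner_prod_def cinner_adj cinner_linear_simps)

lemma norm_adj [simp]: "norm (adj A) = norm A"
proof -
 have *: "norm (adj B) \<le> norm B" for B :: "'c::complex_hilbert_space \<Rightarrow>\<^sub>B 'd::complex_hilbert_space"
 proof (rule norm_cblinfun_bound)
  fix y
  show "norm (adj B y) \<le> norm B * norm y"
  proof (cases "adj B y = 0")
   case False
   have "(norm (adj B y))\<^sup>2 = cmod (cinner (B (adj B y)) y)"
   by (simp add: cinner_adj cinner_self norm_power)
   also have "\<dots> \<le> norm B * norm (adj B y) * norm y"
   by (rule order_trans[OF cmod_cinner_le]) (intro mult_right_mono norm_cblinfun_apply_le norm_ge_zero)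
   finally show ?thesis
   using False by (simp add: power2_eq_square)
  qed simp
 qed simp
 from *[of A] *[of "adj A"] show ?thesis by simp
qed

lemma bounded_linear_adj: "bounded_linear adj"
 by (rule bounded_linear_intro[where K = 1]) (auto simp: adj_add adj_scaleR)

section \<open>Inverses of operators\<close>

lemma is_inverse_op_unique: "is_inverse_op A B \<Longrightarrow> is_inverse_op A C \<Longrightarrow> B = C"
 unfolding is_inverse_op_def by (metis comp_op_assoc comp_op_id)

lemma inverse_op_eqI: "is_inverse_op A B \<Longrightarrow> inverse_op A = B"
 unfolding inverse_op_def using is_inverse_op_unique by blast

lemma is_inverse_op_inverse_op: "boundedly_invertible A \<Longrightarrow> is_inverse_op A (inverse_op A)"
 unfolding boundedly_invertible_def using inverse_op_eqI by metis

lemma inverse_op_apply: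
 assumes "boundedly_invertible A"
 shows "cblinfun_apply (inverse_op A) (A x) = x" "cblinfun_apply A (inverse_op A y) = y"
proof -
 have "(inverse_op A o\<^sub>C A) x = x" "(A o\<^sub>C inverse_op A) y = y"
  using is_inverse_op_inverse_op[OF assms] unfolding is_inverse_op_def by simp_all
 then show "cblinfun_apply (inverse_op A) (A x) = x" "cblinfun_apply A (inverse_op A y) = y"
  by simp_all
qed

lemma is_inverse_op_adj: "is_inverse_op A B \<Longrightarrow> is_inverse_op (adj A) (adj B)"
 unfolding is_inverse_op_def by (metis adj_comp adj_id)

lemma boundedly_invertible_adj: "boundedly_invertible A \<Longrightarrow> boundedly_invertible (adj A)"
 unfolding boundedly_invertible_def using is_inverse_op_adj by blast

lemma inverse_op_adj: "boundedly_invertible A \<Longrightarrow> inverse_op (adj A) = adj (inverse_op A)"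
 by (rule inverse_op_eqI[OF is_inverse_op_adj[OF is_inverse_op_inverse_op]])

text \<open>The identity \<open>BB\<close> expresses \<open>B t - B s\<close> through
  \<open>A s - A t\<close>. Near \<open>s\<close> it first bounds \<open>norm (B t)\<close> by twice
  \<open>norm (B s)\<close>, by absorption, and then forces convergence.\<close>

lemma continuous_inverse_op:
 fixes A :: "'c::topological_space \<Rightarrow> ('a::complex_normed_vector \<Rightarrow>\<^sub>B 'b::complex_normed_vector)"
 assumes A: "continuous_on S A" and inv: "\<And>t. t \<in> S \<Longrightarrow> boundedly_invertible (A t)"
 shows "continuous_on S (\<lambda>t. inverse_op (A t))"
 unfolding continuous_on_def
proof
 fix s
 assume s: "s \<in> S"
 define B where "B t = inverse_op (A t)" for t
 have ev: "eventually (\<lambda>t. t \<in> S) (at s within S)"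
  by (simp add: eventually_at_filter)
 have lim: "(A \<longlongrightarrow> A s) (at s within S)"
  using A s by (simp add: continuous_on_def)
 then have lim0: "((\<lambda>t. norm (A s - A t)) \<longlongrightarrow> 0) (at s within S)"
  using tendsto_norm[OF tendsto_diff[OF tendsto_const[of "A s"] lim]] by simp
 have BB: "B t - B s = B t o\<^sub>C (A s - A t) o\<^sub>C B s" if "t \<in> S" for t
  by (rule cblinfun_eqI) (simp add: B_def inverse_op_apply inv that s)
 \<comment> \<open>The threshold makes \<open>norm (A s - A t) * norm (B s)\<close> at most 1/2, so
   that the term containing \<open>norm (B t)\<close> can be absorbed.\<close>
 have "eventually (\<lambda>t. norm (A s - A t) < 1 / (2 * (norm (B s) + 1))) (at s within S)"
  by (rule order_tendstoD(2)[OF lim0]) (simp add: add_nonneg_pos)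
 with ev have "eventually (\<lambda>t. norm (B t - B s) \<le> 2 * norm (B s) * norm (A s - A t) * norm (B s)) (at s within S)"
 proof eventually_elim
  case (elim t)
  have le: "norm (B t - B s) \<le> norm (B t) * norm (A s - A t) * norm (B s)"
   unfolding BB[OF elim(1)]
   by (rule order_trans[OF norm_comp_op_le]) (intro mult_right_mono norm_comp_op_le norm_ge_zero)
  have "norm (A s - A t) * norm (B s) \<le> 1 / (2 * (norm (B s) + 1)) * norm (B s)"
   using elim(2) by (intro mult_right_mono) auto
  also have "\<dots> \<le> 1 / 2"
   by (simp add: divide_simps add_nonneg_pos)
  finally have "norm (B t) * (norm (A s - A t) * norm (B s)) \<le> norm (B t) * (1 / 2)"
   by (intro mult_left_mono) auto
  moreover have "norm (B t) \<le> norm (B s) + norm (B t - B s)"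
   using norm_triangle_ineq[of "B s" "B t - B s"] by simp
  ultimately have "norm (B t) \<le> 2 * norm (B s)"
   using le by (simp add: mult.assoc)
  with le show ?case
   by (meson mult_right_mono norm_ge_zero order_trans)
 qed
 moreover have "((\<lambda>t. 2 * norm (B s) * norm (A s - A t) * norm (B s)) \<longlongrightarrow> 0) (at s within S)"
  using tendsto_mult[OF tendsto_mult[OF tendsto_const[of "2 * norm (B s)"] lim0] tendsto_const[of "norm (B s)"]]
  by simp
 ultimately have "((\<lambda>t. B t - B s) \<longlongrightarrow> 0) (at s within S)"
  by (rule Lim_null_comparison)
 then show "((\<lambda>t. inverse_op (A t)) \<longlongrightarrow> inverse_op (A s)) (at s within S)"
  unfolding B_def by (simp add: Lim_null[symmetric])
qed

text \<open>Solve \<open>P x = v\<close> as the fixed point of the contraction \<open>x \<mapsto> x - t (P x - v)\<close> for small \<open>t > 0\<close>.\<close>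

lemma coercive_boundedly_invertible:
 fixes P :: "'a::complex_hilbert_space \<Rightarrow>\<^sub>B 'a"
 assumes \<delta>: "0 < \<delta>" and coer: "\<And>x. \<delta> * (norm x)\<^sup>2 \<le> Re (cinner (cblinfun_apply P x) x)"
 shows "boundedly_invertible P"
proof -
 define K where "K = norm P + \<delta>"
 have "K > 0" "norm P \<le> K" "\<delta> \<le> K"
  using \<delta> by (auto simp: K_def add_nonneg_pos)
 \<comment> \<open>This \<open>t\<close> minimises 1 - 2 t \<delta> + t^2 K^2, the bound for the
   contraction of the squared norm. Including \<delta> in \<open>K\<close> ensures t \<delta> \<le>
   1.\<close>
 define t where "t = \<delta> / K\<^sup>2"
 define c where "c = sqrt (1 - t * \<delta>)"
 have t: "t > 0" "t * \<delta> > 0" "t * \<delta> \<le> 1"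
  using \<delta> \<open>K > 0\<close> \<open>\<delta> \<le> K\<close>
  by (auto simp: t_def field_simps power2_eq_square intro: mult_mono)
 have c: "0 \<le> c" "c < 1"
  using t by (auto simp: c_def)
 have contr: "norm (x - t *\<^sub>R P x) \<le> c * norm x" for x
 proof -
  have "(norm (x - t *\<^sub>R P x))\<^sup>2 = (norm x)\<^sup>2 - 2 * t * inner (P x) x + t\<^sup>2 * (norm (P x))\<^sup>2"
   unfolding power2_norm_eq_inner
   by (simp add: inner_diff_left inner_diff_right inner_commute algebra_simps power2_eq_square)
  also have "\<dots> \<le> (norm x)\<^sup>2 - 2 * t * (\<delta> * (norm x)\<^sup>2) + t\<^sup>2 * (K * norm x)\<^sup>2"
  proof -
   have "norm (P x) \<le> K * norm x"
   by (rule order_trans[OF norm_cblinfun_apply_le]) (simp add: mult_right_mono \<open>norm P \<le> K\<close>)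
   then have "t\<^sup>2 * (norm (P x))\<^sup>2 \<le> t\<^sup>2 * (K * norm x)\<^sup>2"
   by (intro mult_left_mono power_mono) auto
   moreover have "t * (\<delta> * (norm x)\<^sup>2) \<le> t * inner (P x) x"
   using coer[of x] t by (intro mult_left_mono) (auto simp: inner_eq_Re_cinner)
   ultimately show ?thesis by simp
  qed
  also have "\<dots> = (1 - t * \<delta>) * (norm x)\<^sup>2"
   using \<open>K > 0\<close> by (simp add: t_def field_simps power2_eq_square)
  also have "\<dots> = (c * norm x)\<^sup>2"
   using t by (simp add: c_def power_mult_distrib)
  finally show ?thesis
   by (rule power2_le_imp_le) (use c in simp)
 qed
 have "\<exists>!x. P x = v" for v
 proof -
  have diff: "x - t *\<^sub>R (P x - v) - (y - t *\<^sub>R (P y - v)) = (x - y) - t *\<^sub>R P (x - y)" for x y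
   by (simp add: scaleR_right_diff_distrib)
  have "\<exists>!x\<in>UNIV. (\<lambda>x. x - t *\<^sub>R (P x - v)) x = x"
  proof (rule Banach_fix[OF complete_UNIV _ c])
   show "\<And>x y. x \<in> UNIV \<Longrightarrow> y \<in> UNIV \<Longrightarrow> dist (x - t *\<^sub>R (P x - v)) (y - t *\<^sub>R (P y - v)) \<le> c * dist x y"
   unfolding dist_norm diff by (rule contr)
  qed auto
  moreover have "x - t *\<^sub>R (P x - v) = x \<longleftrightarrow> P x = v" for x
   using t by simp
  ultimately show ?thesis by simp
 qed
 then have Pv: "\<And>v. \<exists>!x. P x = v" .
 define Q where "Q v = (THE x. P x = v)" for v
 have Q: "P (Q v) = v" for v
  unfolding Q_def by (rule theI'[OF Pv])
 have Q': "Q (P x) = x" for x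
  using Pv[of "P x"] Q[of "P x"] by blast
 have "bounded_clinear Q"
 proof (rule bounded_linear_cblinfunI[where K = "1 / \<delta>"])
  show "Q (x + y) = Q x + Q y" for x y
   using Q'[of "Q x + Q y"] by (simp add: Q)
  show "Q (c *\<^sub>C x) = c *\<^sub>C Q x" for c x
   using Q'[of "c *\<^sub>C Q x"] by (simp add: Q)
  show "norm (Q x) \<le> 1 / \<delta> * norm x" for x
  proof (cases "Q x = 0")
   case False
   have "\<delta> * (norm (Q x))\<^sup>2 \<le> Re (cinner x (Q x))"
   using coer[of "Q x"] by (simp add: Q)
   also have "\<dots> \<le> norm x * norm (Q x)"
   by (rule order_trans[OF complex_Re_le_cmod cmod_cinner_le])
   finally show ?thesis
   using False \<delta> by (simp add: power2_eq_square field_simps)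
  qed (use \<delta> in auto)
 qed
 then have "is_inverse_op P (CBlinfun Q)"
  by (auto simp: is_inverse_op_def CBlinfun_inverse_apply Q Q' intro!: cblinfun_eqI)
 then show ?thesis by (auto simp: boundedly_invertible_def)
qed

text \<open>Normal equations: the lower bound makes \<open>adj A o\<^sub>C A\<close> coercive, which
  yields a left inverse of \<open>A\<close>; the injectivity of \<open>adj A\<close> turns it into a
  right inverse.\<close>

lemma bounded_below_boundedly_invertible:
 fixes A :: "'a::complex_hilbert_space \<Rightarrow>\<^sub>B 'b::complex_hilbert_space"
 assumes "0 < \<delta>" and low: "\<And>x. \<delta> * norm x \<le> norm (cblinfun_apply A x)"
  and inj: "\<And>y. cblinfun_apply (adj A) y = 0 \<Longrightarrow> y = 0"
 shows "boundedly_invertible A"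
proof -
 have "boundedly_invertible (adj A o\<^sub>C A)"
 proof (rule coercive_boundedly_invertible)
  show "0 < \<delta>\<^sup>2" using assms by simp
  show "\<delta>\<^sup>2 * (norm x)\<^sup>2 \<le> Re (cinner ((adj A o\<^sub>C A) x) x)" for x
   using power_mono[OF low[of x], of 2] \<open>0 < \<delta>\<close>
   by (simp add: cinner_adj' cinner_self power_mult_distrib)
 qed
 note inv = inverse_op_apply[OF this, simplified]
 define B where "B = inverse_op (adj A o\<^sub>C A) o\<^sub>C adj A"
 have "B o\<^sub>C A = id_op"
  by (rule cblinfun_eqI) (simp add: B_def inv)
 moreover have "A o\<^sub>C B = id_op"
 proof (rule cblinfun_eqI)
  fix y
  have "adj A (A (B y) - y) = 0"
   by (simp add: B_def inv)
  then show "(A o\<^sub>C B) y = id_op y"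
   using inj[of "A (B y) - y"] by simp
 qed
 ultimately show ?thesis
  by (auto simp: boundedly_invertible_def is_inverse_op_def)
qed

text \<open>The uniform boundedness principle by a gliding hump. Vectors of norm above 9^n are
  paired with a series of steps of length 3^(-n); the steps after the n-th have total length at most
  half of 3^(-n), so they cannot undo the n-th one, and the pairings with the sum \<open>Y\<close>
  grow at least like 3^n / 2.\<close>

lemma weakly_bounded_imp_bounded:
 fixes S :: "'a::complex_hilbert_space set"
 assumes wb: "\<And>k. \<exists>B. \<forall>x\<in>S. cmod (cinner x k) \<le> B"
 shows "bounded S"
proof (rule ccontr)
 assume unb: "\<not> bounded S"
 have "\<exists>x\<in>S. norm x > 9 ^ n" for n :: nat
 proof (rule ccontr)
  assume "\<not> (\<exists>x\<in>S. 9 ^ n < norm x)"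
  then have "\<forall>x\<in>S. norm x \<le> 9 ^ n" by (auto simp: not_less)
  with unb show False unfolding bounded_iff by blast
 qed
 then have "\<forall>n\<in>UNIV. \<exists>x. x \<in> S \<and> norm x > 9 ^ n" by blast
 from bchoice[OF this] obtain X where XS: "\<And>n. X n \<in> S" and X: "\<And>n. norm (X n) > 9 ^ n" by blast
 have X0: "norm (X n) > 0" for n
  using X[of n] by (rule less_trans[rotated]) simp
 define v where "v n = ((1/3) ^ n / norm (X n)) *\<^sub>R X n" for n
 have nv: "norm (v n) = (1/3) ^ n" for n
  using X0[of n] by (simp add: v_def)
 have Xv: "cmod (cinner (X n) (v n)) = (1/3) ^ n * norm (X n)" for n
  using X0[of n] by (simp add: v_def cinner_scaleR_right cinner_self norm_mult power2_eq_square)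
 \<comment> \<open>gliding hump: one of \<open>y + v\<close>, \<open>y - v\<close> is paired with \<open>X n\<close> at least as strongly as \<open>v\<close>\<close>
 define y where "y = rec_nat 0 (\<lambda>n y. if cmod (cinner (X n) (v n)) \<le> cmod (cinner (X n) (y + v n))
  then y + v n else y - v n)"
 have y_Suc: "y (Suc n) = (if cmod (cinner (X n) (v n)) \<le> cmod (cinner (X n) (y n + v n))
  then y n + v n else y n - v n)" and y_0: "y 0 = 0" for n
  by (simp_all add: y_def)
 have big: "(1/3) ^ n * norm (X n) \<le> cmod (cinner (X n) (y (Suc n)))" for n
 proof -
  have "2 * cmod (cinner (X n) (v n)) \<le> cmod (cinner (X n) (y n + v n)) + cmod (cinner (X n) (y n - v n))"
   using norm_triangle_ineq4[of "cinner (X n) (y n + v n)" "cinner (X n) (y n - v n)"]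
   by (simp add: cinner_add_right cinner_diff_right norm_mult)
  then show ?thesis unfolding y_Suc Xv[symmetric] by auto
 qed
 define d where "d n = y (Suc n) - y n" for n
 have nd: "norm (d n) = (1/3) ^ n" for n
  by (simp add: d_def y_Suc nv)
 have sd: "summable (\<lambda>n. norm (d n))"
  unfolding nd by (rule summable_geometric) simp
 have yd: "y n = sum d {..<n}" for n
  unfolding d_def sum_lessThan_telescope y_0 by simp
 define Y where "Y = suminf d"
 have tail: "norm (Y - y (Suc n)) \<le> (1/3) ^ n / 2" for n
 proof -
  have "Y - y (Suc n) = (\<Sum>i. d (i + Suc n))"
   unfolding Y_def yd by (rule suminf_minus_initial_segment[OF summable_norm_cancel[OF sd], symmetric])
  also have "norm \<dots> \<le> (\<Sum>i. norm (d (i + Suc n)))"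
   by (rule summable_norm) (use sd summable_ignore_initial_segment in blast)
  also have "\<dots> = (\<Sum>i. (1/3) ^ Suc n * (1/3) ^ i)"
   by (simp add: nd power_add mult.commute)
  also have "\<dots> = (1/3) ^ Suc n * (1 / (1 - 1/3))"
   by (subst suminf_mult) (auto simp: suminf_geometric summable_geometric)
  finally show ?thesis by simp
 qed
 obtain B where B: "\<And>x. x \<in> S \<Longrightarrow> cmod (cinner x Y) \<le> B"
  using wb[of Y] by blast
 have "3 ^ n \<le> 2 * B" for n :: nat
 proof -
  have "cmod (cinner (X n) (Y - y (Suc n))) \<le> norm (X n) * ((1/3) ^ n / 2)"
   by (rule order_trans[OF cmod_cinner_le mult_left_mono[OF tail]]) simp
  then have "cmod (cinner (X n) (Y - y (Suc n))) \<le> ((1/3) ^ n * norm (X n)) / 2"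
   by (simp only: times_divide_eq_right mult.commute)
  moreover have "cmod (cinner (X n) (y (Suc n))) \<le> cmod (cinner (X n) Y) + cmod (cinner (X n) (Y - y (Suc n)))"
   using norm_triangle_ineq4[of "cinner (X n) Y" "cinner (X n) (Y - y (Suc n))"]
   by (simp add: cinner_diff_right)
  ultimately have "(1/3) ^ n * norm (X n) \<le> 2 * B"
   using big[of n] B[OF XS[of n]] by linarith
  moreover have "(1/3) ^ n * 9 ^ n \<le> (1/3) ^ n * norm (X n)"
   using X[of n] by (intro mult_left_mono) auto
  ultimately show ?thesis
   by (simp flip: power_mult_distrib)
 qed
 then show False
  using real_arch_pow[of 3 "2 * B"] by (meson not_le one_less_numeral_iff semiring_norm(77))
qed

section \<open>Holomorphic operator pairs and the Weyl function\<close>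

lemma isometric_op_norm: "isometric_op V \<Longrightarrow> norm (cblinfun_apply V x) = norm x"
 unfolding isometric_op_def using cinner_self[of "V x"] cinner_self[of x]
 by (metis of_real_eq_iff norm_ge_zero power2_eq_iff_nonneg)

lemma isometric_op_adj_apply: "isometric_op V \<Longrightarrow> adj V (cblinfun_apply V x) = x"
 by (rule cinner_eqI_right) (simp add: isometric_op_def flip: cinner_adj)

lemma proj_compl_apply: "cblinfun_apply (proj_compl V) x = x - V (adj V x)"
 by (simp add: proj_compl_def)

lemma adj_proj_compl [simp]: "adj (proj_compl V) = proj_compl V"
 by (simp add: proj_compl_def adj_diff adj_comp)

lemma proj_compl_isometry:
 assumes "isometric_op V"
 shows "cblinfun_apply (proj_compl V) (V x) = 0" "adj V (proj_compl V y) = 0"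
  "cblinfun_apply (proj_compl V) (proj_compl V y) = proj_compl V y"
 by (simp_all add: proj_compl_apply isometric_op_adj_apply assms)

lemma cinner_proj_compl: "cinner (proj_compl V x) y = cinner x (proj_compl V y)"
 by (metis adj_proj_compl cinner_adj)

lemma norm_isometric_decomp:
 assumes "isometric_op V"
 shows "(norm x)\<^sup>2 = (norm (adj V x))\<^sup>2 + (norm (proj_compl V x))\<^sup>2"
proof -
 have "cinner x x = cinner (adj V x) (adj V x) + cinner (proj_compl V x) (proj_compl V x)"
  by (simp add: cinner_proj_compl proj_compl_isometry(3)[OF assms])
   (simp add: proj_compl_apply cinner_diff_right cinner_adj')
 then show ?thesis
  unfolding cinner_self by (simp add: of_real_eq_iff flip: of_real_add of_real_power)
qed

lemma norm_adj_isometric_le: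
 assumes "isometric_op V"
 shows "norm (adj V x) \<le> norm x"
proof (rule power2_le_imp_le)
 show "(norm (adj V x))\<^sup>2 \<le> (norm x)\<^sup>2"
  unfolding norm_isometric_decomp[OF assms, of x] by simp
qed simp

lemma norm_proj_compl_le:
 assumes "isometric_op V"
 shows "norm (proj_compl V x) \<le> norm x"
proof (rule power2_le_imp_le)
 show "(norm (proj_compl V x))\<^sup>2 \<le> (norm x)\<^sup>2"
  unfolding norm_isometric_decomp[OF assms, of x] by simp
qed simp

lemma norm_inverse_op_le:
 assumes "boundedly_invertible A"
 shows "norm x \<le> norm (inverse_op A) * norm (cblinfun_apply A x)"
 using norm_cblinfun_apply_le[of "inverse_op A" "A x"] by (simp add: inverse_op_apply assms)

text \<open>If \<open>b\<close> exceeds \<open>r\<close>, then r^2 is at most b r and one factor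
  \<open>b\<close> cancels; the summand 1 in the constant covers the other case.\<close>

lemma quadratic_bound:
 fixes b r \<epsilon> L :: real
 assumes "0 < \<epsilon>" "0 \<le> L" "0 \<le> b" "0 \<le> r" and "\<epsilon> * b\<^sup>2 \<le> L * b * r + r\<^sup>2"
 shows "b \<le> (1 + (L + 1) / \<epsilon>) * r"
proof (cases "b \<le> r")
 case True
 have "0 \<le> (L + 1) / \<epsilon> * r" using assms by simp
 with True show ?thesis by (simp add: distrib_right)
next
 case False
 then have "b > 0" using assms by simp
 have "r\<^sup>2 \<le> b * r"
  using False assms by (simp add: power2_eq_square mult_right_mono)
 then have "b * (\<epsilon> * b) \<le> b * ((L + 1) * r)"
  using assms(5) by (simp add: algebra_simps power2_eq_square)
 then have "\<epsilon> * b \<le> (L + 1) * r"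
  using \<open>b > 0\<close> by simp
 then have "b \<le> (L + 1) / \<epsilon> * r"
  using assms by (simp add: field_simps)
 then show ?thesis using assms by (simp add: distrib_right)
qed

lemma Im_scaleC_i_bounds:
 "Im (cinner x y) \<le> norm x * norm y" "Re (cinner x y) \<le> norm x * norm y"
 by (meson abs_Im_le_cmod abs_Re_le_cmod abs_le_D1 cmod_cinner_le order_trans)+

text \<open>The data at one point \<lambda> of the upper half-plane: \<open>M\<close> is
  M_+(\<lambda>), \<open>c0\<close> and \<open>c1\<close> are the values of C_0 and C_1 at
  \<lambda>, and \<open>d0\<close>, \<open>d1\<close> those of D_0 and D_1 at the conjugate point.
  \<open>M_pos\<close> and \<open>M_neg\<close> are uniform dissipativity of \<open>M\<close> and of
  its adjoint, which is M_- at the conjugate point; the sign conditions on the pairs are written as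
  quadratic forms.\<close>

locale weyl_pair =
 fixes V :: "'h1::complex_hilbert_space \<Rightarrow>\<^sub>B 'h0::complex_hilbert_space"
  and M :: "'h0 \<Rightarrow>\<^sub>B 'h1"
  and c0 :: "'h0 \<Rightarrow>\<^sub>B 'kp::complex_hilbert_space" and c1 :: "'h1 \<Rightarrow>\<^sub>B 'kp"
  and d0 :: "'h0 \<Rightarrow>\<^sub>B 'km::complex_hilbert_space" and d1 :: "'h1 \<Rightarrow>\<^sub>B 'km"
  and \<epsilon> :: real
 assumes iso: "isometric_op V" and eps: "0 < \<epsilon>"
  and M_pos: "\<And>h. \<epsilon> * (norm h)\<^sup>2 \<le> 2 * Im (cinner (M h) (adj V h)) + (norm (proj_compl V h))\<^sup>2"
  and M_neg: "\<And>b. 2 * Im (cinner (adj V (adj M b)) b) + (norm (proj_compl V (adj M b)))\<^sup>2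
   \<le> - \<epsilon> * (norm b)\<^sup>2"
  and C_nonneg: "\<And>a. 0 \<le> 2 * Im (cinner (adj V (adj c0 a)) (adj c1 a))
   + (norm (proj_compl V (adj c0 a)))\<^sup>2"
  and C_inv: "boundedly_invertible (c0 - \<i> *\<^sub>C (c1 o\<^sub>C adj V))"
  and D_nonpos: "\<And>a. 2 * Im (cinner (adj V (adj d0 a)) (adj d1 a))
   + (norm (proj_compl V (adj d0 a)))\<^sup>2 \<le> 0"
  and D_inv: "boundedly_invertible (d0 o\<^sub>C V + \<i> *\<^sub>C d1)"
  and coupling: "\<And>a. c1 (adj V (adj d0 a)) - c0 (V (adj d1 a)) + \<i> *\<^sub>C c0 (proj_compl V (adj d0 a)) = 0"
begin

abbreviation "P \<equiv> proj_compl V"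

text \<open>\<open>N\<close> is the operator whose inverse gives the inverse of \<tau>_+ + M_+,
  \<open>T0\<close> is the adjoint of the D-tilde-0 of the Green function, and \<open>Nt\<close> is
  the operator inverted in \<open>Y_tau_plus\<close>.\<close>

definition N where "N = c0 - c1 o\<^sub>C M"
definition T0 where "T0 = adj (d1 o\<^sub>C adj V + \<i> *\<^sub>C (d0 o\<^sub>C P))"
definition Nt where "Nt = adj (d0 o\<^sub>C V) - M o\<^sub>C T0"

lemma adj_N_apply: "adj N a = adj c0 a - adj M (adj c1 a)"
 by (simp add: N_def adj_diff adj_comp)

lemma T0_apply: "cblinfun_apply T0 a = V (adj d1 a) - \<i> *\<^sub>C P (adj d0 a)"
 by (simp add: T0_def adj_add adj_scaleC adj_comp scaleC_minus_left)

lemma Nt_apply: "cblinfun_apply Nt a = adj V (adj d0 a) - M (T0 a)"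
 by (simp add: Nt_def adj_comp)

lemma adj_V_T0: "adj V (T0 a) = adj d1 a"
 by (simp add: T0_apply isometric_op_adj_apply proj_compl_isometry iso)

lemma P_T0: "cblinfun_apply P (T0 a) = - (\<i> *\<^sub>C P (adj d0 a))"
 by (simp add: T0_apply proj_compl_isometry iso)

text \<open>This is the coupling condition in terms of \<open>T0\<close>. It says that all pairs of
  \<open>T0 a\<close> and \<open>- adj V (adj d0 a)\<close> lie in the kernel of the row (c0 c1);
  \<open>ker_c\<close> is the converse.\<close>

lemma intertwining: "c1 (adj V (adj d0 a)) = c0 (T0 a)"
 using coupling[of a] by (simp add: T0_apply algebra_simps eq_neg_iff_add_eq_0)

lemma adj_intertwining_apply:
 "d0 (V (adj c1 a)) = (d1 o\<^sub>C adj V + \<i> *\<^sub>C (d0 o\<^sub>C P)) (adj c0 a)"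
proof (rule cinner_eqI)
 fix y
 have "cinner (d0 (V (adj c1 a))) y = cinner a (c1 (adj V (adj d0 y)))"
  by (simp add: cinner_adj cinner_adj')
 also have "\<dots> = cinner (adj T0 (adj c0 a)) y"
  by (simp add: intertwining cinner_adj')
 finally show "cinner (d0 (V (adj c1 a))) y = cinner ((d1 o\<^sub>C adj V + \<i> *\<^sub>C (d0 o\<^sub>C P)) (adj c0 a)) y"
  by (simp add: T0_def)
qed

text \<open>The kernel of the row \<open>(c\<^sub>0 c\<^sub>1)\<close> is parametrised by the adjoint of the pair \<open>(d\<^sub>0, d\<^sub>1)\<close>, and
 vice versa; this replaces the maximality of the dissipative relations.\<close>

lemma ker_c:
 assumes "c0 h0 + c1 h1 = 0"
 shows "\<exists>a. h0 = T0 a \<and> h1 = - adj V (adj d0 a)"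
proof -
 define W where "W = d0 o\<^sub>C V + \<i> *\<^sub>C d1"
 \<comment> \<open>The parameter is chosen so that the remainder satisfies
   \<open>k1 = - (\<i> *\<^sub>C adj V k0)\<close>. On such pairs the row (c0 c1) acts as the
   invertible operator of \<open>C_inv\<close>, so the remainder vanishes.\<close>
 define a where "a = - inverse_op (adj W) (h1 + \<i> *\<^sub>C adj V h0)"
 have "adj W a = - (h1 + \<i> *\<^sub>C adj V h0)"
  using D_inv by (simp add: a_def W_def boundedly_invertible_adj inverse_op_apply(2))
 then have a: "adj V (adj d0 a) - \<i> *\<^sub>C adj d1 a = - (h1 + \<i> *\<^sub>C adj V h0)"
  by (simp add: W_def adj_add adj_comp adj_scaleC scaleC_minus_left)
 define k0 k1 where "k0 = h0 - T0 a" and "k1 = h1 + adj V (adj d0 a)"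
 have "c0 k0 + c1 k1 = 0"
  using assms intertwining[of a] by (simp add: k0_def k1_def algebra_simps)
 moreover have k1: "k1 = - (\<i> *\<^sub>C adj V k0)"
  using a by (simp add: k0_def k1_def adj_V_T0 scaleC_diff_right algebra_simps)
 ultimately have "(c0 - \<i> *\<^sub>C (c1 o\<^sub>C adj V)) k0 = 0"
  by simp
 then have "k0 = 0"
  using inverse_op_apply(1)[OF C_inv, of k0] by simp
 with k1 have "k1 = 0" by simp
 with \<open>k0 = 0\<close> show ?thesis
  by (intro exI[of _ a]) (simp add: k0_def k1_def eq_neg_iff_add_eq_0)
qed

lemma ker_d:
 assumes "d0 (V k) = (d1 o\<^sub>C adj V + \<i> *\<^sub>C (d0 o\<^sub>C P)) l"
 shows "\<exists>a. k = adj c1 a \<and> l = adj c0 a"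
proof -
 define W where "W = c0 - \<i> *\<^sub>C (c1 o\<^sub>C adj V)"
 \<comment> \<open>Here the choice makes the remainder satisfy
   \<open>l' = - (\<i> *\<^sub>C V k')\<close>, which reduces the equation to the invertible
   operator of \<open>D_inv\<close> applied to \<open>k'\<close>.\<close>
 define a where "a = inverse_op (adj W) (l + \<i> *\<^sub>C V k)"
 have "adj W a = l + \<i> *\<^sub>C V k"
  using C_inv by (simp add: a_def W_def boundedly_invertible_adj inverse_op_apply(2))
 then have a: "adj c0 a + \<i> *\<^sub>C V (adj c1 a) = l + \<i> *\<^sub>C V k"
  by (simp add: W_def adj_diff adj_comp adj_scaleC scaleC_minus_left)
 define k' l' where "k' = k - adj c1 a" and "l' = l - adj c0 a"
 have l': "l' = - (\<i> *\<^sub>C V k')"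
  using a by (simp add: k'_def l'_def scaleC_diff_right algebra_simps)
 have "d0 (V k') = (d1 o\<^sub>C adj V + \<i> *\<^sub>C (d0 o\<^sub>C P)) l'"
  using assms adj_intertwining_apply[of a]
  by (simp add: k'_def l'_def scaleC_diff_right algebra_simps)
 also have "\<dots> = - (\<i> *\<^sub>C d1 k')"
  by (simp add: l' isometric_op_adj_apply proj_compl_isometry iso)
 finally have "(d0 o\<^sub>C V + \<i> *\<^sub>C d1) k' = 0"
  by simp
 then have "k' = 0"
  using inverse_op_apply(1)[OF D_inv, of k'] by simp
 then show ?thesis
  using l' by (intro exI[of _ a]) (simp add: k'_def l'_def)
qed

text \<open>With \<open>b = adj c1 a\<close> and \<open>r = adj N a\<close>, the vector
  \<open>adj c0 a\<close> equals \<open>adj M b + r\<close>. The form of the pair is nonnegative and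
  that of \<open>adj M\<close> strictly negative, so \<open>b\<close> is controlled by
  \<open>r\<close>; the adjoint of the operator in \<open>C_inv\<close> then recovers
  \<open>a\<close> from \<open>b\<close> and \<open>r\<close>.\<close>

lemma adj_N_bounded_below: "\<exists>\<delta>>0. \<forall>a. \<delta> * norm a \<le> norm (adj N a)"
proof -
 define W where "W = adj (c0 - \<i> *\<^sub>C (c1 o\<^sub>C adj V))"
 have W: "boundedly_invertible W"
  unfolding W_def by (rule boundedly_invertible_adj[OF C_inv])
 define K where "K = norm M"
 define B where "B = 1 + (2 * (1 + K) + 1) / \<epsilon>"
 define F where "F = norm (inverse_op W) * (K * B + 1 + B) + 1"
 have K0: "K \<ge> 0" by (simp add: K_def)
 have B0: "B > 0" using K0 eps by (simp add: B_def add_pos_nonneg)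
 have F0: "F > 0" using K0 B0 by (simp add: F_def add_nonneg_pos)
 have "norm a \<le> F * norm (adj N a)" for a
 proof -
  define b r where "b = adj c1 a" and "r = adj N a"
  have c0a: "adj c0 a = adj M b + r"
   by (simp add: b_def r_def adj_N_apply)
  have Mb: "norm (adj M b) \<le> K * norm b"
   using norm_cblinfun_apply_le[of "adj M" b] by (simp add: K_def)
  have "0 \<le> 2 * Im (cinner (adj V (adj M b + r)) b) + (norm (P (adj M b + r)))\<^sup>2"
   using C_nonneg[of a] by (simp add: c0a b_def)
  also have "\<dots> = (2 * Im (cinner (adj V (adj M b)) b) + (norm (P (adj M b)))\<^sup>2)
   + 2 * Im (cinner (adj V r) b) + 2 * Re (cinner (P (adj M b)) (P r)) + (norm (P r))\<^sup>2"
   by (simp add: cinner_add_left power2_norm_eq_inner inner_add_left inner_add_right inner_commute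
   inner_eq_Re_cinner[symmetric] algebra_simps)
  also have "\<dots> \<le> - \<epsilon> * (norm b)\<^sup>2 + 2 * (norm r * norm b) + 2 * ((K * norm b) * norm r) + (norm r)\<^sup>2"
  proof -
   have "Im (cinner (adj V r) b) \<le> norm r * norm b"
   by (rule order_trans[OF Im_scaleC_i_bounds(1)]) (intro mult_right_mono norm_adj_isometric_le iso norm_ge_zero)
   moreover have "Re (cinner (P (adj M b)) (P r)) \<le> (K * norm b) * norm r"
   by (rule order_trans[OF Im_scaleC_i_bounds(2)])
   (intro mult_mono order_trans[OF norm_proj_compl_le[OF iso] Mb] norm_proj_compl_le iso norm_ge_zero
   mult_nonneg_nonneg K0)
   moreover have "(norm (P r))\<^sup>2 \<le> (norm r)\<^sup>2"
   by (intro power_mono norm_proj_compl_le iso norm_ge_zero)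
   ultimately show ?thesis using M_neg[of b] by linarith
  qed
  finally have "\<epsilon> * (norm b)\<^sup>2 \<le> (2 * (1 + K)) * norm b * norm r + (norm r)\<^sup>2"
   by (simp add: algebra_simps)
  from quadratic_bound[OF eps _ _ _ this] K0 have bB: "norm b \<le> B * norm r"
   by (simp add: B_def)
  have "W a = adj c0 a + \<i> *\<^sub>C V b"
   by (simp add: W_def b_def adj_diff adj_comp adj_scaleC scaleC_minus_left)
  then have "norm (W a) \<le> norm (adj c0 a) + norm b"
   using norm_triangle_ineq[of "adj c0 a" "\<i> *\<^sub>C V b"]
   by (simp add: norm_scaleC isometric_op_norm iso)
  also have "norm (adj c0 a) \<le> K * norm b + norm r"
   using norm_triangle_ineq[of "adj M b" r] Mb by (simp add: c0a)
  also have "K * norm b + norm r + norm b \<le> K * (B * norm r) + norm r + B * norm r"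
   using bB K0 by (intro add_mono mult_left_mono) auto
  finally have "norm (W a) \<le> (K * B + 1 + B) * norm r"
   by (simp add: algebra_simps)
  then have "norm a \<le> norm (inverse_op W) * ((K * B + 1 + B) * norm r)"
   by (intro order_trans[OF norm_inverse_op_le[OF W]] mult_left_mono) auto
  also have "\<dots> \<le> F * norm r"
   by (simp add: F_def algebra_simps)
  finally show ?thesis by (simp add: r_def)
 qed
 then show ?thesis
  using F0 by (intro exI[of _ "1 / F"]) (simp add: field_simps)
qed

text \<open>The counterpart on the D side: \<open>h = T0 a\<close> carries the form of the pair (d0,
  d1) up to the error \<open>r = Nt a\<close>. Since \<open>r\<close> enters only linearly, the
  constant is simply 2 / \<epsilon>.\<close>

lemma Nt_bounded_below: "\<exists>\<delta>>0. \<forall>a. \<delta> * norm a \<le> norm (cblinfun_apply Nt a)"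
proof -
 define W where "W = adj (d0 o\<^sub>C V + \<i> *\<^sub>C d1)"
 have W: "boundedly_invertible W"
  unfolding W_def by (rule boundedly_invertible_adj[OF D_inv])
 define K where "K = norm M"
 define B where "B = 2 / \<epsilon>"
 define F where "F = norm (inverse_op W) * (K * B + 1 + B) + 1"
 have K0: "K \<ge> 0" by (simp add: K_def)
 have B0: "B > 0" using eps by (simp add: B_def)
 have F0: "F > 0" using K0 B0 by (simp add: F_def add_nonneg_pos)
 have "norm a \<le> F * norm (Nt a)" for a
 proof -
  define h r where "h = T0 a" and "r = Nt a"
  have Vd0: "adj V (adj d0 a) = M h + r"
   by (simp add: h_def r_def Nt_apply)
  have q: "adj d1 a = adj V h"
   by (simp add: h_def adj_V_T0)
  have qh: "norm (adj d1 a) \<le> norm h"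
   unfolding q by (rule norm_adj_isometric_le[OF iso])
  have "norm (P h) = norm (P (adj d0 a))"
   by (simp add: h_def P_T0 norm_scaleC)
  then have "2 * Im (cinner (M h + r) (adj V h)) + (norm (P h))\<^sup>2 \<le> 0"
   using D_nonpos[of a] by (simp add: Vd0 q)
  with M_pos[of h] have le: "\<epsilon> * (norm h)\<^sup>2 \<le> 2 * Im (cinner (- r) (adj V h))"
   by (simp add: cinner_add_left)
  have "Im (cinner (- r) (adj V h)) \<le> norm (- r) * norm (adj V h)"
   by (rule Im_scaleC_i_bounds)
  also have "\<dots> \<le> norm r * norm h"
   unfolding norm_minus_cancel by (intro mult_left_mono norm_adj_isometric_le iso norm_ge_zero)
  finally have le2: "\<epsilon> * (norm h)\<^sup>2 \<le> 2 * (norm r * norm h)"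
   using le by linarith
  have hB: "norm h \<le> B * norm r"
  proof (cases "h = 0")
   case False
   have "norm h * (\<epsilon> * norm h) \<le> norm h * (2 * norm r)"
   using le2 by (simp only: power2_eq_square mult.commute mult.left_commute)
   then have "\<epsilon> * norm h \<le> 2 * norm r"
   using False by simp
   then show ?thesis using eps by (simp add: B_def field_simps)
  qed (use B0 in simp)
  have "W a = (M h + r) - \<i> *\<^sub>C adj d1 a"
   by (simp add: W_def adj_add adj_comp adj_scaleC scaleC_minus_left Vd0)
  then have "norm (W a) \<le> norm (M h + r) + norm (adj d1 a)"
   using norm_triangle_ineq4[of "M h + r" "\<i> *\<^sub>C adj d1 a"] by (simp add: norm_scaleC)
  also have "norm (M h + r) \<le> K * norm h + norm r"
   using norm_triangle_ineq[of "M h" r] norm_cblinfun_apply_le[of M h] by (simp add: K_def)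
  also have "K * norm h + norm r + norm (adj d1 a) \<le> K * (B * norm r) + norm r + B * norm r"
   using hB qh K0 by (intro add_mono mult_left_mono) auto
  finally have "norm (W a) \<le> (K * B + 1 + B) * norm r"
   by (simp add: algebra_simps)
  then have "norm a \<le> norm (inverse_op W) * ((K * B + 1 + B) * norm r)"
   by (intro order_trans[OF norm_inverse_op_le[OF W]] mult_left_mono) auto
  also have "\<dots> \<le> F * norm r"
   by (simp add: F_def algebra_simps)
  finally show ?thesis by (simp add: r_def)
 qed
 then show ?thesis
  using F0 by (intro exI[of _ "1 / F"]) (simp add: field_simps)
qed

text \<open>A kernel vector \<open>h\<close> of \<open>N\<close> gives the element (h, - M h) of the
  kernel of (c0 c1). Its parameter \<open>a\<close> from \<open>ker_c\<close> is annihilated by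
  \<open>Nt\<close>, which is bounded below.\<close>

lemma N_injective: "h = 0" if "N h = 0"
proof -
 have "c0 h + c1 (- M h) = 0"
  using that by (simp add: N_def)
 from ker_c[OF this] obtain a where a: "h = T0 a" "M h = adj V (adj d0 a)"
  by auto
 then have "Nt a = 0"
  by (simp add: Nt_apply)
 with Nt_bounded_below have "\<exists>\<delta>>0. \<delta> * norm a \<le> 0"
  by (metis norm_zero)
 then have "a = 0"
  by (auto simp: mult_le_0_iff)
 with a show ?thesis by simp
qed

text \<open>Dually, \<open>ker_d\<close> parametrises (k, adj M k) by an \<open>a\<close> with
  \<open>adj N a = 0\<close>.\<close>

lemma adj_Nt_injective: "k = 0" if "adj Nt k = 0"
proof -
 have "d0 (V k) = (d1 o\<^sub>C adj V + \<i> *\<^sub>C (d0 o\<^sub>C P)) (adj M k)"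
  using that by (simp add: Nt_def adj_diff adj_comp T0_def)
 from ker_d[OF this] obtain a where a: "k = adj c1 a" "adj M k = adj c0 a"
  by auto
 then have "adj N a = 0"
  by (simp add: adj_N_apply)
 with adj_N_bounded_below have "\<exists>\<delta>>0. \<delta> * norm a \<le> 0"
  by (metis norm_zero)
 then have "a = 0"
  by (auto simp: mult_le_0_iff)
 with a show ?thesis by simp
qed

lemma boundedly_invertible_N: "boundedly_invertible N"
proof -
 obtain \<delta> where "\<delta> > 0" "\<And>a. \<delta> * norm a \<le> norm (adj N a)"
  using adj_N_bounded_below by blast
 then have "boundedly_invertible (adj N)"
  by (rule bounded_below_boundedly_invertible) (simp add: N_injective)
 then show ?thesis
  using boundedly_invertible_adj by fastforce
qed

lemma boundedly_invertible_Nt: "boundedly_invertible Nt"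
proof -
 obtain \<delta> where "\<delta> > 0" "\<And>a. \<delta> * norm a \<le> norm (Nt a)"
  using Nt_bounded_below by blast
 then show ?thesis
  by (rule bounded_below_boundedly_invertible) (simp add: adj_Nt_injective)
qed

definition R where "R = - (inverse_op N o\<^sub>C c1)"

text \<open>Inverting the relation means solving \<open>c0 y + c1 (x - M y) = 0\<close> for
  \<open>y\<close>, that is, \<open>N y = - c1 x\<close>.\<close>

lemma op_of_relation_eq:
 "op_of_relation ((relation_plus_op {(h0, h1). c0 h0 + c1 h1 = 0} M)\<inverse>) = R"
 unfolding op_of_relation_def
proof (rule the_equality)
 note inv = inverse_op_apply[OF boundedly_invertible_N]
 show *: "\<forall>x y. (x, y) \<in> (relation_plus_op {(h0, h1). c0 h0 + c1 h1 = 0} M)\<inverse> \<longleftrightarrow> y = R x"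
 proof (intro allI)
  fix x y
  have "(x, y) \<in> (relation_plus_op {(h0, h1). c0 h0 + c1 h1 = 0} M)\<inverse> \<longleftrightarrow> c0 y + c1 (x - M y) = 0"
   by (auto simp: relation_plus_op_def intro: exI[of _ "x - M y"])
  also have "\<dots> \<longleftrightarrow> N y = - c1 x"
   by (auto simp: N_def algebra_simps eq_neg_iff_add_eq_0)
  also have "\<dots> \<longleftrightarrow> y = R x"
   using inv(1)[of y] inv(2)[of "- c1 x"] by (auto simp: R_def)
  finally show "(x, y) \<in> (relation_plus_op {(h0, h1). c0 h0 + c1 h1 = 0} M)\<inverse> \<longleftrightarrow> y = R x" .
 qed
 show "A = R" if "\<forall>x y. (x, y) \<in> (relation_plus_op {(h0, h1). c0 h0 + c1 h1 = 0} M)\<inverse> \<longleftrightarrow> y = A x"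
  for A :: "'h1 \<Rightarrow>\<^sub>B 'h0"
  by (rule cblinfun_eqI) (use that * in blast)
qed

lemma inverse_N_c0: "inverse_op N (c0 h) = h - R (M h)"
 using inverse_op_apply(1)[OF boundedly_invertible_N, of h]
 by (simp add: N_def R_def algebra_simps)

text \<open>By \<open>intertwining\<close>, \<open>c1\<close> after \<open>Nt\<close> equals
  \<open>N\<close> after \<open>T0\<close>. This is the passage from the C pair, through which
  \<open>R\<close> is defined, to the D pair.\<close>

lemma R_Nt: "R (Nt a) = - T0 a"
proof -
 have "c1 (Nt a) = N (T0 a)"
  by (simp add: Nt_apply N_def intertwining)
 then show ?thesis
  by (simp add: R_def inverse_op_apply(1)[OF boundedly_invertible_N])
qed

end

text \<open>From here on the pair acts on \<open>\<H>\<^sub>0 = 'a \<times> 'k0\<close> and \<open>\<H>\<^sub>1 = 'a \<times> 'k1\<close>.\<close>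

locale weyl_pair_prod =
 weyl_pair V M c0 c1 d0 d1 \<epsilon>
 for V :: "'a::complex_hilbert_space \<times> 'k1::complex_hilbert_space \<Rightarrow>\<^sub>B 'a \<times> 'k0::complex_hilbert_space"
  and M :: "'a \<times> 'k0 \<Rightarrow>\<^sub>B 'a \<times> 'k1"
  and c0 :: "'a \<times> 'k0 \<Rightarrow>\<^sub>B 'kp::complex_hilbert_space" and c1 :: "'a \<times> 'k1 \<Rightarrow>\<^sub>B 'kp"
  and d0 :: "'a \<times> 'k0 \<Rightarrow>\<^sub>B 'km::complex_hilbert_space" and d1 :: "'a \<times> 'k1 \<Rightarrow>\<^sub>B 'km"
  and \<epsilon> :: real +
 fixes W :: "'k1 \<Rightarrow>\<^sub>B 'k0"
 assumes V_eq: "V = block_op id_op 0 0 W"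
begin

definition Omega_op where
 "Omega_op = block_op (M - M o\<^sub>C R o\<^sub>C M) (- (1 / 2) *\<^sub>R id_op + M o\<^sub>C R)
   (- (1 / 2) *\<^sub>R id_op + R o\<^sub>C M) (- R)"

lemma fst_V: "fst (cblinfun_apply V x) = fst x" and fst_adj_V: "fst (adj V y) = fst y"
 and fst_P: "fst (cblinfun_apply P y) = 0"
 by (simp_all add: proj_compl_apply V_eq adj_block_op)

text \<open>Subtracting half of J removes the identity from the upper right corner and doubles it in
  the lower left one. The matrix then factors into the column (-M, I) and the row (-(I - R M), -R):
  the initial value of Z_+ and the adjoint of that of Y_\<tau> at the conjugate point.\<close>

lemma Omega_minus_J:
 "compress Omega_op - (1 / 2) *\<^sub>R J_op =
  col_op (- (fst_op o\<^sub>C M)) fst_op o\<^sub>C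
  adj (col_op (- adj (c0 o\<^sub>C emb_fst)) (adj (c1 o\<^sub>C emb_fst)) o\<^sub>C inverse_op (adj c0 - adj M o\<^sub>C adj c1))"
proof -
 have "adj c0 - adj M o\<^sub>C adj c1 = adj N"
  by (simp add: N_def adj_diff adj_comp)
 then have inv: "adj (inverse_op (adj c0 - adj M o\<^sub>C adj c1)) = inverse_op N"
  by (simp add: inverse_op_adj boundedly_invertible_N)
 show ?thesis
 proof (rule cblinfun_eqI)
  fix x :: "'a \<times> 'a"
  obtain u v where x: "x = (u, v)" by (cases x)
  have c1: "inverse_op N (c1 h) = - R h" for h
   by (simp add: R_def)
  have half: "(1 / 2) *\<^sub>R w + ((1 / 2) *\<^sub>R w + y) = w + y" for w y :: 'a
   by (simp flip: scaleR_add_left add.assoc)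
  have half': "(1 / 2) *\<^sub>R w + (1 / 2) *\<^sub>R w = w" for w :: 'a
   by (simp flip: scaleR_add_left)
  show "(compress Omega_op - (1 / 2) *\<^sub>R J_op) x =
   (col_op (- (fst_op o\<^sub>C M)) fst_op o\<^sub>C
   adj (col_op (- adj (c0 o\<^sub>C emb_fst)) (adj (c1 o\<^sub>C emb_fst)) o\<^sub>C inverse_op (adj c0 - adj M o\<^sub>C adj c1))) x"
   unfolding adj_comp[of "col_op _ _"] inv adj_col_op
   by (simp add: x adj_minus c1 inverse_N_c0 compress_def Omega_op_def J_op_def)
   (simp add: algebra_simps half half')
 qed
qed

text \<open>Now the factors are the column (-(I - M R), -R) and the row (-M, I). Writing the vector
  \<open>g\<close> produced by the row as \<open>Nt m\<close> and using \<open>R_Nt\<close>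
  expresses the column through the D pair.\<close>

lemma Omega_plus_J:
 "compress Omega_op + (1 / 2) *\<^sub>R J_op =
  col_op (- adj (d0 o\<^sub>C emb_fst)) (adj (d1 o\<^sub>C emb_fst)) o\<^sub>C
   inverse_op (adj (d0 o\<^sub>C V) - M o\<^sub>C adj (d1 o\<^sub>C adj V + \<i> *\<^sub>C (d0 o\<^sub>C P))) o\<^sub>C
  adj (col_op (- (fst_op o\<^sub>C adj M)) fst_op)"
proof -
 have Nt: "adj (d0 o\<^sub>C V) - M o\<^sub>C adj (d1 o\<^sub>C adj V + \<i> *\<^sub>C (d0 o\<^sub>C P)) = Nt"
  by (simp add: Nt_def T0_def)
 show ?thesis
 proof (rule cblinfun_eqI)
  fix x :: "'a \<times> 'a"
  obtain u v where x: "x = (u, v)" by (cases x)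
  define g where "g = (v, 0) - M (u, 0)"
  define m where "m = inverse_op Nt g"
  have g: "g = Nt m"
   by (simp add: m_def inverse_op_apply(2)[OF boundedly_invertible_Nt])
  have Rg: "R g = - T0 m"
   by (simp add: g R_Nt)
  have 1: "fst (- g + M (R g)) = - fst (adj d0 m)"
   unfolding Rg by (simp add: g Nt_apply fst_adj_V)
  have 2: "fst (- R g) = fst (adj d1 m)"
   by (simp add: Rg T0_apply fst_V fst_P)
  have half: "(1 / 2) *\<^sub>R w + ((1 / 2) *\<^sub>R w + y) = w + y" for w y :: 'a
   by (simp flip: scaleR_add_left add.assoc)
  have half': "(1 / 2) *\<^sub>R w + (1 / 2) *\<^sub>R w = w" for w :: 'a
   by (simp flip: scaleR_add_left)
  have eq: "R g = R (v, 0) - R (M (u, 0))"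
   by (simp add: g_def)
  have "(compress Omega_op + (1 / 2) *\<^sub>R J_op) x = (fst (- g + M (R g)), fst (- R g))"
   unfolding eq
   by (simp add: x g_def compress_def Omega_op_def J_op_def)
   (simp add: algebra_simps half half')
  also have "\<dots> = (- fst (adj d0 m), fst (adj d1 m))"
   by (simp only: 1 2)
  finally show "(compress Omega_op + (1 / 2) *\<^sub>R J_op) x =
   (col_op (- adj (d0 o\<^sub>C emb_fst)) (adj (d1 o\<^sub>C emb_fst)) o\<^sub>C
   inverse_op (adj (d0 o\<^sub>C V) - M o\<^sub>C adj (d1 o\<^sub>C adj V + \<i> *\<^sub>C (d0 o\<^sub>C P))) o\<^sub>C
   adj (col_op (- (fst_op o\<^sub>C adj M)) fst_op)) x"
   unfolding Nt adj_col_op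
   by (simp add: x adj_minus adj_comp adj_emb_fst adj_fst_op m_def g_def)
 qed
qed

end

section \<open>Linear differential equations in Banach spaces\<close>

text \<open>Picard iteration for \<open>v\<close> with u = exp (2 K t) v: the exponential weight
  makes the integral operator a contraction with constant 1/2 on the whole interval, whatever its
  length. The abstract product serves vector-valued and operator-valued equations alike.\<close>

lemma linear_ode_exists:
 fixes prod :: "'a::real_normed_vector \<Rightarrow> 'v::banach \<Rightarrow> 'v" and A :: "real \<Rightarrow> 'a" and g :: "real \<Rightarrow> 'v"
 assumes prod: "bounded_bilinear prod" and c: "0 \<le> c"
  and A: "continuous_on {0..c} A" and g: "continuous_on {0..c} g"
 shows "\<exists>u. u 0 = a \<and>
  (\<forall>t\<in>{0..c}. (u has_vector_derivative (prod (A t) (u t) + g t)) (at t within {0..c}))"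
proof -
 interpret prod: bounded_bilinear prod by (rule prod)
 obtain K0 where K0: "0 \<le> K0" "\<And>x y. norm (prod x y) \<le> norm x * norm y * K0"
  using prod.nonneg_bounded by blast
 have "bounded (A ` {0..c})"
  by (rule compact_imp_bounded[OF compact_continuous_image[OF A compact_Icc]])
 then obtain KA where KA: "\<And>t. t \<in> {0..c} \<Longrightarrow> norm (A t) \<le> KA"
  unfolding bounded_iff by blast
 have KA0: "0 \<le> KA"
  by (rule order_trans[OF norm_ge_zero KA[of 0]]) (use c in simp)
 define K where "K = KA * K0 + 1"
 have "K > 0" using K0(1) KA0 by (simp add: K_def add_nonneg_pos)
 have K: "norm (prod (A t) x) \<le> K * norm x" if "t \<in> {0..c}" for t x
 proof -
  have "norm (prod (A t) x) \<le> norm (A t) * norm x * K0" by (rule K0)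
  also have "\<dots> \<le> KA * norm x * K0"
   using KA[OF that] K0 by (intro mult_right_mono) auto
  also have "\<dots> \<le> K * norm x" by (simp add: K_def algebra_simps)
  finally show ?thesis .
 qed
 \<comment> \<open>Bounded continuous functions live on the whole line, so functions on [0, c] are
   extended by their values at the nearest point of the interval.\<close>
 define cl where "cl t = max 0 (min t c)" for t :: real
 have cl: "cl t \<in> {0..c}" for t using c by (auto simp: cl_def)
 have cl_id: "cl t = t" if "t \<in> {0..c}" for t using that by (auto simp: cl_def)
 define F where "F v s = exp (2 * K * s) *\<^sub>R prod (A s) (apply_bcontfun v s) + g s" for v s
 have F_cont: "continuous_on {0..c} (F v)" for v
  unfolding F_def
  by (intro continuous_intros prod.continuous_on A g continuous_on_subset[OF continuous_on_apply_bcontfun])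
   (auto intro: continuous_on_apply_bcontfun)
 define T0 where "T0 v t = exp (- 2 * K * t) *\<^sub>R (a + integral {0..t} (F v))" for v t
 have T0_cont: "continuous_on {0..c} (T0 v)" for v
  unfolding T0_def
  by (intro continuous_intros indefinite_integral_continuous_1 integrable_continuous_interval F_cont)
 define T where "T v = Bcontfun (\<lambda>t. T0 v (cl t))" for v
 have T: "apply_bcontfun (T v) t = T0 v (cl t)" for v t
 proof -
  have "bounded (T0 v ` {0..c})"
   by (rule compact_imp_bounded[OF compact_continuous_image[OF T0_cont compact_Icc]])
  then obtain b where b: "\<And>t. t \<in> {0..c} \<Longrightarrow> norm (T0 v t) \<le> b"
   unfolding bounded_iff by blast
  have "(\<lambda>t. T0 v (cl t)) \<in> bcontfun"
  proof (rule bcontfun_normI)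
   show "continuous_on UNIV (\<lambda>t. T0 v (cl t))"
   by (rule continuous_on_compose2[OF T0_cont])
   (use cl in \<open>auto simp: cl_def intro!: continuous_intros\<close>)
   show "norm (T0 v (cl t)) \<le> b" for t
   by (rule b[OF cl])
  qed
  then show ?thesis by (simp add: T_def Bcontfun_inverse)
 qed
 have contr: "dist (T v) (T w) \<le> 1 / 2 * dist v w" for v w
 proof (rule dist_bound)
  fix t
  define s where "s = cl t"
  have s: "s \<in> {0..c}" unfolding s_def by (rule cl)
  have sub: "{0..s} \<subseteq> {0..c}" using s by auto
  have int: "F v integrable_on {0..s}" "F w integrable_on {0..s}"
   by (intro integrable_continuous_interval continuous_on_subset[OF F_cont sub])+
  have "norm (integral {0..s} (F v) - integral {0..s} (F w)) = norm (integral {0..s} (\<lambda>x. F v x - F w x))"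
   by (simp add: int integral_diff)
  also have "\<dots> \<le> integral {0..s} (\<lambda>x. (K * dist v w) * exp (2 * K * x))"
  proof (rule integral_norm_bound_integral)
   show "(\<lambda>x. F v x - F w x) integrable_on {0..s}"
   by (intro integrable_diff int)
   show "(\<lambda>x. (K * dist v w) * exp (2 * K * x)) integrable_on {0..s}"
   by (intro integrable_continuous_interval continuous_intros)
   fix x assume x: "x \<in> {0..s}"
   have "F v x - F w x = exp (2 * K * x) *\<^sub>R prod (A x) (apply_bcontfun v x - apply_bcontfun w x)"
   by (simp add: F_def prod.diff_right scaleR_diff_right)
   also have "norm \<dots> \<le> exp (2 * K * x) * (K * norm (apply_bcontfun v x - apply_bcontfun w x))"
   using x sub by (auto intro!: K)
   also have "\<dots> \<le> exp (2 * K * x) * (K * dist v w)"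
   using \<open>K > 0\<close> dist_bounded[of v x w] by (intro mult_left_mono) (auto simp: dist_norm)
   finally show "norm (F v x - F w x) \<le> (K * dist v w) * exp (2 * K * x)"
   by (simp add: mult.commute)
  qed
  also have "\<dots> = (dist v w / 2) * exp (2 * K * s) - (dist v w / 2) * exp (2 * K * 0)"
  proof (rule integral_unique, rule fundamental_theorem_of_calculus)
   show "0 \<le> s" using s by simp
   fix x
   have "((\<lambda>x. (dist v w / 2) * exp (2 * K * x)) has_real_derivative (dist v w / 2) * (exp (2 * K * x) * (2 * K)))
   (at x within {0..s})"
   by (auto intro!: derivative_eq_intros)
   then show "((\<lambda>x. (dist v w / 2) * exp (2 * K * x)) has_vector_derivative (K * dist v w) * exp (2 * K * x))
   (at x within {0..s})"
   by (simp add: has_real_derivative_iff_has_vector_derivative mult_ac)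
  qed
  also have "\<dots> \<le> (dist v w / 2) * exp (2 * K * s)" by simp
  finally have le: "norm (integral {0..s} (F v) - integral {0..s} (F w)) \<le> (dist v w / 2) * exp (2 * K * s)" .
  have "dist (T0 v s) (T0 w s) = exp (- 2 * K * s) * norm (integral {0..s} (F v) - integral {0..s} (F w))"
   by (simp add: T0_def dist_norm flip: scaleR_diff_right)
  also have "\<dots> \<le> exp (- 2 * K * s) * ((dist v w / 2) * exp (2 * K * s))"
   using le by (intro mult_left_mono) auto
  also have "\<dots> = 1 / 2 * dist v w"
   by (simp add: exp_minus field_simps)
  finally show "dist (apply_bcontfun (T v) t) (apply_bcontfun (T w) t) \<le> 1 / 2 * dist v w"
   by (simp add: T s_def)
 qed
 have "\<exists>!v. T v = v"
  by (rule banach_fix_type[where c = "1/2"]) (use contr in auto)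
 then obtain v where v: "T v = v" by blast
 define u where "u t = a + integral {0..t} (F v)" for t
 have uv: "prod (A t) (u t) + g t = F v t" if "t \<in> {0..c}" for t
 proof -
  have "apply_bcontfun v t = T0 v t"
   using T[of v t] v that by (simp add: cl_id)
  then have "u t = exp (2 * K * t) *\<^sub>R apply_bcontfun v t"
   by (simp add: T0_def u_def flip: exp_add)
  then show ?thesis by (simp add: F_def prod.scaleR_right)
 qed
 have "(u has_vector_derivative F v t) (at t within {0..c})" if "t \<in> {0..c}" for t
  unfolding u_def
  using integral_has_vector_derivative[OF F_cont that, of v]
  by (auto intro!: derivative_eq_intros)
 then show ?thesis
  by (intro exI[of _ u]) (auto simp: uv, simp add: u_def)
qed

text \<open>The function exp (-K t) times the integral of \<open>f\<close> starts at 0 and has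
  nonpositive derivative, while the integral itself is nonnegative.\<close>

lemma gronwall_zero:
 fixes f :: "real \<Rightarrow> real"
 assumes f: "continuous_on {0..c} f" and nonneg: "\<And>t. t \<in> {0..c} \<Longrightarrow> 0 \<le> f t"
  and le: "\<And>t. t \<in> {0..c} \<Longrightarrow> f t \<le> K * integral {0..t} f" and t: "t \<in> {0..c}"
 shows "f t = 0"
proof -
 define F where "F t = integral {0..t} f" for t
 define G where "G t = exp (- K * t) * F t" for t
 have F': "(F has_real_derivative f s) (at s within {0..t})" if "s \<in> {0..t}" for s
 proof -
  have "(F has_real_derivative f s) (at s within {0..c})"
   unfolding F_def using integral_has_real_derivative[OF f, of s] that t by auto
  then show ?thesis by (rule DERIV_subset) (use t in auto)
 qed
 have "((\<lambda>s. exp (- K * s) * (f s - K * F s)) has_integral (G t - G 0)) {0..t}"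
 proof (rule fundamental_theorem_of_calculus)
  fix s assume s: "s \<in> {0..t}"
  have "(G has_real_derivative (exp (- K * s) * (- K)) * F s + exp (- K * s) * f s) (at s within {0..t})"
   unfolding G_def by (auto intro!: derivative_eq_intros F'[OF s])
  then show "(G has_vector_derivative exp (- K * s) * (f s - K * F s)) (at s within {0..t})"
   by (simp add: has_real_derivative_iff_has_vector_derivative algebra_simps)
 qed (use t in simp)
 then have "G t - G 0 \<le> 0"
 proof (rule has_integral_le[OF _ has_integral_0])
  fix s assume "s \<in> {0..t}"
  then show "exp (- K * s) * (f s - K * F s) \<le> 0"
   using le[of s] t by (simp add: F_def mult_le_0_iff)
 qed
 then have "exp (- K * t) * F t \<le> 0" by (simp add: G_def F_def)
 then have "F t \<le> 0" by (simp add: mult_le_0_iff)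
 moreover have "0 \<le> F t"
  unfolding F_def by (rule integral_nonneg)
   (use t nonneg in \<open>auto intro!: integrable_continuous_interval continuous_on_subset[OF f]\<close>)
 ultimately have "F t = 0" by simp
 with le[OF t] nonneg[OF t] show ?thesis by (simp add: F_def)
qed

lemma linear_ode_unique_integral:
 fixes prod :: "'a::real_normed_vector \<Rightarrow> 'v::banach \<Rightarrow> 'v" and A :: "real \<Rightarrow> 'a" and v :: "real \<Rightarrow> 'v"
 assumes prod: "bounded_bilinear prod"
  and A: "continuous_on {0..c} A" and v: "continuous_on {0..c} v"
  and eq: "\<And>t. t \<in> {0..c} \<Longrightarrow> v t = integral {0..t} (\<lambda>s. prod (A s) (v s))"
  and t: "t \<in> {0..c}"
 shows "v t = 0"
proof -
 interpret prod: bounded_bilinear prod by (rule prod)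
 obtain K0 where K0: "0 \<le> K0" "\<And>x y. norm (prod x y) \<le> norm x * norm y * K0"
  using prod.nonneg_bounded by blast
 have "bounded (A ` {0..c})"
  by (rule compact_imp_bounded[OF compact_continuous_image[OF A compact_Icc]])
 then obtain KA where KA: "\<And>t. t \<in> {0..c} \<Longrightarrow> norm (A t) \<le> KA"
  unfolding bounded_iff by blast
 have K: "norm (prod (A t) x) \<le> (KA * K0) * norm x" if "t \<in> {0..c}" for t x
 proof -
  have "norm (prod (A t) x) \<le> norm (A t) * norm x * K0" by (rule K0)
  also have "\<dots> \<le> KA * norm x * K0"
   using KA[OF that] K0 by (intro mult_right_mono) auto
  also have "\<dots> = (KA * K0) * norm x" by (simp add: algebra_simps)
  finally show ?thesis .
 qed
 have "norm (v t) = 0"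
 proof (rule gronwall_zero[where K = "KA * K0" and f = "\<lambda>t. norm (v t)"])
  show "continuous_on {0..c} (\<lambda>t. norm (v t))" by (intro continuous_intros v)
  fix s assume s: "s \<in> {0..c}"
  have sub: "{0..s} \<subseteq> {0..c}" using s by auto
  have "norm (v s) = norm (integral {0..s} (\<lambda>s. prod (A s) (v s)))"
   using eq[OF s] by simp
  also have "\<dots> \<le> integral {0..s} (\<lambda>s. (KA * K0) * norm (v s))"
  proof (rule integral_norm_bound_integral)
   show "(\<lambda>s. prod (A s) (v s)) integrable_on {0..s}"
   by (intro integrable_continuous_interval prod.continuous_on continuous_on_subset[OF _ sub] A v)
   show "(\<lambda>s. (KA * K0) * norm (v s)) integrable_on {0..s}"
   by (intro integrable_continuous_interval continuous_intros continuous_on_subset[OF v sub])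
  qed (use sub in \<open>auto intro!: K\<close>)
  finally show "norm (v s) \<le> (KA * K0) * integral {0..s} (\<lambda>t. norm (v t))" by simp
 qed (use t in auto)
 then show ?thesis by simp
qed

lemma linear_ode_unique:
 fixes prod :: "'a::real_normed_vector \<Rightarrow> 'v::banach \<Rightarrow> 'v" and A :: "real \<Rightarrow> 'a" and u :: "real \<Rightarrow> 'v"
 assumes prod: "bounded_bilinear prod" and A: "continuous_on {0..c} A"
  and u: "\<And>t. t \<in> {0..c} \<Longrightarrow> (u has_vector_derivative (prod (A t) (u t) + g t)) (at t within {0..c})"
  and w: "\<And>t. t \<in> {0..c} \<Longrightarrow> (w has_vector_derivative (prod (A t) (w t) + g t)) (at t within {0..c})"
  and init: "u 0 = w 0" and t: "t \<in> {0..c}"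
 shows "u t = w t"
proof -
 interpret prod: bounded_bilinear prod by (rule prod)
 have d: "((\<lambda>t. u t - w t) has_vector_derivative prod (A t) (u t - w t)) (at t within {0..c})"
  if "t \<in> {0..c}" for t
  using has_vector_derivative_diff[OF u[OF that] w[OF that]] by (simp add: prod.diff_right)
 have cont: "continuous_on {0..c} (\<lambda>t. u t - w t)"
  by (rule continuous_on_vector_derivative[OF d])
 have "u t - w t = 0"
 proof (rule linear_ode_unique_integral[OF prod A cont _ t])
  fix s assume s: "s \<in> {0..c}"
  have "((\<lambda>t. prod (A t) (u t - w t)) has_integral (u s - w s) - (u 0 - w 0)) {0..s}"
   by (rule fundamental_theorem_of_calculus)
   (use s in \<open>auto intro: has_vector_derivative_within_subset[OF d]\<close>)
  then show "u s - w s = integral {0..s} (\<lambda>s. prod (A s) (u s - w s))"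
   using init by (simp add: has_integral_iff)
 qed
 then show ?thesis by simp
qed

text \<open>The reflection of t into c - t turns the terminal value problem into an initial value
  problem with negated coefficients. It provides preimages under the fundamental operator.\<close>

lemma linear_ode_exists_backward:
 fixes prod :: "'a::real_normed_vector \<Rightarrow> 'v::banach \<Rightarrow> 'v" and A :: "real \<Rightarrow> 'a" and g :: "real \<Rightarrow> 'v"
 assumes prod: "bounded_bilinear prod" and c: "0 \<le> c"
  and A: "continuous_on {0..c} A" and g: "continuous_on {0..c} g"
 shows "\<exists>u. u c = a \<and>
  (\<forall>t\<in>{0..c}. (u has_vector_derivative (prod (A t) (u t) + g t)) (at t within {0..c}))"
proof -
 interpret prod: bounded_bilinear prod by (rule prod)
 have refl: "continuous_on {0..c} (\<lambda>t. - f (c - t))" if "continuous_on {0..c} f"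
  for f :: "real \<Rightarrow> 'b::real_normed_vector"
  by (intro continuous_intros continuous_on_compose2[OF that]) auto
 obtain w where w: "w 0 = a" "\<And>t. t \<in> {0..c} \<Longrightarrow>
   (w has_vector_derivative (prod (- A (c - t)) (w t) + - g (c - t))) (at t within {0..c})"
  using linear_ode_exists[OF prod c refl[OF A] refl[OF g], of a] by blast
 define u where "u t = w (c - t)" for t
 have "(u has_vector_derivative (prod (A t) (u t) + g t)) (at t within {0..c})" if t: "t \<in> {0..c}" for t
 proof -
  have im: "(\<lambda>t. c - t) ` {0..c} = {0..c}"
   by (auto simp: image_iff intro!: bexI[of _ "c - _"])
  have "((w \<circ> (\<lambda>t. c - t)) has_vector_derivative (-1) *\<^sub>R (prod (- A t) (w (c - t)) + - g t)) (at t within {0..c})"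
   by (rule vector_diff_chain_within)
   (use t w(2)[of "c - t"] in \<open>auto simp: im intro!: derivative_eq_intros\<close>)
  then show ?thesis
   by (simp add: u_def[abs_def] o_def prod.minus_left add.commute)
 qed
 then show ?thesis
  using w(1) by (intro exI[of _ u]) (auto simp: u_def)
qed

subsection \<open>Intervals starting at the origin\<close>

text \<open>One notion for [0, b), [0, b] and [0, \<infinity>). The positive element makes
  derivatives within the set unique, also at 0.\<close>

definition initial_interval :: "real set \<Rightarrow> bool" where
 "initial_interval I \<longleftrightarrow> (\<exists>d\<in>I. 0 < d) \<and> (\<forall>t\<in>I. 0 \<le> t) \<and> (\<forall>c\<in>I. {0..c} \<subseteq> I)"

lemma initial_interval_zero: "initial_interval I \<Longrightarrow> 0 \<in> I"
 unfolding initial_interval_def by fastforce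

lemma initial_interval_nonneg: "initial_interval I \<Longrightarrow> t \<in> I \<Longrightarrow> 0 \<le> t"
 unfolding initial_interval_def by blast

lemma initial_interval_subset: "initial_interval I \<Longrightarrow> c \<in> I \<Longrightarrow> {0..c} \<subseteq> I"
 unfolding initial_interval_def by blast

text \<open>Reduces derivatives within the interval to a compact interval [0, c]: some
  \<open>c\<close> beyond \<open>t\<close> if there is one, and otherwise \<open>t\<close> itself,
  which is then the right end point.\<close>

lemma at_within_initial_interval:
 assumes I: "initial_interval I" and t: "t \<in> I"
 shows "\<exists>c\<in>I. 0 < c \<and> t \<le> c \<and> at t within I = at t within {0..c}"
proof (cases "\<exists>c\<in>I. t < c")
 case True
 then obtain c where c: "c \<in> I" "t < c" by blast
 have "at t within I = at t within {0..c}"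
  by (rule at_within_nhd[of t "{..<c}"])
   (use c initial_interval_subset[OF I c(1)] initial_interval_nonneg[OF I] in auto)
 then show ?thesis
  using c initial_interval_nonneg[OF I t] by (intro bexI[of _ c]) auto
next
 case False
 then have "I = {0..t}"
  using initial_interval_subset[OF I t] initial_interval_nonneg[OF I] by (auto simp: not_less)
 moreover have "0 < t"
  using I False unfolding initial_interval_def by (auto simp: not_less intro: less_le_trans)
 ultimately show ?thesis using t by blast
qed

lemma deriv_on_eqI:
 assumes I: "initial_interval I" and t: "t \<in> I"
  and f: "(f has_vector_derivative f') (at t within I)"
 shows "deriv_on I f t = f'"
proof -
 obtain c where "0 < c" "t \<le> c" "at t within I = at t within {0..c}"
  using at_within_initial_interval[OF I t] by blast
 then show ?thesis
  using f initial_interval_nonneg[OF I t] vector_derivative_within_cbox[of 0 c t f f']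
  by (simp add: deriv_on_def)
qed

text \<open>The solutions on the intervals [0, c] agree by uniqueness, so the value at
  \<open>t\<close> can be read off from the one on [0, t].\<close>

lemma linear_ode_exists_on:
 fixes prod :: "'a::real_normed_vector \<Rightarrow> 'v::banach \<Rightarrow> 'v" and A :: "real \<Rightarrow> 'a" and g :: "real \<Rightarrow> 'v"
 assumes prod: "bounded_bilinear prod" and I: "initial_interval I"
  and A: "continuous_on I A" and g: "continuous_on I g"
 shows "\<exists>u. u 0 = a \<and> (\<forall>t\<in>I. (u has_vector_derivative (prod (A t) (u t) + g t)) (at t within I))"
proof -
 have sub: "\<And>c. c \<in> I \<Longrightarrow> {0..c} \<subseteq> I" using initial_interval_subset[OF I] .
 have "\<forall>c\<in>I. \<exists>u. u 0 = a \<and>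
  (\<forall>t\<in>{0..c}. (u has_vector_derivative (prod (A t) (u t) + g t)) (at t within {0..c}))"
  using linear_ode_exists[OF prod] continuous_on_subset[OF A sub] continuous_on_subset[OF g sub]
   initial_interval_nonneg[OF I] by blast
 from bchoice[OF this] obtain s where s0: "\<And>c. c \<in> I \<Longrightarrow> s c 0 = a"
  and s: "\<And>c t. c \<in> I \<Longrightarrow> t \<in> {0..c} \<Longrightarrow>
   (s c has_vector_derivative (prod (A t) (s c t) + g t)) (at t within {0..c})"
  by blast
 have agree: "s t t = s c t" if "c \<in> I" "t \<in> {0..c}" for c t
 proof (rule linear_ode_unique[OF prod _ s, where t = t])
  show t: "t \<in> I" using that sub by blast
  show "continuous_on {0..t} A" by (rule continuous_on_subset[OF A sub[OF t]])
  show "(s c has_vector_derivative prod (A x) (s c x) + g x) (at x within {0..t})" if "x \<in> {0..t}" for x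
   by (rule has_vector_derivative_within_subset[OF s]) (use that \<open>c \<in> I\<close> \<open>t \<in> {0..c}\<close> in auto)
  show "s t 0 = s c 0" using s0 t that by simp
  show "t \<in> {0..t}" using that by auto
 qed
 have "((\<lambda>t. s t t) has_vector_derivative (prod (A t) (s t t) + g t)) (at t within I)" if t: "t \<in> I" for t
 proof -
  obtain c where c: "c \<in> I" "t \<le> c" "at t within I = at t within {0..c}"
   using at_within_initial_interval[OF I t] by blast
  have tc: "t \<in> {0..c}" using c initial_interval_nonneg[OF I t] by auto
  show ?thesis
   unfolding c(3) agree[OF c(1) tc]
   by (rule has_vector_derivative_transform[OF tc _ s[OF c(1) tc]]) (use agree[OF c(1)] in auto)
 qed
 then show ?thesis
  using s0[OF initial_interval_zero[OF I]] by (intro exI[of _ "\<lambda>t. s t t"]) auto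
qed

lemma linear_ode_unique_on:
 fixes prod :: "'a::real_normed_vector \<Rightarrow> 'v::banach \<Rightarrow> 'v" and A :: "real \<Rightarrow> 'a" and u :: "real \<Rightarrow> 'v"
 assumes prod: "bounded_bilinear prod" and I: "initial_interval I" and A: "continuous_on I A"
  and u: "\<And>t. t \<in> I \<Longrightarrow> (u has_vector_derivative (prod (A t) (u t) + g t)) (at t within I)"
  and w: "\<And>t. t \<in> I \<Longrightarrow> (w has_vector_derivative (prod (A t) (w t) + g t)) (at t within I)"
  and init: "u 0 = w 0" and t: "t \<in> I"
 shows "u t = w t"
proof (rule linear_ode_unique[where c = t and u = u and w = w and g = g, OF prod _ _ _ init])
 have sub: "{0..t} \<subseteq> I" by (rule initial_interval_subset[OF I t])
 show "continuous_on {0..t} A" by (rule continuous_on_subset[OF A sub])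
 show "(u has_vector_derivative prod (A x) (u x) + g x) (at x within {0..t})" if "x \<in> {0..t}" for x
  by (rule has_vector_derivative_within_subset[OF u _]) (use that sub in auto)
 show "(w has_vector_derivative prod (A x) (w x) + g x) (at x within {0..t})" if "x \<in> {0..t}" for x
  by (rule has_vector_derivative_within_subset[OF w _]) (use that sub in auto)
 show "t \<in> {0..t}" using initial_interval_nonneg[OF I t] by simp
qed

text \<open>A sequence of functions tending uniformly to zero with equicontinuous derivatives has
 derivatives tending uniformly to zero.\<close>

lemma uniform_limit_derivative_zero:
 fixes f g :: "nat \<Rightarrow> real \<Rightarrow> 'v::banach"
 assumes c: "0 < c"
  and der: "\<And>m t. t \<in> {0..c} \<Longrightarrow> (f m has_vector_derivative g m t) (at t within {0..c})"
  and f0: "uniform_limit {0..c} f (\<lambda>t. 0) sequentially"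
  and equi: "\<And>e. 0 < e \<Longrightarrow> \<exists>d>0. \<forall>m. \<forall>s\<in>{0..c}. \<forall>t\<in>{0..c}. \<bar>s - t\<bar> < d \<longrightarrow> norm (g m s - g m t) < e"
 shows "uniform_limit {0..c} g (\<lambda>t. 0) sequentially"
proof (rule uniform_limitI)
 fix e :: real assume e: "0 < e"
 obtain d where d: "d > 0" and dm: "\<And>m s t. s \<in> {0..c} \<Longrightarrow> t \<in> {0..c} \<Longrightarrow> \<bar>s - t\<bar> < d \<Longrightarrow> norm (g m s - g m t) < e / 2"
  using equi[of "e / 2"] e by auto
 \<comment> \<open>Half of \<open>c\<close> leaves room for an interval of length \<open>h\<close>
   on at least one side of \<open>t\<close>; half of \<open>d\<close> keeps it within the range of
   equicontinuity.\<close>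
 define h where "h = min (d / 2) (c / 2)"
 have h: "0 < h" "h < d" "h \<le> c / 2" using d c by (auto simp: h_def)
 have "\<forall>\<^sub>F m in sequentially. \<forall>t\<in>{0..c}. dist (f m t) 0 < h * e / 8"
  by (rule uniform_limitD[OF f0]) (use h e in simp)
 then show "\<forall>\<^sub>F m in sequentially. \<forall>t\<in>{0..c}. dist (g m t) 0 < e"
 proof eventually_elim
  case (elim m)
  show ?case
  proof
   fix t assume t: "t \<in> {0..c}"
   \<comment> \<open>The window [p, p + h] starts at \<open>t\<close> in the left half of [0, c] and
     ends at \<open>t\<close> in the right half. Over it the mean of \<open>g m\<close>, a
     difference quotient of \<open>f m\<close>, is close to \<open>g m t\<close>.\<close>
   obtain p where p: "p \<in> {0..c}" "p + h \<in> {0..c}" "\<And>s. s \<in> {p..p + h} \<Longrightarrow> \<bar>s - t\<bar> < d"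
   proof (cases "t \<le> c / 2")
   case True
   show thesis by (rule that[of t]) (use True t h in auto)
   next
   case False
   show thesis by (rule that[of "t - h"]) (use False t h in auto)
   qed
   have sub: "{p..p + h} \<subseteq> {0..c}" using p h by auto
   have "(g m has_integral (f m (p + h) - f m p)) {p..p + h}"
   by (rule fundamental_theorem_of_calculus)
   (use h sub in \<open>auto intro: has_vector_derivative_within_subset[OF der]\<close>)
   moreover have "((\<lambda>s. g m t) has_integral h *\<^sub>R g m t) {p..p + h}"
   using has_integral_const_real[of "g m t" p "p + h"] h by simp
   ultimately have i: "((\<lambda>s. g m s - g m t) has_integral (f m (p + h) - f m p - h *\<^sub>R g m t)) {p..p + h}"
   by (rule has_integral_diff)
   have "norm (f m (p + h) - f m p - h *\<^sub>R g m t) \<le> e / 2 * measure lborel {p..p + h}"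
   proof (rule has_integral_bound_real[OF _ finite.emptyI i])
   fix x assume "x \<in> {p..p + h} - {}"
   then show "norm (g m x - g m t) \<le> e / 2"
   using less_imp_le[OF dm[OF _ t p(3)[of x]], of m] sub by blast
   qed (use e in simp)
   then have "norm (f m (p + h) - f m p - h *\<^sub>R g m t) \<le> e / 2 * h"
   using h by simp
   moreover have "norm (f m (p + h)) < h * e / 8" "norm (f m p) < h * e / 8"
   using elim p by auto
   moreover have "norm (h *\<^sub>R g m t) \<le> norm (f m (p + h) - f m p - h *\<^sub>R g m t) + norm (f m (p + h)) + norm (f m p)"
   using norm_triangle_ineq4[of "f m (p + h) - f m p" "f m (p + h) - f m p - h *\<^sub>R g m t"]
   norm_triangle_ineq4[of "f m (p + h)" "f m p"] by simp
   moreover have "norm (h *\<^sub>R g m t) = h * norm (g m t)" "e / 2 * h = h * e / 2" "0 < h * e"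
   using h e by simp_all
   ultimately have "h * norm (g m t) < h * e"
   by linarith
   then show "dist (g m t) 0 < e" using h by simp
  qed
 qed
qed

section \<open>Quasi-derivatives and the first-order system\<close>

lemma half_order_pos [simp]: "0 < half_order E"
 by (simp add: half_order_def card_gt_0_iff)

lemma regular_initial_interval:
 assumes "regular_diff_expr E"
 shows "initial_interval (interval E)"
proof -
 have E: "0 < endpoint E" "{t. 0 \<le> t \<and> ereal t < endpoint E} \<subseteq> interval E"
  "interval E \<subseteq> {t. 0 \<le> t \<and> ereal t \<le> endpoint E}"
  using assms by (auto simp: regular_diff_expr_def)
 obtain d where d: "0 < ereal d" "ereal d < endpoint E"
  using E(1) ereal_dense2 by blast
 show ?thesis
  unfolding initial_interval_def
 proof (intro conjI ballI subsetI)
  show "\<exists>d\<in>interval E. 0 < d"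
   using d E(2) by (intro bexI[of _ d]) auto
  show "0 \<le> t" if "t \<in> interval E" for t using that E(3) by auto
  fix c t assume c: "c \<in> interval E" and t: "t \<in> {0..c}"
  show "t \<in> interval E"
  proof (cases "t = c")
   case False
   then have "ereal t < ereal c" using t by simp
   also have "\<dots> \<le> endpoint E" using c E(3) by auto
   finally show ?thesis using E(2) t by auto
  qed (use c in simp)
 qed
qed

lemma Ck_on_continuous: "Ck_on m I f \<Longrightarrow> continuous_on I f"
proof (cases m)
 case (Suc k)
 assume "Ck_on m I f"
 then have "(deriv_on I ^^ 0) f differentiable_on I"
  unfolding Ck_on_def Suc by blast
 then show ?thesis by (simp add: differentiable_imp_continuous_on)
qed (simp add: Ck_on_def)

lemma deriv_on_cong:
 assumes "\<And>s. s \<in> I \<Longrightarrow> f s = g s" and "t \<in> I"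
 shows "deriv_on I f t = deriv_on I g t"
proof -
 have "(f has_vector_derivative d) (at t within I) \<longleftrightarrow> (g has_vector_derivative d) (at t within I)" for d
  using has_vector_derivative_transform[OF assms(2), of f g d]
   has_vector_derivative_transform[OF assms(2), of g f d] assms(1) by metis
 then show ?thesis by (simp add: deriv_on_def vector_derivative_def)
qed

text \<open>The two axioms are all that inverting p_0 requires, so statements on quasi-derivatives
  are proved once for vector functions and operator functions.\<close>

locale coeff_action =
 fixes act :: "('h::complex_hilbert_space \<Rightarrow>\<^sub>B 'h) \<Rightarrow> 'v \<Rightarrow> 'v::complex_normed_vector"
 assumes act_comp: "act (A o\<^sub>C B) v = act A (act B v)" and act_id: "act id_op v = v"

interpretation apply_action: coeff_action cblinfun_apply
 by standard simp_all

interpretation comp_action: coeff_action comp_op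
 by standard (auto intro: cblinfun_eqI)

text \<open>\<open>top_deriv act E t w\<close> recovers \<open>D\<^sup>n y\<close> from the quasi-derivatives \<open>w k = y\<^sup>[\<^sup>k\<^sup>](t)\<close>, and
 \<open>system_rhs act E t f w k\<close> is the derivative of \<open>y\<^sup>[\<^sup>k\<^sup>]\<close> if \<open>l[y](t) = f\<close>.\<close>

definition top_deriv where
 "top_deriv act E t w =
  act (inverse_op (pcoeff E 0 t))
   (w (half_order E) + (\<i> / 2) *\<^sub>C act (qcoeff E 0 t) (w (half_order E - 1)))"

definition low_deriv where
 "low_deriv act E t w j = (if j < half_order E then w j else top_deriv act E t w)"

definition system_rhs where
 "system_rhs act E t f w k = (let n = half_order E; j = k - n + 1 in
  if k < n then low_deriv act E t w (k + 1)
  else - (if j < n then w (n + j) else f) + act (pcoeff E j t) (low_deriv act E t w (n - j))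
   + (\<i> / 2) *\<^sub>C (act (adj (qcoeff E (j - 1) t)) (low_deriv act E t w (n - j + 1))
   - (if j < n then act (qcoeff E j t) (low_deriv act E t w (n - j - 1)) else 0)))"

context coeff_action begin

lemma act_inverse:
 assumes "regular_diff_expr E" "t \<in> interval E"
 shows "act (inverse_op (pcoeff E 0 t)) (act (pcoeff E 0 t) v) = v"
  "act (pcoeff E 0 t) (act (inverse_op (pcoeff E 0 t)) v) = v"
proof -
 have "is_inverse_op (pcoeff E 0 t) (inverse_op (pcoeff E 0 t))"
  using assms by (auto simp: regular_diff_expr_def intro: is_inverse_op_inverse_op)
 then show "act (inverse_op (pcoeff E 0 t)) (act (pcoeff E 0 t) v) = v"
  "act (pcoeff E 0 t) (act (inverse_op (pcoeff E 0 t)) v) = v"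
  by (simp_all add: is_inverse_op_def act_id flip: act_comp)
qed

lemma deriv_low_deriv:
 assumes E: "regular_diff_expr E" and t: "t \<in> interval E" and j: "j \<le> half_order E"
 shows "(deriv_on (interval E) ^^ j) y t = low_deriv act E t (\<lambda>k. quasi_deriv act E y k t) j"
proof (cases "j < half_order E")
 case False
 with j have "j = half_order E" by simp
 then show ?thesis
  using act_inverse(1)[OF E t]
  by (simp add: low_deriv_def top_deriv_def quasi_deriv_def Let_def)
qed (simp add: low_deriv_def quasi_deriv_def)

text \<open>The recursion defining y^[n+j] is solved for the derivative of its predecessor. It is an
  identity between values of the total function \<open>deriv_on\<close>; differentiability is a
  separate matter.\<close>

lemma deriv_on_quasi_deriv:
 assumes E: "regular_diff_expr E" and t: "t \<in> interval E" and k: "k < 2 * half_order E"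
 shows "deriv_on (interval E) (quasi_deriv act E y k) t =
  system_rhs act E t (quasi_deriv act E y (2 * half_order E) t) (\<lambda>k. quasi_deriv act E y k t) k"
proof (cases "k < half_order E")
 case True
 have "deriv_on (interval E) (quasi_deriv act E y k) t = (deriv_on (interval E) ^^ (k + 1)) y t"
  using True by (simp add: quasi_deriv_def)
 also have "\<dots> = low_deriv act E t (\<lambda>k. quasi_deriv act E y k t) (k + 1)"
  by (rule deriv_low_deriv[OF E t]) (use True in simp)
 finally show ?thesis using True by (simp add: system_rhs_def Let_def)
next
 case False
 define n where "n = half_order E"
 define i where "i = k - n"
 have k_eq: "k = n + i" and i: "i < n"
  using False k by (auto simp: i_def n_def)
 have low: "(deriv_on (interval E) ^^ j) y t = low_deriv act E t (\<lambda>k. quasi_deriv act E y k t) j"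
  if "j \<le> n" for j
  using deriv_low_deriv[OF E t] that by (simp add: n_def)
 have qd: "quasi_deriv act E y (n + j) t = upper_quasi_deriv act E y j t" for j
  by (simp add: quasi_deriv_def n_def)
 have "quasi_deriv act E y k = upper_quasi_deriv act E y i"
  by (simp add: quasi_deriv_def n_def k_eq)
 then have "deriv_on (interval E) (quasi_deriv act E y k) t =
  - upper_quasi_deriv act E y (Suc i) t + act (pcoeff E (Suc i) t) ((deriv_on (interval E) ^^ (n - Suc i)) y t)
   + (\<i> / 2) *\<^sub>C (act (adj (qcoeff E i t)) ((deriv_on (interval E) ^^ (n - Suc i + 1)) y t)
   - (if Suc i < n then act (qcoeff E (Suc i) t) ((deriv_on (interval E) ^^ (n - Suc i - 1)) y t) else 0))"
  by (simp add: Let_def n_def)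
 also have "upper_quasi_deriv act E y (Suc i) t =
  (if Suc i < n then quasi_deriv act E y (n + Suc i) t else quasi_deriv act E y (2 * n) t)"
 proof (cases "Suc i < n")
  case True
  show ?thesis by (simp only: True if_True qd)
 next
  case False
  then have "n + Suc i = 2 * n" using i by linarith
  then show ?thesis using False qd[of "Suc i"] by (simp only: if_False)
 qed
 finally show ?thesis
  using i low[of "n - Suc i"] low[of "n - Suc i + 1"] low[of "n - Suc i - 1"]
  by (simp add: system_rhs_def Let_def k_eq flip: n_def)
qed

text \<open>By induction on the order, first below n, then at n by inverting p_0, then above. The
  equation for the last component is demanded only at the single point \<open>t\<close>, and only in
  the second conclusion, because for domain elements it holds merely almost everywhere.\<close>

lemma quasi_deriv_of_system:
 assumes E: "regular_diff_expr E"
  and w: "\<And>k t. k < 2 * half_order E - 1 \<Longrightarrow> t \<in> interval E \<Longrightarrow>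
   (w k has_vector_derivative system_rhs act E t (f t) (\<lambda>j. w j t) k) (at t within interval E)"
  and y: "\<And>t. t \<in> interval E \<Longrightarrow> y t = w 0 t" and t: "t \<in> interval E"
 shows "k < 2 * half_order E \<Longrightarrow> quasi_deriv act E y k t = w k t"
  and "(w (2 * half_order E - 1) has_vector_derivative
   system_rhs act E t (f t) (\<lambda>j. w j t) (2 * half_order E - 1)) (at t within interval E)
   \<Longrightarrow> quasi_deriv act E y (2 * half_order E) t = f t"
proof -
 define n where "n = half_order E"
 have n0: "n > 0" unfolding n_def by (rule half_order_pos)
 then have n1: "n - 1 < 2 * half_order E - 1" unfolding n_def by linarith
 note I = regular_initial_interval[OF E]
 let ?D = "deriv_on (interval E)"
 have low0: "(?D ^^ k) y t = w k t" if "k < n" "t \<in> interval E" for k t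
  using that
 proof (induction k arbitrary: t)
  case (Suc k)
  have "?D ((?D ^^ k) y) t = ?D (w k) t"
   by (rule deriv_on_cong) (use Suc in auto)
  also have "\<dots> = system_rhs act E t (f t) (\<lambda>j. w j t) k"
   by (rule deriv_on_eqI[OF I _ w]) (use Suc n_def in auto)
  also have "\<dots> = w (Suc k) t"
   using Suc by (simp add: system_rhs_def low_deriv_def n_def)
  finally show ?case by simp
 qed (simp add: y)
 have "?D ((?D ^^ (n - 1)) y) t = top_deriv act E t (\<lambda>j. w j t)" if t: "t \<in> interval E" for t
 proof -
  have "?D ((?D ^^ (n - 1)) y) t = ?D (w (n - 1)) t"
   by (rule deriv_on_cong) (use low0 n0 t in auto)
  also have "\<dots> = system_rhs act E t (f t) (\<lambda>j. w j t) (n - 1)"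
   by (rule deriv_on_eqI[OF I t w[OF n1 t]])
  finally show ?thesis
   using n0 by (simp add: system_rhs_def low_deriv_def n_def)
 qed
 moreover have "?D ((?D ^^ (n - 1)) y) = (?D ^^ n) y"
  using n0 by (cases n) auto
 ultimately have low: "(?D ^^ j) y t = low_deriv act E t (\<lambda>j. w j t) j" if "j \<le> n" "t \<in> interval E" for j t
  using low0[of j t] that by (cases "j = n") (auto simp: low_deriv_def n_def)
 have step: "upper_quasi_deriv act E y (Suc i) t = (if Suc i < n then w (n + Suc i) t else f t)"
  if i: "i < n" and t: "t \<in> interval E"
   and eq: "\<And>s. s \<in> interval E \<Longrightarrow> upper_quasi_deriv act E y i s = w (n + i) s"
   and d: "(w (n + i) has_vector_derivative system_rhs act E t (f t) (\<lambda>j. w j t) (n + i)) (at t within interval E)"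
  for i t
 proof -
  have "?D (upper_quasi_deriv act E y i) t = ?D (w (n + i)) t"
   by (rule deriv_on_cong[OF eq t])
  also have "\<dots> = system_rhs act E t (f t) (\<lambda>j. w j t) (n + i)"
   by (rule deriv_on_eqI[OF I t d])
  finally show ?thesis
   using i low[OF _ t, of "n - Suc i"] low[OF _ t, of "n - Suc i + 1"] low[OF _ t, of "n - Suc i - 1"]
   by (simp add: system_rhs_def Let_def flip: n_def)
 qed
 have up: "upper_quasi_deriv act E y i t = w (n + i) t" if "i < n" "t \<in> interval E" for i t
  using that
 proof (induction i arbitrary: t)
  case 0
  then show ?case
   using act_inverse(2)[OF E 0(2)] low[OF _ 0(2), of n] low0[of "n - 1" t] n0
   by (simp add: Let_def low_deriv_def top_deriv_def flip: n_def)
 next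
  case (Suc i)
  have "upper_quasi_deriv act E y (Suc i) t = (if Suc i < n then w (n + Suc i) t else f t)"
   by (rule step) (use Suc in \<open>auto intro!: w simp: n_def\<close>)
  then show ?case using Suc by simp
 qed
 show "quasi_deriv act E y k t = w k t" if "k < 2 * half_order E"
  using low0[of k t] up[of "k - n" t] that t by (auto simp: quasi_deriv_def n_def)
 show "quasi_deriv act E y (2 * half_order E) t = f t"
  if "(w (2 * half_order E - 1) has_vector_derivative
   system_rhs act E t (f t) (\<lambda>j. w j t) (2 * half_order E - 1)) (at t within interval E)"
 proof -
  have "2 * half_order E - 1 = n + (n - 1)"
   using n0 unfolding n_def by linarith
  note d = that[unfolded this]
  have "upper_quasi_deriv act E y (Suc (n - 1)) t = (if Suc (n - 1) < n then w (n + Suc (n - 1)) t else f t)"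
   by (rule step[OF _ t up d]) (use n0 in auto)
  then show ?thesis
   using n0 by (simp add: quasi_deriv_def n_def)
 qed
qed

end

subsection \<open>Coordinates\<close>

lemma pos_less_card: "pos (i :: 'n::{finite,linorder}) < CARD('n)"
 unfolding pos_def by (rule psubset_card_mono) auto

lemma inj_pos: "inj (pos :: 'n::{finite,linorder} \<Rightarrow> nat)"
proof (rule injI)
 fix i j :: 'n
 assume eq: "pos i = pos j"
 have "pos i < pos j" if "i < j" for i j :: 'n
  unfolding pos_def by (rule psubset_card_mono) (use that in auto)
 from this[of i j] this[of j i] eq show "i = j"
  by (cases i j rule: linorder_cases) auto
qed

lemma range_pos: "range (pos :: 'n::{finite,linorder} \<Rightarrow> nat) = {..<CARD('n)}"
 by (rule card_subset_eq) (auto simp: pos_less_card card_image inj_pos)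

lemma bij_betw_pos: "bij_betw (pos :: 'n::{finite,linorder} \<Rightarrow> nat) UNIV {..<CARD('n)}"
 by (simp add: bij_betw_def inj_pos range_pos)

definition idx :: "nat \<Rightarrow> 'n::{finite,linorder}" where "idx = inv pos"

lemma idx_pos [simp]: "idx (pos i) = i"
 by (simp add: idx_def inj_pos)

lemma pos_idx [simp]: "k < CARD('n) \<Longrightarrow> pos (idx k :: 'n::{finite,linorder}) = k"
 unfolding idx_def by (rule f_inv_into_f) (simp add: range_pos)

lift_definition nth_op :: "'n::finite \<Rightarrow> ('a::complex_normed_vector) ^ 'n \<Rightarrow>\<^sub>B 'a" is "\<lambda>i x. x $ i"
 by (simp add: bounded_clinear_def bounded_linear_vec_nth)

declare nth_op.rep_eq [simp]

definition axis_op :: "'n::finite \<Rightarrow> 'a \<Rightarrow>\<^sub>B ('a::complex_normed_vector) ^ 'n" where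
 "axis_op i = vec_op (\<lambda>j. if j = i then id_op else 0)"

lemma axis_op_apply: "cblinfun_apply (axis_op i) x = (\<chi> j. if j = i then x else 0)"
 by (simp add: axis_op_def if_distribR vec_eq_iff)

text \<open>The coordinate that holds y^[k]. The second half is indexed backwards, as y^(2) lists
  the orders 2n - 1 down to n. \<open>qemb\<close> embeds into the same coordinate.\<close>

definition qcomp :: "nat \<Rightarrow> ('h::complex_normed_vector, 'n::{finite,linorder}) vec \<times> ('h, 'n) vec \<Rightarrow>\<^sub>B 'h" where
 "qcomp k = (if k < CARD('n) then nth_op (idx k) o\<^sub>C fst_op
  else nth_op (idx (2 * CARD('n) - 1 - k)) o\<^sub>C snd_op)"

definition qemb :: "nat \<Rightarrow> 'h \<Rightarrow>\<^sub>B ('h::complex_normed_vector, 'n::{finite,linorder}) vec \<times> ('h, 'n) vec" where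
 "qemb k = (if k < CARD('n) then col_op (axis_op (idx k)) 0
  else col_op 0 (axis_op (idx (2 * CARD('n) - 1 - k))))"

lemma qcomp_eqI:
 fixes u v :: "('h::complex_normed_vector, 'n::{finite,linorder}) vec \<times> ('h, 'n) vec"
 assumes "\<And>k. k < 2 * CARD('n) \<Longrightarrow> cblinfun_apply (qcomp k) u = qcomp k v"
 shows "u = v"
proof (rule prod_eqI)
 show "fst u = fst v"
  unfolding vec_eq_iff
 proof
  fix i :: 'n
  have "cblinfun_apply (qcomp (pos i)) u = qcomp (pos i) v"
   by (rule assms) (use pos_less_card[of i] in linarith)
  then show "fst u $ i = fst v $ i"
   by (simp add: qcomp_def pos_less_card)
 qed
 show "snd u = snd v"
  unfolding vec_eq_iff
 proof
  fix i :: 'n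
  let ?k = "2 * CARD('n) - 1 - pos i"
  have k: "?k < 2 * CARD('n)" "\<not> ?k < CARD('n)" "2 * CARD('n) - 1 - ?k = pos i"
   using pos_less_card[of i] by linarith+
  have "cblinfun_apply (qcomp ?k) u = qcomp ?k v"
   by (rule assms[OF k(1)])
  then show "snd u $ i = snd v $ i"
   by (simp only: qcomp_def k if_False) simp
 qed
qed

lemma qcomp_qemb:
 assumes "j < 2 * CARD('n::{finite,linorder})" "k < 2 * CARD('n)"
 shows "cblinfun_apply (qcomp j) (cblinfun_apply (qemb k :: 'h::complex_normed_vector \<Rightarrow>\<^sub>B ('h, 'n) vec \<times> ('h, 'n) vec) x) =
  (if j = k then x else 0)"
proof -
 have idx_eq: "(idx i :: 'n) = idx l \<longleftrightarrow> i = l" if "i < CARD('n)" "l < CARD('n)" for i l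
  using that by (metis pos_idx)
 show ?thesis
  using assms by (auto simp: qcomp_def qemb_def axis_op_apply idx_eq)
qed

lemma sum_qemb_qcomp:
 fixes u :: "('h::complex_normed_vector, 'n::{finite,linorder}) vec \<times> ('h, 'n) vec"
 shows "(\<Sum>k<2 * CARD('n). cblinfun_apply (qemb k) (cblinfun_apply (qcomp k) u)) = u"
proof (rule qcomp_eqI)
 let ?e = "qemb :: nat \<Rightarrow> 'h \<Rightarrow>\<^sub>B ('h, 'n) vec \<times> ('h, 'n) vec"
 fix j assume j: "j < 2 * CARD('n)"
 have "cblinfun_apply (qcomp j) (\<Sum>k<2 * CARD('n). cblinfun_apply (?e k) (cblinfun_apply (qcomp k) u)) =
  (\<Sum>k<2 * CARD('n). if j = k then cblinfun_apply (qcomp k) u else 0)"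
  unfolding cblinfun_apply_sum by (rule sum.cong) (use j in \<open>auto simp: qcomp_qemb\<close>)
 then show "cblinfun_apply (qcomp j) (\<Sum>k<2 * CARD('n). cblinfun_apply (?e k) (cblinfun_apply (qcomp k) u)) = qcomp j u"
  using j by simp
qed

lemma has_vector_derivative_qcomp:
 fixes u :: "real \<Rightarrow> ('h::complex_normed_vector, 'n::{finite,linorder}) vec \<times> ('h, 'n) vec"
 assumes "\<And>k. k < 2 * CARD('n) \<Longrightarrow> ((\<lambda>t. qcomp k (u t)) has_vector_derivative qcomp k v) F"
 shows "(u has_vector_derivative v) F"
proof -
 let ?e = "qemb :: nat \<Rightarrow> 'h \<Rightarrow>\<^sub>B ('h, 'n) vec \<times> ('h, 'n) vec"
 have "((\<lambda>t. \<Sum>k<2 * CARD('n). cblinfun_apply (?e k) (cblinfun_apply (qcomp k) (u t))) has_vector_derivative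
  (\<Sum>k<2 * CARD('n). cblinfun_apply (?e k) (cblinfun_apply (qcomp k) v))) F"
  by (intro has_vector_derivative_sum bounded_linear.has_vector_derivative[OF bounded_linear_apply] assms) auto
 then show ?thesis by (simp only: sum_qemb_qcomp)
qed

lemma sum_op_apply: "cblinfun_apply (sum f S) x = (\<Sum>k\<in>S. cblinfun_apply (f k) x)"
 by (induction S rule: infinite_finite_induct) auto

lemma has_vector_derivative_qcomp_op:
 fixes U :: "real \<Rightarrow> ('k::complex_normed_vector \<Rightarrow>\<^sub>B ('h::complex_normed_vector, 'n::{finite,linorder}) vec \<times> ('h, 'n) vec)"
 assumes "\<And>k. k < 2 * CARD('n) \<Longrightarrow> ((\<lambda>t. qcomp k o\<^sub>C U t) has_vector_derivative qcomp k o\<^sub>C V) F"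
 shows "(U has_vector_derivative V) F"
proof -
 have eq: "(\<Sum>k<2 * CARD('n). qemb k o\<^sub>C (qcomp k o\<^sub>C W)) = W"
  for W :: "'k \<Rightarrow>\<^sub>B ('h, 'n) vec \<times> ('h, 'n) vec"
  by (rule cblinfun_eqI) (simp add: sum_op_apply sum_qemb_qcomp)
 let ?e = "qemb :: nat \<Rightarrow> 'h \<Rightarrow>\<^sub>B ('h, 'n) vec \<times> ('h, 'n) vec"
 have "((\<lambda>t. \<Sum>k<2 * CARD('n). ?e k o\<^sub>C (qcomp k o\<^sub>C U t)) has_vector_derivative
  (\<Sum>k<2 * CARD('n). ?e k o\<^sub>C (qcomp k o\<^sub>C V))) F"
  by (intro has_vector_derivative_sum assms
   bounded_linear.has_vector_derivative[OF bounded_bilinear.bounded_linear_right[OF bounded_bilinear_comp_op]]) auto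
 then show ?thesis by (simp only: eq)
qed

definition state ::
 "('h::complex_hilbert_space, 'n::{finite,linorder}) diff_expr \<Rightarrow> (real \<Rightarrow> 'h) \<Rightarrow> real
  \<Rightarrow> ('h, 'n) vec \<times> ('h, 'n) vec" where
 "state E y t = (vec1 E y t, vec2 E y t)"

lemma qcomp_state:
 fixes E :: "('h::complex_hilbert_space, 'n::{finite,linorder}) diff_expr"
 shows "k < 2 * half_order E \<Longrightarrow> qcomp k (state E y t) = qderiv E y k t"
 by (auto simp: qcomp_def state_def vec1_def vec2_def half_order_def)

lemma qcomp_op_tilde:
 fixes E :: "('h::complex_hilbert_space, 'n::{finite,linorder}) diff_expr"
 shows "k < 2 * half_order E \<Longrightarrow> qcomp k o\<^sub>C op_tilde E Y t = op_qderiv E Y k t"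
 by (rule cblinfun_eqI) (auto simp: qcomp_def op_tilde_def half_order_def)

subsection \<open>The system operator\<close>

text \<open>The coefficient of the first-order system for l[y] = z y. Feeding
  \<open>system_rhs\<close> with the coordinate maps in place of values turns its formula into an
  operator.\<close>

definition system_op ::
 "('h::complex_hilbert_space, 'n::{finite,linorder}) diff_expr \<Rightarrow> complex \<Rightarrow> real
  \<Rightarrow> (('h, 'n) vec \<times> ('h, 'n) vec \<Rightarrow>\<^sub>B ('h, 'n) vec \<times> ('h, 'n) vec)" where
 "system_op E z t = (\<Sum>k<2 * half_order E. qemb k o\<^sub>C system_rhs comp_op E t (z *\<^sub>C qcomp 0) qcomp k)"

lemma low_deriv_apply:
 "cblinfun_apply (low_deriv comp_op E t w k) x = low_deriv cblinfun_apply E t (\<lambda>j. w j x) k"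
 by (simp add: low_deriv_def top_deriv_def)

lemma system_rhs_apply:
 "cblinfun_apply (system_rhs comp_op E t f w k) x =
  system_rhs cblinfun_apply E t (f x) (\<lambda>j. w j x) k"
 by (cases "k < half_order E"; cases "k - half_order E + 1 < half_order E")
  (simp_all add: system_rhs_def low_deriv_apply Let_def)

text \<open>The inhomogeneity occurs in the last component only and with a minus sign; hence the
  term \<open>- src (\<psi> t)\<close> in the inhomogeneous systems below.\<close>

lemma system_rhs_inhom:
 assumes "k < 2 * half_order E"
 shows "system_rhs act E t f w k = system_rhs act E t g w k + (if k = 2 * half_order E - 1 then g - f else 0)"
 using assms half_order_pos[of E] by (auto simp: system_rhs_def Let_def)

lemma qcomp_system_op:
 fixes E :: "('h::complex_hilbert_space, 'n::{finite,linorder}) diff_expr"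
 assumes "k < 2 * half_order E"
 shows "qcomp k (system_op E z t u) = system_rhs cblinfun_apply E t (z *\<^sub>C qcomp 0 u) (\<lambda>j. qcomp j u) k"
proof -
 have "qcomp k (system_op E z t u) =
  (\<Sum>j<2 * half_order E. if k = j then system_rhs comp_op E t (z *\<^sub>C qcomp 0) qcomp j u else 0)"
  unfolding system_op_def sum_op_apply cblinfun_apply_sum
  by (rule sum.cong) (use assms in \<open>auto simp: half_order_def qcomp_qemb\<close>)
 then show ?thesis using assms by (simp add: system_rhs_apply)
qed

lemma qcomp_system_op_comp:
 fixes E :: "('h::complex_hilbert_space, 'n::{finite,linorder}) diff_expr"
 assumes "k < 2 * half_order E"
 shows "qcomp k o\<^sub>C (system_op E z t o\<^sub>C U) =
  system_rhs comp_op E t (z *\<^sub>C (qcomp 0 o\<^sub>C U)) (\<lambda>j. qcomp j o\<^sub>C U) k"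
 by (rule cblinfun_eqI) (simp add: qcomp_system_op[OF assms] system_rhs_apply)

lemma continuous_system_op:
 fixes E :: "('h::complex_hilbert_space, 'n::{finite,linorder}) diff_expr"
 assumes E: "regular_diff_expr E"
 shows "continuous_on (interval E) (system_op E z)"
proof -
 have p: "continuous_on (interval E) (pcoeff E k)" if "k \<le> half_order E" for k
  using E that by (auto simp: regular_diff_expr_def intro: Ck_on_continuous)
 have q: "continuous_on (interval E) (qcoeff E k)" if "k < half_order E" for k
  using E that by (auto simp: regular_diff_expr_def intro: Ck_on_continuous)
 have aq: "continuous_on (interval E) (\<lambda>t. adj (qcoeff E k t))" if "k < half_order E" for k
  by (rule bounded_linear.continuous_on[OF bounded_linear_adj q[OF that]])
 have inv: "continuous_on (interval E) (\<lambda>t. inverse_op (pcoeff E 0 t))"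
  by (rule continuous_inverse_op[OF p]) (use E in \<open>auto simp: regular_diff_expr_def\<close>)
 note comp = bounded_bilinear.continuous_on[OF bounded_bilinear_comp_op]
 note scC = bounded_linear.continuous_on[OF bounded_linear_scaleC]
 have top: "continuous_on (interval E) (\<lambda>t. top_deriv comp_op E t qcomp)"
  unfolding top_deriv_def
  by (intro comp inv continuous_on_add continuous_on_const scC q) simp
 have low: "continuous_on (interval E) (\<lambda>t. low_deriv comp_op E t qcomp j)" for j
  unfolding low_deriv_def by (cases "j < half_order E") (simp_all add: top)
 have "continuous_on (interval E) (\<lambda>t. system_rhs comp_op E t (z *\<^sub>C qcomp 0) qcomp k)"
  if k: "k < 2 * half_order E" for k
 proof (cases "k < half_order E")
  case False
  define j where "j = k - half_order E + 1"
  have j: "j \<le> half_order E" "j - 1 < half_order E" using False k by (auto simp: j_def)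
  have "continuous_on (interval E) (\<lambda>t. if j < half_order E then qcoeff E j t o\<^sub>C low_deriv comp_op E t qcomp (half_order E - j - 1) else 0)"
   by (cases "j < half_order E") (auto intro!: comp q low)
  with False j show ?thesis
   unfolding system_rhs_def Let_def j_def[symmetric]
   by (simp only: if_False) (intro continuous_on_add continuous_on_diff continuous_on_const comp scC p aq low; simp)
 qed (simp add: system_rhs_def low)
 then have "continuous_on (interval E)
  (\<lambda>t. \<Sum>k<2 * half_order E. qemb k o\<^sub>C system_rhs comp_op E t (z *\<^sub>C qcomp 0) qcomp k)"
  by (intro continuous_on_sum comp continuous_on_const) auto
 then show ?thesis by (simp add: system_op_def[abs_def])
qed

subsection \<open>The symplectic form\<close>

definition br :: "('a::complex_hilbert_space) \<times> 'a \<Rightarrow> 'a \<times> 'a \<Rightarrow> complex" where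
 "br u v = cinner (fst u) (snd v) - cinner (snd u) (fst v)"

lemma bracket_eq_br: "bracket E y z t = br (state E y t) (state E z t)"
 by (simp add: bracket_def br_def state_def)

lemma bounded_bilinear_br: "bounded_bilinear (br :: 'a::complex_hilbert_space \<times> 'a \<Rightarrow> _)"
proof -
 note c = bounded_bilinear_cinner
 have 1: "bounded_bilinear (\<lambda>(u :: 'a \<times> 'a) (v :: 'a \<times> 'a). cinner (fst u) (snd v))"
  by (rule bounded_bilinear.comp[OF c bounded_linear_fst bounded_linear_snd])
 have 2: "bounded_bilinear (\<lambda>(u :: 'a \<times> 'a) (v :: 'a \<times> 'a). cinner (snd u) (fst v))"
  by (rule bounded_bilinear.comp[OF c bounded_linear_snd bounded_linear_fst])
 show ?thesis
 proof
  fix a a' b b' :: "'a \<times> 'a" and r :: real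
  show "br (a + a') b = br a b + br a' b" "br a (b + b') = br a b + br a b'"
   by (simp_all add: br_def cinner_linear_simps)
  show "br (r *\<^sub>R a) b = r *\<^sub>R br a b" "br a (r *\<^sub>R b) = r *\<^sub>R br a b"
   by (simp_all add: br_def cinner_scaleR_left cinner_scaleR_right scaleR_diff_right)
  obtain K1 K2 where K: "\<And>(a :: 'a \<times> 'a) (b :: 'a \<times> 'a). cmod (cinner (fst a) (snd b)) \<le> norm a * norm b * K1"
   "\<And>(a :: 'a \<times> 'a) (b :: 'a \<times> 'a). cmod (cinner (snd a) (fst b)) \<le> norm a * norm b * K2"
   using bounded_bilinear.bounded[OF 1] bounded_bilinear.bounded[OF 2] by blast
  show "\<exists>K. \<forall>a b :: 'a \<times> 'a. norm (br a b) \<le> norm a * norm b * K"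
  proof (intro exI allI)
   fix a b :: "'a \<times> 'a"
   show "norm (br a b) \<le> norm a * norm b * (K1 + K2)"
   unfolding br_def distrib_left
   by (rule order_trans[OF norm_triangle_ineq4]) (intro add_mono K)
  qed
 qed
qed

text \<open>One sum and its conjugate with exchanged arguments make up the form, so only one half
  has to be differentiated.\<close>

lemma br_qcomp:
 fixes u v :: "('h::complex_hilbert_space, 'n::{finite,linorder}) vec \<times> ('h, 'n) vec"
 shows "br u v = (\<Sum>k<CARD('n). cinner (qcomp k u) (qcomp (2 * CARD('n) - 1 - k) v))
  - cnj (\<Sum>k<CARD('n). cinner (qcomp k v) (qcomp (2 * CARD('n) - 1 - k) u))"
proof -
 have s: "cinner (fst u) (snd v) = (\<Sum>k<CARD('n). cinner (qcomp k u) (qcomp (2 * CARD('n) - 1 - k) v))"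
  for u v :: "('h, 'n) vec \<times> ('h, 'n) vec"
 proof -
  have "cinner (fst u) (snd v) = (\<Sum>i\<in>(UNIV::'n set). cinner (qcomp (pos i) u) (qcomp (2 * CARD('n) - 1 - pos i) v))"
   unfolding cinner_vec_def
  proof (rule sum.cong)
   fix i :: 'n
   have k: "\<not> 2 * CARD('n) - 1 - pos i < CARD('n)" "2 * CARD('n) - 1 - (2 * CARD('n) - 1 - pos i) = pos i"
   using pos_less_card[of i] by linarith+
   show "cinner (fst u $ i) (snd v $ i) = cinner (qcomp (pos i) u) (qcomp (2 * CARD('n) - 1 - pos i) v)"
   by (simp only: qcomp_def k if_False pos_less_card if_True idx_pos) simp
  qed simp
  also have "\<dots> = (\<Sum>k<CARD('n). cinner (qcomp k u) (qcomp (2 * CARD('n) - 1 - k) v))"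
   by (rule sum.reindex_bij_betw[OF bij_betw_pos])
  finally show ?thesis .
 qed
 have "cinner (snd u) (fst v) = cnj (cinner (fst v) (snd u))"
  by (rule cinner_commute)
 then show ?thesis by (simp add: br_def s)
qed

text \<open>The left side is the derivative of the product of u^(1) and v^(2). The pairings of
  neighbouring quasi-derivatives telescope between the sums \<open>a\<close> and \<open>b\<close>;
  the terms in p and q remain, prepared for comparison with their counterparts after
  exchange.\<close>

lemma lagrange_half:
 fixes E :: "('h::complex_hilbert_space, 'n::{finite,linorder}) diff_expr" and w x :: "nat \<Rightarrow> 'h"
 defines "n \<equiv> half_order E"
 assumes n: "n = Suc m"
 shows "(\<Sum>k<n. cinner (system_rhs cblinfun_apply E t f w k) (x (2 * n - 1 - k))
   + cinner (w k) (system_rhs cblinfun_apply E t g x (2 * n - 1 - k)))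
  = cinner (top_deriv cblinfun_apply E t w) (x n) - cinner (w 0) g
   + (\<Sum>k<n. cinner (w k) (pcoeff E (n - k) t (x k)))
   + (\<Sum>k<m. (\<i> / 2) * (cinner (w (Suc k)) (qcoeff E (m - k) t (x k))
   - cinner (qcoeff E (m - k) t (w k)) (x (Suc k))))
   - (\<i> / 2) * cinner (qcoeff E 0 t (w m)) (top_deriv cblinfun_apply E t x)"
proof -
 have rhs: "system_rhs cblinfun_apply E t g x (2 * n - 1 - k) =
   - (if k = 0 then g else x (2 * n - k)) + pcoeff E (n - k) t (x k)
   + (\<i> / 2) *\<^sub>C (adj (qcoeff E (m - k) t) (low_deriv cblinfun_apply E t x (Suc k))
   - (if 0 < k then qcoeff E (n - k) t (x (k - 1)) else 0))" if k: "k < n" for k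
 proof -
  have i: "\<not> 2 * n - 1 - k < n" "2 * n - 1 - k - n + 1 = n - k" "n - k < n \<longleftrightarrow> 0 < k" "n - (n - k) = k"
   "n - k - 1 = m - k" "n + (n - k) = 2 * n - k"
   using k n by auto
  have "k - Suc 0 < n" using k by simp
  then show ?thesis
   using k unfolding system_rhs_def Let_def n_def[symmetric] i if_False
   by (auto simp: low_deriv_def simp flip: n_def)
 qed
 have low: "system_rhs cblinfun_apply E t f w k = low_deriv cblinfun_apply E t w (Suc k)" if "k < n" for k
  using that by (simp add: system_rhs_def n_def)
 have lw: "low_deriv cblinfun_apply E t v (Suc k) = (if k < m then v (Suc k) else top_deriv cblinfun_apply E t v)" for v k
  using n by (auto simp: low_deriv_def n_def)
 have half: "cnj (\<i> / 2) = - (\<i> / 2)" by simp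
 define a where "a k = cinner (low_deriv cblinfun_apply E t w (Suc k)) (x (2 * n - 1 - k))" for k
 define b where "b k = cinner (w k) (if k = 0 then g else x (2 * n - k))" for k
 define c where "c k = cinner (qcoeff E (m - k) t (w k)) (low_deriv cblinfun_apply E t x (Suc k))" for k
 define d where "d k = cinner (w k) (if 0 < k then qcoeff E (n - k) t (x (k - 1)) else 0)" for k
 have "(\<Sum>k<n. cinner (system_rhs cblinfun_apply E t f w k) (x (2 * n - 1 - k))
   + cinner (w k) (system_rhs cblinfun_apply E t g x (2 * n - 1 - k)))
  = (\<Sum>k<n. a k - b k + cinner (w k) (pcoeff E (n - k) t (x k)) - (\<i> / 2) * c k + (\<i> / 2) * d k)"
 proof (rule sum.cong)
  fix k assume "k \<in> {..<n}"
  then have k: "k < n" by simp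
  show "cinner (system_rhs cblinfun_apply E t f w k) (x (2 * n - 1 - k))
   + cinner (w k) (system_rhs cblinfun_apply E t g x (2 * n - 1 - k))
   = a k - b k + cinner (w k) (pcoeff E (n - k) t (x k)) - (\<i> / 2) * c k + (\<i> / 2) * d k"
   unfolding rhs[OF k] low[OF k] a_def b_def c_def d_def
   by (simp only: cinner_linear_simps half cinner_adj) (simp add: algebra_simps)
 qed simp
 also have "\<dots> = (\<Sum>k<n. a k) - (\<Sum>k<n. b k) + (\<Sum>k<n. cinner (w k) (pcoeff E (n - k) t (x k)))
   - (\<i> / 2) * (\<Sum>k<n. c k) + (\<i> / 2) * (\<Sum>k<n. d k)"
  by (simp only: sum.distrib sum_subtractf sum_distrib_left)
 also have "(\<Sum>k<n. a k) = (\<Sum>k<m. cinner (w (Suc k)) (x (2 * n - 1 - k))) + cinner (top_deriv cblinfun_apply E t w) (x n)"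
  by (simp add: n a_def lw mult_2)
 also have "(\<Sum>k<n. b k) = cinner (w 0) g + (\<Sum>k<m. cinner (w (Suc k)) (x (2 * n - 1 - k)))"
  unfolding n sum.lessThan_Suc_shift by (simp add: b_def n)
 also have "(\<Sum>k<n. c k) = (\<Sum>k<m. cinner (qcoeff E (m - k) t (w k)) (x (Suc k)))
   + cinner (qcoeff E 0 t (w m)) (top_deriv cblinfun_apply E t x)"
  by (simp add: n c_def lw)
 also have "(\<Sum>k<n. d k) = (\<Sum>k<m. cinner (w (Suc k)) (qcoeff E (m - k) t (x k)))"
  unfolding n sum.lessThan_Suc_shift by (simp add: d_def n)
 finally show ?thesis
  by (simp add: sum_subtractf sum_distrib_left algebra_simps)
qed

text \<open>In the difference of the two halves the sums over p cancel by selfadjointness, and the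
  sums over q are conjugate to each other. What is left at order n cancels since p_0 D^n y = y^[n] +
  (i/2) q_0 D^(n-1) y and p_0 is selfadjoint.\<close>

lemma lagrange_identity:
 fixes E :: "('h::complex_hilbert_space, 'n::{finite,linorder}) diff_expr"
  and u v u' v' :: "('h, 'n) vec \<times> ('h, 'n) vec"
 assumes E: "regular_diff_expr E" and t: "t \<in> interval E"
  and u: "\<And>k. k < 2 * half_order E \<Longrightarrow> qcomp k u' = system_rhs cblinfun_apply E t f (\<lambda>j. qcomp j u) k"
  and v: "\<And>k. k < 2 * half_order E \<Longrightarrow> qcomp k v' = system_rhs cblinfun_apply E t g (\<lambda>j. qcomp j v) k"
 shows "br u' v + br u v' = cinner f (qcomp 0 v) - cinner (qcomp 0 u) g"
proof -
 define n where "n = half_order E"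
 have "0 < n" unfolding n_def by (rule half_order_pos)
 then obtain m where m: "n = Suc m" using gr0_implies_Suc by blast
 have nc: "CARD('n) = n" by (simp add: n_def half_order_def)
 define H where "H u u' v v' = (\<Sum>k<n. cinner (qcomp k u') (qcomp (2 * n - 1 - k) v)
   + cinner (qcomp k u) (qcomp (2 * n - 1 - k) v'))"
  for u u' v v' :: "('h, 'n) vec \<times> ('h, 'n) vec"
 have br: "br u' v + br u v' = H u u' v v' - cnj (H v v' u u')"
  unfolding br_qcomp nc H_def by (simp add: sum.distrib algebra_simps)
 let ?w = "\<lambda>j. cblinfun_apply (qcomp j) u" and ?x = "\<lambda>j. cblinfun_apply (qcomp j) v"
 let ?dw = "top_deriv cblinfun_apply E t ?w" and ?dx = "top_deriv cblinfun_apply E t ?x"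
 let ?p = "\<lambda>k. cblinfun_apply (pcoeff E k t)" and ?q = "\<lambda>k. cblinfun_apply (qcoeff E k t)"
 have H1: "H u u' v v' = cinner ?dw (?x n) - cinner (?w 0) g + (\<Sum>k<n. cinner (?w k) (?p (n - k) (?x k)))
   + (\<Sum>k<m. (\<i> / 2) * (cinner (?w (Suc k)) (?q (m - k) (?x k)) - cinner (?q (m - k) (?w k)) (?x (Suc k))))
   - (\<i> / 2) * cinner (?q 0 (?w m)) ?dx"
  unfolding H_def
  by (subst lagrange_half[where E = E and w = ?w and x = ?x and f = f and g = g and t = t, folded n_def, OF m, symmetric],
   rule sum.cong) (use u v in \<open>auto simp: n_def\<close>)
 have H2: "H v v' u u' = cinner ?dx (?w n) - cinner (?x 0) f + (\<Sum>k<n. cinner (?x k) (?p (n - k) (?w k)))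
   + (\<Sum>k<m. (\<i> / 2) * (cinner (?x (Suc k)) (?q (m - k) (?w k)) - cinner (?q (m - k) (?x k)) (?w (Suc k))))
   - (\<i> / 2) * cinner (?q 0 (?x m)) ?dw"
  unfolding H_def
  by (subst lagrange_half[where E = E and w = ?x and x = ?w and f = g and g = f and t = t, folded n_def, OF m, symmetric],
   rule sum.cong) (use u v in \<open>auto simp: n_def\<close>)
 have p: "cinner (?p k a) b = cinner a (?p k b)" if "k \<le> n" for k a b
 proof -
  have "adj (pcoeff E k t) = pcoeff E k t"
   using E t that by (auto simp: regular_diff_expr_def n_def)
  then show ?thesis by (metis cinner_adj)
 qed
 have "cnj (\<Sum>k<n. cinner (?x k) (?p (n - k) (?w k))) = (\<Sum>k<n. cinner (?w k) (?p (n - k) (?x k)))"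
  by (simp add: p flip: cinner_commute)
 moreover have "cnj (\<Sum>k<m. (\<i> / 2) * (cinner (?x (Suc k)) (?q (m - k) (?w k)) - cinner (?q (m - k) (?x k)) (?w (Suc k))))
  = (\<Sum>k<m. (\<i> / 2) * (cinner (?w (Suc k)) (?q (m - k) (?x k)) - cinner (?q (m - k) (?w k)) (?x (Suc k))))"
  by (auto simp: algebra_simps simp flip: cinner_commute intro!: sum.cong)
 ultimately have eq: "br u' v + br u v' =
   cinner ?dw (?x n) - cinner (?w 0) g - (\<i> / 2) * cinner (?q 0 (?w m)) ?dx
   - (cinner (?w n) ?dx - cinner f (?x 0) + (\<i> / 2) * cinner ?dw (?q 0 (?x m)))"
  unfolding br H1 H2 by (simp flip: cinner_commute)
 have top: "?p 0 (top_deriv cblinfun_apply E t y) = y n + (\<i> / 2) *\<^sub>C ?q 0 (y m)" for y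
  using apply_action.act_inverse(2)[OF E t] by (simp add: top_deriv_def m flip: n_def)
 have half: "cnj (\<i> / 2) = - (\<i> / 2)" by simp
 have "cinner (?p 0 ?dw) ?dx = cinner ?dw (?p 0 ?dx)"
  by (rule p) simp
 then have "cinner (?w n) ?dx + (\<i> / 2) * cinner (?q 0 (?w m)) ?dx
   = cinner ?dw (?x n) - (\<i> / 2) * cinner ?dw (?q 0 (?x m))"
  unfolding top by (simp only: cinner_linear_simps half mult_minus_left add_uminus_conv_diff)
 then show ?thesis
  unfolding eq by (simp add: algebra_simps)
qed

subsection \<open>Operator solutions\<close>

lemma op_solution_system:
 fixes E :: "('h::complex_hilbert_space, 'n::{finite,linorder}) diff_expr"
 assumes E: "regular_diff_expr E" and Y: "op_solution E z Y" and t: "t \<in> interval E"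
 shows "(op_tilde E Y has_vector_derivative (system_op E z t o\<^sub>C op_tilde E Y t)) (at t within interval E)"
proof (rule has_vector_derivative_qcomp_op)
 fix k assume "k < 2 * CARD('n)"
 then have k: "k < 2 * half_order E" by (simp add: half_order_def)
 have "op_qderiv E Y k differentiable (at t within interval E)"
  using Y k t by (auto simp: op_solution_def differentiable_on_def)
 then have "(op_qderiv E Y k has_vector_derivative deriv_on (interval E) (op_qderiv E Y k) t) (at t within interval E)"
  by (simp add: deriv_on_def vector_derivative_works)
 moreover have "(\<lambda>s. qcomp k o\<^sub>C op_tilde E Y s) = op_qderiv E Y k"
  by (rule ext) (rule qcomp_op_tilde[OF k])
 moreover have "system_rhs comp_op E t (z *\<^sub>C (qcomp 0 o\<^sub>C op_tilde E Y t)) (\<lambda>j. qcomp j o\<^sub>C op_tilde E Y t) k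
  = system_rhs comp_op E t (op_qderiv E Y (2 * half_order E) t) (\<lambda>j. op_qderiv E Y j t) k"
 proof -
  have "op_qderiv E Y (2 * half_order E) t = z *\<^sub>C (qcomp 0 o\<^sub>C op_tilde E Y t)"
   using Y t by (simp add: op_solution_def qcomp_op_tilde quasi_deriv_def)
  then show ?thesis
   using k by (auto simp: system_rhs_def low_deriv_def top_deriv_def Let_def qcomp_op_tilde)
 qed
 ultimately show "((\<lambda>s. qcomp k o\<^sub>C op_tilde E Y s) has_vector_derivative
   qcomp k o\<^sub>C (system_op E z t o\<^sub>C op_tilde E Y t)) (at t within interval E)"
  unfolding qcomp_system_op_comp[OF k] by (simp add: comp_action.deriv_on_quasi_deriv[OF E t k])
qed

lemma system_op_solution:
 fixes E :: "('h::complex_hilbert_space, 'n::{finite,linorder}) diff_expr"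
  and U :: "real \<Rightarrow> ('k::complex_normed_vector \<Rightarrow>\<^sub>B ('h, 'n) vec \<times> ('h, 'n) vec)"
 assumes E: "regular_diff_expr E"
  and U: "\<And>t. t \<in> interval E \<Longrightarrow> (U has_vector_derivative (system_op E z t o\<^sub>C U t)) (at t within interval E)"
 defines "Y \<equiv> (\<lambda>t. if t \<in> interval E then qcomp 0 o\<^sub>C U t else 0)"
 shows "op_solution E z Y" and "t \<in> interval E \<Longrightarrow> op_tilde E Y t = U t"
proof -
 have w: "((\<lambda>t. qcomp k o\<^sub>C U t) has_vector_derivative
   system_rhs comp_op E t (z *\<^sub>C (qcomp 0 o\<^sub>C U t)) (\<lambda>j. qcomp j o\<^sub>C U t) k) (at t within interval E)"
  if "k < 2 * half_order E" "t \<in> interval E" for k t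
  unfolding qcomp_system_op_comp[OF that(1), symmetric]
  by (rule bounded_linear.has_vector_derivative[OF bounded_bilinear.bounded_linear_right[OF bounded_bilinear_comp_op] U[OF that(2)]])
 note qs = comp_action.quasi_deriv_of_system[OF E, where w = "\<lambda>k t. qcomp k o\<^sub>C U t" and y = Y
   and f = "\<lambda>t. z *\<^sub>C (qcomp 0 o\<^sub>C U t)"]
 have qd: "op_qderiv E Y k t = qcomp k o\<^sub>C U t" if "k < 2 * half_order E" "t \<in> interval E" for k t
  by (rule qs(1)) (use that w in \<open>auto simp: Y_def\<close>)
 have top: "op_qderiv E Y (2 * half_order E) t = z *\<^sub>C (qcomp 0 o\<^sub>C U t)" if "t \<in> interval E" for t
  by (rule qs(2)) (use that w[of "2 * half_order E - 1" t] w in \<open>auto simp: Y_def\<close>)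
 show "op_solution E z Y"
  unfolding op_solution_def
 proof (intro conjI allI impI ballI)
  fix k assume k: "k < 2 * half_order E"
  show "op_qderiv E Y k differentiable_on interval E"
   unfolding differentiable_on_def
  proof
   fix t assume t: "t \<in> interval E"
   have "(op_qderiv E Y k has_vector_derivative system_rhs comp_op E t (z *\<^sub>C (qcomp 0 o\<^sub>C U t)) (\<lambda>j. qcomp j o\<^sub>C U t) k)
   (at t within interval E)"
   by (rule has_vector_derivative_transform[OF t _ w[OF k t]]) (simp add: qd k)
   then show "op_qderiv E Y k differentiable (at t within interval E)"
   by (rule differentiableI_vector)
  qed
 next
  fix t assume t: "t \<in> interval E"
  then show "op_qderiv E Y (2 * half_order E) t = z *\<^sub>C Y t"
   unfolding top[OF t] by (simp add: Y_def)
 qed (simp add: Y_def)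
 show "op_tilde E Y t = U t" if "t \<in> interval E"
 proof (rule cblinfun_eqI, rule qcomp_eqI)
  fix x k assume "k < 2 * CARD('n)"
  then have "qcomp k o\<^sub>C op_tilde E Y t = qcomp k o\<^sub>C U t"
   using that by (simp add: qcomp_op_tilde qd half_order_def)
  then show "qcomp k (op_tilde E Y t x) = qcomp k (U t x)"
   by (metis comp_op.rep_eq)
 qed
qed

lemma op_solution_unique:
 fixes E :: "('h::complex_hilbert_space, 'n::{finite,linorder}) diff_expr"
 assumes E: "regular_diff_expr E" and Y: "op_solution E z Y" and Z: "op_solution E z Z"
  and init: "op_tilde E Y 0 = op_tilde E Z 0"
 shows "Y = Z"
proof
 fix t
 show "Y t = Z t"
 proof (cases "t \<in> interval E")
  case True
  have "op_tilde E Y t = op_tilde E Z t"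
   by (rule linear_ode_unique_on[where g = "\<lambda>_. 0" and u = "op_tilde E Y" and w = "op_tilde E Z", OF bounded_bilinear_comp_op regular_initial_interval[OF E]
   continuous_system_op[OF E, of z] _ _ init True])
   (use op_solution_system[OF E Y] op_solution_system[OF E Z] in auto)
  then have "qcomp 0 o\<^sub>C op_tilde E Y t = qcomp 0 o\<^sub>C op_tilde E Z t" by simp
  then show ?thesis by (simp add: qcomp_op_tilde quasi_deriv_def)
 qed (use Y Z in \<open>simp add: op_solution_def\<close>)
qed

lemma op_solution_with_init_eqI:
 fixes E :: "('h::complex_hilbert_space, 'n::{finite,linorder}) diff_expr"
 assumes "regular_diff_expr E" "op_solution E z Y" "op_tilde E Y 0 = A"
 shows "op_solution_with_init E z A = Y"
 unfolding op_solution_with_init_def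
 by (rule the_equality) (use assms op_solution_unique in blast)+

text \<open>The operator solution Y_0 together with its quasi-derivatives, which is the fundamental
  operator of the system normalised at 0.\<close>

definition fund ::
 "('h::complex_hilbert_space, 'n::{finite,linorder}) diff_expr \<Rightarrow> complex \<Rightarrow> real
  \<Rightarrow> (('h, 'n) vec \<times> ('h, 'n) vec \<Rightarrow>\<^sub>B ('h, 'n) vec \<times> ('h, 'n) vec)" where
 "fund E z t = op_tilde E (op_solution_with_init E z id_op) t"

lemma fund:
 fixes E :: "('h::complex_hilbert_space, 'n::{finite,linorder}) diff_expr"
 assumes E: "regular_diff_expr E"
 shows fund_deriv: "t \<in> interval E \<Longrightarrow>
   (fund E z has_vector_derivative (system_op E z t o\<^sub>C fund E z t)) (at t within interval E)"
  and fund_zero: "fund E z 0 = id_op"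
  and Y_zero_eq: "t \<in> interval E \<Longrightarrow> Y_zero E t z = qcomp 0 o\<^sub>C fund E z t"
  and Y_zero_outside: "t \<notin> interval E \<Longrightarrow> Y_zero E t z = 0"
proof -
 note I = regular_initial_interval[OF E]
 obtain U where U0: "U 0 = id_op" and U: "\<And>t. t \<in> interval E \<Longrightarrow>
   (U has_vector_derivative (system_op E z t o\<^sub>C U t)) (at t within interval E)"
  using linear_ode_exists_on[OF bounded_bilinear_comp_op I continuous_system_op[OF E]
   continuous_on_const[of _ 0], of id_op z] by auto
 define Y where "Y = (\<lambda>t. if t \<in> interval E then qcomp 0 o\<^sub>C U t else 0)"
 note Y = system_op_solution[OF E, of U z, OF U, folded Y_def]
 have Yt: "op_tilde E Y t = U t" if "t \<in> interval E" for t
  by (rule Y(2)[OF _ that])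
 have sol: "op_solution E z Y" by (rule Y(1))
 have Y_eq: "op_solution_with_init E z id_op = Y"
  by (rule op_solution_with_init_eqI[OF E sol]) (simp add: Yt U0 initial_interval_zero[OF I])
 have fund_eq: "fund E z t = op_tilde E Y t" for t
  by (simp add: fund_def Y_eq)
 then have fe: "fund E z = op_tilde E Y" by (rule ext)
 show "(fund E z has_vector_derivative (system_op E z t o\<^sub>C fund E z t)) (at t within interval E)"
  if "t \<in> interval E"
  unfolding fe by (rule op_solution_system[OF E sol that])
 show "fund E z 0 = id_op"
  by (simp add: fund_eq Yt U0 initial_interval_zero[OF I])
 show "Y_zero E t z = qcomp 0 o\<^sub>C fund E z t" if "t \<in> interval E"
  using that by (simp add: Y_zero_def Y_eq fund_eq Yt) (simp add: Y_def)
 show "Y_zero E t z = 0" if "t \<notin> interval E"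
  using that by (simp add: Y_zero_def Y_eq Y_def)
qed

text \<open>Multiplying a solution by a constant operator from the right preserves the equation.
  This reduces the operator solutions \<open>Y_tau_plus\<close> and \<open>Y_tau_minus\<close> to
  Y_0 times an initial value.\<close>

lemma op_solution_with_init_eq:
 fixes E :: "('h::complex_hilbert_space, 'n::{finite,linorder}) diff_expr"
 assumes E: "regular_diff_expr E"
 shows "op_solution_with_init E z A t = Y_zero E t z o\<^sub>C A"
proof -
 define U where "U t = fund E z t o\<^sub>C A" for t
 have U: "(U has_vector_derivative (system_op E z t o\<^sub>C U t)) (at t within interval E)"
  if "t \<in> interval E" for t
  using bounded_linear.has_vector_derivative[OF bounded_bilinear.bounded_linear_left[OF bounded_bilinear_comp_op]
   fund_deriv[OF E that, of z], of A]
  by (simp add: U_def[abs_def] comp_op_assoc)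
 define Y where "Y = (\<lambda>t. if t \<in> interval E then qcomp 0 o\<^sub>C U t else 0)"
 have "op_solution E z Y"
  unfolding Y_def by (rule system_op_solution(1)[OF E U])
 moreover have "op_tilde E Y 0 = A"
  unfolding Y_def using system_op_solution(2)[OF E U, of 0] initial_interval_zero[OF regular_initial_interval[OF E]]
  by (simp add: U_def fund_zero[OF E])
 ultimately have "op_solution_with_init E z A = Y"
  by (rule op_solution_with_init_eqI[OF E])
 then show ?thesis
  by (simp add: Y_def U_def Y_zero_eq[OF E] Y_zero_outside[OF E] comp_op_assoc) (auto intro: cblinfun_eqI)
qed

section \<open>Square integrable functions\<close>

lemma AE_summable_of_integral_bound:
 fixes g :: "nat \<Rightarrow> 'a \<Rightarrow> real"
 assumes g: "\<And>i. integrable M (g i)" and nonneg: "\<And>i x. 0 \<le> g i x"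
  and le: "\<And>i. integral\<^sup>L M (g i) \<le> b i" and b: "summable b"
 shows "AE x in M. summable (\<lambda>i. g i x)" and "integrable M (\<lambda>x. \<Sum>i. g i x)"
proof -
 have "(\<integral>\<^sup>+x. (\<Sum>i. ennreal (g i x)) \<partial>M) = (\<Sum>i. \<integral>\<^sup>+x. ennreal (g i x) \<partial>M)"
  by (rule nn_integral_suminf) (use g in auto)
 also have "\<dots> = (\<Sum>i. ennreal (integral\<^sup>L M (g i)))"
  by (intro suminf_cong nn_integral_eq_integral g) (simp add: nonneg)
 also have "\<dots> \<le> (\<Sum>i. ennreal (b i))"
  by (intro suminf_le summableI ennreal_leI le)
 also have "\<dots> < \<infinity>"
 proof -
  have "0 \<le> b i" for i
   by (rule order_trans[OF integral_nonneg_AE le]) (simp add: nonneg)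
  then have "(\<Sum>i. ennreal (b i)) = ennreal (\<Sum>i. b i)"
   by (rule suminf_ennreal2[OF _ b])
  then show ?thesis by (simp only: ennreal_less_top infinity_ennreal_def)
 qed
 finally have "AE x in M. (\<Sum>i. ennreal (g i x)) \<noteq> \<infinity>"
  by (intro nn_integral_PInf_AE) (use g in auto)
 then show s: "AE x in M. summable (\<lambda>i. g i x)"
 proof eventually_elim
  case (elim x)
  then show ?case
   using nonneg by (intro summable_suminf_not_top) auto
 qed
 show "integrable M (\<lambda>x. \<Sum>i. g i x)"
 proof (rule integrable_suminf[OF g])
  show "AE x in M. summable (\<lambda>i. norm (g i x))" using s nonneg by simp
  have "summable (\<lambda>i. integral\<^sup>L M (g i))"
   by (rule summable_comparison_test[OF _ b])
   (use le nonneg in \<open>auto intro!: exI[of _ 0] simp: abs_of_nonneg integral_nonneg_AE\<close>)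
  then show "summable (\<lambda>i. \<integral>x. norm (g i x) \<partial>M)" using nonneg by simp
 qed
qed

text \<open>With p = 2^i, p d \<le> 1 + (p d)^2 gives d \<le> 2^(-i) + 2^i d^2.\<close>

lemma weighted_cauchy_schwarz_suminf:
 fixes d :: "nat \<Rightarrow> real"
 assumes d: "\<And>i. 0 \<le> d i" and s: "summable (\<lambda>i. 2 ^ i * (d i)\<^sup>2)"
 shows "summable d"
proof (rule summable_comparison_test)
 have "d i \<le> (1/2) ^ i + 2 ^ i * (d i)\<^sup>2" for i
 proof -
  define p where "p = (2::real) ^ i"
  have p: "p > 0" "(1/2) ^ i = 1 / p" by (simp_all add: p_def power_one_over)
  have "0 \<le> (p * d i - 1 / 2)\<^sup>2 + 3 / 4" by (simp add: add_nonneg_nonneg)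
  then have "p * d i \<le> 1 + (p * d i)\<^sup>2"
   by (simp add: power2_eq_square algebra_simps)
  then have "d i \<le> (1 + (p * d i)\<^sup>2) / p"
   using p by (simp add: field_simps)
  also have "\<dots> = 1 / p + p * (d i)\<^sup>2"
   using p by (simp add: field_simps power2_eq_square)
  finally show ?thesis by (simp only: p(2) flip: p_def)
 qed
 then show "\<exists>N. \<forall>n\<ge>N. norm (d n) \<le> (1/2) ^ n + 2 ^ n * (d n)\<^sup>2"
  using d by simp
 show "summable (\<lambda>n. (1/2) ^ n + 2 ^ n * (d n)\<^sup>2)"
  by (intro summable_add s summable_geometric) simp
qed

text \<open>The weights 2^i are beaten by the rate 4^(-i), so the weighted squares are summable
  almost everywhere; they in turn make the plain increments summable.\<close>

lemma AE_convergent_of_fast_Cauchy: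
 fixes F :: "nat \<Rightarrow> 'a \<Rightarrow> 'v::banach"
 assumes F: "\<And>i. integrable M (\<lambda>x. (norm (F (Suc i) x - F i x))\<^sup>2)"
  and le: "\<And>i. (\<integral>x. (norm (F (Suc i) x - F i x))\<^sup>2 \<partial>M) \<le> C * (1/4) ^ i"
 shows "AE x in M. convergent (\<lambda>i. F i x)"
proof -
 have "AE x in M. summable (\<lambda>i. 2 ^ i * (norm (F (Suc i) x - F i x))\<^sup>2)"
 proof (rule AE_summable_of_integral_bound(1))
  show "integrable M (\<lambda>x. 2 ^ i * (norm (F (Suc i) x - F i x))\<^sup>2)" for i
   by (intro integrable_mult_right F)
  show "(\<integral>x. 2 ^ i * (norm (F (Suc i) x - F i x))\<^sup>2 \<partial>M) \<le> C * (1/2) ^ i" for i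
  proof -
   have "2 ^ i * (\<integral>x. (norm (F (Suc i) x - F i x))\<^sup>2 \<partial>M) \<le> 2 ^ i * (C * (1/4) ^ i)"
   by (intro mult_left_mono le) simp
   also have "\<dots> = C * (2 * (1/4)) ^ i"
   by (simp only: power_mult_distrib mult.left_commute)
   finally show ?thesis by simp
  qed
  show "summable (\<lambda>i. C * (1/2) ^ i)"
   by (intro summable_mult summable_geometric) simp
 qed simp
 then show ?thesis
 proof eventually_elim
  case (elim x)
  have "summable (\<lambda>i. norm (F (Suc i) x - F i x))"
   by (rule weighted_cauchy_schwarz_suminf) (use elim in auto)
  then have "summable (\<lambda>i. F (Suc i) x - F i x)"
   by (rule summable_norm_cancel)
  then have "convergent (\<lambda>n. \<Sum>i<n. F (Suc i) x - F i x)"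
   by (simp add: summable_iff_convergent)
  then have "convergent (\<lambda>n. F n x - F 0 x)"
   unfolding sum_lessThan_telescope[of "\<lambda>i. F i x"] .
  then have "convergent (\<lambda>n. (F n x - F 0 x) + F 0 x)"
   by (intro convergent_add convergent_const)
  then show ?case by simp
 qed
qed

section \<open>The space L2 and projections in it\<close>

definition sq_integrable :: "'a measure \<Rightarrow> ('a \<Rightarrow> 'v::real_normed_vector) \<Rightarrow> bool" where
 "sq_integrable M f \<longleftrightarrow> f \<in> borel_measurable M \<and> integrable M (\<lambda>x. (norm (f x))\<^sup>2)"

lemma square_integrable_eq: "square_integrable I f \<longleftrightarrow> sq_integrable (lebesgue_on I) f"
 by (simp add: square_integrable_def sq_integrable_def)

lemma sq_integrable_measurable: "sq_integrable M f \<Longrightarrow> f \<in> borel_measurable M"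
 by (simp add: sq_integrable_def)

lemma sq_integrable_add:
 fixes f g :: "'a \<Rightarrow> 'v::{real_inner, second_countable_topology}"
 assumes "sq_integrable M f" "sq_integrable M g"
 shows "sq_integrable M (\<lambda>x. f x + g x)"
 unfolding sq_integrable_def
proof
 show "(\<lambda>x. f x + g x) \<in> borel_measurable M"
  using assms by (intro borel_measurable_add sq_integrable_measurable)
 show "integrable M (\<lambda>x. (norm (f x + g x))\<^sup>2)"
 proof (rule Bochner_Integration.integrable_bound)
  show "integrable M (\<lambda>x. 2 * (norm (f x))\<^sup>2 + 2 * (norm (g x))\<^sup>2)"
   using assms by (auto simp: sq_integrable_def)
  show "(\<lambda>x. (norm (f x + g x))\<^sup>2) \<in> borel_measurable M"
   using assms by (auto simp: sq_integrable_def)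
  show "AE x in M. norm ((norm (f x + g x))\<^sup>2) \<le> norm (2 * (norm (f x))\<^sup>2 + 2 * (norm (g x))\<^sup>2)"
  proof (rule AE_I2)
   fix x
   have "(norm (f x + g x))\<^sup>2 + (norm (f x - g x))\<^sup>2 = 2 * (norm (f x))\<^sup>2 + 2 * (norm (g x))\<^sup>2"
   unfolding power2_norm_eq_inner
   by (simp add: inner_add_left inner_add_right inner_diff_left inner_diff_right)
   then have "(norm (f x + g x))\<^sup>2 \<le> 2 * (norm (f x))\<^sup>2 + 2 * (norm (g x))\<^sup>2"
   using zero_le_power2[of "norm (f x - g x)"] by linarith
   then show "norm ((norm (f x + g x))\<^sup>2) \<le> norm (2 * (norm (f x))\<^sup>2 + 2 * (norm (g x))\<^sup>2)"
   by simp
  qed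
 qed
qed

lemma sq_integrable_scaleC:
 fixes f :: "'a \<Rightarrow> 'v::{complex_hilbert_space, second_countable_topology}"
 assumes "sq_integrable M f"
 shows "sq_integrable M (\<lambda>x. a *\<^sub>C f x)"
proof -
 have "(\<lambda>x. a *\<^sub>C f x) \<in> borel_measurable M"
  by (rule measurable_compose[OF sq_integrable_measurable[OF assms]])
   (intro borel_measurable_continuous_onI linear_continuous_on bounded_linear_scaleC)
 then show ?thesis
  using assms by (simp add: sq_integrable_def norm_scaleC power_mult_distrib)
qed

lemma sq_integrable_scaleR:
 fixes f :: "'a \<Rightarrow> 'v::{complex_hilbert_space, second_countable_topology}"
 shows "sq_integrable M f \<Longrightarrow> sq_integrable M (\<lambda>x. a *\<^sub>R f x)"
 unfolding scaleR_scaleC by (rule sq_integrable_scaleC)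

lemma sq_integrable_diff:
 fixes f g :: "'a \<Rightarrow> 'v::{complex_hilbert_space, second_countable_topology}"
 assumes "sq_integrable M f" "sq_integrable M g"
 shows "sq_integrable M (\<lambda>x. f x - g x)"
 using sq_integrable_add[OF assms(1) sq_integrable_scaleR[OF assms(2), of "-1"]] by simp

lemma measurable_cinner:
 fixes f g :: "'a \<Rightarrow> 'v::{complex_hilbert_space, second_countable_topology}"
 assumes "f \<in> borel_measurable M" "g \<in> borel_measurable M"
 shows "(\<lambda>x. cinner (f x) (g x)) \<in> borel_measurable M"
 by (rule borel_measurable_continuous_Pair[OF assms])
  (intro bounded_bilinear.continuous_on[OF bounded_bilinear_cinner] continuous_intros)

lemma integrable_cinner:
 fixes f g :: "'a \<Rightarrow> 'v::{complex_hilbert_space, second_countable_topology}"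
 assumes f: "sq_integrable M f" and g: "sq_integrable M g"
 shows "integrable M (\<lambda>x. cinner (f x) (g x))"
proof (rule Bochner_Integration.integrable_bound)
 show "integrable M (\<lambda>x. (norm (f x))\<^sup>2 + (norm (g x))\<^sup>2)"
  using f g by (auto simp: sq_integrable_def)
 show "(\<lambda>x. cinner (f x) (g x)) \<in> borel_measurable M"
  using f g by (intro measurable_cinner sq_integrable_measurable)
 show "AE x in M. norm (cinner (f x) (g x)) \<le> norm ((norm (f x))\<^sup>2 + (norm (g x))\<^sup>2)"
 proof (rule AE_I2)
  fix x
  have "0 \<le> (norm (f x) - norm (g x))\<^sup>2 + (norm (f x))\<^sup>2 + (norm (g x))\<^sup>2" by simp
  then have "norm (f x) * norm (g x) \<le> (norm (f x))\<^sup>2 + (norm (g x))\<^sup>2"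
   by (simp add: power2_eq_square algebra_simps)
  with cmod_cinner_le[of "f x" "g x"]
  show "norm (cinner (f x) (g x)) \<le> norm ((norm (f x))\<^sup>2 + (norm (g x))\<^sup>2)"
   by simp
 qed
qed

text \<open>A discriminant estimate with N + 1 in place of N, which avoids dividing by zero. The
  resulting weak form of the Cauchy-Schwarz inequality is used only for limits, where the constant
  is immaterial.\<close>

lemma quadratic_nonneg_discriminant:
 fixes e d N :: real
 assumes "\<And>t. 0 \<le> e + 2 * t * d + t\<^sup>2 * N" and "0 \<le> N"
 shows "d\<^sup>2 \<le> e * (N + 1)"
proof -
 define p where "p = N + 1"
 have p: "p > 0" using assms(2) by (simp add: p_def)
 have "0 \<le> e + 2 * (- d / p) * d + (- d / p)\<^sup>2 * (p - 1)"
  using assms(1)[of "- d / p"] by (simp add: p_def)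
 also have "\<dots> = e - d\<^sup>2 / p - d\<^sup>2 / p\<^sup>2"
  using p by (simp add: field_simps power2_eq_square)
 also have "\<dots> \<le> e - d\<^sup>2 / p" by simp
 finally show ?thesis using p by (simp add: field_simps p_def)
qed

lemma norm_add_scaleR_square:
 "(norm (a + t *\<^sub>R b))\<^sup>2 = (norm a)\<^sup>2 + 2 * t * Re (cinner b a) + t\<^sup>2 * (norm (b::'v::complex_hilbert_space))\<^sup>2"
 unfolding power2_norm_eq_inner
 by (simp add: inner_add_left inner_add_right inner_commute algebra_simps power2_eq_square
   flip: inner_eq_Re_cinner)

definition L2_dist where
 "L2_dist M f g = (\<integral>x. (norm (f x - g x))\<^sup>2 \<partial>M)"

lemma integral_norm_add_scaleR_square:
 fixes f g :: "'a \<Rightarrow> 'v::{complex_hilbert_space, second_countable_topology}"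
 assumes f: "sq_integrable M f" and g: "sq_integrable M g"
 shows "(\<integral>x. (norm (f x + t *\<^sub>R g x))\<^sup>2 \<partial>M) = (\<integral>x. (norm (f x))\<^sup>2 \<partial>M)
  + 2 * t * Re (\<integral>x. cinner (g x) (f x) \<partial>M) + t\<^sup>2 * (\<integral>x. (norm (g x))\<^sup>2 \<partial>M)"
proof -
 have int: "integrable M (\<lambda>x. (norm (f x))\<^sup>2)" "integrable M (\<lambda>x. (norm (g x))\<^sup>2)"
  "integrable M (\<lambda>x. Re (cinner (g x) (f x)))"
  using f g integrable_cinner[OF g f] by (auto simp: sq_integrable_def)
 show ?thesis
  unfolding norm_add_scaleR_square using int integral_Re[OF integrable_cinner[OF g f]]
  by simp
qed

lemma Re_integral_cinner_bound:
 fixes f g :: "'a \<Rightarrow> 'v::{complex_hilbert_space, second_countable_topology}"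
 assumes f: "sq_integrable M f" and g: "sq_integrable M g"
 shows "(Re (\<integral>x. cinner (g x) (f x) \<partial>M))\<^sup>2 \<le> (\<integral>x. (norm (f x))\<^sup>2 \<partial>M) * ((\<integral>x. (norm (g x))\<^sup>2 \<partial>M) + 1)"
proof (rule quadratic_nonneg_discriminant)
 fix t
 show "0 \<le> (\<integral>x. (norm (f x))\<^sup>2 \<partial>M)
  + 2 * t * Re (\<integral>x. cinner (g x) (f x) \<partial>M) + t\<^sup>2 * (\<integral>x. (norm (g x))\<^sup>2 \<partial>M)"
  unfolding integral_norm_add_scaleR_square[OF f g, symmetric] by simp
qed simp

lemma cmod_integral_cinner_bound:
 fixes f g :: "'a \<Rightarrow> 'v::{complex_hilbert_space, second_countable_topology}"
 assumes f: "sq_integrable M f" and g: "sq_integrable M g"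
 shows "(cmod (\<integral>x. cinner (g x) (f x) \<partial>M))\<^sup>2 \<le> (\<integral>x. (norm (f x))\<^sup>2 \<partial>M) * ((\<integral>x. (norm (g x))\<^sup>2 \<partial>M) + 1)"
proof -
 define I where "I = (\<integral>x. cinner (g x) (f x) \<partial>M)"
 define c where "c = (if I = 0 then 1 else cnj I / cmod I)"
 have c: "cmod c = 1" "c * I = cmod I"
  using complex_norm_square[of I]
  by (auto simp: c_def norm_divide power2_eq_square field_simps)
 have "(\<integral>x. cinner (c *\<^sub>C g x) (f x) \<partial>M) = c * I"
  using integrable_cinner[OF g f] by (simp add: I_def cinner_scaleC_left)
 then show ?thesis
  using Re_integral_cinner_bound[OF f sq_integrable_scaleC[OF g, of c]] c
  by (simp add: norm_scaleC flip: I_def)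
qed

lemma L2_converges_cinner:
 fixes f :: "'a \<Rightarrow> 'v::{complex_hilbert_space, second_countable_topology}"
 assumes F: "\<And>n. sq_integrable M (F n)" and f: "sq_integrable M f" and g: "sq_integrable M g"
  and lim: "(\<lambda>n. L2_dist M (F n) f) \<longlonglongrightarrow> 0"
 shows "(\<lambda>n. \<integral>x. cinner (F n x) (g x) \<partial>M) \<longlonglongrightarrow> (\<integral>x. cinner (f x) (g x) \<partial>M)"
  and "(\<lambda>n. \<integral>x. cinner (g x) (F n x) \<partial>M) \<longlonglongrightarrow> (\<integral>x. cinner (g x) (f x) \<partial>M)"
proof -
 define N where "N = (\<integral>x. (norm (g x))\<^sup>2 \<partial>M) + 1"
 have sq: "sq_integrable M (\<lambda>x. F n x - f x)" for n
  by (rule sq_integrable_diff[OF F f])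
 have "(\<lambda>n. sqrt (L2_dist M (F n) f * N)) \<longlonglongrightarrow> sqrt (0 * N)"
  by (intro tendsto_intros lim)
 then have z: "(\<lambda>n. sqrt (L2_dist M (F n) f * N)) \<longlonglongrightarrow> 0" by simp
 have "(\<lambda>n. (\<integral>x. cinner (g x) (F n x) \<partial>M) - (\<integral>x. cinner (g x) (f x) \<partial>M)) \<longlonglongrightarrow> 0"
 proof (rule Lim_null_comparison[OF _ z], rule always_eventually, rule allI)
  fix n
  have "(\<integral>x. cinner (g x) (F n x) \<partial>M) - (\<integral>x. cinner (g x) (f x) \<partial>M) = (\<integral>x. cinner (g x) (F n x - f x) \<partial>M)"
   using integrable_cinner[OF g F] integrable_cinner[OF g f] by (simp add: cinner_diff_right)
  then show "norm ((\<integral>x. cinner (g x) (F n x) \<partial>M) - (\<integral>x. cinner (g x) (f x) \<partial>M)) \<le> sqrt (L2_dist M (F n) f * N)"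
   using real_le_rsqrt[OF cmod_integral_cinner_bound[OF sq g, of n]] by (simp add: N_def L2_dist_def)
 qed
 then show 1: "(\<lambda>n. \<integral>x. cinner (g x) (F n x) \<partial>M) \<longlonglongrightarrow> (\<integral>x. cinner (g x) (f x) \<partial>M)"
  by (simp add: LIM_zero_iff)
 have cnj: "cnj (\<integral>x. cinner (g x) (h x) \<partial>M) = (\<integral>x. cinner (h x) (g x) \<partial>M)" for h
 proof -
  have "(\<integral>x. cinner (h x) (g x) \<partial>M) = (\<integral>x. cnj (cinner (g x) (h x)) \<partial>M)"
   by (rule Bochner_Integration.integral_cong[OF refl]) (rule cinner_commute)
  then show ?thesis by simp
 qed
 have "(\<lambda>n. cnj (\<integral>x. cinner (g x) (F n x) \<partial>M)) \<longlonglongrightarrow> cnj (\<integral>x. cinner (g x) (f x) \<partial>M)"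
  by (rule tendsto_cnj[OF 1])
 then show "(\<lambda>n. \<integral>x. cinner (F n x) (g x) \<partial>M) \<longlonglongrightarrow> (\<integral>x. cinner (f x) (g x) \<partial>M)"
  unfolding cnj .
qed

text \<open>A fast subsequence converges almost everywhere, and Fatou's lemma along it bounds the
  distance of every late term to the pointwise limit.\<close>

lemma L2_complete:
 fixes F :: "nat \<Rightarrow> 'a \<Rightarrow> 'v::{complex_hilbert_space, second_countable_topology}"
 assumes F: "\<And>n. sq_integrable M (F n)"
  and Cauchy: "\<And>e. 0 < e \<Longrightarrow> \<exists>N. \<forall>m\<ge>N. \<forall>n\<ge>N. L2_dist M (F m) (F n) \<le> e"
 shows "\<exists>f. sq_integrable M f \<and> (\<lambda>n. L2_dist M (F n) f) \<longlonglongrightarrow> 0"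
proof -
 have "\<exists>N. \<forall>m\<ge>N. \<forall>n\<ge>N. L2_dist M (F m) (F n) \<le> (1/4) ^ i" for i
  by (rule Cauchy) simp
 then have "\<forall>i. \<exists>N. \<forall>m\<ge>N. \<forall>n\<ge>N. L2_dist M (F m) (F n) \<le> (1/4) ^ i" by blast
 from choice[OF this] obtain N where N: "\<And>i m n. N i \<le> m \<Longrightarrow> N i \<le> n \<Longrightarrow> L2_dist M (F m) (F n) \<le> (1/4) ^ i"
  by blast
 \<comment> \<open>Partial sums, so that the chosen indices are monotone and still dominate the
   thresholds \<open>N i\<close>.\<close>
 define r where "r i = (\<Sum>j\<le>i. N j)" for i
 have Nr: "N i \<le> r i" "r i \<le> r (Suc i)" for i
  unfolding r_def by (auto intro: member_le_sum)
 define G where "G i = F (r i)" for i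
 have G: "sq_integrable M (G i)" for i by (simp add: G_def F)
 have int: "integrable M (\<lambda>x. (norm (G i x - G j x))\<^sup>2)" for i j
  using sq_integrable_diff[OF G G] by (simp add: sq_integrable_def)
 have "AE x in M. convergent (\<lambda>i. G i x)"
 proof (rule AE_convergent_of_fast_Cauchy[OF int])
  fix i
  have "L2_dist M (G (Suc i)) (G i) \<le> (1/4) ^ i"
   unfolding G_def by (rule N) (use Nr[of i] in auto)
  then show "(\<integral>x. (norm (G (Suc i) x - G i x))\<^sup>2 \<partial>M) \<le> 1 * (1/4) ^ i"
   by (simp add: L2_dist_def)
 qed
 then have conv: "AE x in M. (\<lambda>i. G i x) \<longlonglongrightarrow> lim (\<lambda>i. G i x)"
  by (simp add: convergent_LIMSEQ_iff)
 define f where "f x = lim (\<lambda>i. G i x)" for x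
 have fm: "f \<in> borel_measurable M"
  unfolding f_def by (rule borel_measurable_lim_metric) (use G sq_integrable_measurable in blast)
 have fatou: "integrable M (\<lambda>x. (norm (F n x - f x))\<^sup>2) \<and> L2_dist M (F n) f \<le> (1/4) ^ i"
  if n: "N i \<le> n" for i n
 proof -
  have nn: "(\<integral>\<^sup>+x. ennreal ((norm (F n x - f x))\<^sup>2) \<partial>M) \<le> ennreal ((1/4) ^ i)"
  proof -
   have "(\<integral>\<^sup>+x. ennreal ((norm (F n x - f x))\<^sup>2) \<partial>M) =
   (\<integral>\<^sup>+x. liminf (\<lambda>j. ennreal ((norm (F n x - G j x))\<^sup>2)) \<partial>M)"
   proof (rule nn_integral_cong_AE)
   show "AE x in M. ennreal ((norm (F n x - f x))\<^sup>2) = liminf (\<lambda>j. ennreal ((norm (F n x - G j x))\<^sup>2))"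
   using conv
   proof eventually_elim
   case (elim x)
   then have "(\<lambda>j. ennreal ((norm (F n x - G j x))\<^sup>2)) \<longlonglongrightarrow> ennreal ((norm (F n x - f x))\<^sup>2)"
   unfolding f_def by (intro tendsto_intros)
   then show ?case using lim_imp_Liminf trivial_limit_sequentially by metis
   qed
   qed
   also have "\<dots> \<le> liminf (\<lambda>j. \<integral>\<^sup>+x. ennreal ((norm (F n x - G j x))\<^sup>2) \<partial>M)"
   proof (rule nn_integral_liminf)
   show "(\<lambda>x. ennreal ((norm (F n x - G j x))\<^sup>2)) \<in> borel_measurable M" for j
   proof -
   have "integrable M (\<lambda>x. (norm (F n x - G j x))\<^sup>2)"
   using sq_integrable_diff[OF F G, of n j] by (simp add: sq_integrable_def)
   then show ?thesis
   by (rule measurable_compose[OF borel_measurable_integrable measurable_ennreal])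
   qed
   qed
   also have "\<dots> \<le> ennreal ((1/4) ^ i)"
   proof (rule Liminf_le)
   show "\<forall>\<^sub>F j in sequentially. (\<integral>\<^sup>+x. ennreal ((norm (F n x - G j x))\<^sup>2) \<partial>M) \<le> ennreal ((1/4) ^ i)"
   using eventually_ge_at_top[of i]
   proof eventually_elim
   case (elim j)
   have "r i \<le> r j" using elim lift_Suc_mono_le[of r i j] Nr(2) by blast
   then have "N i \<le> r j" using Nr(1)[of i] by linarith
   then have "L2_dist M (F n) (G j) \<le> (1/4) ^ i"
   unfolding G_def by (intro N n)
   moreover have "integrable M (\<lambda>x. (norm (F n x - G j x))\<^sup>2)"
   using sq_integrable_diff[OF F G, of n j] by (simp add: sq_integrable_def)
   ultimately show ?case
   by (subst nn_integral_eq_integral) (auto simp: L2_dist_def intro: ennreal_leI)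
   qed
   qed simp
   finally show ?thesis .
  qed
  have m: "(\<lambda>x. (norm (F n x - f x))\<^sup>2) \<in> borel_measurable M"
   using fm sq_integrable_measurable[OF F[of n]] by measurable
  have "integrable M (\<lambda>x. (norm (F n x - f x))\<^sup>2)"
   by (rule integrableI_nonneg[OF m]) (use nn in \<open>auto intro: le_less_trans\<close>)
  moreover from this nn have "L2_dist M (F n) f \<le> (1/4) ^ i"
   unfolding L2_dist_def by (subst (asm) nn_integral_eq_integral) auto
  ultimately show ?thesis by blast
 qed
 have "sq_integrable M (\<lambda>x. F (N 0) x - f x)"
  using fatou[of 0 "N 0"] fm sq_integrable_measurable[OF F[of "N 0"]] by (simp add: sq_integrable_def)
 from sq_integrable_diff[OF F this, of "N 0"] have "sq_integrable M f" by simp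
 moreover have "(\<lambda>n. L2_dist M (F n) f) \<longlonglongrightarrow> 0"
 proof (rule LIMSEQ_I)
  fix e :: real assume "0 < e"
  then obtain i where i: "(1/4) ^ i < e"
   using real_arch_pow_inv[of e "1/4"] by auto
  show "\<exists>no. \<forall>n\<ge>no. norm (L2_dist M (F n) f - 0) < e"
  proof (intro exI allI impI)
   fix n assume "N i \<le> n"
   then have "L2_dist M (F n) f \<le> (1/4) ^ i" using fatou by blast
   moreover have "0 \<le> L2_dist M (F n) f" by (simp add: L2_dist_def)
   ultimately show "norm (L2_dist M (F n) f - 0) < e" using i by simp
  qed
 qed
 ultimately show ?thesis by blast
qed

text \<open>The orthogonal projection of \<open>f\<close> along the closure of a subspace \<open>S\<close>, as the limit of a
 minimising sequence.\<close>

lemma L2_projection: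
 fixes S :: "('a \<Rightarrow> 'v::{complex_hilbert_space, second_countable_topology}) set"
 assumes S: "\<And>g. g \<in> S \<Longrightarrow> sq_integrable M g" and S0: "(\<lambda>x. 0) \<in> S"
  and add: "\<And>g h. g \<in> S \<Longrightarrow> h \<in> S \<Longrightarrow> (\<lambda>x. g x + h x) \<in> S"
  and scale: "\<And>a g. g \<in> S \<Longrightarrow> (\<lambda>x. a *\<^sub>C g x) \<in> S"
  and f: "sq_integrable M f"
 shows "\<exists>k g. (\<forall>n::nat. k n \<in> S) \<and> sq_integrable M g \<and>
  (\<lambda>n. L2_dist M (\<lambda>x. f x + k n x) g) \<longlonglongrightarrow> 0 \<and> (\<forall>h\<in>S. (\<integral>x. cinner (h x) (g x) \<partial>M) = 0)"
proof -
 define J where "J k = (\<integral>x. (norm (f x + k x))\<^sup>2 \<partial>M)" for k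
 define m where "m = Inf (J ` S)"
 have bdd: "bdd_below (J ` S)"
  by (rule bdd_belowI[of _ 0]) (auto simp: J_def)
 have m_le: "m \<le> J k" if "k \<in> S" for k
  unfolding m_def by (rule cInf_lower[OF _ bdd]) (use that in auto)
 have "\<exists>k\<in>S. J k < m + 1 / (real n + 1)" for n
  using cInf_lessD[of "J ` S" "m + 1 / (real n + 1)"] S0 by (auto simp: m_def)
 then have "\<forall>n. \<exists>k. k \<in> S \<and> J k < m + 1 / (real n + 1)" by blast
 from choice[OF this] obtain k where kS: "\<And>n. k n \<in> S" and k: "\<And>n. J (k n) < m + 1 / (real n + 1)"
  by blast
 have F: "sq_integrable M (\<lambda>x. f x + h x)" if "h \<in> S" for h
  by (intro sq_integrable_add f S that)
 have scaleR: "(\<lambda>x. a *\<^sub>R g x) \<in> S" if "g \<in> S" for a g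
  unfolding scaleR_scaleC by (rule scale[OF that])
 have dist: "L2_dist M (\<lambda>x. f x + k i x) (\<lambda>x. f x + k j x) \<le> 2 / (real i + 1) + 2 / (real j + 1)" for i j
 proof -
  define mid where "mid x = (1/2) *\<^sub>R (k i x + k j x)" for x
  have mid: "mid \<in> S" unfolding mid_def by (intro scaleR add kS)
  have int: "integrable M (\<lambda>x. (norm (f x + h x))\<^sup>2)" if "h \<in> S" for h
   using F[OF that] by (simp add: sq_integrable_def)
  have "(norm ((f x + k i x) - (f x + k j x)))\<^sup>2 =
   2 * (norm (f x + k i x))\<^sup>2 + 2 * (norm (f x + k j x))\<^sup>2 - 4 * (norm (f x + mid x))\<^sup>2" for x
  proof -
   have "(1/2) *\<^sub>R ((f x + k i x) + (f x + k j x)) = f x + mid x"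
   by (simp add: mid_def scaleR_add_right algebra_simps flip: scaleR_add_left)
   with parallelogram_mid[of "f x + k i x" "f x + k j x"] show ?thesis by simp
  qed
  then have "L2_dist M (\<lambda>x. f x + k i x) (\<lambda>x. f x + k j x) = 2 * J (k i) + 2 * J (k j) - 4 * J mid"
   unfolding L2_dist_def J_def by (simp add: int kS mid)
  with k[of i] k[of j] m_le[OF mid] show ?thesis by simp
 qed
 have "\<exists>g. sq_integrable M g \<and> (\<lambda>n. L2_dist M (\<lambda>x. f x + k n x) g) \<longlonglongrightarrow> 0"
 proof (rule L2_complete[OF F[OF kS]])
  fix e :: real assume e: "0 < e"
  obtain N where "4 / e < real N"
   using reals_Archimedean2 by blast
  then have "4 / e < real N + 1" by linarith
  then have N: "4 / (real N + 1) < e"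
   using e by (simp add: divide_less_eq mult.commute)
  show "\<exists>N. \<forall>i\<ge>N. \<forall>j\<ge>N. L2_dist M (\<lambda>x. f x + k i x) (\<lambda>x. f x + k j x) \<le> e"
  proof (intro exI allI impI)
   fix i j
   assume "N \<le> i" "N \<le> j"
   then have "2 / (real i + 1) \<le> 2 / (real N + 1)" "2 / (real j + 1) \<le> 2 / (real N + 1)"
   by (auto intro!: divide_left_mono)
   with dist[of i j] N show "L2_dist M (\<lambda>x. f x + k i x) (\<lambda>x. f x + k j x) \<le> e" by simp
  qed
 qed
 then obtain g where g: "sq_integrable M g" "(\<lambda>n. L2_dist M (\<lambda>x. f x + k n x) g) \<longlonglongrightarrow> 0"
  by blast
 have Re0: "Re (\<integral>x. cinner (h x) (g x) \<partial>M) = 0" if h: "h \<in> S" for h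
 proof -
  define N where "N = (\<integral>x. (norm (h x))\<^sup>2 \<partial>M)"
  have N: "0 \<le> N" by (simp add: N_def)
  define d where "d n = Re (\<integral>x. cinner (h x) (f x + k n x) \<partial>M)" for n
  \<comment> \<open>\<open>k n\<close> misses the infimum by less than 1 / (n + 1), so the quadratic
    polynomial describing a move in direction \<open>h\<close>, measured from the infimum, is
    nonnegative and its linear coefficient small.\<close>
  have dn: "(d n)\<^sup>2 \<le> (1 / (real n + 1)) * (N + 1)" for n
  proof (rule quadratic_nonneg_discriminant[OF _ N])
   fix t
   have "(\<lambda>x. k n x + t *\<^sub>R h x) \<in> S" by (intro add scaleR h kS)
   then have "m \<le> (\<integral>x. (norm (f x + (k n x + t *\<^sub>R h x)))\<^sup>2 \<partial>M)"
   using m_le by (simp add: J_def)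
   also have "\<dots> = J (k n) + 2 * t * d n + t\<^sup>2 * N"
   using integral_norm_add_scaleR_square[OF F[OF kS[of n]] S[OF h], of t]
   by (simp add: J_def d_def N_def add.assoc)
   finally show "0 \<le> 1 / (real n + 1) + 2 * t * d n + t\<^sup>2 * N"
   using k[of n] by linarith
  qed
  have "(\<lambda>n. (1 / (real n + 1)) * (N + 1)) \<longlonglongrightarrow> 0 * (N + 1)"
   using LIMSEQ_inverse_real_of_nat
   by (intro tendsto_intros) (simp add: inverse_eq_divide add.commute)
  then have lim0: "(\<lambda>n. (1 / (real n + 1)) * (N + 1)) \<longlonglongrightarrow> 0"
   by (simp only: mult_zero_left)
  have "(\<lambda>n. (d n)\<^sup>2) \<longlonglongrightarrow> 0"
   by (rule Lim_null_comparison[OF _ lim0], rule always_eventually)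
   (simp only: real_norm_def abs_power2 dn simp_thms)
  moreover have "d \<longlonglongrightarrow> Re (\<integral>x. cinner (h x) (g x) \<partial>M)"
   unfolding d_def
   by (intro tendsto_Re L2_converges_cinner(2)[OF F[OF kS] g(1) S[OF h] g(2)])
  then have "(\<lambda>n. (d n)\<^sup>2) \<longlonglongrightarrow> (Re (\<integral>x. cinner (h x) (g x) \<partial>M))\<^sup>2"
   by (intro tendsto_intros)
  ultimately have "(Re (\<integral>x. cinner (h x) (g x) \<partial>M))\<^sup>2 = 0"
   by (rule LIMSEQ_unique[symmetric])
  then show ?thesis by simp
 qed
 have "(\<integral>x. cinner (h x) (g x) \<partial>M) = 0" if h: "h \<in> S" for h
 proof (rule complex_eqI)
  have "(\<integral>x. cinner (\<i> *\<^sub>C h x) (g x) \<partial>M) = \<i> * (\<integral>x. cinner (h x) (g x) \<partial>M)"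
   using integrable_cinner[OF S[OF h] g(1)] by (simp add: cinner_scaleC_left)
  with Re0[OF scale[OF h, of \<i>]] show "Im (\<integral>x. cinner (h x) (g x) \<partial>M) = Im 0" by simp
 qed (use Re0[OF h] in simp)
 with kS g show ?thesis by blast
qed

section \<open>Absolutely continuous functions\<close>

subsection \<open>Lebesgue's differentiation theorem\<close>

text \<open>Only the upper estimate is kept: it is applied to the distance of a vector function from
  a constant vector, whose means need to be small.\<close>

lemma lebesgue_differentiation_right:
 fixes \<phi> :: "real \<Rightarrow> real"
 assumes "\<And>a b. \<phi> integrable_on {a..b}"
 shows "\<exists>N. negligible N \<and>
  (\<forall>x e. x \<notin> N \<longrightarrow> 0 < e \<longrightarrow> (\<exists>d>0. \<forall>h. 0 < h \<longrightarrow> h < d \<longrightarrow> integral {x..x + h} \<phi> \<le> h * (\<phi> x + e)))"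
proof -
 obtain N where N: "negligible N" and lim: "\<And>x e. x \<notin> N \<Longrightarrow> 0 < e \<Longrightarrow>
  \<exists>d>0. \<forall>h. 0 < h \<and> h < d \<longrightarrow> norm (integral (cbox x (x + h *\<^sub>R One)) \<phi> /\<^sub>R h ^ DIM(real) - \<phi> x) < e"
  using integrable_ccontinuous_explicit[of \<phi>] assms by (metis box_real(2))
 have "\<exists>d>0. \<forall>h. 0 < h \<longrightarrow> h < d \<longrightarrow> integral {x..x + h} \<phi> \<le> h * (\<phi> x + e)" if xe: "x \<notin> N" "0 < e" for x e
 proof -
  obtain d where d: "d > 0" "\<And>h. 0 < h \<Longrightarrow> h < d \<Longrightarrow>
   norm (integral (cbox x (x + h *\<^sub>R One)) \<phi> /\<^sub>R h ^ DIM(real) - \<phi> x) < e"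
   using lim[OF xe] by blast
  have "integral {x..x + h} \<phi> \<le> h * (\<phi> x + e)" if h: "0 < h" "h < d" for h
  proof -
   have "\<bar>integral {x..x + h} \<phi> / h - \<phi> x\<bar> < e"
   using d(2)[OF h] by (simp add: divide_inverse mult.commute)
   then have "integral {x..x + h} \<phi> / h \<le> \<phi> x + e" by linarith
   then show ?thesis using h by (simp add: divide_le_eq mult.commute)
  qed
  then show ?thesis using d(1) by blast
 qed
 with N show ?thesis by blast
qed

lemma lebesgue_differentiation_left:
 fixes \<phi> :: "real \<Rightarrow> real"
 assumes int: "\<And>a b. \<phi> integrable_on {a..b}"
 shows "\<exists>N. negligible N \<and>
  (\<forall>x e. x \<notin> N \<longrightarrow> 0 < e \<longrightarrow> (\<exists>d>0. \<forall>h. 0 < h \<longrightarrow> h < d \<longrightarrow> integral {x - h..x} \<phi> \<le> h * (\<phi> x + e)))"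
proof -
 have "(\<lambda>x. \<phi> (- x)) integrable_on {a..b}" for a b
  using int[of "- b" "- a"] Henstock_Kurzweil_Integration.integrable_reflect_real[where f = \<phi> and a = "- b" and b = "- a"] by (simp only: minus_minus)
 from lebesgue_differentiation_right[OF this] obtain N where N: "negligible N"
  and lim: "\<And>x e. x \<notin> N \<Longrightarrow> 0 < e \<Longrightarrow>
   \<exists>d>0. \<forall>h. 0 < h \<longrightarrow> h < d \<longrightarrow> integral {x..x + h} (\<lambda>x. \<phi> (- x)) \<le> h * (\<phi> (- x) + e)"
  by blast
 have "negligible (uminus ` N)"
  by (rule negligible_differentiable_image_negligible[OF _ N])
   (auto simp: differentiable_on_def intro!: derivative_intros)
 moreover have "\<exists>d>0. \<forall>h. 0 < h \<longrightarrow> h < d \<longrightarrow> integral {x - h..x} \<phi> \<le> h * (\<phi> x + e)"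
  if x: "x \<notin> uminus ` N" and e: "0 < e" for x e
 proof -
  have "- x \<notin> N" using x by (metis image_eqI minus_minus)
  have refl: "integral {- x..- x + h} (\<lambda>s. \<phi> (- s)) = integral {x - h..x} \<phi>" for h
   using Henstock_Kurzweil_Integration.integral_reflect_real[where f = \<phi> and a = "x - h" and b = x]
   by simp
  from lim[OF \<open>- x \<notin> N\<close> e] show ?thesis
   unfolding refl minus_minus .
 qed
 ultimately show ?thesis by blast
qed

definition primitive :: "(real \<Rightarrow> 'v::{banach, second_countable_topology}) \<Rightarrow> real \<Rightarrow> 'v" where
 "primitive h t = (\<integral>s. indicator {0..<t} s *\<^sub>R h s \<partial>lebesgue)"

lemma integrable_indicator_Icc_scaleR:
 "integrable lebesgue (\<lambda>s. indicator {a..b::real} s *\<^sub>R (e :: 'v::{banach, second_countable_topology}))"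
 by (rule integrable_scaleR_left, rule integrable_real_indicator) (auto simp: emeasure_lborel_Icc_eq)

text \<open>The detour over a constant \<open>e\<close> allows \<open>e\<close> to be taken later
  from a countable dense set while \<open>w\<close> is the value of \<open>h\<close> at the
  point.\<close>

lemma primitive_increment_bound:
 fixes h :: "real \<Rightarrow> 'v::{banach, second_countable_topology}"
 assumes h: "integrable lebesgue h" and xy: "0 \<le> x" "x \<le> y"
 shows "norm (primitive h y - primitive h x - (y - x) *\<^sub>R w) \<le>
  integral {x..y} (\<lambda>s. norm (h s - e)) + (y - x) * norm (e - w)"
proof -
 have ind: "integrable lebesgue (\<lambda>s. indicator {a..<b} s *\<^sub>R v)" "(\<integral>s. indicator {a..<b} s *\<^sub>R v \<partial>lebesgue) = (b - a) *\<^sub>R v"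
  if "a \<le> b" for a b :: real and v :: "'w::{banach, second_countable_topology}"
 proof -
  have "has_bochner_integral lebesgue (\<lambda>s. indicator {a..<b} s *\<^sub>R v) (measure lebesgue {a..<b} *\<^sub>R v)"
   by (rule has_bochner_integral_scaleR_left, rule has_bochner_integral_real_indicator)
   (use that in auto)
  then show "integrable lebesgue (\<lambda>s. indicator {a..<b} s *\<^sub>R v)" "(\<integral>s. indicator {a..<b} s *\<^sub>R v \<partial>lebesgue) = (b - a) *\<^sub>R v"
   using that by (auto simp: has_bochner_integral_iff)
 qed
 have hi: "integrable lebesgue (\<lambda>s. indicator S s *\<^sub>R h s)" if "S \<in> sets lebesgue" for S
  by (rule integrable_mult_indicator[OF that h])
 have "primitive h y - primitive h x - (y - x) *\<^sub>R w =
  (\<integral>s. indicator {x..<y} s *\<^sub>R h s - indicator {x..<y} s *\<^sub>R w \<partial>lebesgue)"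
 proof -
  have "(\<integral>s. indicator {0..<y} s *\<^sub>R h s - indicator {0..<x} s *\<^sub>R h s \<partial>lebesgue) = (\<integral>s. indicator {x..<y} s *\<^sub>R h s \<partial>lebesgue)"
   using xy by (intro Bochner_Integration.integral_cong refl) (auto simp: indicator_def)
  then have "primitive h y - primitive h x = (\<integral>s. indicator {x..<y} s *\<^sub>R h s \<partial>lebesgue)"
   unfolding primitive_def by (simp add: hi)
  then show ?thesis using xy by (simp add: hi ind)
 qed
 also have "norm \<dots> \<le> (\<integral>s. indicator {x..y} s *\<^sub>R norm (h s - e) + indicator {x..<y} s *\<^sub>R norm (e - w) \<partial>lebesgue)"
 proof (rule order_trans[OF integral_norm_bound], rule integral_mono_AE)
  show "integrable lebesgue (\<lambda>s. norm (indicator {x..<y} s *\<^sub>R h s - indicator {x..<y} s *\<^sub>R w))"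
   using xy by (intro integrable_norm Bochner_Integration.integrable_diff hi ind) auto
  have "integrable lebesgue (\<lambda>s. norm (indicator {x..y} s *\<^sub>R h s - indicator {x..y} s *\<^sub>R e))"
   by (intro integrable_norm Bochner_Integration.integrable_diff hi integrable_indicator_Icc_scaleR) auto
  also have "(\<lambda>s. norm (indicator {x..y} s *\<^sub>R h s - indicator {x..y} s *\<^sub>R e)) = (\<lambda>s. indicator {x..y} s *\<^sub>R norm (h s - e))"
   by (auto simp: indicator_def)
  finally show "integrable lebesgue (\<lambda>s. indicator {x..y} s *\<^sub>R norm (h s - e) + indicator {x..<y} s *\<^sub>R norm (e - w))"
   using xy by (intro Bochner_Integration.integrable_add ind)
  show "AE s in lebesgue. norm (indicator {x..<y} s *\<^sub>R h s - indicator {x..<y} s *\<^sub>R w) \<le>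
   indicator {x..y} s *\<^sub>R norm (h s - e) + indicator {x..<y} s *\<^sub>R norm (e - w)"
   using norm_triangle_ineq[of "h s - e" "e - w" for s] by (intro AE_I2) (auto simp: indicator_def)
 qed
 also have "\<dots> = integral {x..y} (\<lambda>s. norm (h s - e)) + (y - x) * norm (e - w)"
 proof -
  have "integrable lebesgue (\<lambda>s. norm (indicator {x..y} s *\<^sub>R h s - indicator {x..y} s *\<^sub>R e))"
   by (intro integrable_norm Bochner_Integration.integrable_diff hi integrable_indicator_Icc_scaleR) auto
  also have "(\<lambda>s. norm (indicator {x..y} s *\<^sub>R h s - indicator {x..y} s *\<^sub>R e)) = (\<lambda>s. indicator {x..y} s *\<^sub>R norm (h s - e))"
   by (auto simp: indicator_def)
  finally have i: "integrable lebesgue (\<lambda>s. indicator {x..y} s *\<^sub>R norm (h s - e))" .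
  then have eq: "(\<integral>s. indicator {x..y} s *\<^sub>R norm (h s - e) + indicator {x..<y} s *\<^sub>R norm (e - w) \<partial>lebesgue) =
   (\<integral>s. indicator {x..y} s *\<^sub>R norm (h s - e) \<partial>lebesgue) + (y - x) * norm (e - w)"
   using i ind[OF xy(2), of "norm (e - w)"] by (subst Bochner_Integration.integral_add) auto
  have "integrable (lebesgue_on {x..y}) (\<lambda>s. norm (h s - e))"
   using i by (simp add: integrable_restrict_space)
  then have "integral {x..y} (\<lambda>s. norm (h s - e)) = (\<integral>s. norm (h s - e) \<partial>(lebesgue_on {x..y}))"
   by (simp add: lebesgue_integral_eq_integral)
  also have "\<dots> = (\<integral>s. indicator {x..y} s *\<^sub>R norm (h s - e) \<partial>lebesgue)"
   by (simp add: integral_restrict_space)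
  finally show ?thesis unfolding eq by (simp only:)
 qed
 finally show ?thesis .
qed

text \<open>The scalar differentiation theorem is applied to the distances of \<open>h\<close> from
  countably many vectors \<open>e\<close>; the union of the exceptional sets is still null, and near
  any other point \<open>h\<close> is approximated by such an \<open>e\<close>.\<close>

lemma primitive_has_vector_derivative:
 fixes h :: "real \<Rightarrow> 'v::{banach, second_countable_topology}"
 assumes h: "integrable lebesgue h"
 shows "\<exists>N. negligible N \<and> (\<forall>x. 0 < x \<longrightarrow> x \<notin> N \<longrightarrow> (primitive h has_vector_derivative h x) (at x))"
proof -
 obtain D :: "'v set" where D: "countable D" "\<And>X. open X \<Longrightarrow> X \<noteq> {} \<Longrightarrow> \<exists>d\<in>D. d \<in> X"
  using countable_dense_exists by blast
 define \<phi> where "\<phi> e s = norm (h s - e)" for e s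
 have int: "\<phi> e integrable_on {a..b}" for e a b
 proof -
  have "integrable lebesgue (\<lambda>s. norm (indicator {a..b} s *\<^sub>R h s - indicator {a..b} s *\<^sub>R e))"
   by (intro integrable_norm Bochner_Integration.integrable_diff integrable_indicator_Icc_scaleR
   integrable_mult_indicator[OF _ h]) auto
  also have "(\<lambda>s. norm (indicator {a..b} s *\<^sub>R h s - indicator {a..b} s *\<^sub>R e)) = (\<lambda>s. indicator {a..b} s *\<^sub>R \<phi> e s)"
   by (auto simp: indicator_def \<phi>_def)
  finally have "integrable (lebesgue_on {a..b}) (\<phi> e)"
   by (simp add: integrable_restrict_space)
  then show ?thesis by (rule integrable_on_lebesgue_on) simp
 qed
 have "\<forall>e. \<exists>N. negligible N \<and>
  (\<forall>x r. x \<notin> N \<longrightarrow> 0 < r \<longrightarrow> (\<exists>d>0. \<forall>l. 0 < l \<longrightarrow> l < d \<longrightarrow> integral {x..x + l} (\<phi> e) \<le> l * (\<phi> e x + r)))"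
  using lebesgue_differentiation_right[OF int] by blast
 from choice[OF this] obtain N1 where N1: "\<And>e. negligible (N1 e)" and lim1: "\<And>e x r. x \<notin> N1 e \<Longrightarrow> 0 < r \<Longrightarrow>
   \<exists>d>0. \<forall>l. 0 < l \<longrightarrow> l < d \<longrightarrow> integral {x..x + l} (\<phi> e) \<le> l * (\<phi> e x + r)"
  by blast
 have "\<forall>e. \<exists>N. negligible N \<and>
  (\<forall>x r. x \<notin> N \<longrightarrow> 0 < r \<longrightarrow> (\<exists>d>0. \<forall>l. 0 < l \<longrightarrow> l < d \<longrightarrow> integral {x - l..x} (\<phi> e) \<le> l * (\<phi> e x + r)))"
  using lebesgue_differentiation_left[OF int] by blast
 from choice[OF this] obtain N2 where N2: "\<And>e. negligible (N2 e)" and lim2: "\<And>e x r. x \<notin> N2 e \<Longrightarrow> 0 < r \<Longrightarrow>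
   \<exists>d>0. \<forall>l. 0 < l \<longrightarrow> l < d \<longrightarrow> integral {x - l..x} (\<phi> e) \<le> l * (\<phi> e x + r)"
  by blast
 define N where "N = (\<Union>e\<in>D. N1 e \<union> N2 e)"
 have "negligible N"
  unfolding N_def by (rule negligible_countable_Union) (use D N1 N2 in auto)
 moreover have "(primitive h has_vector_derivative h x) (at x)" if x: "0 < x" "x \<notin> N" for x
  unfolding has_vector_derivative_def has_derivative_within_alt
 proof (intro conjI allI impI)
  show "bounded_linear (\<lambda>t. t *\<^sub>R h x)" by (rule bounded_linear_scaleR_left)
  fix r :: real assume r: "0 < r"
  \<comment> \<open>Three thirds of \<open>r\<close>: the distance of \<open>h x\<close> from
    \<open>e\<close> enters twice, and the error in the mean value once.\<close>
  obtain e where e: "e \<in> D" "e \<in> ball (h x) (r / 3)"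
   using D(2)[of "ball (h x) (r / 3)"] r by auto
  have xN: "x \<notin> N1 e" "x \<notin> N2 e" using x e(1) by (auto simp: N_def)
  have he: "\<phi> e x < r / 3" "norm (e - h x) < r / 3"
   using e(2) by (auto simp: \<phi>_def dist_norm norm_minus_commute)
  obtain d1 where d1: "d1 > 0" "\<And>l. 0 < l \<Longrightarrow> l < d1 \<Longrightarrow> integral {x..x + l} (\<phi> e) \<le> l * (\<phi> e x + r / 3)"
   using lim1[OF xN(1), of "r / 3"] r by auto
  obtain d2 where d2: "d2 > 0" "\<And>l. 0 < l \<Longrightarrow> l < d2 \<Longrightarrow> integral {x - l..x} (\<phi> e) \<le> l * (\<phi> e x + r / 3)"
   using lim2[OF xN(2), of "r / 3"] r by auto
  have bound: "l * (\<phi> e x + r / 3) + l * norm (e - h x) \<le> r * l" if "0 < l" for l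
  proof -
   have "l * (\<phi> e x + r / 3 + norm (e - h x)) \<le> l * r"
   using that he by (intro mult_left_mono) auto
   then show ?thesis by (simp add: algebra_simps)
  qed
  show "\<exists>d>0. \<forall>y\<in>UNIV. norm (y - x) < d \<longrightarrow>
   norm (primitive h y - primitive h x - (y - x) *\<^sub>R h x) \<le> r * norm (y - x)"
  proof (intro exI[of _ "min x (min d1 d2)"] conjI ballI impI)
   show "0 < min x (min d1 d2)" using x d1 d2 by simp
   fix y assume y: "norm (y - x) < min x (min d1 d2)"
   consider "y = x" | "y > x" | "y < x" by linarith
   then show "norm (primitive h y - primitive h x - (y - x) *\<^sub>R h x) \<le> r * norm (y - x)"
   proof cases
   case 2
   define l where "l = y - x"
   have l: "0 < l" "l < d1" "y = x + l" using 2 y by (auto simp: l_def)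
   have "norm (primitive h y - primitive h x - (y - x) *\<^sub>R h x) \<le> integral {x..y} (\<phi> e) + (y - x) * norm (e - h x)"
   unfolding \<phi>_def by (rule primitive_increment_bound[OF h]) (use x 2 in auto)
   also have "\<dots> \<le> l * (\<phi> e x + r / 3) + l * norm (e - h x)"
   using d1(2)[OF l(1,2)] by (simp add: l(3))
   also have "\<dots> \<le> r * l" by (rule bound[OF l(1)])
   finally show ?thesis using l by simp
   next
   case 3
   define l where "l = x - y"
   have l: "0 < l" "l < d2" "y = x - l" using 3 y by (auto simp: l_def)
   have "norm (primitive h y - primitive h x - (y - x) *\<^sub>R h x) = norm (primitive h x - primitive h y - (x - y) *\<^sub>R h x)"
   by (subst norm_minus_cancel[symmetric]) (simp add: algebra_simps)
   also have "\<dots> \<le> integral {y..x} (\<phi> e) + (x - y) * norm (e - h x)"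
   unfolding \<phi>_def by (rule primitive_increment_bound[OF h]) (use y 3 in auto)
   also have "\<dots> \<le> l * (\<phi> e x + r / 3) + l * norm (e - h x)"
   using d2(2)[OF l(1,2)] by (simp add: l(3))
   also have "\<dots> \<le> r * l" by (rule bound[OF l(1)])
   finally show ?thesis using l by simp
   qed simp
  qed
 qed
 ultimately show ?thesis by blast
qed

subsection \<open>Dyadic slopes\<close>

definition cell :: "nat \<Rightarrow> real \<Rightarrow> nat" where "cell k t = nat \<lfloor>2 ^ k * t\<rfloor>"

definition incr :: "(real \<Rightarrow> 'v::real_normed_vector) \<Rightarrow> nat \<Rightarrow> nat \<Rightarrow> 'v" where
 "incr G k j = G (real (Suc j) / 2 ^ k) - G (real j / 2 ^ k)"

definition slope :: "(real \<Rightarrow> 'v::real_normed_vector) \<Rightarrow> nat \<Rightarrow> real \<Rightarrow> 'v" where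
 "slope G k t = 2 ^ k *\<^sub>R incr G k (cell k t)"

lemma cell_eq_iff: "0 \<le> t \<Longrightarrow> cell k t = j \<longleftrightarrow> real j / 2 ^ k \<le> t \<and> t < real (Suc j) / 2 ^ k"
proof -
 assume "0 \<le> t"
 then have "cell k t = j \<longleftrightarrow> \<lfloor>2 ^ k * t\<rfloor> = int j"
  unfolding cell_def by (metis int_nat_eq mult_nonneg_nonneg nat_int of_int_0_le_iff zero_le_floor zero_le_numeral zero_le_power)
 also have "\<dots> \<longleftrightarrow> real j \<le> 2 ^ k * t \<and> 2 ^ k * t < real j + 1"
  by (simp add: floor_eq_iff)
 also have "\<dots> \<longleftrightarrow> real j / 2 ^ k \<le> t \<and> t < real (Suc j) / 2 ^ k"
  by (simp add: divide_le_eq less_divide_eq mult.commute add.commute)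
 finally show ?thesis .
qed

lemma cell_less_iff: "0 \<le> t \<Longrightarrow> cell k t < j \<longleftrightarrow> t < real j / 2 ^ k"
proof -
 assume "0 \<le> t"
 then have "cell k t < j \<longleftrightarrow> \<lfloor>2 ^ k * t\<rfloor> < int j"
  unfolding cell_def by (simp add: nat_less_iff)
 also have "\<dots> \<longleftrightarrow> 2 ^ k * t < real j"
  by (simp add: floor_less_iff)
 also have "\<dots> \<longleftrightarrow> t < real j / 2 ^ k"
  by (simp add: less_divide_eq mult.commute)
 finally show ?thesis .
qed

lemma cell_div: "0 \<le> t \<Longrightarrow> cell (k + l) t div 2 ^ l = cell k t"
proof -
 assume t: "0 \<le> t"
 have "\<lfloor>2 ^ (k + l) * t\<rfloor> div 2 ^ l = \<lfloor>2 ^ (k + l) * t / real_of_int (2 ^ l)\<rfloor>"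
  by (rule floor_divide_real_eq_div[symmetric]) simp
 also have "2 ^ (k + l) * t / real_of_int (2 ^ l) = 2 ^ k * t"
  by (simp add: power_add)
 finally have "nat (\<lfloor>2 ^ (k + l) * t\<rfloor> div 2 ^ l) = cell k t"
  by (simp add: cell_def)
 then show ?thesis
  using t by (simp add: cell_def nat_div_distrib nat_power_eq)
qed

abbreviation "unit_leb \<equiv> lebesgue_on {0..<1::real}"

lemma step_integral:
 fixes g :: "nat \<Rightarrow> 'w::{banach, second_countable_topology}"
 shows "has_bochner_integral unit_leb (\<lambda>t. g (cell k t)) (\<Sum>j<2 ^ k. (1 / 2 ^ k) *\<^sub>R g j)"
proof -
 define S where "S j = {real j / 2 ^ k..<real (Suc j) / 2 ^ k}" for j
 have sub: "S j \<subseteq> {0..<1}" if "j < 2 ^ k" for j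
 proof -
  have "real (Suc j) \<le> 2 ^ k"
   using that by (metis Suc_leI of_nat_le_iff of_nat_numeral of_nat_power)
  then have "real (Suc j) / 2 ^ k \<le> 1" by simp
  moreover have "0 \<le> real j / 2 ^ k" by simp
  ultimately show ?thesis unfolding S_def by (auto intro: less_le_trans order_trans)
 qed
 have "has_bochner_integral unit_leb (\<lambda>t. \<Sum>j<2 ^ k. indicator (S j) t *\<^sub>R g j) (\<Sum>j<2 ^ k. (1 / 2 ^ k) *\<^sub>R g j)"
 proof (rule has_bochner_integral_sum, rule has_bochner_integral_scaleR_left)
  fix j :: nat assume "j \<in> {..<2 ^ k}"
  then have j: "S j \<subseteq> {0..<1}" using sub by simp
  have le: "real j / 2 ^ k \<le> real (Suc j) / 2 ^ k"
   by (simp add: divide_right_mono)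
  have em: "emeasure unit_leb (S j) = ennreal (1 / 2 ^ k)"
   using j le by (subst emeasure_restrict_space) (auto simp: S_def add_divide_distrib)
  have "has_bochner_integral unit_leb (indicator (S j)) (measure unit_leb (S j))"
   by (rule has_bochner_integral_real_indicator) (use j em in \<open>auto simp: sets_restrict_space_iff S_def\<close>)
  then show "has_bochner_integral unit_leb (indicator (S j)) (1 / 2 ^ k :: real)"
   by (simp add: measure_def em)
 qed
 then show ?thesis
 proof (rule has_bochner_integral_cong[THEN iffD1, rotated -1])
  fix t assume "t \<in> space unit_leb"
  then have t: "0 \<le> t" "t < 1" by auto
  have c: "cell k t < 2 ^ k" using t by (simp add: cell_less_iff)
  have "(\<Sum>j<2 ^ k. indicator (S j) t *\<^sub>R g j) = (\<Sum>j<2 ^ k. if cell k t = j then g j else 0)"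
   by (rule sum.cong) (use t in \<open>auto simp: S_def cell_eq_iff indicator_def\<close>)
  then show "(\<Sum>j<2 ^ k. indicator (S j) t *\<^sub>R g j) = g (cell k t)"
   using c by simp
 qed auto
qed

lemma sum_blocks:
 fixes F :: "nat \<Rightarrow> 'a::comm_monoid_add"
 shows "(\<Sum>i<2 ^ (k + l). F i) = (\<Sum>j<2 ^ k. \<Sum>i\<in>{j * 2 ^ l..<j * 2 ^ l + 2 ^ l}. F i)"
 using sum.nat_group[of F "2 ^ l" "2 ^ k"] by (simp add: power_add)

lemma sum_incr_block:
 "(\<Sum>i\<in>{j * 2 ^ l..<j * 2 ^ l + 2 ^ l}. incr G (k + l) i) = incr G k j"
proof -
 have "(\<Sum>i\<in>{j * 2 ^ l..<j * 2 ^ l + 2 ^ l}. incr G (k + l) i) =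
  G (real (j * 2 ^ l + 2 ^ l) / 2 ^ (k + l)) - G (real (j * 2 ^ l) / 2 ^ (k + l))"
  unfolding incr_def by (rule sum_Suc_diff'[of "j * 2 ^ l" _ "\<lambda>i. G (real i / 2 ^ (k + l))"]) simp
 also have "real (j * 2 ^ l + 2 ^ l) / 2 ^ (k + l) = real (Suc j) / 2 ^ k"
  by (simp add: power_add divide_simps) (simp add: algebra_simps)
 also have "real (j * 2 ^ l) / 2 ^ (k + l) = real j / 2 ^ k"
  by (simp add: power_add)
 finally show ?thesis by (simp add: incr_def)
qed

text \<open>The slopes form a martingale for the dyadic partitions: paired with a function of the
  coarse cell, the fine slope has the same integral as the coarse one.\<close>

lemma slope_martingale:
 fixes G :: "real \<Rightarrow> 'w::{real_inner, banach, second_countable_topology}"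
 shows "has_bochner_integral unit_leb (\<lambda>t. inner (a (cell k t)) (slope G (k + l) t))
  (\<Sum>j<2 ^ k. inner (a j) (incr G k j))"
proof -
 have "(\<Sum>i<2 ^ (k + l). (1 / 2 ^ (k + l)) *\<^sub>R inner (a (i div 2 ^ l)) (2 ^ (k + l) *\<^sub>R incr G (k + l) i))
  = (\<Sum>i<2 ^ (k + l). inner (a (i div 2 ^ l)) (incr G (k + l) i))"
  by simp
 also have "\<dots> = (\<Sum>j<2 ^ k. \<Sum>i\<in>{j * 2 ^ l..<j * 2 ^ l + 2 ^ l}. inner (a (i div 2 ^ l)) (incr G (k + l) i))"
  by (rule sum_blocks)
 also have "\<dots> = (\<Sum>j<2 ^ k. \<Sum>i\<in>{j * 2 ^ l..<j * 2 ^ l + 2 ^ l}. inner (a j) (incr G (k + l) i))"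
 proof (intro sum.cong refl)
  fix j i :: nat assume i: "i \<in> {j * 2 ^ l..<j * 2 ^ l + 2 ^ l}"
  have "i div 2 ^ l = j"
   by (rule div_nat_eqI) (use i in \<open>auto simp: mult.commute\<close>)
  then show "inner (a (i div 2 ^ l)) (incr G (k + l) i) = inner (a j) (incr G (k + l) i)" by simp
 qed
 also have "\<dots> = (\<Sum>j<2 ^ k. inner (a j) (incr G k j))"
  by (simp add: sum_incr_block flip: inner_sum_right)
 finally have eq: "(\<Sum>i<2 ^ (k + l). (1 / 2 ^ (k + l)) *\<^sub>R inner (a (i div 2 ^ l)) (2 ^ (k + l) *\<^sub>R incr G (k + l) i))
  = (\<Sum>j<2 ^ k. inner (a j) (incr G k j))" .
 show ?thesis
  unfolding eq[symmetric]
  by (rule has_bochner_integral_cong[THEN iffD1, OF _ _ refl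
   step_integral[of "\<lambda>i. inner (a (i div 2 ^ l)) (2 ^ (k + l) *\<^sub>R incr G (k + l) i)" "k + l"]])
   (auto simp: cell_div slope_def)
qed

text \<open>With \<open>c\<close> the cosine of the angle, the left side is 2 (1 - c), and the norm
  of \<open>y\<close>, being at least 1, may multiply it. The right side, twice the loss of length
  under projection to the direction of \<open>x\<close>, has an integral controlled by the growth of
  the mean length.\<close>

lemma norm_sgn_diff_le:
 fixes x y :: "'w::real_inner"
 assumes x: "x \<noteq> 0" and y: "1 \<le> norm y"
 shows "(norm (sgn y - sgn x))\<^sup>2 \<le> 2 * (norm y - inner (sgn x) y)"
proof -
 define c where "c = inner (sgn x) (sgn y)"
 have y0: "y \<noteq> 0" using y by auto
 have "norm (sgn x) = 1" "norm (sgn y) = 1" using x y0 by (auto simp: norm_sgn)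
 then have c1: "c \<le> 1" unfolding c_def using norm_cauchy_schwarz[of "sgn x" "sgn y"] by simp
 have "inner (sgn x) y = norm y * c"
  using y0 by (simp add: c_def sgn_div_norm)
 moreover have "(norm (sgn y - sgn x))\<^sup>2 = 2 * (1 - c)"
  using \<open>norm (sgn x) = 1\<close> \<open>norm (sgn y) = 1\<close>
  by (simp add: power2_norm_eq_inner inner_diff_left inner_diff_right c_def inner_commute norm_eq_1)
 moreover have "1 * (1 - c) \<le> norm y * (1 - c)"
  using y c1 by (intro mult_right_mono) auto
 ultimately show ?thesis by (simp add: algebra_simps)
qed

text \<open>Since the mean slope is increasing and bounded, the unit tangents form a Cauchy sequence in
 \<open>L\<^sub>2\<close>.\<close>

lemma sgn_slope_AE_convergent:
 fixes G :: "real \<Rightarrow> 'w::{real_inner, banach, second_countable_topology}"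
 assumes ge1: "\<And>k j. 1 \<le> 2 ^ k * norm (incr G k j)"
  and bdd: "\<And>k. k0 \<le> k \<Longrightarrow> (\<Sum>j<2 ^ k. norm (incr G k j)) \<le> B"
 shows "\<exists>r. (\<forall>i. k0 \<le> r i) \<and> (\<forall>i::nat. i \<le> r i) \<and>
  (AE t in unit_leb. convergent (\<lambda>i. sgn (slope G (r i) t)))"
proof -
 define \<Lambda> where "\<Lambda> k = (\<Sum>j<2 ^ k. norm (incr G k j))" for k
 have ne: "incr G k j \<noteq> 0" for k j
  using ge1[of k j] by auto
 have sgn_slope: "sgn (slope G k t) = sgn (incr G k (cell k t))" for k t
  by (simp add: slope_def sgn_scaleR)
 have norm_slope: "1 \<le> norm (slope G k t)" for k t
  using ge1 by (simp add: slope_def)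
 have int: "integrable unit_leb (\<lambda>t. (norm (sgn (slope G (k + l) t) - sgn (slope G k t)))\<^sup>2)" for k l
 proof -
  have "integrable unit_leb (\<lambda>t. (norm (sgn (incr G (k + l) (cell (k + l) t)) - sgn (incr G k (cell (k + l) t div 2 ^ l))))\<^sup>2)"
   using step_integral[of "\<lambda>i. (norm (sgn (incr G (k + l) i) - sgn (incr G k (i div 2 ^ l))))\<^sup>2" "k + l"]
   by (auto simp: has_bochner_integral_iff)
  then show ?thesis
   by (rule Bochner_Integration.integrable_cong[THEN iffD1, OF refl, rotated]) (auto simp: sgn_slope cell_div)
 qed
 have le: "(\<integral>t. (norm (sgn (slope G (k + l) t) - sgn (slope G k t)))\<^sup>2 \<partial>unit_leb) \<le> 2 * (\<Lambda> (k + l) - \<Lambda> k)" for k l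
 proof -
  have 1: "has_bochner_integral unit_leb (\<lambda>t. norm (slope G (k + l) t)) (\<Lambda> (k + l))"
   using step_integral[of "\<lambda>j. norm (2 ^ (k + l) *\<^sub>R incr G (k + l) j)" "k + l"]
   by (simp add: \<Lambda>_def slope_def)
  \<comment> \<open>Paired with the coarse unit tangent, the fine slope integrates by the martingale
    property to the mean coarse length.\<close>
  have 2: "has_bochner_integral unit_leb (\<lambda>t. inner (sgn (slope G k t)) (slope G (k + l) t)) (\<Lambda> k)"
  proof -
   have "inner (sgn d) d = norm d" for d :: 'w
   by (cases "d = 0") (simp_all add: sgn_div_norm dot_square_norm power2_eq_square)
   then show ?thesis
   using slope_martingale[of "\<lambda>j. sgn (incr G k j)" k G l] by (simp add: \<Lambda>_def sgn_slope)
  qed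
  have 3: "has_bochner_integral unit_leb
   (\<lambda>t. 2 * (norm (slope G (k + l) t) - inner (sgn (slope G k t)) (slope G (k + l) t))) (2 * (\<Lambda> (k + l) - \<Lambda> k))"
   by (intro has_bochner_integral_mult_right has_bochner_integral_diff 1 2)
  have "(\<integral>t. (norm (sgn (slope G (k + l) t) - sgn (slope G k t)))\<^sup>2 \<partial>unit_leb) \<le>
   (\<integral>t. 2 * (norm (slope G (k + l) t) - inner (sgn (slope G k t)) (slope G (k + l) t)) \<partial>unit_leb)"
  proof (rule integral_mono[OF int])
   show "integrable unit_leb (\<lambda>t. 2 * (norm (slope G (k + l) t) - inner (sgn (slope G k t)) (slope G (k + l) t)))"
   using 3 by (rule integrable.intros)
   show "(norm (sgn (slope G (k + l) t) - sgn (slope G k t)))\<^sup>2 \<le>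
   2 * (norm (slope G (k + l) t) - inner (sgn (slope G k t)) (slope G (k + l) t))" for t
   by (rule norm_sgn_diff_le[OF _ norm_slope]) (simp add: slope_def ne)
  qed
  also have "\<dots> = 2 * (\<Lambda> (k + l) - \<Lambda> k)"
   by (rule has_bochner_integral_integral_eq[OF 3])
  finally show ?thesis .
 qed
 have mono: "\<Lambda> k \<le> \<Lambda> (k + l)" for k l
 proof -
  have "0 \<le> (\<integral>t. (norm (sgn (slope G (k + l) t) - sgn (slope G k t)))\<^sup>2 \<partial>unit_leb)"
   by simp
  from order_trans[OF this le[of k l]] show ?thesis by simp
 qed
 have "convergent (\<lambda>i. \<Lambda> (k0 + i))"
 proof (rule Bseq_mono_convergent)
  show "Bseq (\<lambda>i. \<Lambda> (k0 + i))"
   by (rule BseqI'[of _ B]) (use bdd in \<open>auto simp: \<Lambda>_def sum_nonneg\<close>)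
  show "\<forall>m n. m \<le> n \<longrightarrow> \<Lambda> (k0 + m) \<le> \<Lambda> (k0 + n)"
  proof (intro allI impI)
   fix m n :: nat assume "m \<le> n"
   then obtain l where "n = m + l" using le_Suc_ex by blast
   then show "\<Lambda> (k0 + m) \<le> \<Lambda> (k0 + n)" using mono[of "k0 + m" l] by (simp add: add.assoc)
  qed
 qed
 then have Cauchy: "Cauchy (\<lambda>i. \<Lambda> (k0 + i))" by (rule convergent_Cauchy)
 have "\<forall>i. \<exists>N. \<forall>m\<ge>N. \<forall>n\<ge>N. norm (\<Lambda> (k0 + m) - \<Lambda> (k0 + n)) < (1/4) ^ i"
  using Cauchy by (auto simp: Cauchy_iff)
 from choice[OF this] obtain N where N: "\<And>i m n. N i \<le> m \<Longrightarrow> N i \<le> n \<Longrightarrow> norm (\<Lambda> (k0 + m) - \<Lambda> (k0 + n)) < (1/4) ^ i"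
  by blast
 \<comment> \<open>Summing \<open>Suc (N j)\<close> makes \<open>s\<close> increasing, above
   \<open>N i\<close> and above \<open>i\<close> at once.\<close>
 define s where "s i = (\<Sum>j\<le>i. Suc (N j))" for i
 have s: "N i \<le> s i" "s i \<le> s (Suc i)" "i \<le> s i" for i
 proof -
  show "s i \<le> s (Suc i)" by (simp add: s_def)
  have "Suc (N i) \<le> s i" unfolding s_def by (rule member_le_sum) auto
  then show "N i \<le> s i" by simp
  have "(\<Sum>j\<le>i. 1) \<le> s i" unfolding s_def by (rule sum_mono) simp
  then show "i \<le> s i" by simp
 qed
 define r where "r i = k0 + s i" for i
 have "AE t in unit_leb. convergent (\<lambda>i. sgn (slope G (r i) t))"
 proof (rule AE_convergent_of_fast_Cauchy[where C = 2])
  fix i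
  obtain l where l: "s (Suc i) = s i + l" using s(2)[of i] le_Suc_ex by blast
  then have rl: "r (Suc i) = r i + l" by (simp add: r_def)
  show "integrable unit_leb (\<lambda>t. (norm (sgn (slope G (r (Suc i)) t) - sgn (slope G (r i) t)))\<^sup>2)"
   unfolding rl by (rule int)
  have "norm (\<Lambda> (r (Suc i)) - \<Lambda> (r i)) < (1/4) ^ i"
   unfolding r_def by (rule N) (use s[of i] in linarith)+
  then show "(\<integral>t. (norm (sgn (slope G (r (Suc i)) t) - sgn (slope G (r i) t)))\<^sup>2 \<partial>unit_leb) \<le> 2 * (1/4) ^ i"
   using le[of "r i" l] by (simp add: rl)
 qed
 then show ?thesis
  by (intro exI[of _ r]) (auto simp: r_def intro: trans_le_add2 s(3))
qed

lemma abs_continuous_incr: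
 assumes ac: "abs_continuous_on 0 1 f" and e: "0 < e"
 shows "\<exists>\<delta>>0. \<forall>k J. J \<subseteq> {..<2 ^ k} \<longrightarrow> real (card J) < \<delta> * 2 ^ k \<longrightarrow> (\<Sum>j\<in>J. norm (incr f k j)) < e"
proof -
 from ac[unfolded abs_continuous_on_def, rule_format, OF e]
 obtain \<delta> where \<delta>: "\<delta> > 0" and small: "\<forall>(n::nat) u v.
   (\<forall>i<n. 0 \<le> u i \<and> u i \<le> v i \<and> v i \<le> 1) \<and> disjoint_family_on (\<lambda>i. {u i<..<v i}) {..<n} \<and>
   (\<Sum>i<n. v i - u i) < \<delta> \<longrightarrow> (\<Sum>i<n. norm (f (v i) - f (u i))) < e"
  by auto
 have "(\<Sum>j\<in>J. norm (incr f k j)) < e" if J: "J \<subseteq> {..<2 ^ k}" and card: "real (card J) < \<delta> * 2 ^ k" for k J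
 proof -
  define u where "u i = real i / 2 ^ k" for i
  \<comment> \<open>Indices outside \<open>J\<close> receive empty intervals, so the family can be
    indexed by all cells.\<close>
  define v where "v i = (if i \<in> J then real (Suc i) / 2 ^ k else u i)" for i
  have fin: "finite J" using J finite_subset by blast
  have uv: "0 \<le> u i \<and> u i \<le> v i \<and> v i \<le> 1" if "i < 2 ^ k" for i
  proof -
   have "real (Suc i) \<le> 2 ^ k"
   using that by (metis Suc_leI of_nat_le_iff of_nat_numeral of_nat_power)
   then show ?thesis using that by (auto simp: u_def v_def divide_simps)
  qed
  have disj: "disjoint_family_on (\<lambda>i. {u i<..<v i}) {..<2 ^ k}"
  proof -
   have "{u i<..<v i} \<inter> {u j<..<v j} = {}" if "i < j" for i j
   proof -
   have "v i \<le> real (Suc i) / 2 ^ k" by (simp add: v_def u_def divide_right_mono)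
   also have "\<dots> \<le> u j" using that by (simp add: u_def divide_right_mono)
   finally show ?thesis by auto
   qed
   then show ?thesis unfolding disjoint_family_on_def by (metis Int_commute linorder_neqE_nat)
  qed
  have "(\<Sum>i<2 ^ k. v i - u i) = (\<Sum>i<2 ^ k. if i \<in> J then 1 / 2 ^ k else 0)"
   by (rule sum.cong) (auto simp: v_def u_def add_divide_distrib)
  also have "\<dots> = (\<Sum>i\<in>J. 1 / 2 ^ k)"
   using J by (subst sum.inter_restrict[symmetric]) (auto intro: sum.cong simp: Int_absorb1)
  also have "\<dots> < \<delta>"
   using card by (simp add: divide_less_eq)
  finally have len: "(\<Sum>i<2 ^ k. v i - u i) < \<delta>" .
  have "(\<Sum>j\<in>J. norm (incr f k j)) = (\<Sum>i<2 ^ k. if i \<in> J then norm (incr f k i) else 0)"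
   using J by (subst sum.inter_restrict[symmetric]) (auto intro: sum.cong simp: Int_absorb1)
  also have "\<dots> = (\<Sum>i<2 ^ k. norm (f (v i) - f (u i)))"
   by (rule sum.cong) (auto simp: incr_def v_def u_def)
  also have "\<dots> < e"
   using small[rule_format, of "2 ^ k" u v] uv disj len by blast
  finally show ?thesis .
 qed
 with \<delta> show ?thesis by blast
qed

text \<open>At level \<open>k0\<close> the blocks are shorter than \<delta>, so the variation in
  each is below 1 at every finer level, and there are 2^k0 blocks.\<close>

lemma abs_continuous_sum_incr_bounded:
 assumes ac: "abs_continuous_on 0 1 f"
 shows "\<exists>k0 B. \<forall>k\<ge>k0. (\<Sum>j<2 ^ k. norm (incr f k j)) \<le> B"
proof -
 obtain \<delta> where \<delta>: "\<delta> > 0" and small: "\<And>k J. J \<subseteq> {..<2 ^ k} \<Longrightarrow> real (card J) < \<delta> * 2 ^ k \<Longrightarrow>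
  (\<Sum>j\<in>J. norm (incr f k j)) < 1"
  using abs_continuous_incr[OF ac zero_less_one] by blast
 obtain k0 where k0: "1 / \<delta> < 2 ^ k0"
  using real_arch_pow[of 2 "1 / \<delta>"] by auto
 have "(\<Sum>j<2 ^ k. norm (incr f k j)) \<le> 2 ^ k0" if k_ge: "k0 \<le> k" for k
 proof -
  obtain l where k: "k = k0 + l" using le_Suc_ex[OF k_ge] by blast
  have "(\<Sum>j<2 ^ k. norm (incr f k j)) = (\<Sum>j<2 ^ k0. \<Sum>i\<in>{j * 2 ^ l..<j * 2 ^ l + 2 ^ l}. norm (incr f k i))"
   unfolding k by (rule sum_blocks)
  also have "\<dots> \<le> (\<Sum>j<(2::nat) ^ k0. 1)"
  proof (rule sum_mono)
   fix j :: nat assume "j \<in> {..<2 ^ k0}"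
   then have "Suc j * 2 ^ l \<le> 2 ^ k0 * 2 ^ l" by (intro mult_right_mono) auto
   then have sub: "{j * 2 ^ l..<j * 2 ^ l + 2 ^ l} \<subseteq> {..<2 ^ k}"
   by (auto simp: k power_add)
   have "1 * 2 ^ l < (\<delta> * 2 ^ k0) * (2 ^ l :: real)"
   using k0 \<delta> by (intro mult_strict_right_mono) (auto simp: field_simps)
   then have "real (card {j * 2 ^ l..<j * 2 ^ l + 2 ^ l}) < \<delta> * 2 ^ k"
   by (simp add: k power_add mult.assoc)
   from small[OF sub this] show "(\<Sum>i\<in>{j * 2 ^ l..<j * 2 ^ l + 2 ^ l}. norm (incr f k i)) \<le> 1"
   by simp
  qed
  finally show ?thesis by simp
 qed
 then show ?thesis by blast
qed

text \<open>Radial retraction onto the ball of radius \<open>K\<close>. In contrast to cutting off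
  by an indicator it is continuous and passes to pointwise limits.\<close>

definition clip :: "real \<Rightarrow> 'v \<Rightarrow> 'v::real_normed_vector" where
 "clip K v = (K / max K (norm v)) *\<^sub>R v"

lemma norm_clip_le: "0 < K \<Longrightarrow> norm (clip K v) \<le> K"
 by (auto simp: clip_def max_def divide_simps)

lemma norm_minus_clip: "0 < K \<Longrightarrow> norm (v - clip K v) = max 0 (norm v - K)"
proof -
 assume K: "0 < K"
 have "v - clip K v = (1 - K / max K (norm v)) *\<^sub>R v"
  by (simp add: clip_def scaleR_diff_left)
 then have "norm (v - clip K v) = \<bar>1 - K / max K (norm v)\<bar> * norm v" by simp
 also have "\<dots> = max 0 (norm v - K)"
  using K by (cases "norm v \<le> K") (auto simp: max_def abs_if divide_simps)
 finally show ?thesis .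
qed

lemma continuous_clip: "0 < K \<Longrightarrow> continuous_on UNIV (clip K)"
 unfolding clip_def[abs_def] by (intro continuous_intros) auto

text \<open>Uniform integrability: the cells with slope above \<open>K\<close> are few by
  Chebyshev's inequality, so absolute continuity makes the increments over them small in
  total.\<close>

lemma abs_continuous_slope_UI:
 fixes f :: "real \<Rightarrow> 'v::{real_inner, banach, second_countable_topology}"
 assumes ac: "abs_continuous_on 0 1 f" and bdd: "\<And>k. k0 \<le> k \<Longrightarrow> (\<Sum>j<2 ^ k. norm (incr f k j)) \<le> B"
  and e: "0 < e"
 shows "\<exists>K>0. \<forall>k\<ge>k0. integrable unit_leb (\<lambda>t. max 0 (norm (slope f k t) - K)) \<and>
  (\<integral>t. max 0 (norm (slope f k t) - K) \<partial>unit_leb) \<le> e"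
proof -
 obtain \<delta> where \<delta>: "\<delta> > 0" and small: "\<And>k J. J \<subseteq> {..<2 ^ k} \<Longrightarrow> real (card J) < \<delta> * 2 ^ k \<Longrightarrow>
  (\<Sum>j\<in>J. norm (incr f k j)) < e"
  using abs_continuous_incr[OF ac e] by blast
 have B0: "0 \<le> B" using bdd[of k0] by (rule order_trans[rotated]) (simp_all add: sum_nonneg)
 \<comment> \<open>With the total variation bounded by \<open>B\<close>, the steep cells then have
   total length less than \<delta>; the summand 1 makes this strict.\<close>
 define K where "K = (B + 1) / \<delta>"
 have K: "K > 0" using B0 \<delta> by (simp add: K_def)
 have "integrable unit_leb (\<lambda>t. max 0 (norm (slope f k t) - K)) \<and>
  (\<integral>t. max 0 (norm (slope f k t) - K) \<partial>unit_leb) \<le> e" if k: "k0 \<le> k" for k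
 proof -
  define J where "J = {j. j < 2 ^ k \<and> K < 2 ^ k * norm (incr f k j)}"
  have J: "J \<subseteq> {..<2 ^ k}" by (auto simp: J_def)
  have fin: "finite J" using J finite_subset by blast
  have "real (card J) * K = (\<Sum>j\<in>J. K)" by simp
  also have "\<dots> \<le> (\<Sum>j\<in>J. 2 ^ k * norm (incr f k j))"
   by (rule sum_mono) (auto simp: J_def)
  also have "\<dots> = 2 ^ k * (\<Sum>j\<in>J. norm (incr f k j))"
   by (simp add: sum_distrib_left)
  also have "\<dots> \<le> 2 ^ k * (\<Sum>j<2 ^ k. norm (incr f k j))"
   by (intro mult_left_mono sum_mono2 J) auto
  also have "\<dots> \<le> 2 ^ k * B" by (intro mult_left_mono bdd k) simp
  also have "\<dots> < 2 ^ k * (K * \<delta>)" using \<delta> by (simp add: K_def)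
  finally have "real (card J) * K < (\<delta> * 2 ^ k) * K" by (simp add: ac_simps)
  then have "real (card J) < \<delta> * 2 ^ k" using K by simp
  from small[OF J this] have sJ: "(\<Sum>j\<in>J. norm (incr f k j)) < e" .
  have int: "has_bochner_integral unit_leb (\<lambda>t. max 0 (norm (slope f k t) - K))
   (\<Sum>j<2 ^ k. (1 / 2 ^ k) * max 0 (2 ^ k * norm (incr f k j) - K))"
   using step_integral[of "\<lambda>j. max 0 (norm (2 ^ k *\<^sub>R incr f k j) - K)" k]
   by (simp add: slope_def)
  have "(\<Sum>j<2 ^ k. (1 / 2 ^ k) * max 0 (2 ^ k * norm (incr f k j) - K)) \<le>
   (\<Sum>j<2 ^ k. if j \<in> J then norm (incr f k j) else 0)"
  proof (rule sum_mono)
   fix j :: nat assume j: "j \<in> {..<2 ^ k}"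
   show "(1 / 2 ^ k) * max 0 (2 ^ k * norm (incr f k j) - K) \<le> (if j \<in> J then norm (incr f k j) else 0)"
   using j K by (auto simp: J_def max_def divide_simps mult.commute)
  qed
  also have "\<dots> = (\<Sum>j\<in>J. norm (incr f k j))"
   using J by (subst sum.inter_restrict[symmetric]) (auto intro: sum.cong simp: Int_absorb1)
  finally show ?thesis using int sJ by (auto simp: has_bochner_integral_iff)
 qed
 with K show ?thesis by blast
qed

lemma abs_continuous_imp_continuous:
 fixes f :: "real \<Rightarrow> 'v::real_normed_vector"
 assumes "abs_continuous_on a b f"
 shows "continuous_on {a..b} f"
 unfolding continuous_on_iff
proof (intro ballI allI impI)
 fix x e :: real assume x: "x \<in> {a..b}" and e: "0 < e"
 from assms[unfolded abs_continuous_on_def, rule_format, OF e]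
 obtain \<delta> where \<delta>: "\<delta> > 0" and small: "\<forall>(n::nat) u v.
   (\<forall>i<n. a \<le> u i \<and> u i \<le> v i \<and> v i \<le> b) \<and> disjoint_family_on (\<lambda>i. {u i<..<v i}) {..<n} \<and>
   (\<Sum>i<n. v i - u i) < \<delta> \<longrightarrow> (\<Sum>i<n. norm (f (v i) - f (u i))) < e"
  by auto
 have one: "norm (f v - f u) < e" if "a \<le> u" "u \<le> v" "v \<le> b" "v - u < \<delta>" for u v
  using small[rule_format, of 1 "\<lambda>_. u" "\<lambda>_. v"] that by (simp add: disjoint_family_on_def)
 show "\<exists>d>0. \<forall>x'\<in>{a..b}. dist x' x < d \<longrightarrow> dist (f x') (f x) < e"
 proof (intro exI[of _ \<delta>] conjI ballI impI \<delta>)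
  fix y assume y: "y \<in> {a..b}" "dist y x < \<delta>"
  show "dist (f y) (f x) < e"
  proof (cases "x \<le> y")
   case True
   with one[of x y] x y show ?thesis by (simp add: dist_norm)
  next
   case False
   with one[of y x] x y show ?thesis by (simp add: dist_norm norm_minus_commute)
  qed
 qed
qed

section \<open>Convergence of slopes and the density of an absolutely continuous curve\<close>

lemma nn_integral_Fatou_real:
 fixes u :: "nat \<Rightarrow> 'a \<Rightarrow> real"
 assumes u: "\<And>i. integrable M (u i)" and nonneg: "\<And>i x. 0 \<le> u i x"
  and le: "\<And>i. integral\<^sup>L M (u i) \<le> B"
 shows "(\<integral>\<^sup>+x. liminf (\<lambda>i. ennreal (u i x)) \<partial>M) \<le> ennreal B"
proof -
 have "(\<integral>\<^sup>+x. liminf (\<lambda>i. ennreal (u i x)) \<partial>M) \<le> liminf (\<lambda>i. \<integral>\<^sup>+x. ennreal (u i x) \<partial>M)"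
  by (rule nn_integral_liminf) (use u in auto)
 also have "\<dots> \<le> ennreal B"
 proof (rule Liminf_le)
  show "\<forall>\<^sub>F i in sequentially. (\<integral>\<^sup>+x. ennreal (u i x) \<partial>M) \<le> ennreal B"
   by (rule always_eventually, rule allI, subst nn_integral_eq_integral[OF u])
   (use nonneg le in \<open>auto intro: ennreal_leI\<close>)
 qed simp
 finally show ?thesis .
qed

lemma integral_Fatou_real:
 fixes u :: "nat \<Rightarrow> 'a \<Rightarrow> real"
 assumes u: "\<And>i. integrable M (u i)" and nonneg: "\<And>i x. 0 \<le> u i x"
  and le: "\<And>i. integral\<^sup>L M (u i) \<le> B" and B: "0 \<le> B"
  and v: "v \<in> borel_measurable M" and lim: "AE x in M. (\<lambda>i. u i x) \<longlonglongrightarrow> v x"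
 shows "integrable M v" and "integral\<^sup>L M v \<le> B"
proof -
 have v0: "AE x in M. 0 \<le> v x"
  using lim by eventually_elim (rule LIMSEQ_le_const, auto simp: nonneg)
 have "(\<integral>\<^sup>+x. ennreal (v x) \<partial>M) = (\<integral>\<^sup>+x. liminf (\<lambda>i. ennreal (u i x)) \<partial>M)"
 proof (rule nn_integral_cong_AE)
  show "AE x in M. ennreal (v x) = liminf (\<lambda>i. ennreal (u i x))"
   using lim
  proof eventually_elim
   case (elim x)
   then have "(\<lambda>i. ennreal (u i x)) \<longlonglongrightarrow> ennreal (v x)" by (rule tendsto_ennrealI)
   then show ?case using lim_imp_Liminf trivial_limit_sequentially by metis
  qed
 qed
 also have "\<dots> \<le> ennreal B" by (rule nn_integral_Fatou_real[OF u nonneg le])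
 finally have nn: "(\<integral>\<^sup>+x. ennreal (v x) \<partial>M) \<le> ennreal B" .
 show i: "integrable M v"
  by (rule integrableI_nonneg[OF v v0]) (use le_less_trans[OF nn ennreal_less_top] in simp)
 show "integral\<^sup>L M v \<le> B"
  using nn v0 B by (simp add: nn_integral_eq_integral[OF i])
qed

text \<open>The limit of the unit tangents is a.e. not vertical, by Fatou's lemma, so that the slopes
 themselves converge.\<close>

lemma slope_AE_convergent:
 fixes f :: "real \<Rightarrow> 'v::{real_inner, banach, second_countable_topology}"
 assumes bdd: "\<And>k. k0 \<le> k \<Longrightarrow> (\<Sum>j<2 ^ k. norm (incr f k j)) \<le> B"
 shows "\<exists>r. (\<forall>i. k0 \<le> r i) \<and> (\<forall>i::nat. i \<le> r i) \<and>
  (AE t in unit_leb. convergent (\<lambda>i. slope f (r i) t))"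
proof -
 \<comment> \<open>The first coordinate of the graph makes all slopes at least 1 in norm, as the
   Cauchy argument for unit tangents requires.\<close>
 define G where "G t = (t, f t)" for t
 have incr_G: "incr G k j = (1 / 2 ^ k, incr f k j)" for k j
  by (simp add: incr_def G_def add_divide_distrib)
 have slope_G: "slope G k t = (1, slope f k t)" for k t
  by (simp add: slope_def incr_G)
 have norm_G: "norm (incr G k j) \<le> 1 / 2 ^ k + norm (incr f k j)" for k j
  unfolding incr_G using norm_Pair_le[of "1 / 2 ^ k :: real" "incr f k j"] by simp
 have bdd_G: "(\<Sum>j<2 ^ k. norm (incr G k j)) \<le> 1 + B" if "k0 \<le> k" for k
 proof -
  have "(\<Sum>j<2 ^ k. norm (incr G k j)) \<le> (\<Sum>j<2 ^ k. 1 / 2 ^ k + norm (incr f k j))"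
   by (rule sum_mono) (rule norm_G)
  also have "\<dots> = 1 + (\<Sum>j<2 ^ k. norm (incr f k j))"
   by (simp add: sum.distrib)
  finally show ?thesis using bdd[OF that] by simp
 qed
 have "1 \<le> 2 ^ k * norm (incr G k j)" for k j
 proof -
  have "norm (1 / 2 ^ k :: real) \<le> norm (incr G k j)"
   unfolding incr_G by (rule norm_fst_le)
  then show ?thesis by (simp add: divide_le_eq mult.commute)
 qed
 from sgn_slope_AE_convergent[OF this bdd_G] obtain r where r: "\<And>i. k0 \<le> r i" "\<And>i::nat. i \<le> r i"
  and conv: "AE t in unit_leb. convergent (\<lambda>i. sgn (slope G (r i) t))"
  by blast
 define n where "n i t = norm (slope G (r i) t)" for i t
 have n1: "1 \<le> n i t" for i t
  using norm_fst_le[of "1 :: real" "slope f (r i) t"] by (simp add: n_def slope_G)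
 have int: "has_bochner_integral unit_leb (n i) (\<Sum>j<2 ^ r i. norm (incr G (r i) j))" for i
  using step_integral[of "\<lambda>j. norm (2 ^ r i *\<^sub>R incr G (r i) j)" "r i"]
  by (simp add: n_def[abs_def] slope_def)
 have "(\<integral>\<^sup>+t. liminf (\<lambda>i. ennreal (n i t)) \<partial>unit_leb) \<le> ennreal (1 + B)"
  by (rule nn_integral_Fatou_real)
   (use int bdd_G r n1 in \<open>auto simp: has_bochner_integral_iff intro: order_trans[OF zero_le_one]\<close>)
 also have "\<dots> < \<infinity>" by simp
 finally have "AE t in unit_leb. liminf (\<lambda>i. ennreal (n i t)) \<noteq> \<infinity>"
 proof (intro nn_integral_PInf_AE)
  have "n i \<in> borel_measurable unit_leb" for i
   using int[of i] by (auto simp: has_bochner_integral_iff)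
  then show "(\<lambda>t. liminf (\<lambda>i. ennreal (n i t))) \<in> borel_measurable unit_leb"
   by measurable
 qed simp
 with conv have "AE t in unit_leb. convergent (\<lambda>i. slope f (r i) t)"
 proof eventually_elim
  case (elim t)
  then obtain c where c: "(\<lambda>i. sgn (slope G (r i) t)) \<longlonglongrightarrow> c"
   by (auto simp: convergent_def)
  have sgn: "sgn (slope G (r i) t) = (1 / n i t, slope f (r i) t /\<^sub>R n i t)" for i
   by (simp add: sgn_div_norm n_def slope_G divide_inverse)
  have c1: "(\<lambda>i. 1 / n i t) \<longlonglongrightarrow> fst c" and c2: "(\<lambda>i. slope f (r i) t /\<^sub>R n i t) \<longlonglongrightarrow> snd c"
   using tendsto_fst[OF c] tendsto_snd[OF c] by (simp_all add: sgn)
  have "fst c \<noteq> 0"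
  proof
   assume "fst c = 0"
   then have z: "(\<lambda>i. inverse (n i t)) \<longlonglongrightarrow> 0" using c1 by (simp add: inverse_eq_divide)
   obtain b where b: "liminf (\<lambda>i. ennreal (n i t)) = ennreal b" "0 \<le> b"
   using elim(2) by (cases "liminf (\<lambda>i. ennreal (n i t))") auto
   have "\<forall>\<^sub>F i in sequentially. inverse (n i t) < inverse (b + 1)"
   using order_tendstoD(2)[OF z, of "inverse (b + 1)"] b(2) by simp
   then have "\<forall>\<^sub>F i in sequentially. ennreal (b + 1) \<le> ennreal (n i t)"
   proof eventually_elim
   case (elim i)
   have "0 < n i t" using n1[of i t] by linarith
   with elim b(2) have "b + 1 < n i t"
   by (simp add: inverse_less_iff_less)
   then show ?case by (intro ennreal_leI) simp
   qed
   then have "ennreal (b + 1) \<le> liminf (\<lambda>i. ennreal (n i t))"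
   by (rule Liminf_bounded)
   then show False using b by simp
  qed
  then have "(\<lambda>i. (slope f (r i) t /\<^sub>R n i t) /\<^sub>R (1 / n i t)) \<longlonglongrightarrow> snd c /\<^sub>R fst c"
   by (intro tendsto_intros c1 c2)
  moreover have "(slope f (r i) t /\<^sub>R n i t) /\<^sub>R (1 / n i t) = slope f (r i) t" for i
   using n1[of i t] by simp
  ultimately show ?case by (auto simp: convergent_def)
 qed
 with r show ?thesis by blast
qed

text \<open>The increments telescope at every level finer than \<open>k\<close>, so the integral is
  independent of the level; this identity survives in the limit.\<close>

lemma slope_integral_dyadic:
 fixes f :: "real \<Rightarrow> 'v::{real_inner, banach, second_countable_topology}"
 assumes p: "p \<le> 2 ^ k"
 shows "has_bochner_integral unit_leb (\<lambda>t. indicator {0..<real p / 2 ^ k} t *\<^sub>R slope f (k + l) t)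
  (f (real p / 2 ^ k) - f 0)"
proof -
 define m P where "m = k + l" and "P = p * 2 ^ l"
 have P: "P \<le> 2 ^ m" using p by (simp add: P_def m_def power_add)
 have q: "real P / 2 ^ m = real p / 2 ^ k" by (simp add: P_def m_def power_add)
 have "(\<Sum>j<2 ^ m. (1 / 2 ^ m) *\<^sub>R (if j < P then 2 ^ m *\<^sub>R incr f m j else 0)) = (\<Sum>j<2 ^ m. if j \<in> {..<P} then incr f m j else 0)"
  by (rule sum.cong) auto
 also have "\<dots> = (\<Sum>j\<in>{..<2 ^ m} \<inter> {..<P}. incr f m j)"
  by (rule sum.inter_restrict[symmetric]) simp
 also have "{..<2 ^ m} \<inter> {..<P} = {..<P}" using P by auto
 also have "(\<Sum>j<P. incr f m j) = f (real P / 2 ^ m) - f 0"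
  unfolding incr_def using sum_lessThan_telescope[of "\<lambda>j. f (real j / 2 ^ m)" P] by simp
 finally have eq: "(\<Sum>j<2 ^ m. (1 / 2 ^ m) *\<^sub>R (if j < P then 2 ^ m *\<^sub>R incr f m j else 0)) = f (real p / 2 ^ k) - f 0"
  by (simp only: q)
 show ?thesis
  unfolding eq[symmetric] m_def[symmetric]
  by (rule has_bochner_integral_cong[THEN iffD1, OF _ _ refl
   step_integral[of "\<lambda>j. if j < P then 2 ^ m *\<^sub>R incr f m j else 0" m]])
   (auto simp: slope_def cell_less_iff q indicator_def)
qed

lemma finite_measure_unit_interval: "finite_measure unit_leb"
 by (rule finite_measure_lebesgue_on, rule bounded_set_imp_lmeasurable) auto

text \<open>The density is the pointwise limit of slopes. Almost everywhere convergence alone does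
  not move the limit under the integral; clipping at height \<open>K\<close> costs at most
  \<open>e\<close> by uniform integrability, and clipped slopes converge dominatedly. This gives the
  identity at dyadic points, and continuity does the rest.\<close>

lemma abs_continuous_primitive:
 fixes f :: "real \<Rightarrow> 'v::{real_inner, banach, second_countable_topology}"
 assumes ac: "abs_continuous_on 0 1 f"
 shows "\<exists>h. integrable lebesgue h \<and> (\<forall>t\<in>{0..<1}. f t - f 0 = primitive h t)"
proof -
 obtain k0 B where bdd: "\<And>k. k0 \<le> k \<Longrightarrow> (\<Sum>j<2 ^ k. norm (incr f k j)) \<le> B"
  using abs_continuous_sum_incr_bounded[OF ac] by blast
 have B0: "0 \<le> B" using bdd[of k0] by (rule order_trans[rotated]) (simp_all add: sum_nonneg)
 obtain r where r: "\<And>i. k0 \<le> r i" "\<And>i::nat. i \<le> r i"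
  and conv: "AE t in unit_leb. convergent (\<lambda>i. slope f (r i) t)"
  using slope_AE_convergent[of k0 f B, OF bdd] by blast
 define s where "s i t = slope f (r i) t" for i t
 define h0 where "h0 t = lim (\<lambda>i. s i t)" for t
 have lim: "AE t in unit_leb. (\<lambda>i. s i t) \<longlonglongrightarrow> h0 t"
  using conv by (simp add: h0_def s_def convergent_LIMSEQ_iff)
 have int_s: "integrable unit_leb (s i)" for i
  using step_integral[of "\<lambda>j. 2 ^ r i *\<^sub>R incr f (r i) j" "r i"]
  by (auto simp: s_def[abs_def] slope_def has_bochner_integral_iff)
 have ms: "s i \<in> borel_measurable unit_leb" for i
  using int_s by (rule borel_measurable_integrable)
 have mh: "h0 \<in> borel_measurable unit_leb"
  unfolding h0_def by (rule borel_measurable_lim_metric) (rule ms)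
 have norm_s: "(\<integral>t. norm (s i t) \<partial>unit_leb) \<le> B" for i
 proof -
  have "has_bochner_integral unit_leb (\<lambda>t. norm (s i t)) (\<Sum>j<2 ^ r i. norm (incr f (r i) j))"
   using step_integral[of "\<lambda>j. norm (2 ^ r i *\<^sub>R incr f (r i) j)" "r i"]
   by (simp add: s_def slope_def)
  then show ?thesis using bdd[OF r(1)] by (simp add: has_bochner_integral_iff)
 qed
 have "integrable unit_leb (\<lambda>t. norm (h0 t))"
 proof (rule integral_Fatou_real(1)[where u = "\<lambda>i t. norm (s i t)" and B = B])
  show "AE t in unit_leb. (\<lambda>i. norm (s i t)) \<longlonglongrightarrow> norm (h0 t)"
   using lim by eventually_elim (rule tendsto_norm)
 qed (use int_s norm_s B0 mh in auto)
 then have int_h: "integrable unit_leb h0"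
  using mh by (simp add: integrable_norm_iff)
 have dyadic: "(\<integral>t. indicator {0..<real p / 2 ^ k} t *\<^sub>R h0 t \<partial>unit_leb) = f (real p / 2 ^ k) - f 0"
  if p: "p \<le> 2 ^ k" for p k
 proof -
  define I where "I t = (indicator {0..<real p / 2 ^ k} t :: real)" for t
  have mI: "I \<in> borel_measurable unit_leb"
   unfolding I_def by (rule measurable_restrict_space1, rule borel_measurable_indicator) simp
  have I: "0 \<le> I t" "I t \<le> 1" for t by (auto simp: I_def indicator_def)
  define X where "X = (\<integral>t. I t *\<^sub>R h0 t \<partial>unit_leb)"
  have intI: "integrable unit_leb (\<lambda>t. I t *\<^sub>R g t)" if "integrable unit_leb g" for g :: "real \<Rightarrow> 'v"
   by (rule Bochner_Integration.integrable_bound[OF that])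
   (use mI borel_measurable_integrable[OF that] I in \<open>auto simp: mult_left_le_one_le\<close>)
  have key: "norm (X - (f (real p / 2 ^ k) - f 0)) \<le> 2 * e" if e: "0 < e" for e
  proof -
   obtain K where K: "K > 0" and UI: "\<And>k. k0 \<le> k \<Longrightarrow>
   integrable unit_leb (\<lambda>t. max 0 (norm (slope f k t) - K)) \<and>
   (\<integral>t. max 0 (norm (slope f k t) - K) \<partial>unit_leb) \<le> e"
   using abs_continuous_slope_UI[OF ac bdd e] by blast
   have UIs: "integrable unit_leb (\<lambda>t. max 0 (norm (s i t) - K))"
   "(\<integral>t. max 0 (norm (s i t) - K) \<partial>unit_leb) \<le> e" for i
   using UI[OF r(1)[of i]] by (auto simp: s_def)
   have UIh: "integrable unit_leb (\<lambda>t. max 0 (norm (h0 t) - K))"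
   "(\<integral>t. max 0 (norm (h0 t) - K) \<partial>unit_leb) \<le> e"
   proof -
   have l: "AE t in unit_leb. (\<lambda>i. max 0 (norm (s i t) - K)) \<longlonglongrightarrow> max 0 (norm (h0 t) - K)"
   using lim by eventually_elim (intro tendsto_intros)
   have m: "(\<lambda>t. max 0 (norm (h0 t) - K)) \<in> borel_measurable unit_leb"
   using mh by measurable
   note F = integral_Fatou_real[where u = "\<lambda>i t. max 0 (norm (s i t) - K)" and B = e, OF UIs(1) _ UIs(2) _ m l]
   show "integrable unit_leb (\<lambda>t. max 0 (norm (h0 t) - K))"
   "(\<integral>t. max 0 (norm (h0 t) - K) \<partial>unit_leb) \<le> e"
   by (rule F; use e in simp)+
   qed
   have clip_int: "integrable unit_leb (\<lambda>t. clip K (g t))"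
   if "g \<in> borel_measurable unit_leb" for g :: "real \<Rightarrow> 'v"
   proof (rule finite_measure.integrable_const_bound[where B = K])
   show "finite_measure unit_leb"
   by (rule finite_measure_unit_interval)
   show "(\<lambda>t. clip K (g t)) \<in> borel_measurable unit_leb"
   by (rule measurable_compose[OF that borel_measurable_continuous_onI[OF continuous_clip[OF K]]])
   qed (simp add: norm_clip_le K)
   have err: "norm ((\<integral>t. I t *\<^sub>R g t \<partial>unit_leb) - (\<integral>t. I t *\<^sub>R clip K (g t) \<partial>unit_leb)) \<le> e"
   if g: "integrable unit_leb g" and gi: "integrable unit_leb (\<lambda>t. max 0 (norm (g t) - K))"
   and ge: "(\<integral>t. max 0 (norm (g t) - K) \<partial>unit_leb) \<le> e" for g :: "real \<Rightarrow> 'v"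
   proof -
   note ci = clip_int[OF borel_measurable_integrable[OF g]]
   have "(\<integral>t. I t *\<^sub>R g t \<partial>unit_leb) - (\<integral>t. I t *\<^sub>R clip K (g t) \<partial>unit_leb)
   = (\<integral>t. I t *\<^sub>R (g t - clip K (g t)) \<partial>unit_leb)"
   using intI[OF g] intI[OF ci] by (simp add: scaleR_diff_right)
   also have "norm \<dots> \<le> (\<integral>t. max 0 (norm (g t) - K) \<partial>unit_leb)"
   proof (rule Bochner_Integration.integral_norm_bound_integral[OF _ gi])
   show "integrable unit_leb (\<lambda>t. I t *\<^sub>R (g t - clip K (g t)))"
   by (intro intI Bochner_Integration.integrable_diff g ci)
   show "norm (I t *\<^sub>R (g t - clip K (g t))) \<le> max 0 (norm (g t) - K)" for t
   using norm_minus_clip[OF K, of "g t"] I[of t] by (simp add: mult_left_le_one_le)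
   qed
   finally show ?thesis using ge by simp
   qed
   have clip_lim: "(\<lambda>i. \<integral>t. I t *\<^sub>R clip K (s i t) \<partial>unit_leb) \<longlonglongrightarrow> (\<integral>t. I t *\<^sub>R clip K (h0 t) \<partial>unit_leb)"
   proof (rule integral_dominated_convergence[where w = "\<lambda>_. K"])
   show "AE t in unit_leb. (\<lambda>i. I t *\<^sub>R clip K (s i t)) \<longlonglongrightarrow> I t *\<^sub>R clip K (h0 t)"
   using lim
   proof eventually_elim
   case (elim t)
   have "continuous_on UNIV (clip K :: 'v \<Rightarrow> 'v)" by (rule continuous_clip[OF K])
   then have "isCont (clip K) (h0 t)" by (simp add: continuous_on_eq_continuous_at)
   then show ?case by (intro tendsto_intros isCont_tendsto_compose[OF _ elim])
   qed
   show "AE t in unit_leb. norm (I t *\<^sub>R clip K (s i t)) \<le> K" for i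
   proof (rule AE_I2)
   fix t
   have "I t * norm (clip K (s i t)) \<le> 1 * norm (clip K (s i t))"
   using I by (intro mult_right_mono) auto
   with norm_clip_le[OF K, of "s i t"] I[of t] show "norm (I t *\<^sub>R clip K (s i t)) \<le> K" by simp
   qed
   show "integrable unit_leb (\<lambda>_. K)"
   by (rule finite_measure.integrable_const[OF finite_measure_unit_interval])
   show "(\<lambda>t. I t *\<^sub>R clip K (h0 t)) \<in> borel_measurable unit_leb"
   by (rule borel_measurable_integrable[OF intI[OF clip_int[OF mh]]])
   show "(\<lambda>t. I t *\<^sub>R clip K (s i t)) \<in> borel_measurable unit_leb" for i
   by (rule borel_measurable_integrable[OF intI[OF clip_int[OF ms]]])
   qed
   have "norm (X - (f (real p / 2 ^ k) - f 0)) \<le>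
   2 * e + norm ((\<integral>t. I t *\<^sub>R clip K (h0 t) \<partial>unit_leb) - (\<integral>t. I t *\<^sub>R clip K (s i t) \<partial>unit_leb))"
   if i: "k \<le> i" for i
   proof -
   \<comment> \<open>Because \<open>r i\<close> is at least \<open>i\<close>, and so at least
     \<open>k\<close>, the dyadic point is still a grid point at level \<open>r i\<close>.\<close>
   obtain l where l: "r i = k + l" using r(2)[of i] i le_Suc_ex order_trans by metis
   have eq: "(\<integral>t. I t *\<^sub>R s i t \<partial>unit_leb) = f (real p / 2 ^ k) - f 0"
   using slope_integral_dyadic[OF p, of f l] by (simp add: I_def s_def l has_bochner_integral_iff)
   have tri: "norm (a - d) \<le> norm (a - b) + norm (d - c) + norm (b - c)" for a b c d :: 'v
   using norm_triangle_ineq4[of "(a - b) + (b - c)" "d - c"] norm_triangle_ineq[of "a - b" "b - c"] by simp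
   show ?thesis
   unfolding X_def eq[symmetric]
   using tri[of "\<integral>t. I t *\<^sub>R h0 t \<partial>unit_leb" "\<integral>t. I t *\<^sub>R s i t \<partial>unit_leb"
   "\<integral>t. I t *\<^sub>R clip K (h0 t) \<partial>unit_leb" "\<integral>t. I t *\<^sub>R clip K (s i t) \<partial>unit_leb"]
   err[OF int_h UIh] err[OF int_s UIs, of i] by linarith
   qed
   moreover have "(\<lambda>i. 2 * e + norm ((\<integral>t. I t *\<^sub>R clip K (h0 t) \<partial>unit_leb) - (\<integral>t. I t *\<^sub>R clip K (s i t) \<partial>unit_leb)))
   \<longlonglongrightarrow> 2 * e + norm ((\<integral>t. I t *\<^sub>R clip K (h0 t) \<partial>unit_leb) - (\<integral>t. I t *\<^sub>R clip K (h0 t) \<partial>unit_leb))"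
   by (intro tendsto_intros clip_lim)
   ultimately show ?thesis
   by (intro LIMSEQ_le_const[where X = "\<lambda>i. 2 * e + norm ((\<integral>t. I t *\<^sub>R clip K (h0 t) \<partial>unit_leb) - (\<integral>t. I t *\<^sub>R clip K (s i t) \<partial>unit_leb))"])
   auto
  qed
  have "norm (X - (f (real p / 2 ^ k) - f 0)) \<le> 0"
  proof (rule field_le_epsilon)
   fix e :: real assume "0 < e"
   then show "norm (X - (f (real p / 2 ^ k) - f 0)) \<le> 0 + e" using key[of "e / 2"] by simp
  qed
  then show ?thesis by (simp add: X_def I_def)
 qed
 define h where "h t = indicator {0..<1::real} t *\<^sub>R h0 t" for t
 have ih: "integrable lebesgue h"
  unfolding h_def using int_h by (simp add: integrable_restrict_space)
 have prim: "primitive h (real p / 2 ^ k) = f (real p / 2 ^ k) - f 0" if "p \<le> 2 ^ k" for p k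
 proof -
  have "primitive h (real p / 2 ^ k) = (\<integral>t. indicator {0..<1} t *\<^sub>R (indicator {0..<real p / 2 ^ k} t *\<^sub>R h0 t) \<partial>lebesgue)"
   unfolding primitive_def h_def by (simp add: mult.commute)
  also have "\<dots> = (\<integral>t. indicator {0..<real p / 2 ^ k} t *\<^sub>R h0 t \<partial>unit_leb)"
   by (simp add: integral_restrict_space)
  finally show ?thesis using dyadic[OF that] by simp
 qed
 have "f t - f 0 = primitive h t" if t: "t \<in> {0..<1}" for t
 proof -
  define q where "q n = real (cell n t) / 2 ^ n" for n
  have q: "q n \<le> t" "t < q n + 1 / 2 ^ n" "0 \<le> q n" "cell n t \<le> 2 ^ n" for n
  proof -
   have "real (cell n t) / 2 ^ n \<le> t \<and> t < real (Suc (cell n t)) / 2 ^ n"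
   using cell_eq_iff[of t n "cell n t"] t by simp
   then show "q n \<le> t" "t < q n + 1 / 2 ^ n"
   by (auto simp: q_def add_divide_distrib)
   show "0 \<le> q n" by (simp add: q_def)
   have "cell n t < 2 ^ n" using t by (simp add: cell_less_iff)
   then show "cell n t \<le> 2 ^ n" by simp
  qed
  have qt: "q \<longlonglongrightarrow> t"
  proof (rule tendsto_sandwich)
   have "(\<lambda>n. t - (1 / 2) ^ n) \<longlonglongrightarrow> t - 0"
   by (intro tendsto_intros LIMSEQ_power_zero) simp
   then show "(\<lambda>n. t - 1 / 2 ^ n) \<longlonglongrightarrow> t" by (simp add: power_one_over)
   show "\<forall>\<^sub>F n in sequentially. t - 1 / 2 ^ n \<le> q n"
   by (rule always_eventually) (use q(2) in \<open>auto simp: less_eq_real_def algebra_simps\<close>)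
   show "\<forall>\<^sub>F n in sequentially. q n \<le> t" by (rule always_eventually) (simp add: q(1))
  qed (rule tendsto_const)
  have "(\<lambda>n. f (q n)) \<longlonglongrightarrow> f t"
  proof (rule continuous_on_tendsto_compose[OF abs_continuous_imp_continuous[OF ac] qt])
   show "t \<in> {0..1}" using t by simp
   show "\<forall>\<^sub>F n in sequentially. q n \<in> {0..1}"
   proof (rule always_eventually, rule allI)
   fix n show "q n \<in> {0..1}" using q(1)[of n] q(3)[of n] t by auto
   qed
  qed
  then have 1: "(\<lambda>n. f (q n) - f 0) \<longlonglongrightarrow> f t - f 0" by (intro tendsto_intros)
  have "(\<lambda>n. primitive h (q n)) \<longlonglongrightarrow> primitive h t"
   unfolding primitive_def
  proof (rule integral_dominated_convergence[where w = "\<lambda>s. norm (h s)"])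
   show "AE s in lebesgue. (\<lambda>n. indicator {0..<q n} s *\<^sub>R h s) \<longlonglongrightarrow> indicator {0..<t} s *\<^sub>R h s"
   proof (rule AE_I2)
   fix s
   show "(\<lambda>n. indicator {0..<q n} s *\<^sub>R h s) \<longlonglongrightarrow> indicator {0..<t} s *\<^sub>R h s"
   proof (cases "s < t")
   case True
   have "\<forall>\<^sub>F n in sequentially. s < q n" by (rule order_tendstoD(1)[OF qt True])
   then have "\<forall>\<^sub>F n in sequentially. indicator {0..<q n} s *\<^sub>R h s = indicator {0..<t} s *\<^sub>R h s"
   by eventually_elim (use True in \<open>auto simp: indicator_def\<close>)
   then show ?thesis by (rule tendsto_eventually)
   next
   case False
   have eq: "(\<lambda>n. indicator {0..<q n} s *\<^sub>R h s) = (\<lambda>n. 0)"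
   proof
   fix n show "indicator {0..<q n} s *\<^sub>R h s = 0"
   using False q(1)[of n] by (auto simp: indicator_def)
   qed
   show ?thesis unfolding eq using False by (simp add: indicator_def)
   qed
   qed
   show "integrable lebesgue (\<lambda>s. norm (h s))" using ih by simp
   show "(\<lambda>s. indicator {0..<t} s *\<^sub>R h s) \<in> borel_measurable lebesgue"
   by (rule borel_measurable_integrable[OF integrable_mult_indicator[OF _ ih]]) simp
   show "(\<lambda>s. indicator {0..<q n} s *\<^sub>R h s) \<in> borel_measurable lebesgue" for n
   by (rule borel_measurable_integrable[OF integrable_mult_indicator[OF _ ih]]) simp
   show "AE s in lebesgue. norm (indicator {0..<q n} s *\<^sub>R h s) \<le> norm (h s)" for n
   by (rule AE_I2) (auto simp: indicator_def)
  qed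
  moreover have "primitive h (q n) = f (q n) - f 0" for n
   unfolding q_def by (rule prim[OF q(4)])
  ultimately show ?thesis using LIMSEQ_unique[OF 1] by simp
 qed
 with ih show ?thesis by blast
qed

lemma abs_continuous_scale:
 assumes ac: "abs_continuous_on 0 c f" and c: "0 < c"
 shows "abs_continuous_on 0 1 (\<lambda>s. f (c * s))"
 unfolding abs_continuous_on_def
proof (intro allI impI)
 fix e :: real assume e: "0 < e"
 from ac[unfolded abs_continuous_on_def, rule_format, OF e]
 obtain \<delta> where \<delta>: "\<delta> > 0" and small: "\<forall>(n::nat) u v.
   (\<forall>i<n. 0 \<le> u i \<and> u i \<le> v i \<and> v i \<le> c) \<and> disjoint_family_on (\<lambda>i. {u i<..<v i}) {..<n} \<and>
   (\<Sum>i<n. v i - u i) < \<delta> \<longrightarrow> (\<Sum>i<n. norm (f (v i) - f (u i))) < e"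
  by auto
 show "\<exists>\<delta>>0. \<forall>(n::nat) u v. (\<forall>i<n. 0 \<le> u i \<and> u i \<le> v i \<and> v i \<le> 1) \<and>
   disjoint_family_on (\<lambda>i. {u i<..<v i}) {..<n} \<and> (\<Sum>i<n. v i - u i) < \<delta> \<longrightarrow>
   (\<Sum>i<n. norm (f (c * v i) - f (c * u i))) < e"
 proof (intro exI[of _ "\<delta> / c"] conjI allI impI)
  show "0 < \<delta> / c" using \<delta> c by simp
  fix n :: nat and u v
  assume A: "(\<forall>i<n. 0 \<le> u i \<and> u i \<le> v i \<and> v i \<le> 1) \<and>
   disjoint_family_on (\<lambda>i. {u i<..<v i}) {..<n} \<and> (\<Sum>i<n. v i - u i) < \<delta> / c"
  have "\<forall>i<n. 0 \<le> c * u i \<and> c * u i \<le> c * v i \<and> c * v i \<le> c"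
   using A c by (auto intro: mult_left_le)
  moreover have "disjoint_family_on (\<lambda>i. {c * u i<..<c * v i}) {..<n}"
  proof -
   have "x / c \<in> {u i<..<v i}" if "x \<in> {c * u i<..<c * v i}" for x i
   using that c by (auto simp: field_simps)
   then show ?thesis using A unfolding disjoint_family_on_def by blast
  qed
  moreover have "(\<Sum>i<n. c * v i - c * u i) < \<delta>"
  proof -
   have "(\<Sum>i<n. c * v i - c * u i) = c * (\<Sum>i<n. v i - u i)"
   by (simp add: sum_distrib_left right_diff_distrib)
   also have "\<dots> < c * (\<delta> / c)"
   using A c by (intro mult_strict_left_mono) auto
   finally show ?thesis using c by simp
  qed
  ultimately show "(\<Sum>i<n. norm (f (c * v i) - f (c * u i))) < e"
   using small[rule_format, of n "\<lambda>i. c * u i" "\<lambda>i. c * v i"] by blast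
 qed
qed

theorem abs_continuous_AE_differentiable:
 fixes f :: "real \<Rightarrow> 'v::{real_inner, banach, second_countable_topology}"
 assumes ac: "abs_continuous_on 0 c f" and c: "0 < c"
 shows "\<exists>N. negligible N \<and> (\<forall>x\<in>{0<..<c} - N. \<exists>d. (f has_vector_derivative d) (at x))"
proof -
 define g where "g s = f (c * s)" for s
 have "abs_continuous_on 0 1 g"
  unfolding g_def by (rule abs_continuous_scale[OF ac c])
 from abs_continuous_primitive[OF this] obtain h where h: "integrable lebesgue h"
  and gh: "\<And>t. t \<in> {0..<1} \<Longrightarrow> g t - g 0 = primitive h t"
  by blast
 obtain N where N: "negligible N"
  and d: "\<And>x. 0 < x \<Longrightarrow> x \<notin> N \<Longrightarrow> (primitive h has_vector_derivative h x) (at x)"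
  using primitive_has_vector_derivative[OF h] by blast
 have "negligible ((*) c ` N)"
  by (rule negligible_differentiable_image_negligible[OF _ N])
   (auto simp: differentiable_on_def intro!: derivative_intros)
 moreover have "\<exists>d. (f has_vector_derivative d) (at x)" if x: "x \<in> {0<..<c} - (*) c ` N" for x
 proof -
  define s where "s = x / c"
  have xs: "x = c * s" using c by (simp add: s_def)
  have s: "0 < s" "s < 1" "s \<notin> N"
  proof -
   show "0 < s" "s < 1" using x c by (simp_all add: s_def)
   show "s \<notin> N" using x xs by blast
  qed
  have "((\<lambda>t. primitive h t + g 0) has_vector_derivative h s) (at s)"
   using has_vector_derivative_add[OF d[OF s(1,3)] has_vector_derivative_const[of "g 0"]] by simp
  then have gd: "(g has_vector_derivative h s) (at s)"
  proof (rule has_vector_derivative_transform_within_open[where S = "{0<..<1}"])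
   show "primitive h t + g 0 = g t" if "t \<in> {0<..<1}" for t
   using gh[of t] that by (simp add: algebra_simps)
  qed (use s in auto)
  have "((g \<circ> (\<lambda>x. x / c)) has_vector_derivative (1 / c) *\<^sub>R h s) (at x)"
   by (rule vector_diff_chain_at)
   (use gd c in \<open>auto simp: s_def intro!: derivative_eq_intros simp flip: has_real_derivative_iff_has_vector_derivative\<close>)
  moreover have "g \<circ> (\<lambda>x. x / c) = f" using c by (auto simp: g_def)
  ultimately show ?thesis by auto
 qed
 ultimately show ?thesis by blast
qed

text \<open>After rescaling, \<open>f\<close> is the primitive of some integrable \<open>h\<close>,
  and where both derivatives exist they agree. Hence \<open>k\<close> is \<open>h\<close> rescaled
  up to a null set, and its integrability is part of the conclusion.\<close>

lemma abs_continuous_ftc: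
 fixes f :: "real \<Rightarrow> 'v::euclidean_space"
 assumes ac: "abs_continuous_on 0 c f" and c: "0 \<le> c" and N: "negligible N"
  and der: "\<And>x. x \<in> {0..c} - N \<Longrightarrow> (f has_vector_derivative k x) (at x within {0..c})"
 shows "(k has_integral (f c - f 0)) {0..c}"
proof (cases "c = 0")
 case False
 then have c: "0 < c" using c by simp
 define g where "g s = f (c * s)" for s
 have gac: "abs_continuous_on 0 1 g" unfolding g_def by (rule abs_continuous_scale[OF ac c])
 from abs_continuous_primitive[OF gac] obtain h where h: "integrable lebesgue h"
  and gh: "\<And>t. t \<in> {0..<1} \<Longrightarrow> g t - g 0 = primitive h t"
  by blast
 obtain N' where N': "negligible N'"
  and d: "\<And>x. 0 < x \<Longrightarrow> x \<notin> N' \<Longrightarrow> (primitive h has_vector_derivative h x) (at x)"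
  using primitive_has_vector_derivative[OF h] by blast
 have ph: "(h has_integral primitive h t) {0..t}" for t
 proof -
  have "set_integrable lebesgue {0..<t} h"
   unfolding set_integrable_def by (rule integrable_mult_indicator[OF _ h]) simp
  from has_integral_set_lebesgue[OF this] have "(h has_integral primitive h t) {0..<t}"
   by (simp add: primitive_def set_lebesgue_integral_def)
  then show ?thesis
   by (rule has_integral_spike_set_eq[THEN iffD1, rotated 2]) (auto intro: negligible_subset[of "{t}"])
 qed
 have "continuous_on {0..1} (\<lambda>t. integral {0..t} h)"
  by (rule indefinite_integral_continuous_1) (use ph[of 1] in blast)
 also have "(\<lambda>t. integral {0..t} h) = primitive h" using integral_unique[OF ph] by blast
 finally have "continuous_on {0..1} (\<lambda>t. g t - g 0 - primitive h t)"
  by (intro continuous_on_diff continuous_on_const abs_continuous_imp_continuous[OF gac])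
 \<comment> \<open>Continuity extends the identity to the right end point, which the dyadic cells
   leave out.\<close>
 then have gh1: "g t - g 0 - primitive h t = 0" if "t \<in> {0..1}" for t
  using continuous_constant_on_closure[of "{0..<1}" "\<lambda>t. g t - g 0 - primitive h t" 0 t] gh that by simp
 have "((\<lambda>s. c *\<^sub>R k (c * s)) has_integral (g 1 - g 0)) {0..1}"
 proof (rule has_integral_spike)
  show "negligible (N' \<union> {0} \<union> (\<lambda>x. x / c) ` N)"
   using N N' c by (auto intro!: negligible_Un negligible_differentiable_image_negligible derivative_intros
   simp: differentiable_on_def)
  show "(h has_integral g 1 - g 0) {0..1}" using ph[of 1] gh1[of 1] by simp
  show "c *\<^sub>R k (c * s) = h s" if s: "s \<in> {0..1} - (N' \<union> {0} \<union> (\<lambda>x. x / c) ` N)" for s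
  proof -
   have "c * s \<notin> N"
   proof
   assume "c * s \<in> N"
   then have "c * s / c \<in> (\<lambda>x. x / c) ` N" by (rule imageI)
   then show False using s c by simp
   qed
   then have cs: "c * s \<in> {0..c} - N" using s c by simp
   have "(primitive h has_vector_derivative h s) (at s)" by (rule d) (use s in auto)
   from has_vector_derivative_at_within[OF has_vector_derivative_add[OF this has_vector_derivative_const[of "g 0"]], of "{0..1}"]
   have "((\<lambda>t. primitive h t + g 0) has_vector_derivative h s) (at s within {0..1})" by simp
   then have 1: "(g has_vector_derivative h s) (at s within {0..1})"
   proof (rule has_vector_derivative_transform[rotated 2])
   show "s \<in> {0..1}" using s by simp
   show "g t = primitive h t + g 0" if "t \<in> {0..1}" for t using gh1[OF that] by (simp add: algebra_simps)
   qed
   have "((\<lambda>s. c * s) has_vector_derivative c) (at s within {0..1})"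
   by (auto intro!: derivative_eq_intros)
   moreover have "(f has_vector_derivative k (c * s)) (at (c * s) within (\<lambda>s. c * s) ` {0..1})"
   using der[OF cs] c by simp
   ultimately have "((f \<circ> (\<lambda>s. c * s)) has_vector_derivative c *\<^sub>R k (c * s)) (at s within {0..1})"
   by (rule vector_diff_chain_within)
   then have "(g has_vector_derivative c *\<^sub>R k (c * s)) (at s within {0..1})"
   by (simp add: g_def[abs_def] o_def)
   then show ?thesis by (rule vector_derivative_unique_within[OF _ _ 1, rotated]) (use s in \<open>simp add: trivial_limit_within\<close>)
   qed
 qed
 from has_integral_cmul[OF has_integral_stretch_real[OF this, of "1 / c"], of "1 / c"]
 show ?thesis using c by (simp add: g_def image_mult_atLeastAtMost_if mult.commute[of _ c])
qed (simp add: has_integral_refl)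

section \<open>Solutions of the inhomogeneous equation\<close>

lemma lipschitz_abs_continuous:
 assumes "\<And>u v. a \<le> u \<Longrightarrow> u \<le> v \<Longrightarrow> v \<le> b \<Longrightarrow> norm (f v - f u) \<le> K * (v - u)"
 shows "abs_continuous_on a b f"
 unfolding abs_continuous_on_def
proof (intro allI impI)
 fix e :: real assume e: "0 < e"
 define K' where "K' = \<bar>K\<bar> + 1"
 have K': "K' > 0" by (simp add: K'_def)
 show "\<exists>\<delta>>0. \<forall>(n::nat) u v. (\<forall>i<n. a \<le> u i \<and> u i \<le> v i \<and> v i \<le> b) \<and>
   disjoint_family_on (\<lambda>i. {u i<..<v i}) {..<n} \<and> (\<Sum>i<n. v i - u i) < \<delta> \<longrightarrow>
   (\<Sum>i<n. norm (f (v i) - f (u i))) < e"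
 proof (intro exI[of _ "e / K'"] conjI allI impI)
  show "0 < e / K'" using e K' by simp
  fix n :: nat and u v
  assume A: "(\<forall>i<n. a \<le> u i \<and> u i \<le> v i \<and> v i \<le> b) \<and>
   disjoint_family_on (\<lambda>i. {u i<..<v i}) {..<n} \<and> (\<Sum>i<n. v i - u i) < e / K'"
  have "(\<Sum>i<n. norm (f (v i) - f (u i))) \<le> (\<Sum>i<n. K' * (v i - u i))"
  proof (rule sum_mono)
   fix i assume "i \<in> {..<n}"
   then have uv: "a \<le> u i" "u i \<le> v i" "v i \<le> b" using A by auto
   have "norm (f (v i) - f (u i)) \<le> K * (v i - u i)" by (rule assms[OF uv])
   also have "\<dots> \<le> K' * (v i - u i)" using uv by (intro mult_right_mono) (auto simp: K'_def)
   finally show "norm (f (v i) - f (u i)) \<le> K' * (v i - u i)" .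
  qed
  also have "\<dots> = K' * (\<Sum>i<n. v i - u i)" by (simp add: sum_distrib_left)
  also have "\<dots> < K' * (e / K')" using A K' by (intro mult_strict_left_mono) auto
  finally show "(\<Sum>i<n. norm (f (v i) - f (u i))) < e" using K' by simp
 qed
qed

lemma C1_abs_continuous:
 fixes f :: "real \<Rightarrow> 'v::real_normed_vector"
 assumes d: "\<And>t. t \<in> {a..b} \<Longrightarrow> (f has_vector_derivative g t) (at t within {a..b})"
  and g: "continuous_on {a..b} g"
 shows "abs_continuous_on a b f"
proof -
 have "bounded (g ` {a..b})"
  by (rule compact_imp_bounded[OF compact_continuous_image[OF g compact_Icc]])
 then obtain K where K: "\<And>t. t \<in> {a..b} \<Longrightarrow> norm (g t) \<le> K"
  unfolding bounded_iff by blast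
 show ?thesis
 proof (rule lipschitz_abs_continuous)
  fix u v assume uv: "a \<le> u" "u \<le> v" "v \<le> b"
  have "norm (f v - f u) \<le> K * norm (v - u)"
  proof (rule differentiable_bound)
   show "convex {a..b}" by simp
   show "(f has_derivative (\<lambda>h. h *\<^sub>R g t)) (at t within {a..b})" if "t \<in> {a..b}" for t
   using d[OF that] by (simp add: has_vector_derivative_def)
   show "onorm (\<lambda>h. h *\<^sub>R g t) \<le> K" if "t \<in> {a..b}" for t
   proof (rule onorm_le)
   fix x show "norm (x *\<^sub>R g t) \<le> K * norm x"
   using mult_right_mono[OF K[OF that], of "\<bar>x\<bar>"] by (simp add: mult.commute)
   qed
  qed (use uv in auto)
  then show "norm (f v - f u) \<le> K * (v - u)" using uv by simp
 qed
qed

text \<open>The common source of the closure properties below: only increments matter, so it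
  suffices to dominate those of \<open>f\<close> by those of \<open>g\<close> and
  \<open>h\<close>.\<close>

lemma abs_continuous_sum_bound:
 fixes f :: "real \<Rightarrow> 'v::real_normed_vector" and g h :: "real \<Rightarrow> 'w::real_normed_vector"
 assumes g: "abs_continuous_on a b g" and h: "abs_continuous_on a b h" and K: "0 \<le> K"
  and le: "\<And>u v. a \<le> u \<Longrightarrow> u \<le> v \<Longrightarrow> v \<le> b \<Longrightarrow>
   norm (f v - f u) \<le> K * (norm (g v - g u) + norm (h v - h u))"
 shows "abs_continuous_on a b f"
 unfolding abs_continuous_on_def
proof (intro allI impI)
 fix e :: real assume e: "0 < e"
 define e' where "e' = (e / (K + 1)) / 2"
 have e'0: "0 < e'" using e K by (simp add: e'_def)
 have "e' + e' = e / (K + 1)" unfolding e'_def by (rule field_sum_of_halves)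
 then have "(K + 1) * (e' + e') = e" using K by simp
 with e'0 have e': "0 < e'" "K * (e' + e') < e" by (simp_all add: algebra_simps)
 from g[unfolded abs_continuous_on_def, rule_format, OF e'(1)]
 obtain d1 where d1: "d1 > 0" and g1: "\<forall>(n::nat) u v.
   (\<forall>i<n. a \<le> u i \<and> u i \<le> v i \<and> v i \<le> b) \<and> disjoint_family_on (\<lambda>i. {u i<..<v i}) {..<n} \<and>
   (\<Sum>i<n. v i - u i) < d1 \<longrightarrow> (\<Sum>i<n. norm (g (v i) - g (u i))) < e'" by auto
 from h[unfolded abs_continuous_on_def, rule_format, OF e'(1)]
 obtain d2 where d2: "d2 > 0" and h1: "\<forall>(n::nat) u v.
   (\<forall>i<n. a \<le> u i \<and> u i \<le> v i \<and> v i \<le> b) \<and> disjoint_family_on (\<lambda>i. {u i<..<v i}) {..<n} \<and>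
   (\<Sum>i<n. v i - u i) < d2 \<longrightarrow> (\<Sum>i<n. norm (h (v i) - h (u i))) < e'" by auto
 show "\<exists>\<delta>>0. \<forall>(n::nat) u v. (\<forall>i<n. a \<le> u i \<and> u i \<le> v i \<and> v i \<le> b) \<and>
   disjoint_family_on (\<lambda>i. {u i<..<v i}) {..<n} \<and> (\<Sum>i<n. v i - u i) < \<delta> \<longrightarrow>
   (\<Sum>i<n. norm (f (v i) - f (u i))) < e"
 proof (intro exI[of _ "min d1 d2"] conjI allI impI)
  show "0 < min d1 d2" using d1 d2 by simp
  fix n :: nat and u v
  assume A: "(\<forall>i<n. a \<le> u i \<and> u i \<le> v i \<and> v i \<le> b) \<and>
   disjoint_family_on (\<lambda>i. {u i<..<v i}) {..<n} \<and> (\<Sum>i<n. v i - u i) < min d1 d2"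
  have "(\<Sum>i<n. norm (f (v i) - f (u i))) \<le> (\<Sum>i<n. K * (norm (g (v i) - g (u i)) + norm (h (v i) - h (u i))))"
   by (rule sum_mono) (use A le in auto)
  also have "\<dots> = K * ((\<Sum>i<n. norm (g (v i) - g (u i))) + (\<Sum>i<n. norm (h (v i) - h (u i))))"
   by (simp add: sum_distrib_left sum.distrib distrib_left)
  also have "\<dots> \<le> K * (e' + e')"
   using g1[rule_format, of n u v] h1[rule_format, of n u v] A K
   by (intro mult_left_mono add_mono) auto
  also have "\<dots> < e" by (rule e'(2))
  finally show "(\<Sum>i<n. norm (f (v i) - f (u i))) < e" .
 qed
qed

lemma abs_continuous_add:
 fixes g h :: "real \<Rightarrow> 'v::real_normed_vector"
 assumes "abs_continuous_on a b g" "abs_continuous_on a b h"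
 shows "abs_continuous_on a b (\<lambda>t. g t + h t)"
proof (rule abs_continuous_sum_bound[OF assms zero_le_one])
 fix u v
 show "norm (g v + h v - (g u + h u)) \<le> 1 * (norm (g v - g u) + norm (h v - h u))"
  using norm_triangle_ineq[of "g v - g u" "h v - h u"] by (simp add: algebra_simps)
qed

lemma abs_continuous_bounded_linear:
 fixes g :: "real \<Rightarrow> 'w::real_normed_vector"
 assumes F: "bounded_linear F" and g: "abs_continuous_on a b g"
 shows "abs_continuous_on a b (\<lambda>t. F (g t))"
proof -
 interpret bounded_linear F by (rule F)
 obtain K where K: "0 \<le> K" "\<And>x. norm (F x) \<le> norm x * K" using nonneg_bounded by blast
 show ?thesis
 proof (rule abs_continuous_sum_bound[OF g g K(1)])
  fix u v
  have "norm (F (g v - g u)) \<le> K * norm (g v - g u)" using K(2) by (simp add: mult.commute)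
  also have "\<dots> \<le> K * (norm (g v - g u) + norm (g v - g u))" using K(1) by (intro mult_left_mono) auto
  finally show "norm (F (g v) - F (g u)) \<le> K * (norm (g v - g u) + norm (g v - g u))"
   by (simp add: diff)
 qed
qed

lemma abs_continuous_sum:
 fixes g :: "'i \<Rightarrow> real \<Rightarrow> 'v::real_normed_vector"
 assumes "finite S" "\<And>i. i \<in> S \<Longrightarrow> abs_continuous_on a b (g i)"
 shows "abs_continuous_on a b (\<lambda>t. \<Sum>i\<in>S. g i t)"
 using assms
proof (induction S rule: finite_induct)
 case empty
 show ?case by (rule lipschitz_abs_continuous[where K = 0]) simp
next
 case (insert i S)
 then show ?case by (simp add: abs_continuous_add)
qed

lemma abs_continuous_bilinear:
 fixes g h :: "real \<Rightarrow> 'w::real_normed_vector"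
 assumes B: "bounded_bilinear B" and g: "abs_continuous_on a b g" and h: "abs_continuous_on a b h"
 shows "abs_continuous_on a b (\<lambda>t. B (g t) (h t))"
proof -
 interpret bounded_bilinear B by (rule B)
 obtain K where K: "0 \<le> K" "\<And>x y. norm (B x y) \<le> norm x * norm y * K" using nonneg_bounded by blast
 have bdd: "\<exists>M\<ge>0. \<forall>t\<in>{a..b}. norm (k t) \<le> M" if "abs_continuous_on a b k" for k :: "real \<Rightarrow> 'w"
 proof -
  have "bounded (k ` {a..b})"
   by (rule compact_imp_bounded[OF compact_continuous_image[OF abs_continuous_imp_continuous[OF that] compact_Icc]])
  then obtain M where "\<forall>t\<in>{a..b}. norm (k t) \<le> M" unfolding bounded_iff by blast
  then show ?thesis by (intro exI[of _ "max 0 M"]) auto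
 qed
 obtain G where G: "0 \<le> G" "\<And>t. t \<in> {a..b} \<Longrightarrow> norm (g t) \<le> G" using bdd[OF g] by blast
 obtain H where H: "0 \<le> H" "\<And>t. t \<in> {a..b} \<Longrightarrow> norm (h t) \<le> H" using bdd[OF h] by blast
 define M where "M = K * (G + H)"
 show ?thesis
 proof (rule abs_continuous_sum_bound[OF g h, of M])
  show "0 \<le> M" using K G H by (simp add: M_def)
  fix u v assume uv: "a \<le> u" "u \<le> v" "v \<le> b"
  have "B (g v) (h v) - B (g u) (h u) = B (g v - g u) (h v) + B (g u) (h v - h u)"
   by (simp add: diff_left diff_right)
  also have "norm \<dots> \<le> norm (g v - g u) * norm (h v) * K + norm (g u) * norm (h v - h u) * K"
   by (rule order_trans[OF norm_triangle_ineq]) (intro add_mono K)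
  also have "\<dots> \<le> norm (g v - g u) * H * K + G * norm (h v - h u) * K"
   using uv K by (intro add_mono mult_right_mono mult_left_mono G H) auto
  also have "\<dots> \<le> M * (norm (g v - g u) + norm (h v - h u))"
   using K G H by (simp add: M_def algebra_simps)
  finally show "norm (B (g v) (h v) - B (g u) (h u)) \<le> M * (norm (g v - g u) + norm (h v - h u))" .
 qed
qed

text \<open>The smoothness conditions of the maximal domain without square integrability. Green's
  formula on [0, c] must be available for homogeneous solutions, which need not be square integrable
  up to b.\<close>

definition loc_domain :: "('h::complex_hilbert_space, 'n::finite) diff_expr \<Rightarrow> (real \<Rightarrow> 'h) set" where
 "loc_domain E = {y.
  (\<forall>k\<le>2 * half_order E - 2. Ck_on 1 (interval E) (qderiv E y k)) \<and>
  (\<forall>c\<in>interval E. abs_continuous_on 0 c (qderiv E y (2 * half_order E - 1)))}"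

lemma max_domain_iff:
 "y \<in> max_domain E \<longleftrightarrow> y \<in> loc_domain E \<and> (\<forall>t. t \<notin> interval E \<longrightarrow> y t = 0) \<and>
  sq_integrable (lebesgue_on (interval E)) y \<and> sq_integrable (lebesgue_on (interval E)) (lexpr E y)"
 by (auto simp: max_domain_def loc_domain_def square_integrable_eq)

lemma initial_interval_measurable: "initial_interval S \<Longrightarrow> S \<in> sets lebesgue"
proof -
 assume S: "initial_interval S"
 have "is_interval S"
  unfolding is_interval_1
  using initial_interval_subset[OF S] initial_interval_nonneg[OF S] by (meson atLeastAtMost_iff order_trans subsetD)
 then show ?thesis by (simp add: real_interval_borel_measurable)
qed

lemma AE_lebesgue_on_iff_negligible:
 assumes "S \<in> sets lebesgue"
 shows "(AE t in lebesgue_on S. P t) \<longleftrightarrow> (\<exists>N. negligible N \<and> (\<forall>t\<in>S - N. P t))"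
proof
 assume "AE t in lebesgue_on S. P t"
 then have "AE t in lebesgue. t \<in> S \<longrightarrow> P t"
  using assms by (simp add: AE_restrict_space_iff)
 then obtain N where "N \<in> null_sets lebesgue" "\<And>t. t \<in> space lebesgue - N \<Longrightarrow> t \<in> S \<longrightarrow> P t"
  by (rule AE_E3) blast
 then show "\<exists>N. negligible N \<and> (\<forall>t\<in>S - N. P t)"
  by (intro exI[of _ N]) (auto simp: negligible_iff_null_sets)
next
 assume "\<exists>N. negligible N \<and> (\<forall>t\<in>S - N. P t)"
 then obtain N where N: "N \<in> null_sets lebesgue" "\<And>t. t \<in> S - N \<Longrightarrow> P t"
  by (auto simp: negligible_iff_null_sets)
 have "AE t in lebesgue. t \<in> S \<longrightarrow> P t"
  by (rule AE_I'[OF N(1)]) (use N(2) in auto)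
 then show "AE t in lebesgue_on S. P t"
  using assms by (simp add: AE_restrict_space_iff)
qed

section \<open>Domain elements as solutions of the first-order system\<close>

locale regular_expr =
 fixes E :: "('h::{complex_hilbert_space,second_countable_topology}, 'n::{finite,linorder}) diff_expr"
 assumes reg: "regular_diff_expr E"
begin

abbreviation "I \<equiv> interval E"
abbreviation "n \<equiv> half_order E"
text \<open>Embedding into the coordinate of y^[2n-1], the only one in which an inhomogeneity of the
  equation appears.\<close>

definition src :: "'h \<Rightarrow>\<^sub>B ('h, 'n) vec \<times> ('h, 'n) vec" where "src = qemb (2 * n - 1)"

lemmas I = regular_initial_interval[OF reg]
lemmas I_subset = initial_interval_subset[OF I]
lemmas I_nonneg = initial_interval_nonneg[OF I]

lemma I_measurable: "I \<in> sets lebesgue" by (rule initial_interval_measurable[OF I])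

lemma n_pos: "0 < n" by (rule half_order_pos)

lemma card_n: "CARD('n) = n" by (simp add: half_order_def)

lemma qcomp_src: "k < 2 * n \<Longrightarrow> cblinfun_apply (qcomp k) (src x) = (if k = 2 * n - 1 then x else 0)"
 using n_pos unfolding src_def by (subst qcomp_qemb) (auto simp: card_n)

lemma qcomp_system_src:
 assumes k: "k < 2 * n"
 shows "qcomp k (system_op E z t u - src \<psi>) =
  system_rhs cblinfun_apply E t (z *\<^sub>C qcomp 0 u + \<psi>) (\<lambda>j. qcomp j u) k"
 unfolding system_rhs_inhom[OF k, of _ t "z *\<^sub>C qcomp 0 u + \<psi>" _ "z *\<^sub>C qcomp 0 u"]
 by (simp add: qcomp_src[OF k] qcomp_system_op[OF k])

lemma state_of_system:
 assumes u: "\<And>t. t \<in> I \<Longrightarrow> (u has_vector_derivative (system_op E z t (u t) - src (\<psi> t))) (at t within I)"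
  and y: "\<And>t. t \<in> I \<Longrightarrow> y t = qcomp 0 (u t)" and t: "t \<in> I"
 shows "state E y t = u t" and "lexpr E y t = z *\<^sub>C y t + \<psi> t"
proof -
 define w where "w k t = cblinfun_apply (qcomp k) (u t)" for k t
 have w: "(w k has_vector_derivative system_rhs cblinfun_apply E t (z *\<^sub>C qcomp 0 (u t) + \<psi> t) (\<lambda>j. w j t) k) (at t within I)"
  if k: "k < 2 * n" and t: "t \<in> I" for k t
  using bounded_linear.has_vector_derivative[OF bounded_linear_apply u[OF t], of "qcomp k"]
  unfolding qcomp_system_src[OF k] w_def .
 have y': "y t = w 0 t" if "t \<in> I" for t using y[OF that] by (simp add: w_def)
 note qs = apply_action.quasi_deriv_of_system[OF reg, where w = w and y = y and f = "\<lambda>t. z *\<^sub>C qcomp 0 (u t) + \<psi> t", OF w y' t]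
 have qd: "qderiv E y k t = w k t" if "k < 2 * n" for k
  using qs(1) that by simp
 show "state E y t = u t"
 proof (rule qcomp_eqI)
  fix k assume "k < 2 * CARD('n)"
  then have k: "k < 2 * n" by (simp add: card_n)
  show "cblinfun_apply (qcomp k) (state E y t) = qcomp k (u t)"
   by (simp add: qcomp_state[OF k] qd[OF k] w_def)
 qed
 have "2 * n - 1 < 2 * n" using n_pos by linarith
 have "qderiv E y (2 * n) t = z *\<^sub>C qcomp 0 (u t) + \<psi> t"
  by (rule qs(2)[OF _ _ _ w[OF \<open>2 * n - 1 < 2 * n\<close> t]]) auto
 then show "lexpr E y t = z *\<^sub>C y t + \<psi> t"
  by (simp add: lexpr_def y[OF t])
qed

lemma continuous_system_apply:
 assumes "continuous_on S u" "S \<subseteq> I"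
 shows "continuous_on S (\<lambda>t. system_op E z t (u t))"
 by (rule bounded_bilinear.continuous_on[OF bounded_bilinear_apply
   continuous_on_subset[OF continuous_system_op[OF reg] assms(2)] assms(1)])

lemma system_loc_domain:
 assumes u: "\<And>t. t \<in> I \<Longrightarrow> (u has_vector_derivative (system_op E z t (u t) - src (\<psi> t))) (at t within I)"
  and y: "\<And>t. t \<in> I \<Longrightarrow> y t = qcomp 0 (u t)" and \<psi>: "continuous_on I \<psi>"
 shows "y \<in> loc_domain E"
proof -
 define d where "d t = system_op E z t (u t) - src (\<psi> t)" for t
 have uc: "continuous_on I u"
  by (rule continuous_on_vector_derivative[OF u])
 have dc: "continuous_on I d"
  unfolding d_def
  by (intro continuous_on_diff continuous_system_apply uc order_refl
   bounded_linear.continuous_on[OF bounded_linear_apply \<psi>])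
 have qd: "qderiv E y k t = qcomp k (u t)" if "k < 2 * n" "t \<in> I" for k t
  using state_of_system(1)[OF u y that(2)] qcomp_state[OF that(1), of y t] by simp
 have der: "(qderiv E y k has_vector_derivative qcomp k (d t)) (at t within I)" if "k < 2 * n" "t \<in> I" for k t
  by (rule has_vector_derivative_transform[OF that(2) _
   bounded_linear.has_vector_derivative[OF bounded_linear_apply u[OF that(2)], of "qcomp k", folded d_def]])
   (simp add: qd that)
 have C1: "Ck_on 1 I (qderiv E y k)" if k: "k < 2 * n" for k
  unfolding Ck_on_def
 proof (intro conjI allI impI)
  fix j :: nat assume "j < 1"
  then show "(deriv_on I ^^ j) (qderiv E y k) differentiable_on I"
   using der[OF k] by (auto simp: differentiable_on_def intro: differentiableI_vector)
 next
  have "continuous_on I (\<lambda>t. qcomp k (d t))"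
   by (rule bounded_linear.continuous_on[OF bounded_linear_apply dc])
  then show "continuous_on I ((deriv_on I ^^ 1) (qderiv E y k))"
   by (rule continuous_on_eq) (simp add: deriv_on_eqI[OF I _ der[OF k]])
 qed
 have ac: "abs_continuous_on 0 c (qderiv E y k)" if c: "c \<in> I" and k: "k < 2 * n" for c k
 proof -
  have sub: "{0..c} \<subseteq> I" by (rule I_subset[OF c])
  show ?thesis
   by (rule C1_abs_continuous[OF has_vector_derivative_within_subset[OF der[OF k] sub]
   continuous_on_subset[OF bounded_linear.continuous_on[OF bounded_linear_apply dc] sub]])
   (use sub in auto)
 qed
 show ?thesis
  unfolding loc_domain_def
 proof (intro CollectI conjI allI impI ballI)
  fix k assume "k \<le> 2 * n - 2"
  then have "k < 2 * n" using n_pos by linarith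
  then show "Ck_on 1 I (qderiv E y k)" by (rule C1)
 next
  fix c assume "c \<in> I"
  moreover have "2 * n - 1 < 2 * n" using n_pos by linarith
  ultimately show "abs_continuous_on 0 c (qderiv E y (2 * n - 1))"
   by (rule ac)
 qed
qed

text \<open>All quasi-derivatives but the last are continuously differentiable. The last one is only
  absolutely continuous with values in H, and its almost everywhere differentiability is what yields
  the system off a null set.\<close>

lemma loc_domain_state:
 assumes y: "y \<in> loc_domain E" and c: "c \<in> I"
 shows "abs_continuous_on 0 c (state E y)"
  and "\<exists>N. negligible N \<and> (\<forall>t\<in>{0..c} - N.
   (state E y has_vector_derivative (system_op E z t (state E y t) - src (lexpr E y t - z *\<^sub>C y t))) (at t within {0..c}))"
proof -
 have sub: "{0..c} \<subseteq> I" by (rule I_subset[OF c])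
 have c0: "0 \<le> c" by (rule I_nonneg[OF c])
 have C1: "Ck_on 1 I (qderiv E y k)" if "k < 2 * n - 1" for k
  using y that by (auto simp: loc_domain_def)
 have diff: "qderiv E y k differentiable (at t within I)" if k: "k < 2 * n - 1" and t: "t \<in> I" for k t
 proof -
  have "(deriv_on I ^^ 0) (qderiv E y k) differentiable_on I"
   using C1[OF k] unfolding Ck_on_def by blast
  then show ?thesis using t by (simp add: differentiable_on_def)
 qed
 have der: "(qderiv E y k has_vector_derivative deriv_on I (qderiv E y k) t) (at t within I)"
  if "k < 2 * n - 1" "t \<in> I" for k t
  using diff[OF that] by (simp add: deriv_on_def vector_derivative_works)
 have last: "abs_continuous_on 0 c (qderiv E y (2 * n - 1))"
  using y c by (simp add: loc_domain_def)
 have ac: "abs_continuous_on 0 c (qderiv E y k)" if k: "k < 2 * n" for k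
 proof (cases "k = 2 * n - 1")
  case False
  then have k: "k < 2 * n - 1" using k by linarith
  have "continuous_on I ((deriv_on I ^^ 1) (qderiv E y k))"
   using C1[OF k] by (simp add: Ck_on_def)
  then have "continuous_on I (deriv_on I (qderiv E y k))" by simp
  then show ?thesis
   by (intro C1_abs_continuous[OF has_vector_derivative_within_subset[OF der[OF k] sub]]
   continuous_on_subset[OF _ sub]) (use sub in auto)
 qed (use last in simp)
 have "state E y = (\<lambda>t. \<Sum>k<2 * CARD('n). cblinfun_apply (qemb k) (qderiv E y k t))"
 proof
  fix t
  have "state E y t = (\<Sum>k<2 * CARD('n). cblinfun_apply (qemb k) (cblinfun_apply (qcomp k) (state E y t)))"
   by (rule sum_qemb_qcomp[symmetric])
  also have "\<dots> = (\<Sum>k<2 * CARD('n). cblinfun_apply (qemb k) (qderiv E y k t))"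
   by (rule sum.cong) (simp_all add: qcomp_state card_n)
  finally show "state E y t = (\<Sum>k<2 * CARD('n). cblinfun_apply (qemb k) (qderiv E y k t))" .
 qed
 then show "abs_continuous_on 0 c (state E y)"
  by (simp only:) (intro abs_continuous_sum abs_continuous_bounded_linear[OF bounded_linear_apply] ac; simp add: card_n)
 obtain N0 where N0: "negligible N0" and dl: "\<And>t. t \<in> {0<..<c} - N0 \<Longrightarrow>
   \<exists>d. (qderiv E y (2 * n - 1) has_vector_derivative d) (at t)"
 proof (cases "c = 0")
  case True
  then show ?thesis using that[of "{}"] by auto
 next
  case False
  then show ?thesis using abs_continuous_AE_differentiable[OF last] c0 that by (metis less_eq_real_def)
 qed
 have "(state E y has_vector_derivative (system_op E z t (state E y t) - src (lexpr E y t - z *\<^sub>C y t))) (at t within {0..c})"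
  if t: "t \<in> {0..c} - (N0 \<union> {0, c})" for t
 proof (rule has_vector_derivative_qcomp)
  fix k assume "k < 2 * CARD('n)"
  then have k: "k < 2 * n" by (simp add: card_n)
  have tI: "t \<in> I" and t': "t \<in> {0<..<c} - N0" using t sub by auto
  have "(qderiv E y k has_vector_derivative deriv_on I (qderiv E y k) t) (at t within I)"
  proof (cases "k = 2 * n - 1")
   case True
   obtain d where d: "(qderiv E y k has_vector_derivative d) (at t)"
   using dl[OF t'] True by blast
   then have d': "(qderiv E y k has_vector_derivative d) (at t within I)"
   by (rule has_vector_derivative_at_within)
   show ?thesis using d' deriv_on_eqI[OF I tI d'] by simp
  next
   case False
   then show ?thesis using der[of k t] k tI by auto
  qed
  then have d: "(qderiv E y k has_vector_derivative deriv_on I (qderiv E y k) t) (at t within {0..c})"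
   by (rule has_vector_derivative_within_subset[OF _ sub])
  have eq: "deriv_on I (qderiv E y k) t = qcomp k (system_op E z t (state E y t) - src (lexpr E y t - z *\<^sub>C y t))"
  proof -
   have y0: "cblinfun_apply (qcomp 0) (state E y t) = y t"
   using qcomp_state[of 0 E y t] n_pos by (simp add: quasi_deriv_def)
   have "system_rhs cblinfun_apply E t (lexpr E y t) (\<lambda>j. qderiv E y j t) k =
   system_rhs cblinfun_apply E t (lexpr E y t) (\<lambda>j. qcomp j (state E y t)) k"
   using k by (auto simp: system_rhs_def low_deriv_def top_deriv_def Let_def qcomp_state)
   then show ?thesis
   unfolding qcomp_system_src[OF k] apply_action.deriv_on_quasi_deriv[OF reg tI k]
   by (simp add: y0 lexpr_def)
  qed
  have "(\<lambda>s. qcomp k (state E y s)) = qderiv E y k"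
   by (rule ext) (rule qcomp_state[OF k])
  with d show "((\<lambda>s. qcomp k (state E y s)) has_vector_derivative
   qcomp k (system_op E z t (state E y t) - src (lexpr E y t - z *\<^sub>C y t))) (at t within {0..c})"
   unfolding eq by simp
 qed
 moreover have "negligible (N0 \<union> {0, c})" using N0 by simp
 ultimately show "\<exists>N. negligible N \<and> (\<forall>t\<in>{0..c} - N.
   (state E y has_vector_derivative (system_op E z t (state E y t) - src (lexpr E y t - z *\<^sub>C y t))) (at t within {0..c}))"
  by blast
qed

lemma qcomp_0_state: "cblinfun_apply (qcomp 0) (state E y t) = y t"
 using qcomp_state[of 0 E y t] n_pos by (simp add: quasi_deriv_def)

text \<open>The bracket is a scalar absolutely continuous function whose derivative is given almost
  everywhere by the Lagrange identity.\<close>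

lemma local_green:
 assumes y: "y \<in> loc_domain E" and w: "w \<in> loc_domain E" and c: "c \<in> I"
 shows "((\<lambda>t. cinner (lexpr E y t) (w t) - cinner (y t) (lexpr E w t)) has_integral
  (bracket E y w c - bracket E y w 0)) {0..c}"
proof -
 have sub: "{0..c} \<subseteq> I" by (rule I_subset[OF c])
 obtain N1 where N1: "negligible N1" and d1: "\<And>t. t \<in> {0..c} - N1 \<Longrightarrow>
   (state E y has_vector_derivative (system_op E 0 t (state E y t) - src (lexpr E y t - 0 *\<^sub>C y t))) (at t within {0..c})"
  using loc_domain_state(2)[OF y c, of 0] by blast
 obtain N2 where N2: "negligible N2" and d2: "\<And>t. t \<in> {0..c} - N2 \<Longrightarrow>
   (state E w has_vector_derivative (system_op E 0 t (state E w t) - src (lexpr E w t - 0 *\<^sub>C w t))) (at t within {0..c})"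
  using loc_domain_state(2)[OF w c, of 0] by blast
 have "((\<lambda>t. cinner (lexpr E y t) (w t) - cinner (y t) (lexpr E w t)) has_integral
  (br (state E y c) (state E w c) - br (state E y 0) (state E w 0))) {0..c}"
 proof (rule abs_continuous_ftc)
  show "abs_continuous_on 0 c (\<lambda>t. br (state E y t) (state E w t))"
   by (rule abs_continuous_bilinear[OF bounded_bilinear_br loc_domain_state(1)[OF y c] loc_domain_state(1)[OF w c]])
  show "0 \<le> c" by (rule I_nonneg[OF c])
  show "negligible (N1 \<union> N2)" using N1 N2 by simp
  fix t assume t: "t \<in> {0..c} - (N1 \<union> N2)"
  then have tI: "t \<in> I" using sub by auto
  define u' v' where "u' = system_op E 0 t (state E y t) - src (lexpr E y t - 0 *\<^sub>C y t)"
   and "v' = system_op E 0 t (state E w t) - src (lexpr E w t - 0 *\<^sub>C w t)"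
  have "((\<lambda>t. br (state E y t) (state E w t)) has_vector_derivative
   (br (state E y t) v' + br u' (state E w t))) (at t within {0..c})"
   unfolding u'_def v'_def
   by (rule bounded_bilinear.has_vector_derivative[OF bounded_bilinear_br d1 d2]) (use t in auto)
  moreover have "br u' (state E w t) + br (state E y t) v' = cinner (lexpr E y t) (w t) - cinner (y t) (lexpr E w t)"
   using lagrange_identity[OF reg tI, of u' "lexpr E y t" "state E y t" v' "lexpr E w t" "state E w t"]
   qcomp_system_src[of _ 0 t "state E y t" "lexpr E y t"] qcomp_system_src[of _ 0 t "state E w t" "lexpr E w t"]
   by (simp add: u'_def v'_def qcomp_0_state)
  ultimately show "((\<lambda>t. br (state E y t) (state E w t)) has_vector_derivative
   cinner (lexpr E y t) (w t) - cinner (y t) (lexpr E w t)) (at t within {0..c})"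
   by (simp add: add.commute)
 qed
 then show ?thesis by (simp add: bracket_eq_br)
qed

subsection \<open>Homogeneous solutions\<close>

lemma fund_apply_deriv:
 "t \<in> I \<Longrightarrow> ((\<lambda>t. fund E z t a) has_vector_derivative system_op E z t (fund E z t a)) (at t within I)"
 using bounded_linear.has_vector_derivative[OF bounded_bilinear.bounded_linear_left[OF bounded_bilinear_apply]
   fund_deriv[OF reg], of t z a] by simp

lemma fund_continuous: "continuous_on I (fund E z)"
 by (rule continuous_on_vector_derivative[OF fund_deriv[OF reg]])

lemma Y_zero_continuous: "continuous_on I (\<lambda>t. Y_zero E t z)"
proof -
 have "continuous_on I (\<lambda>t. qcomp 0 o\<^sub>C fund E z t)"
  by (rule bounded_bilinear.continuous_on[OF bounded_bilinear_comp_op continuous_on_const fund_continuous])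
 then show ?thesis by (rule continuous_on_eq) (simp add: Y_zero_eq[OF reg])
qed

lemma Y_zero_solution:
 shows "(\<lambda>t. Y_zero E t z a) \<in> loc_domain E"
  and "t \<in> I \<Longrightarrow> state E (\<lambda>t. Y_zero E t z a) t = fund E z t a"
  and "t \<in> I \<Longrightarrow> lexpr E (\<lambda>t. Y_zero E t z a) t = z *\<^sub>C Y_zero E t z a"
proof -
 have u: "((\<lambda>t. fund E z t a) has_vector_derivative (system_op E z t (fund E z t a) - src 0)) (at t within I)"
  if "t \<in> I" for t
  using fund_apply_deriv[OF that] by simp
 have y: "Y_zero E t z a = qcomp 0 (fund E z t a)" if "t \<in> I" for t
  by (simp add: Y_zero_eq[OF reg that])
 show "(\<lambda>t. Y_zero E t z a) \<in> loc_domain E"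
  by (rule system_loc_domain[where \<psi> = "\<lambda>_. 0", OF u y]) auto
 show "t \<in> I \<Longrightarrow> state E (\<lambda>t. Y_zero E t z a) t = fund E z t a"
  "t \<in> I \<Longrightarrow> lexpr E (\<lambda>t. Y_zero E t z a) t = z *\<^sub>C Y_zero E t z a"
  using state_of_system[where \<psi> = "\<lambda>_. 0" and y = "\<lambda>t. Y_zero E t z a", OF u y, of t] by auto
qed

text \<open>The backward solution through \<open>y\<close> at time \<open>t\<close> has as initial
  value a preimage of \<open>y\<close>.\<close>

lemma fund_surj:
 assumes t: "t \<in> I"
 shows "\<exists>x. fund E z t x = y"
proof -
 have sub: "{0..t} \<subseteq> I" by (rule I_subset[OF t])
 have t0: "0 \<le> t" by (rule I_nonneg[OF t])
 note A = continuous_on_subset[OF continuous_system_op[OF reg] sub, of z]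
 obtain v where v: "v t = y" "\<And>s. s \<in> {0..t} \<Longrightarrow>
   (v has_vector_derivative (system_op E z s (v s) + 0)) (at s within {0..t})"
  using linear_ode_exists_backward[OF bounded_bilinear_apply t0 A continuous_on_const] by blast
 have "fund E z t (v 0) = v t"
 proof (rule linear_ode_unique[where g = "\<lambda>_. 0" and u = "\<lambda>s. fund E z s (v 0)", OF bounded_bilinear_apply A _ v(2)])
  show "((\<lambda>s. fund E z s (v 0)) has_vector_derivative system_op E z s (fund E z s (v 0)) + 0) (at s within {0..t})"
   if "s \<in> {0..t}" for s
   using has_vector_derivative_within_subset[OF fund_apply_deriv sub, of s z "v 0"] that sub by auto
 qed (use t0 in \<open>auto simp: fund_zero[OF reg]\<close>)
 with v(1) show ?thesis by (intro exI[of _ "v 0"]) simp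
qed

lemma br_nondegenerate: "(\<And>y. br u y = 0) \<Longrightarrow> u = 0" for u :: "'a::complex_hilbert_space \<times> 'a"
proof -
 assume "\<And>y. br u y = 0"
 from this[of "(- snd u, fst u)"] have "cinner u u = 0"
  by (simp add: br_def cinner_prod_def)
 then show "u = 0" by simp
qed

text \<open>The equation is known only almost everywhere, so uniqueness is drawn from Green's
  formula: the bracket with any solution at the conjugate point is constant, the values of such
  solutions at \<open>c\<close> fill the whole space, and the form is nondegenerate.\<close>

lemma homogeneous_eq_Y_zero:
 assumes y: "y \<in> loc_domain E" and eq: "AE t in lebesgue_on I. lexpr E y t = z *\<^sub>C y t" and c: "c \<in> I"
 shows "state E y c = fund E z c (state E y 0)" and "y c = Y_zero E c z (state E y 0)"
proof -
 note I0 = initial_interval_zero[OF I]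
 define a where "a = state E y 0"
 have key: "br (state E u c) (fund E (cnj z) c x) = br (state E u 0) x"
  if u: "u \<in> loc_domain E" and eq: "AE t in lebesgue_on I. lexpr E u t = z *\<^sub>C u t" for u x
 proof -
  let ?w = "\<lambda>t. Y_zero E t (cnj z) x"
  obtain N where N: "negligible N" "\<And>t. t \<in> I - N \<Longrightarrow> lexpr E u t = z *\<^sub>C u t"
   using eq unfolding AE_lebesgue_on_iff_negligible[OF I_measurable] by blast
  have "((\<lambda>t. cinner (lexpr E u t) (?w t) - cinner (u t) (lexpr E ?w t)) has_integral 0) {0..c}"
  proof (rule has_integral_spike[OF N(1) _ has_integral_0])
   fix t assume "t \<in> {0..c} - N"
   then have "t \<in> I" "t \<in> I - N" using I_subset[OF c] by auto
   then show "cinner (lexpr E u t) (?w t) - cinner (u t) (lexpr E ?w t) = 0"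
   using N(2) Y_zero_solution(3)[of t "cnj z" x] by (simp add: cinner_linear_simps)
  qed
  from has_integral_unique[OF local_green[OF u Y_zero_solution(1) c] this] show ?thesis
   by (simp add: bracket_eq_br Y_zero_solution(2)[OF c] Y_zero_solution(2)[OF I0] fund_zero[OF reg])
 qed
 have "state E y c - fund E z c a = 0"
 proof (rule br_nondegenerate)
  fix v
  obtain x where x: "fund E (cnj z) c x = v" using fund_surj[OF c] by blast
  have "AE t in lebesgue_on I. lexpr E (\<lambda>t. Y_zero E t z a) t = z *\<^sub>C Y_zero E t z a"
   by (rule AE_I2) (simp add: space_restrict_space Y_zero_solution(3))
  from key[OF Y_zero_solution(1) this, of x] key[OF y eq, of x]
  show "br (state E y c - fund E z c a) v = 0"
   by (simp add: x bounded_bilinear.diff_left[OF bounded_bilinear_br] Y_zero_solution(2)[OF c]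
   Y_zero_solution(2)[OF I0] fund_zero[OF reg] a_def)
 qed
 then show "state E y c = fund E z c (state E y 0)" by (simp add: a_def)
 then show "y c = Y_zero E c z (state E y 0)"
  by (simp add: Y_zero_eq[OF reg c] flip: qcomp_0_state)
qed

end

context regular_expr begin

subsection \<open>Observability\<close>

lemma coeff_continuous:
 shows "k \<le> n \<Longrightarrow> continuous_on I (pcoeff E k)" and "k < n \<Longrightarrow> continuous_on I (qcoeff E k)"
  and "k < n \<Longrightarrow> continuous_on I (\<lambda>t. adj (qcoeff E k t))" and "continuous_on I (\<lambda>t. inverse_op (pcoeff E 0 t))"
proof -
 show p: "continuous_on I (pcoeff E k)" if "k \<le> n" for k
  using reg that by (auto simp: regular_diff_expr_def intro: Ck_on_continuous)
 show q: "continuous_on I (qcoeff E k)" if "k < n" for k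
  using reg that by (auto simp: regular_diff_expr_def intro: Ck_on_continuous)
 show "continuous_on I (\<lambda>t. adj (qcoeff E k t))" if "k < n" for k
  by (rule bounded_linear.continuous_on[OF bounded_linear_adj q[OF that]])
 show "continuous_on I (\<lambda>t. inverse_op (pcoeff E 0 t))"
  by (rule continuous_inverse_op[OF p]) (use reg in \<open>auto simp: regular_diff_expr_def\<close>)
qed

lemma uniform_limit_zero_op:
 fixes B :: "real \<Rightarrow> ('v::complex_normed_vector \<Rightarrow>\<^sub>B 'w::complex_normed_vector)"
 assumes B: "continuous_on {0..c} B" and f: "uniform_limit {0..c} f (\<lambda>_. 0) sequentially"
 shows "uniform_limit {0..c} (\<lambda>m t. B t (f m t)) (\<lambda>_. 0) sequentially"
proof (rule uniform_limitI)
 fix e :: real assume e: "0 < e"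
 have "bounded (B ` {0..c})"
  by (rule compact_imp_bounded[OF compact_continuous_image[OF B compact_Icc]])
 then obtain K0 where "\<forall>t\<in>{0..c}. norm (B t) \<le> K0" unfolding bounded_iff by blast
 then have K: "norm (B t) \<le> \<bar>K0\<bar> + 1" if "t \<in> {0..c}" for t using that by fastforce
 define K where "K = \<bar>K0\<bar> + 1"
 have "K > 0" by (simp add: K_def)
 have "\<forall>\<^sub>F m in sequentially. \<forall>t\<in>{0..c}. dist (f m t) 0 < e / K"
  by (rule uniform_limitD[OF f]) (use e \<open>K > 0\<close> in simp)
 then show "\<forall>\<^sub>F m in sequentially. \<forall>t\<in>{0..c}. dist (B t (f m t)) 0 < e"
 proof eventually_elim
  case (elim m)
  show ?case
  proof
   fix t assume t: "t \<in> {0..c}"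
   have "norm (B t (f m t)) \<le> K * norm (f m t)"
   by (rule order_trans[OF norm_cblinfun_apply_le mult_right_mono[OF K[OF t, folded K_def] norm_ge_zero]])
   also have "\<dots> < K * (e / K)"
   using elim t \<open>K > 0\<close> by (intro mult_strict_left_mono) auto
   finally show "dist (B t (f m t)) 0 < e" using \<open>K > 0\<close> by simp
  qed
 qed
qed

lemma uniform_limit_zero_add:
 fixes f g :: "nat \<Rightarrow> real \<Rightarrow> 'w::real_normed_vector"
 assumes "uniform_limit S f (\<lambda>_. 0) F" "uniform_limit S g (\<lambda>_. 0) F"
 shows "uniform_limit S (\<lambda>m t. f m t + g m t) (\<lambda>_. 0) F"
 using uniform_limit_add[OF assms] by simp

lemma uniform_limit_zero_diff:
 fixes f g :: "nat \<Rightarrow> real \<Rightarrow> 'w::real_normed_vector"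
 assumes "uniform_limit S f (\<lambda>_. 0) F" "uniform_limit S g (\<lambda>_. 0) F"
 shows "uniform_limit S (\<lambda>m t. f m t - g m t) (\<lambda>_. 0) F"
 using uniform_limit_minus[OF assms] by simp

lemma uniform_limit_zero_scaleC:
 fixes f :: "nat \<Rightarrow> real \<Rightarrow> 'w::complex_normed_vector"
 assumes "uniform_limit {0..c} f (\<lambda>_. 0) sequentially"
 shows "uniform_limit {0..c} (\<lambda>m t. a *\<^sub>C f m t) (\<lambda>_. 0) sequentially"
 using uniform_limit_zero_op[OF continuous_on_const[of _ "a *\<^sub>C id_op"] assms] by simp

text \<open>Norm continuity of \<open>Q\<close> handles the whole unit ball at once; this is the
  place of compactness in infinite dimension.\<close>

lemma equicontinuous_apply:
 fixes Q :: "real \<Rightarrow> ('v::complex_normed_vector \<Rightarrow>\<^sub>B 'w::complex_normed_vector)"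
 assumes Q: "continuous_on {0..c} Q" and a: "\<And>m::nat. norm (a m) \<le> 1" and e: "0 < e"
 shows "\<exists>d>0. \<forall>m. \<forall>s\<in>{0..c}. \<forall>t\<in>{0..c}. \<bar>s - t\<bar> < d \<longrightarrow> norm (Q s (a m) - Q t (a m)) < e"
proof -
 have "uniformly_continuous_on {0..c} Q"
  by (rule compact_uniformly_continuous[OF Q compact_Icc])
 then obtain d where d: "d > 0" "\<And>s t. s \<in> {0..c} \<Longrightarrow> t \<in> {0..c} \<Longrightarrow> dist t s < d \<Longrightarrow> dist (Q t) (Q s) < e"
  using e unfolding uniformly_continuous_on_def by blast
 have "norm (Q s (a m) - Q t (a m)) < e" if "s \<in> {0..c}" "t \<in> {0..c}" "\<bar>s - t\<bar> < d" for m s t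
 proof -
  have "norm (Q s (a m) - Q t (a m)) = norm ((Q s - Q t) (a m))" by simp
  also have "\<dots> \<le> norm (Q s - Q t) * norm (a m)" by (rule norm_cblinfun_apply_le)
  also have "\<dots> \<le> norm (Q s - Q t) * 1" by (intro mult_left_mono a) simp
  also have "\<dots> < e" using d(2)[of t s] that by (simp add: dist_norm dist_real_def)
  finally show ?thesis .
 qed
 with d(1) show ?thesis by blast
qed

lemma Y_zero_apply_continuous: "continuous_on I (\<lambda>t. Y_zero E t z x)"
 by (rule bounded_linear.continuous_on[OF bounded_bilinear.bounded_linear_left[OF bounded_bilinear_apply] Y_zero_continuous])

text \<open>If solutions of unit initial norm became small in \<open>L\<^sub>2(0, c)\<close>, then all their quasi-derivatives
 would, one after another, tend uniformly to zero.\<close>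

lemma observability:
 assumes c: "c \<in> I" and c0: "0 < c"
 shows "\<exists>\<delta>>0. \<forall>a. \<delta> * (norm a)\<^sup>2 \<le> integral {0..c} (\<lambda>t. (norm (Y_zero E t z a))\<^sup>2)"
proof (rule ccontr)
 assume neg: "\<not> ?thesis"
 have sub: "{0..c} \<subseteq> I" by (rule I_subset[OF c])
 define En where "En a = integral {0..c} (\<lambda>t. (norm (Y_zero E t z a))\<^sup>2)" for a
 have "\<exists>b. En b < 1 / (real m + 1) * (norm b)\<^sup>2" for m
 proof (rule ccontr)
  assume "\<nexists>b. En b < 1 / (real m + 1) * (norm b)\<^sup>2"
  then have "\<forall>b. 1 / (real m + 1) * (norm b)\<^sup>2 \<le> En b" by (meson not_le)
  moreover have "0 < 1 / (real m + 1)" by simp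
  ultimately show False using neg unfolding En_def by blast
 qed
 then have "\<forall>m. \<exists>b. En b < 1 / (real m + 1) * (norm b)\<^sup>2" by blast
 from choice[OF this] obtain b where b: "\<And>m. En (b m) < 1 / (real m + 1) * (norm (b m))\<^sup>2" by blast
 have yc: "continuous_on {0..c} (\<lambda>t. (norm (Y_zero E t z x))\<^sup>2)" for x
  by (intro continuous_intros continuous_on_subset[OF Y_zero_apply_continuous sub])
 have int: "(\<lambda>s. (norm (Y_zero E s z x))\<^sup>2) integrable_on {0..t}" if "t \<le> c" for x t
  by (rule integrable_continuous_interval[OF continuous_on_subset[OF yc]]) (use that in auto)
 have En0: "0 \<le> En a" for a unfolding En_def by (rule Henstock_Kurzweil_Integration.integral_nonneg[OF int]) auto
 have b0: "b m \<noteq> 0" for m using b[of m] En0[of "b m"] by auto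
 define a where "a m = (1 / norm (b m)) *\<^sub>R b m" for m
 have a1: "norm (a m) = 1" for m using b0 by (simp add: a_def)
 have Ea: "En (a m) < 1 / (real m + 1)" for m
 proof -
  have "En (a m) = (1 / norm (b m))\<^sup>2 * En (b m)"
   unfolding En_def a_def by (simp add: power_mult_distrib power_divide)
  also have "\<dots> < (1 / norm (b m))\<^sup>2 * (1 / (real m + 1) * (norm (b m))\<^sup>2)"
   using b0 by (intro mult_strict_left_mono b) simp
  also have "\<dots> = 1 / (real m + 1)" using b0 by (simp add: power_divide)
  finally show ?thesis .
 qed
 define u where "u m t = fund E z t (a m)" for m t
 define w where "w k m t = cblinfun_apply (qcomp k) (u m t)" for k m t
 let ?null = "\<lambda>f. uniform_limit {0..c} f (\<lambda>_. 0) sequentially"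
 have fc: "continuous_on {0..c} (fund E z)" by (rule continuous_on_subset[OF fund_continuous sub])
 have Yc: "continuous_on {0..c} (\<lambda>t. Y_zero E t z)" by (rule continuous_on_subset[OF Y_zero_continuous sub])
 have Yw: "Y_zero E t z (a m) = w 0 m t" if "t \<in> {0..c}" for m t
  using that sub by (auto simp: Y_zero_eq[OF reg] w_def u_def)
 have null_0: "?null (w 0)"
 proof -
  \<comment> \<open>The energy up to time \<open>t\<close> tends uniformly to zero, and its
    derivative, the squared norm of the solution, is equicontinuous; so L2 smallness becomes uniform
    smallness.\<close>
  define F where "F m t = integral {0..t} (\<lambda>s. (norm (Y_zero E s z (a m)))\<^sup>2)" for m t
  have sq: "?null (\<lambda>m t. (norm (Y_zero E t z (a m)))\<^sup>2)"
  proof (rule uniform_limit_derivative_zero[OF c0, where f = F])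
   show "(F m has_vector_derivative (norm (Y_zero E t z (a m)))\<^sup>2) (at t within {0..c})" if "t \<in> {0..c}" for m t
   unfolding F_def by (rule integral_has_vector_derivative[OF yc that])
   show "?null F"
   proof (rule uniform_limitI)
   fix e :: real assume "0 < e"
   then obtain m0 where m0: "inverse (real (Suc m0)) < e" using reals_Archimedean by blast
   show "\<forall>\<^sub>F m in sequentially. \<forall>t\<in>{0..c}. dist (F m t) 0 < e"
   using eventually_ge_at_top[of m0]
   proof eventually_elim
   case (elim m)
   show ?case
   proof
   fix t assume t: "t \<in> {0..c}"
   have "F m t \<le> En (a m)"
   unfolding F_def En_def
   by (rule integral_subset_le) (use t int in \<open>auto intro: integrable_on_subinterval\<close>)
   moreover have "0 \<le> F m t" unfolding F_def by (rule Henstock_Kurzweil_Integration.integral_nonneg[OF int]) (use t in auto)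
   moreover have "1 / (real m + 1) \<le> inverse (real (Suc m0))"
   using elim by (simp add: inverse_eq_divide frac_le)
   ultimately show "dist (F m t) 0 < e" using Ea[of m] m0 by simp
   qed
   qed
   qed
   fix e :: real assume e: "0 < e"
   have "bounded ((\<lambda>t. Y_zero E t z) ` {0..c})"
   by (rule compact_imp_bounded[OF compact_continuous_image[OF Yc compact_Icc]])
   then obtain K0 where "\<forall>t\<in>{0..c}. norm (Y_zero E t z) \<le> K0" unfolding bounded_iff by blast
   then have K: "norm (Y_zero E t z (a m)) \<le> \<bar>K0\<bar> + 1" if "t \<in> {0..c}" for t m
   using norm_cblinfun_apply_le[of "Y_zero E t z" "a m"] that a1[of m] by fastforce
   define K where "K = \<bar>K0\<bar> + 1"
   have K0: "K > 0" by (simp add: K_def)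
   obtain d where d: "d > 0" and dm: "\<And>m s t. s \<in> {0..c} \<Longrightarrow> t \<in> {0..c} \<Longrightarrow> \<bar>s - t\<bar> < d \<Longrightarrow>
   norm (Y_zero E s z (a m) - Y_zero E t z (a m)) < e / (2 * K)"
   using equicontinuous_apply[OF Yc, of a "e / (2 * K)"] a1 e K0 by auto
   show "\<exists>d>0. \<forall>m. \<forall>s\<in>{0..c}. \<forall>t\<in>{0..c}. \<bar>s - t\<bar> < d \<longrightarrow>
   norm ((norm (Y_zero E s z (a m)))\<^sup>2 - (norm (Y_zero E t z (a m)))\<^sup>2) < e"
   proof (intro exI[of _ d] conjI allI ballI impI d)
   fix m s t assume st: "s \<in> {0..c}" "t \<in> {0..c}" "\<bar>s - t\<bar> < d"
   define p q where "p = norm (Y_zero E s z (a m))" and "q = norm (Y_zero E t z (a m))"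
   have "\<bar>p - q\<bar> < e / (2 * K)"
   unfolding p_def q_def by (rule le_less_trans[OF norm_triangle_ineq3 dm[OF st]])
   moreover have "0 \<le> p" "0 \<le> q" "p + q \<le> 2 * K"
   using K[OF st(1), of m] K[OF st(2), of m] by (auto simp: p_def q_def K_def)
   moreover have "\<bar>p\<^sup>2 - q\<^sup>2\<bar> = \<bar>p - q\<bar> * (p + q)"
   using \<open>0 \<le> p\<close> \<open>0 \<le> q\<close> by (simp add: power2_eq_square square_diff_square_factored abs_mult)
   ultimately have "\<bar>p\<^sup>2 - q\<^sup>2\<bar> \<le> \<bar>p - q\<bar> * (2 * K)"
   by (simp add: mult_left_mono)
   also have "\<dots> < e / (2 * K) * (2 * K)"
   using \<open>\<bar>p - q\<bar> < e / (2 * K)\<close> K0 by (intro mult_strict_right_mono) auto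
   finally show "norm ((norm (Y_zero E s z (a m)))\<^sup>2 - (norm (Y_zero E t z (a m)))\<^sup>2) < e"
   using K0 by (simp add: p_def q_def)
   qed
  qed
  show ?thesis
  proof (rule uniform_limitI)
   fix e :: real assume e: "0 < e"
   have "\<forall>\<^sub>F m in sequentially. \<forall>t\<in>{0..c}. dist ((norm (Y_zero E t z (a m)))\<^sup>2) 0 < e\<^sup>2"
   by (rule uniform_limitD[OF sq]) (use e in simp)
   then show "\<forall>\<^sub>F m in sequentially. \<forall>t\<in>{0..c}. dist (w 0 m t) 0 < e"
   by eventually_elim (use e in \<open>auto simp: Yw power2_less_imp_less\<close>)
  qed
 qed
 \<comment> \<open>The derivative of a component is a norm continuous operator function applied to
   \<open>a m\<close>, hence equicontinuous in \<open>m\<close>.\<close>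
 have null_der: "?null (\<lambda>m t. system_rhs cblinfun_apply E t (z *\<^sub>C w 0 m t) (\<lambda>i. w i m t) k)"
  if k: "k < 2 * n" and nk: "?null (w k)" for k
 proof (rule uniform_limit_derivative_zero[OF c0 _ nk])
  define Q where "Q t = qcomp k o\<^sub>C (system_op E z t o\<^sub>C fund E z t)" for t
  have Qa: "system_rhs cblinfun_apply E t (z *\<^sub>C w 0 m t) (\<lambda>i. w i m t) k = Q t (a m)" for m t
   by (simp add: Q_def qcomp_system_op[OF k] w_def u_def)
  have Qc: "continuous_on {0..c} Q"
   unfolding Q_def
   by (intro bounded_bilinear.continuous_on[OF bounded_bilinear_comp_op] continuous_on_const fc
   continuous_on_subset[OF continuous_system_op[OF reg] sub])
  show "(w k m has_vector_derivative system_rhs cblinfun_apply E t (z *\<^sub>C w 0 m t) (\<lambda>i. w i m t) k) (at t within {0..c})"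
   if "t \<in> {0..c}" for m t
  proof -
   have tI: "t \<in> I" using that sub by auto
   show ?thesis
   unfolding Qa unfolding Q_def w_def u_def comp_op.rep_eq
   by (rule bounded_linear.has_vector_derivative[OF bounded_linear_apply
   has_vector_derivative_within_subset[OF fund_apply_deriv[OF tI] sub]])
  qed
  show "\<exists>d>0. \<forall>m. \<forall>s\<in>{0..c}. \<forall>t\<in>{0..c}. \<bar>s - t\<bar> < d \<longrightarrow>
   norm (system_rhs cblinfun_apply E s (z *\<^sub>C w 0 m s) (\<lambda>i. w i m s) k -
   system_rhs cblinfun_apply E t (z *\<^sub>C w 0 m t) (\<lambda>i. w i m t) k) < e" if "0 < e" for e
   unfolding Qa by (rule equicontinuous_apply[OF Qc _ that]) (simp add: a1)
 qed
 note cs = continuous_on_subset[OF _ sub]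
 have null_all: "?null (w k)" if "k < 2 * n" for k
  using that
 proof (induction k rule: less_induct)
  case (less k)
  show ?case
  proof (cases k)
   case 0
   then show ?thesis using null_0 by simp
  next
   case (Suc j)
   have prev: "?null (w i)" if "i < k" for i
   by (rule less.IH) (use that less.prems in auto)
   define g where "g m t = system_rhs cblinfun_apply E t (z *\<^sub>C w 0 m t) (\<lambda>i. w i m t) j" for m t
   have g: "?null g"
   unfolding g_def by (rule null_der) (use less.prems Suc prev in auto)
   have low: "?null (\<lambda>m t. low_deriv cblinfun_apply E t (\<lambda>i. w i m t) i)" if "i \<le> n" "n < k" for i
   proof (cases "i < n")
   case True
   then show ?thesis using prev[of i] that by (simp add: low_deriv_def)
   next
   case False
   have "?null (\<lambda>m t. inverse_op (pcoeff E 0 t) (w n m t + (\<i> / 2) *\<^sub>C qcoeff E 0 t (w (n - 1) m t)))"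
   using that n_pos
   by (intro uniform_limit_zero_op[OF cs[OF coeff_continuous(4)]] uniform_limit_zero_add prev
   uniform_limit_zero_scaleC uniform_limit_zero_op[OF cs[OF coeff_continuous(2)]]) auto
   then show ?thesis using False by (simp add: low_deriv_def top_deriv_def)
   qed
   \<comment> \<open>Below n the next quasi-derivative is the derivative itself. At n it is obtained
     from D^n y by applying p_0 and subtracting the q_0 term. Above n it is solved from the
     recursion, whose other terms have orders at most n.\<close>
   consider "Suc j < n" | "Suc j = n" | "n \<le> j" by linarith
   then show ?thesis
   proof cases
   case 1
   then have "g = w k" by (auto simp: g_def system_rhs_def low_deriv_def Suc fun_eq_iff)
   with g show ?thesis by simp
   next
   case 2
   have eq: "w k m t = pcoeff E 0 t (g m t) - (\<i> / 2) *\<^sub>C qcoeff E 0 t (w (n - 1) m t)" if "t \<in> {0..c}" for m t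
   proof -
   have "g m t = top_deriv cblinfun_apply E t (\<lambda>i. w i m t)"
   using 2 by (auto simp: g_def system_rhs_def low_deriv_def)
   then show ?thesis
   using apply_action.act_inverse(2)[OF reg, of t] that sub 2
   by (auto simp: top_deriv_def Suc)
   qed
   have "?null (\<lambda>m t. pcoeff E 0 t (g m t) - (\<i> / 2) *\<^sub>C qcoeff E 0 t (w (n - 1) m t))"
   using n_pos 2 Suc
   by (intro uniform_limit_zero_diff uniform_limit_zero_op[OF cs[OF coeff_continuous(1)]] g
   uniform_limit_zero_scaleC uniform_limit_zero_op[OF cs[OF coeff_continuous(2)]] prev) auto
   then show ?thesis
   by (rule uniform_limit_cong'[THEN iffD1, rotated 2]) (use eq in auto)
   next
   case 3
   define i where "i = j - n + 1"
   have i: "i < n" "n + i = k" "0 < i" using 3 less.prems Suc by (auto simp: i_def)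
   let ?l = "\<lambda>m t i. low_deriv cblinfun_apply E t (\<lambda>i. w i m t) i"
   have eq: "w k m t = pcoeff E i t (?l m t (n - i)) + (\<i> / 2) *\<^sub>C
   (adj (qcoeff E (i - 1) t) (?l m t (n - i + 1)) - qcoeff E i t (?l m t (n - i - 1))) - g m t" for m t
   using 3 i unfolding g_def system_rhs_def Let_def i_def[symmetric] by simp
   show ?thesis
   unfolding eq[abs_def]
   using i
   by (intro uniform_limit_zero_diff uniform_limit_zero_add g
   uniform_limit_zero_op[OF cs[OF coeff_continuous(1)]] uniform_limit_zero_scaleC
   uniform_limit_zero_op[OF cs[OF coeff_continuous(2)]] uniform_limit_zero_op[OF cs[OF coeff_continuous(3)]] low) auto
   qed
  qed
 qed
 have lim: "(\<lambda>m. cblinfun_apply (qcomp k) (a m)) \<longlonglongrightarrow> 0" if "k < 2 * n" for k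
 proof -
  have "(\<lambda>m. w k m 0) \<longlonglongrightarrow> 0"
   by (rule tendsto_uniform_limitI[OF null_all[OF that]]) (use c0 in simp)
  then show ?thesis by (simp add: w_def u_def fund_zero[OF reg])
 qed
 have "(\<lambda>m. \<Sum>k<2 * CARD('n). cblinfun_apply (qemb k) (cblinfun_apply (qcomp k) (a m))) \<longlonglongrightarrow>
  (\<Sum>k<2 * CARD('n). cblinfun_apply (qemb k :: 'h \<Rightarrow>\<^sub>B ('h, 'n) vec \<times> ('h, 'n) vec) 0)"
  by (intro tendsto_sum bounded_linear.tendsto[OF bounded_linear_apply] lim) (simp add: card_n)
 then have "a \<longlonglongrightarrow> 0" by (simp add: sum_qemb_qcomp)
 from tendsto_norm[OF this] show False by (simp add: a1 LIMSEQ_const_iff)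
qed

subsection \<open>Compactly supported solutions\<close>

text \<open>The Gram operator of the homogeneous solutions on [0, c]. The weight c - t makes the
  forcing term built from it vanish at \<open>c\<close>, so that its extension by zero is
  continuous.\<close>

definition gram :: "complex \<Rightarrow> real \<Rightarrow> ('h, 'n) vec \<times> ('h, 'n) vec \<Rightarrow>\<^sub>B ('h, 'n) vec \<times> ('h, 'n) vec" where
 "gram z c = integral {0..c} (\<lambda>t. (c - t) *\<^sub>R (adj (Y_zero E t z) o\<^sub>C Y_zero E t z))"

lemma gram_cinner:
 assumes c: "c \<in> I"
 shows "cinner (gram z c x) y = integral {0..c} (\<lambda>t. (c - t) *\<^sub>R cinner (Y_zero E t z x) (Y_zero E t z y))"
proof -
 have sub: "{0..c} \<subseteq> I" by (rule I_subset[OF c])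
 note Yc = continuous_on_subset[OF Y_zero_continuous sub, of z]
 have "continuous_on {0..c} (\<lambda>t. (c - t) *\<^sub>R (adj (Y_zero E t z) o\<^sub>C Y_zero E t z))"
  by (intro continuous_intros bounded_bilinear.continuous_on[OF bounded_bilinear_comp_op] Yc
   bounded_linear.continuous_on[OF bounded_linear_adj])
 note int = integrable_continuous_interval[OF this]
 have bl: "bounded_linear (\<lambda>A :: ('h, 'n) vec \<times> ('h, 'n) vec \<Rightarrow>\<^sub>B ('h, 'n) vec \<times> ('h, 'n) vec. cinner (A x) y)"
  by (rule bounded_linear_compose[OF bounded_bilinear.bounded_linear_left[OF bounded_bilinear_cinner]
   bounded_bilinear.bounded_linear_left[OF bounded_bilinear_apply]])
 show ?thesis
  unfolding gram_def using integral_linear[OF int bl]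
  by (simp add: o_def cinner_scaleR_left cinner_adj')
qed

text \<open>On the left half of the interval the weight is at least c / 2, and observability there
  gives coercivity.\<close>

lemma gram_invertible:
 assumes c: "c \<in> I" and c0: "0 < c"
 shows "boundedly_invertible (gram z c)"
proof -
 have sub: "{0..c} \<subseteq> I" by (rule I_subset[OF c])
 have c2: "c / 2 \<in> I" using sub c0 by auto
 obtain \<delta> where \<delta>: "\<delta> > 0" "\<And>a. \<delta> * (norm a)\<^sup>2 \<le> integral {0..c / 2} (\<lambda>t. (norm (Y_zero E t z a))\<^sup>2)"
 proof -
  have "0 < c / 2" using c0 by simp
  from observability[OF c2 this, of z] that show thesis by blast
 qed
 show ?thesis
 proof (rule coercive_boundedly_invertible)
  show "0 < (c / 2) * \<delta>" using \<delta> c0 by simp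
  fix x
  note Yx = continuous_on_subset[OF Y_zero_apply_continuous sub, of z x]
  have i1: "(\<lambda>t. (c - t) * (norm (Y_zero E t z x))\<^sup>2) integrable_on {0..c}"
   by (intro integrable_continuous_interval continuous_intros Yx)
  have i2: "(\<lambda>t. (c / 2) * (norm (Y_zero E t z x))\<^sup>2) integrable_on {0..c / 2}"
   by (intro integrable_continuous_interval continuous_intros continuous_on_subset[OF Yx]) auto
  have "(c / 2) * \<delta> * (norm x)\<^sup>2 \<le> integral {0..c / 2} (\<lambda>t. (c / 2) * (norm (Y_zero E t z x))\<^sup>2)"
   using mult_left_mono[OF \<delta>(2)[of x], of "c / 2"] c0 by (simp add: mult.assoc)
  also have "\<dots> \<le> integral {0..c / 2} (\<lambda>t. (c - t) * (norm (Y_zero E t z x))\<^sup>2)"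
  proof (rule integral_le[OF i2])
   show "(\<lambda>t. (c - t) * (norm (Y_zero E t z x))\<^sup>2) integrable_on {0..c / 2}"
   by (rule integrable_on_subinterval[OF i1]) (use c0 in auto)
   show "c / 2 * (norm (Y_zero E t z x))\<^sup>2 \<le> (c - t) * (norm (Y_zero E t z x))\<^sup>2" if "t \<in> {0..c / 2}" for t
   by (rule mult_right_mono) (use that c0 in auto)
  qed
  also have "\<dots> \<le> integral {0..c} (\<lambda>t. (c - t) * (norm (Y_zero E t z x))\<^sup>2)"
   by (rule integral_subset_le) (use i1 c0 in \<open>auto intro: integrable_on_subinterval\<close>)
  also have "\<dots> = Re (cinner (gram z c x) x)"
  proof -
   have "cinner (gram z c x) x = integral {0..c} (of_real \<circ> (\<lambda>t. (c - t) * (norm (Y_zero E t z x))\<^sup>2))"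
   unfolding gram_cinner[OF c] by (simp add: cinner_self o_def scaleR_conv_of_real)
   also have "\<dots> = of_real (integral {0..c} (\<lambda>t. (c - t) * (norm (Y_zero E t z x))\<^sup>2))"
   by (rule integral_linear[OF i1 bounded_linear_of_real])
   finally show ?thesis by simp
  qed
  finally show "(c / 2) * \<delta> * (norm x)\<^sup>2 \<le> Re (cinner (gram z c x) x)" .
 qed
qed

definition compact_solution :: "real \<Rightarrow> (real \<Rightarrow> 'h) \<Rightarrow> bool" where
 "compact_solution c w \<longleftrightarrow> w \<in> loc_domain E \<and> continuous_on I (lexpr E w) \<and> (\<forall>t. t \<notin> I \<longrightarrow> w t = 0) \<and>
  (\<forall>t\<in>I. c \<le> t \<longrightarrow> state E w t = 0 \<and> lexpr E w t = 0)"

text \<open>A controllability argument. The bracket of \<open>u\<close> with a homogeneous solution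
  at the conjugate point has the pairing of \<psi> with that solution as derivative;
  \<open>x0\<close> adjusts \<psi> so that at \<open>c\<close> all these brackets become zero, and
  the solution stays zero from there on. The last clause, which characterises \<open>x0\<close>, is
  what \<open>weak_solution_local\<close> needs.\<close>

lemma compact_solution_exists:
 assumes c: "c \<in> I" and c0: "0 < c" and \<phi>: "continuous_on I \<phi>" and \<phi>0: "\<And>t. c \<le> t \<Longrightarrow> \<phi> t = 0"
 shows "\<exists>x0 w. compact_solution c w \<and> state E w 0 = a \<and>
  (\<forall>t\<in>I. lexpr E w t = z *\<^sub>C w t + (\<phi> t - max 0 (c - t) *\<^sub>R Y_zero E t (cnj z) x0)) \<and>
  (\<forall>x. cinner (gram (cnj z) c x0) x = integral {0..c} (\<lambda>t. cinner (\<phi> t) (Y_zero E t (cnj z) x)) + br a x)"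
proof -
 have sub: "{0..c} \<subseteq> I" by (rule I_subset[OF c])
 let ?Y = "\<lambda>t. Y_zero E t (cnj z)"
 note Yc = continuous_on_subset[OF Y_zero_continuous sub, of "cnj z"]
 note \<phi>c = continuous_on_subset[OF \<phi> sub]
 \<comment> \<open>The vector representing the functional that the forcing has to cancel; the second
   summand represents the form \<open>br a\<close>.\<close>
 define b1 where "b1 = integral {0..c} (\<lambda>t. adj (?Y t) (\<phi> t)) + (- snd a, fst a)"
 have b1: "cinner b1 x = integral {0..c} (\<lambda>t. cinner (\<phi> t) (?Y t x)) + br a x" for x
 proof -
  have "(\<lambda>t. adj (?Y t) (\<phi> t)) integrable_on {0..c}"
   by (intro integrable_continuous_interval bounded_bilinear.continuous_on[OF bounded_bilinear_apply]
   bounded_linear.continuous_on[OF bounded_linear_adj] Yc \<phi>c)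
  from integral_linear[OF this bounded_bilinear.bounded_linear_left[OF bounded_bilinear_cinner], of x]
  have "cinner (integral {0..c} (\<lambda>t. adj (?Y t) (\<phi> t))) x = integral {0..c} (\<lambda>t. cinner (\<phi> t) (?Y t x))"
   by (simp add: o_def cinner_adj')
  moreover have "cinner (- snd a, fst a) x = br a x"
   by (simp add: br_def cinner_prod_def)
  ultimately show ?thesis by (simp add: b1_def cinner_add_left)
 qed
 define x0 where "x0 = inverse_op (gram (cnj z) c) b1"
 have x0: "gram (cnj z) c x0 = b1"
  unfolding x0_def by (rule inverse_op_apply(2)[OF gram_invertible[OF c c0]])
 define \<psi> where "\<psi> t = \<phi> t - max 0 (c - t) *\<^sub>R ?Y t x0" for t
 have \<psi>: "continuous_on I \<psi>"
  unfolding \<psi>_def by (intro continuous_intros \<phi> Y_zero_apply_continuous)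
 have \<psi>0: "\<psi> t = 0" if "c \<le> t" for t using that \<phi>0[OF that] by (simp add: \<psi>_def)
 obtain u where u0: "u 0 = a" and u': "\<And>t. t \<in> I \<Longrightarrow>
   (u has_vector_derivative (system_op E z t (u t) + - src (\<psi> t))) (at t within I)"
 proof -
  have "continuous_on I (\<lambda>t. - src (\<psi> t))"
   by (intro continuous_on_minus bounded_linear.continuous_on[OF bounded_linear_apply \<psi>])
  from linear_ode_exists_on[OF bounded_bilinear_apply I continuous_system_op[OF reg] this, of a z] that
  show thesis by blast
 qed
 have u: "(u has_vector_derivative (system_op E z t (u t) - src (\<psi> t))) (at t within I)" if "t \<in> I" for t
  using u'[OF that] by simp
 have vanish: "u t = 0" if t: "t \<in> I" "c \<le> t" for t
 proof (rule br_nondegenerate)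
  fix y
  have subt: "{0..t} \<subseteq> I" by (rule I_subset[OF t(1)])
  obtain x where x: "fund E (cnj z) t x = y" using fund_surj[OF t(1)] by blast
  have d: "((\<lambda>s. br (u s) (fund E (cnj z) s x)) has_vector_derivative cinner (\<psi> s) (?Y s x)) (at s within {0..t})"
   if s: "s \<in> {0..t}" for s
  proof -
   have sI: "s \<in> I" using s subt by auto
   let ?v = "fund E (cnj z) s x"
   have "br (system_op E z s (u s) - src (\<psi> s)) ?v + br (u s) (system_op E (cnj z) s ?v) =
   cinner (z *\<^sub>C qcomp 0 (u s) + \<psi> s) (qcomp 0 ?v) - cinner (qcomp 0 (u s)) (cnj z *\<^sub>C qcomp 0 ?v)"
   by (rule lagrange_identity[OF reg sI]) (simp_all only: qcomp_system_src qcomp_system_op)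
   also have "\<dots> = cinner (\<psi> s) (?Y s x)"
   by (simp add: cinner_linear_simps Y_zero_eq[OF reg sI])
   finally show ?thesis
   using bounded_bilinear.has_vector_derivative[OF bounded_bilinear_br
   has_vector_derivative_within_subset[OF u[OF sI] subt]
   has_vector_derivative_within_subset[OF fund_apply_deriv[OF sI, of "cnj z" x] subt]]
   by (simp add: add.commute)
  qed
  have "((\<lambda>s. cinner (\<psi> s) (?Y s x)) has_integral (br (u t) y - br a x)) {0..t}"
   using fundamental_theorem_of_calculus[OF I_nonneg[OF t(1)] d]
   by (simp add: x u0 fund_zero[OF reg])
  moreover have "((\<lambda>s. cinner (\<psi> s) (?Y s x)) has_integral (- br a x)) {0..t}"
  proof (rule has_integral_on_superset)
   have i1: "(\<lambda>s. cinner (\<phi> s) (?Y s x)) integrable_on {0..c}"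
   by (intro integrable_continuous_interval bounded_bilinear.continuous_on[OF bounded_bilinear_cinner] \<phi>c
   continuous_on_subset[OF Y_zero_apply_continuous sub])
   have i2: "(\<lambda>s. (c - s) *\<^sub>R cinner (?Y s x0) (?Y s x)) integrable_on {0..c}"
   by (intro integrable_continuous_interval continuous_intros
   bounded_bilinear.continuous_on[OF bounded_bilinear_cinner] continuous_on_subset[OF Y_zero_apply_continuous sub])
   have "((\<lambda>s. cinner (\<phi> s) (?Y s x) - (c - s) *\<^sub>R cinner (?Y s x0) (?Y s x)) has_integral
   (integral {0..c} (\<lambda>s. cinner (\<phi> s) (?Y s x)) - cinner (gram (cnj z) c x0) x)) {0..c}"
   unfolding gram_cinner[OF c] by (intro has_integral_diff integrable_integral i1 i2)
   also have "integral {0..c} (\<lambda>s. cinner (\<phi> s) (?Y s x)) - cinner (gram (cnj z) c x0) x = - br a x"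
   by (simp add: x0 b1)
   finally show "((\<lambda>s. cinner (\<psi> s) (?Y s x)) has_integral (- br a x)) {0..c}"
   by (rule has_integral_eq[rotated]) (simp add: \<psi>_def cinner_diff_left cinner_scaleR_left)
   show "cinner (\<psi> s) (?Y s x) = 0" if "s \<notin> {0..c}" for s
   proof (cases "s < 0")
   case True
   then have "s \<notin> I" using I_nonneg by force
   then show ?thesis by (simp add: Y_zero_outside[OF reg])
   qed (use that \<psi>0[of s] in auto)
   show "{0..c} \<subseteq> {0..t}" using t by auto
  qed
  ultimately have "br (u t) y - br a x = - br a x" by (rule has_integral_unique)
  then show "br (u t) y = 0" by simp
 qed
 define w where "w t = (if t \<in> I then cblinfun_apply (qcomp 0) (u t) else 0)" for t
 have w: "w t = qcomp 0 (u t)" if "t \<in> I" for t using that by (simp add: w_def)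
 note sw = state_of_system[OF u w]
 have "compact_solution c w"
  unfolding compact_solution_def
 proof (intro conjI allI impI ballI)
  show "w \<in> loc_domain E" by (rule system_loc_domain[OF u w \<psi>])
  have "continuous_on I (\<lambda>t. z *\<^sub>C cblinfun_apply (qcomp 0) (u t) + \<psi> t)"
   by (intro continuous_on_add \<psi> bounded_linear.continuous_on[OF bounded_linear_scaleC]
   bounded_linear.continuous_on[OF bounded_linear_apply] continuous_on_vector_derivative[OF u])
  then show "continuous_on I (lexpr E w)"
   by (rule continuous_on_eq) (simp add: sw(2) w)
  fix t assume t: "t \<in> I" "c \<le> t"
  show "state E w t = 0" "lexpr E w t = 0"
   using vanish[OF t] \<psi>0[OF t(2)] by (simp_all add: sw[OF _ _ t(1)] w[OF t(1)])
 qed (simp add: w_def)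
 moreover have "state E w 0 = a"
  using sw(1)[OF _ _ initial_interval_zero[OF I]] by (simp add: u0)
 moreover have "\<forall>t\<in>I. lexpr E w t = z *\<^sub>C w t + (\<phi> t - max 0 (c - t) *\<^sub>R ?Y t x0)"
  using sw(2) by (simp add: \<psi>_def)
 moreover have "\<forall>x. cinner (gram (cnj z) c x0) x = integral {0..c} (\<lambda>t. cinner (\<phi> t) (?Y t x)) + br a x"
  unfolding x0 using b1 by (rule allI)
 ultimately show ?thesis by (intro exI[of _ x0] exI[of _ w] conjI)
qed

end

section \<open>Weak solutions\<close>

lemma continuous_indicator_integrable:
 fixes h :: "real \<Rightarrow> 'v::{banach, second_countable_topology}"
 assumes h: "continuous_on {0..c} h"
 shows "integrable lebesgue (\<lambda>t. indicator {0..c} t *\<^sub>R h t)"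
proof -
 have "set_integrable lborel {0..c} h"
  unfolding set_integrable_def by (rule borel_integrable_compact) (use h in auto)
 then have "integrable (completion lborel) (\<lambda>t. indicator {0..c} t *\<^sub>R h t)"
  unfolding set_integrable_def using integrable_completion borel_measurable_integrable by blast
 then show ?thesis .
qed

lemma continuous_cinner_integrable:
 fixes h G :: "real \<Rightarrow> 'v::{complex_hilbert_space, second_countable_topology}"
 assumes h: "continuous_on {0..c} h" and G: "integrable lebesgue G"
  and G0: "\<And>t. t \<notin> {0..c} \<Longrightarrow> G t = 0" and K: "\<And>t. t \<in> {0..c} \<Longrightarrow> norm (h t) \<le> K"
 shows "integrable lebesgue (\<lambda>t. cinner (h t) (G t))"
  and "cmod (\<integral>t. cinner (h t) (G t) \<partial>lebesgue) \<le> K * (\<integral>t. norm (G t) \<partial>lebesgue)"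
proof -
 have bnd: "norm (cinner (h t) (G t)) \<le> K * norm (G t)" for t
 proof (cases "t \<in> {0..c}")
  case True
  have "norm (cinner (h t) (G t)) \<le> norm (h t) * norm (G t)" by (rule cmod_cinner_le)
  also have "\<dots> \<le> K * norm (G t)" using K[OF True] by (rule mult_right_mono) simp
  finally show ?thesis .
 qed (simp add: G0)
 have "(\<lambda>t. indicator {0..c} t *\<^sub>R h t) \<in> borel_measurable lebesgue"
  by (rule borel_measurable_integrable[OF continuous_indicator_integrable[OF h]])
 then have "(\<lambda>t. cinner (indicator {0..c} t *\<^sub>R h t) (G t)) \<in> borel_measurable lebesgue"
  by (rule measurable_cinner) (use G in auto)
 also have "(\<lambda>t. cinner (indicator {0..c} t *\<^sub>R h t) (G t)) = (\<lambda>t. cinner (h t) (G t))"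
 proof
  fix t show "cinner (indicator {0..c} t *\<^sub>R h t) (G t) = cinner (h t) (G t)"
   using G0[of t] by (cases "t \<in> {0..c}") auto
 qed
 finally have m: "(\<lambda>t. cinner (h t) (G t)) \<in> borel_measurable lebesgue" .
 have i: "integrable lebesgue (\<lambda>t. K * norm (G t))" using G by auto
 show int: "integrable lebesgue (\<lambda>t. cinner (h t) (G t))"
  by (rule Bochner_Integration.integrable_bound[OF i m])
   (auto intro!: AE_I2 intro: order_trans[OF bnd abs_ge_self])
 have "cmod (\<integral>t. cinner (h t) (G t) \<partial>lebesgue) \<le> (\<integral>t. K * norm (G t) \<partial>lebesgue)"
  by (rule Bochner_Integration.integral_norm_bound_integral[OF int i]) (use bnd in auto)
 then show "cmod (\<integral>t. cinner (h t) (G t) \<partial>lebesgue) \<le> K * (\<integral>t. norm (G t) \<partial>lebesgue)" by simp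
qed

lemma sq_integrable_truncated_integrable:
 fixes g :: "real \<Rightarrow> 'v::{complex_hilbert_space, second_countable_topology}"
 assumes g: "sq_integrable (lebesgue_on S) g" and S: "S \<in> sets lebesgue" and sub: "{0..c} \<subseteq> S"
 shows "integrable lebesgue (\<lambda>t. indicator {0..c} t *\<^sub>R g t)"
proof -
 have "(\<lambda>t. indicator S t *\<^sub>R g t) \<in> borel_measurable lebesgue"
  using g S unfolding sq_integrable_def by (subst (asm) borel_measurable_restrict_space_iff) auto
 then have "(\<lambda>t. indicator {0..c} t *\<^sub>R (indicator S t *\<^sub>R g t)) \<in> borel_measurable lebesgue"
  by (rule borel_measurable_scaleR[rotated]) (rule borel_measurable_indicator, simp)
 also have "(\<lambda>t. indicator {0..c} t *\<^sub>R (indicator S t *\<^sub>R g t)) = (\<lambda>t. indicator {0..c} t *\<^sub>R g t)"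
  using sub by (auto simp: fun_eq_iff indicator_def)
 finally have m: "(\<lambda>t. indicator {0..c} t *\<^sub>R g t) \<in> borel_measurable lebesgue" .
 have sq: "integrable lebesgue (\<lambda>t. indicator S t *\<^sub>R (norm (g t))\<^sup>2)"
  using g S unfolding sq_integrable_def by (subst (asm) integrable_restrict_space) (auto simp: set_integrable_def)
 have one: "integrable lebesgue (\<lambda>t. indicator {0..c} t *\<^sub>R (1::real))"
  by (rule continuous_indicator_integrable) simp
 show ?thesis
 proof (rule Bochner_Integration.integrable_bound[OF Bochner_Integration.integrable_add[OF one sq] m], rule AE_I2)
  fix t
  have "0 \<le> (norm (g t) - 1)\<^sup>2" by simp
  then have "norm (g t) \<le> 1 + (norm (g t))\<^sup>2" by (simp add: power2_eq_square algebra_simps) (use zero_le_square[of "norm (g t)"] in linarith)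
  then show "norm (indicator {0..c} t *\<^sub>R g t) \<le> norm (indicator {0..c} t *\<^sub>R 1 + indicator S t *\<^sub>R (norm (g t))\<^sup>2)"
   using sub by (auto simp: indicator_def)
 qed
qed

text \<open>Continuous approximations of the indicator of the points before \<open>t\<close> show
  that the primitive of \<open>F\<close> vanishes before \<open>c\<close>, and \<open>F\<close> is
  its derivative almost everywhere.\<close>

lemma integral_zero_imp_AE_zero:
 fixes F :: "real \<Rightarrow> 'v::{complex_hilbert_space, second_countable_topology}"
 assumes F: "integrable lebesgue F" and F0: "\<And>t. t \<notin> {0..c} \<Longrightarrow> F t = 0"
  and orth: "\<And>\<phi>. continuous_on UNIV \<phi> \<Longrightarrow> (\<And>t. c \<le> t \<Longrightarrow> \<phi> t = 0) \<Longrightarrow> (\<integral>t. cinner (\<phi> t) (F t) \<partial>lebesgue) = 0"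
 shows "AE t in lebesgue. F t = 0"
proof -
 have prim: "primitive F t = 0" if t: "t < c" for t
 proof (rule cinner_eqI_right)
  fix e
  have cut: "max 0 (min 1 x) = 0" if "x \<le> 0" for x :: real using that by simp
  \<comment> \<open>A ramp of width 1 / m ending at \<open>t\<close>, so that it is zero from
    \<open>c\<close> on as the orthogonality hypothesis demands.\<close>
  define \<rho> where "\<rho> m s = max 0 (min 1 (real m * (t - s)))" for m s
  have lim: "(\<lambda>m. \<rho> m s) \<longlonglongrightarrow> indicator {..<t} s" for s
  proof (cases "s < t")
   case True
   obtain m0 where m0: "1 / (t - s) < real m0" using reals_Archimedean2 by blast
   have "\<forall>\<^sub>F m in sequentially. \<rho> m s = 1"
   using eventually_ge_at_top[of m0]
   proof eventually_elim
   case (elim m)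
   then have "1 / (t - s) < real m" using m0 by linarith
   then have "1 < real m * (t - s)" using True by (simp add: field_simps)
   then show ?case by (simp add: \<rho>_def)
   qed
   then show ?thesis using True by (auto intro: tendsto_eventually)
  next
   case False
   then have "real m * (t - s) \<le> 0" for m by (intro mult_nonneg_nonpos) auto
   then have "\<rho> m s = 0" for m unfolding \<rho>_def by (rule cut)
   then show ?thesis using False by simp
  qed
  have zero: "(\<integral>s. cinner (\<rho> m s *\<^sub>R e) (F s) \<partial>lebesgue) = 0" for m
  proof (rule orth)
   show "continuous_on UNIV (\<lambda>s. \<rho> m s *\<^sub>R e)" unfolding \<rho>_def by (intro continuous_intros)
   show "\<rho> m s *\<^sub>R e = 0" if "c \<le> s" for s
   proof -
   have "real m * (t - s) \<le> 0" using that t by (intro mult_nonneg_nonpos) auto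
   then show ?thesis unfolding \<rho>_def by (simp only: cut scaleR_zero_left)
   qed
  qed
  have mF: "F \<in> borel_measurable lebesgue" using F by auto
  have "(\<lambda>m. \<integral>s. cinner (\<rho> m s *\<^sub>R e) (F s) \<partial>lebesgue) \<longlonglongrightarrow>
   (\<integral>s. cinner (indicator {0..<t} s *\<^sub>R e) (F s) \<partial>lebesgue)"
  proof (rule integral_dominated_convergence[where w = "\<lambda>s. norm e * norm (F s)"])
   show "(\<lambda>s. cinner (indicator {0..<t} s *\<^sub>R e) (F s)) \<in> borel_measurable lebesgue"
   by (rule measurable_cinner[OF borel_measurable_scaleR[OF borel_measurable_indicator borel_measurable_const] mF]) simp
   show "(\<lambda>s. cinner (\<rho> m s *\<^sub>R e) (F s)) \<in> borel_measurable lebesgue" for m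
   proof (rule measurable_cinner[OF _ mF])
   have "(\<lambda>s. \<rho> m s *\<^sub>R e) \<in> borel_measurable borel" unfolding \<rho>_def
   by (intro borel_measurable_continuous_onI continuous_intros)
   then have "(\<lambda>s. \<rho> m s *\<^sub>R e) \<in> borel_measurable lborel" by simp
   then show "(\<lambda>s. \<rho> m s *\<^sub>R e) \<in> borel_measurable lebesgue" by (rule measurable_completion)
   qed
   show "integrable lebesgue (\<lambda>s. norm e * norm (F s))" using F by auto
   show "AE s in lebesgue. (\<lambda>m. cinner (\<rho> m s *\<^sub>R e) (F s)) \<longlonglongrightarrow> cinner (indicator {0..<t} s *\<^sub>R e) (F s)"
   proof (rule AE_I2)
   fix s
   have "(\<lambda>m. \<rho> m s *\<^sub>R cinner e (F s)) \<longlonglongrightarrow> indicator {..<t} s *\<^sub>R cinner e (F s)"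
   by (intro tendsto_scaleR lim tendsto_const)
   also have "indicator {..<t} s *\<^sub>R cinner e (F s) = cinner (indicator {0..<t} s *\<^sub>R e) (F s)"
   using F0[of s] by (auto simp: indicator_def cinner_scaleR_left)
   finally show "(\<lambda>m. cinner (\<rho> m s *\<^sub>R e) (F s)) \<longlonglongrightarrow> cinner (indicator {0..<t} s *\<^sub>R e) (F s)"
   by (simp add: cinner_scaleR_left)
   qed
   show "AE s in lebesgue. norm (cinner (\<rho> m s *\<^sub>R e) (F s)) \<le> norm e * norm (F s)" for m
   proof (rule AE_I2)
   fix s
   have "norm (cinner (\<rho> m s *\<^sub>R e) (F s)) = \<bar>\<rho> m s\<bar> * cmod (cinner e (F s))"
   by (simp add: cinner_scaleR_left)
   also have "\<dots> \<le> 1 * (norm e * norm (F s))"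
   by (intro mult_mono cmod_cinner_le) (auto simp: \<rho>_def)
   finally show "norm (cinner (\<rho> m s *\<^sub>R e) (F s)) \<le> norm e * norm (F s)" by simp
   qed
  qed
  then have "(\<integral>s. cinner (indicator {0..<t} s *\<^sub>R e) (F s) \<partial>lebesgue) = 0"
   unfolding zero by (simp add: LIMSEQ_const_iff)
  moreover have "cinner e (primitive F t) = (\<integral>s. cinner e (indicator {0..<t} s *\<^sub>R F s) \<partial>lebesgue)"
   unfolding primitive_def
   by (rule integral_bounded_linear[symmetric, OF bounded_bilinear.bounded_linear_right[OF bounded_bilinear_cinner]])
   (intro integrable_mult_indicator F, simp)
  ultimately show "cinner e (primitive F t) = cinner e 0"
   by (simp add: cinner_scaleR_left cinner_scaleR_right)
 qed
 obtain N where N: "negligible N" "\<And>x. 0 < x \<Longrightarrow> x \<notin> N \<Longrightarrow> (primitive F has_vector_derivative F x) (at x)"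
  using primitive_has_vector_derivative[OF F] by blast
 have "F x = 0" if "x \<notin> N \<union> {0, c}" for x
 proof (cases "x \<in> {0..c}")
  case True
  then have x: "0 < x" "x < c" "x \<notin> N" using that by auto
  have "(primitive F has_vector_derivative 0) (at x)"
  proof (rule has_vector_derivative_transform_within_open[where f = "\<lambda>_. 0" and S = "{..<c}"])
   show "((\<lambda>_. 0) has_vector_derivative 0) (at x)" by (rule has_vector_derivative_const)
  qed (use x prim in auto)
  with N(2)[OF x(1,3)] show ?thesis by (rule vector_derivative_unique_at)
 qed (rule F0)
 moreover have "negligible (N \<union> {0, c})" using N by simp
 ultimately show ?thesis
  by (intro AE_I'[of "N \<union> {0, c}"]) (auto simp: negligible_iff_null_sets)
qed

context regular_expr begin

lemma gram_selfadjoint: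
 assumes c: "c \<in> I"
 shows "cinner (gram z c x) y = cinner x (gram z c y)"
proof -
 have "cinner x (gram z c y) = cnj (cinner (gram z c y) x)" by (rule cinner_commute)
 also have "\<dots> = integral {0..c} (\<lambda>t. cnj ((c - t) *\<^sub>R cinner (Y_zero E t z y) (Y_zero E t z x)))"
  unfolding gram_cinner[OF c] by (simp add: integral_cnj o_def)
 also have "\<dots> = cinner (gram z c x) y"
  unfolding gram_cinner[OF c] by (simp add: cinner_commute[symmetric])
 finally show ?thesis by simp
qed

text \<open>Every test function \<phi> is of the form (l - z) w plus a multiple (c - t) of a
  homogeneous solution with parameter \<open>x0\<close>. The candidate \<open>x1\<close> is fixed so
  that this second part has the same pairing with \<open>G\<close> and with the solution for
  \<open>x1\<close>; hence their difference is orthogonal to every \<phi>.\<close>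

lemma weak_solution_local:
 assumes c: "c \<in> I" and c0: "0 < c" and G: "integrable lebesgue G" and G0: "\<And>t. t \<notin> {0..c} \<Longrightarrow> G t = 0"
  and orth: "\<And>w. compact_solution c w \<Longrightarrow> state E w 0 = 0 \<Longrightarrow>
   (\<integral>t. cinner (lexpr E w t - z *\<^sub>C w t) (G t) \<partial>lebesgue) = 0"
 shows "\<exists>x1. AE t in lebesgue. t \<in> {0..c} \<longrightarrow> G t = Y_zero E t (cnj z) x1"
proof -
 have sub: "{0..c} \<subseteq> I" by (rule I_subset[OF c])
 let ?Y = "\<lambda>t. Y_zero E t (cnj z)"
 let ?B = "gram (cnj z) c"
 note Yc = continuous_on_subset[OF Y_zero_continuous sub, of "cnj z"]
 note Yxc = continuous_on_subset[OF Y_zero_apply_continuous sub, of "cnj z"]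
 have "bounded (?Y ` {0..c})"
  by (rule compact_imp_bounded[OF compact_continuous_image[OF Yc compact_Icc]])
 then obtain K where K: "\<And>t. t \<in> {0..c} \<Longrightarrow> norm (?Y t) \<le> K" unfolding bounded_iff by blast
 define f where "f x = (\<integral>t. cinner ((c - t) *\<^sub>R ?Y t x) (G t) \<partial>lebesgue)" for x
 have bnd: "norm ((c - t) *\<^sub>R ?Y t x) \<le> c * (K * norm x)" if t: "t \<in> {0..c}" for t x
 proof -
  have "norm ((c - t) *\<^sub>R ?Y t x) = \<bar>c - t\<bar> * norm (?Y t x)" by simp
  also have "\<dots> \<le> c * (K * norm x)"
   using t by (intro mult_mono order_trans[OF norm_cblinfun_apply_le] mult_right_mono K) auto
  finally show ?thesis .
 qed
 have pYc: "continuous_on {0..c} (\<lambda>t. (c - t) *\<^sub>R ?Y t x)" for x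
  by (intro continuous_intros Yxc)
 note fint = continuous_cinner_integrable[OF pYc G G0 bnd]
 have "bounded_clinear f"
 proof (rule bounded_linear_cblinfunI)
  show "f (x + y) = f x + f y" for x y
   unfolding f_def by (subst Bochner_Integration.integral_add[symmetric, OF fint(1) fint(1)])
   (simp_all add: scaleR_add_right cinner_add_left)
  show "f (a *\<^sub>C x) = a *\<^sub>C f x" for a x
  proof -
   have "f (a *\<^sub>C x) = (\<integral>t. a * cinner ((c - t) *\<^sub>R ?Y t x) (G t) \<partial>lebesgue)"
   unfolding f_def by (simp add: cinner_scaleR_left cinner_scaleC_left cblinfun_apply_scaleC)
   then show ?thesis by (simp add: f_def scaleC_complex_def)
  qed
  show "norm (f x) \<le> (c * K * (\<integral>t. norm (G t) \<partial>lebesgue)) * norm x" for x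
   using fint(2)[of x] by (simp add: f_def mult_ac)
 qed
 then obtain b0 where b0: "\<And>x. f x = cinner x b0" by (rule riesz_representation) blast
 define x1 where "x1 = inverse_op ?B b0"
 have x1: "?B x1 = b0"
  unfolding x1_def by (rule inverse_op_apply(2)[OF gram_invertible[OF c c0]])
 define F where "F t = G t - indicator {0..c} t *\<^sub>R ?Y t x1" for t
 have iY: "integrable lebesgue (\<lambda>t. indicator {0..c} t *\<^sub>R ?Y t x1)"
  by (rule continuous_indicator_integrable[OF Yxc])
 have F: "integrable lebesgue F"
  unfolding F_def by (intro Bochner_Integration.integrable_diff G iY)
 have "AE t in lebesgue. F t = 0"
 proof (rule integral_zero_imp_AE_zero[OF F])
  show "F t = 0" if "t \<notin> {0..c}" for t using that G0[of t] by (simp add: F_def)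
  fix \<phi> :: "real \<Rightarrow> 'h" assume \<phi>: "continuous_on UNIV \<phi>" and \<phi>0: "\<And>t. c \<le> t \<Longrightarrow> \<phi> t = 0"
  have \<phi>I: "continuous_on I \<phi>" and \<phi>c: "continuous_on {0..c} \<phi>"
   using \<phi> by (auto intro: continuous_on_subset)
  obtain x0 w where w: "compact_solution c w" "state E w 0 = 0"
   and lw: "\<And>t. t \<in> I \<Longrightarrow> lexpr E w t = z *\<^sub>C w t + (\<phi> t - max 0 (c - t) *\<^sub>R ?Y t x0)"
   and gx: "\<And>x. cinner (?B x0) x = integral {0..c} (\<lambda>t. cinner (\<phi> t) (?Y t x)) + br 0 x"
   using compact_solution_exists[OF c c0 \<phi>I \<phi>0, of 0 z] by blast
  have "bounded (\<phi> ` {0..c})"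
   by (rule compact_imp_bounded[OF compact_continuous_image[OF \<phi>c compact_Icc]])
  then obtain L where L: "\<And>t. t \<in> {0..c} \<Longrightarrow> norm (\<phi> t) \<le> L" unfolding bounded_iff by blast
  have i1: "integrable lebesgue (\<lambda>t. cinner (\<phi> t) (G t))"
   by (rule continuous_cinner_integrable(1)[OF \<phi>c G G0 L])
  have i2: "integrable lebesgue (\<lambda>t. cinner (\<phi> t) (indicator {0..c} t *\<^sub>R ?Y t x1))"
   by (rule continuous_cinner_integrable(1)[OF \<phi>c iY _ L]) auto
  have "(\<lambda>t. cinner (lexpr E w t - z *\<^sub>C w t) (G t)) = (\<lambda>t. cinner (\<phi> t) (G t) - cinner ((c - t) *\<^sub>R ?Y t x0) (G t))"
  proof
   fix t show "cinner (lexpr E w t - z *\<^sub>C w t) (G t) = cinner (\<phi> t) (G t) - cinner ((c - t) *\<^sub>R ?Y t x0) (G t)"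
   proof (cases "t \<in> {0..c}")
   case True
   then have "lexpr E w t - z *\<^sub>C w t = \<phi> t - (c - t) *\<^sub>R ?Y t x0" using lw[of t] sub by auto
   then show ?thesis by (simp only: cinner_diff_left)
   qed (simp add: G0)
  qed
  with orth[OF w] have "0 = (\<integral>t. cinner (\<phi> t) (G t) - cinner ((c - t) *\<^sub>R ?Y t x0) (G t) \<partial>lebesgue)"
   by simp
  also have "\<dots> = (\<integral>t. cinner (\<phi> t) (G t) \<partial>lebesgue) - f x0"
   unfolding f_def by (rule Bochner_Integration.integral_diff[OF i1 fint(1)])
  finally have "(\<integral>t. cinner (\<phi> t) (G t) \<partial>lebesgue) = f x0" by simp
  also have "\<dots> = cinner (?B x0) x1"
   by (simp add: b0 gram_selfadjoint[OF c] x1)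
  also have "\<dots> = integral {0..c} (\<lambda>t. cinner (\<phi> t) (?Y t x1))"
   by (simp add: gx br_def)
  also have "\<dots> = (\<integral>t. cinner (\<phi> t) (indicator {0..c} t *\<^sub>R ?Y t x1) \<partial>lebesgue)"
  proof -
   have "set_integrable lebesgue {0..c} (\<lambda>t. cinner (\<phi> t) (?Y t x1))"
   using i2 by (simp add: set_integrable_def cinner_scaleR_right)
   from set_lebesgue_integral_eq_integral(2)[OF this] show ?thesis
   by (simp add: set_lebesgue_integral_def cinner_scaleR_right)
  qed
  finally show "(\<integral>t. cinner (\<phi> t) (F t) \<partial>lebesgue) = 0"
   unfolding F_def cinner_diff_right by (simp add: Bochner_Integration.integral_diff[OF i1 i2])
 qed
 then show ?thesis
  by (intro exI[of _ x1]) (auto simp: F_def elim: AE_mp)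
qed

lemma interior_in_I: "0 \<le> t \<Longrightarrow> ereal t < endpoint E \<Longrightarrow> t \<in> I"
 using reg by (auto simp: regular_diff_expr_def)

lemma I_bounds: "t \<in> I \<Longrightarrow> 0 \<le> t \<and> ereal t \<le> endpoint E"
 using reg by (auto simp: regular_diff_expr_def)

lemma integral_lebesgue_on_I:
 fixes h :: "real \<Rightarrow> 'v::{banach, second_countable_topology}"
 shows "(\<integral>t. h t \<partial>lebesgue_on I) = (\<integral>t. indicator I t *\<^sub>R h t \<partial>lebesgue)"
 using I_measurable by (subst integral_restrict_space) auto

text \<open>The hypothesis says that \<open>g\<close> is orthogonal to the range of \<open>L - z\<close> on the compactly supported
 functions vanishing at \<open>0\<close> with all their quasi-derivatives.\<close>

lemma weak_solution:
 assumes g: "sq_integrable (lebesgue_on I) g"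
  and orth: "\<And>c w. 0 < c \<Longrightarrow> ereal c < endpoint E \<Longrightarrow> compact_solution c w \<Longrightarrow> state E w 0 = 0 \<Longrightarrow>
   (\<integral>t. cinner (lexpr E w t - z *\<^sub>C w t) (g t) \<partial>lebesgue_on I) = 0"
 shows "\<exists>x1. AE t in lebesgue_on I. g t = Y_zero E t (cnj z) x1"
proof -
 have ex: "\<exists>x1. AE t in lebesgue. t \<in> {0..c} \<longrightarrow> g t = Y_zero E t (cnj z) x1"
  if c: "0 < c" "ereal c < endpoint E" for c
 proof -
  have cI: "c \<in> I" by (rule interior_in_I) (use c in auto)
  have sub: "{0..c} \<subseteq> I" by (rule I_subset[OF cI])
  let ?G = "\<lambda>t. indicator {0..c} t *\<^sub>R g t"
  have "\<exists>x1. AE t in lebesgue. t \<in> {0..c} \<longrightarrow> ?G t = Y_zero E t (cnj z) x1"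
  proof (rule weak_solution_local[OF cI c(1)])
   show "integrable lebesgue ?G" by (rule sq_integrable_truncated_integrable[OF g I_measurable sub])
   fix w assume w: "compact_solution c w" "state E w 0 = 0"
   have "(\<lambda>t. indicator I t *\<^sub>R cinner (lexpr E w t - z *\<^sub>C w t) (g t)) = (\<lambda>t. cinner (lexpr E w t - z *\<^sub>C w t) (?G t))"
   proof
   fix t
   have "lexpr E w t - z *\<^sub>C w t = 0" if "t \<in> I" "t \<notin> {0..c}"
   proof -
   have t: "c \<le> t" using that I_nonneg[OF that(1)] by auto
   then have "state E w t = 0" "lexpr E w t = 0" using w(1) that(1) by (auto simp: compact_solution_def)
   then show ?thesis using qcomp_0_state[of w t] by simp
   qed
   then show "indicator I t *\<^sub>R cinner (lexpr E w t - z *\<^sub>C w t) (g t) = cinner (lexpr E w t - z *\<^sub>C w t) (?G t)"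
   using sub by (auto simp: indicator_def)
   qed
   with orth[OF c w] show "(\<integral>t. cinner (lexpr E w t - z *\<^sub>C w t) (?G t) \<partial>lebesgue) = 0"
   unfolding integral_lebesgue_on_I by simp
  qed simp
  then obtain x1 where "AE t in lebesgue. t \<in> {0..c} \<longrightarrow> ?G t = Y_zero E t (cnj z) x1" by blast
  then have "AE t in lebesgue. t \<in> {0..c} \<longrightarrow> g t = Y_zero E t (cnj z) x1"
   by eventually_elim simp
  then show ?thesis by blast
 qed
 \<comment> \<open>Observability makes the parameter unique, so the parameters found on different
   intervals coincide.\<close>
 have uniq: "x = x'" if c: "0 < c" "ereal c < endpoint E"
  and "AE t in lebesgue. t \<in> {0..c} \<longrightarrow> g t = Y_zero E t (cnj z) x"
  and "AE t in lebesgue. t \<in> {0..c} \<longrightarrow> g t = Y_zero E t (cnj z) x'" for c x x'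
 proof -
  have cI: "c \<in> I" by (rule interior_in_I) (use c in auto)
  obtain \<delta> where \<delta>: "\<delta> > 0" "\<And>a. \<delta> * (norm a)\<^sup>2 \<le> integral {0..c} (\<lambda>t. (norm (Y_zero E t (cnj z) a))\<^sup>2)"
   using observability[OF cI c(1), of "cnj z"] by blast
  from that(3,4) have "AE t in lebesgue. t \<in> {0..c} \<longrightarrow> Y_zero E t (cnj z) (x - x') = 0"
   by eventually_elim simp
  then obtain N where N: "N \<in> null_sets lebesgue" "\<And>t. t \<in> space lebesgue - N \<Longrightarrow> t \<in> {0..c} \<longrightarrow> Y_zero E t (cnj z) (x - x') = 0"
   by (rule AE_E3) blast
  have "integral {0..c} (\<lambda>t. (norm (Y_zero E t (cnj z) (x - x')))\<^sup>2) = integral {0..c} (\<lambda>t. 0)"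
   by (rule integral_spike[of N]) (use N in \<open>auto simp: negligible_iff_null_sets simp del: cblinfun_apply_diff\<close>)
  then have "\<delta> * (norm (x - x'))\<^sup>2 \<le> 0" using \<delta>(2)[of "x - x'"] by simp
  then have "norm (x - x') = 0" using \<delta>(1) by (simp add: mult_le_0_iff)
  then show "x = x'" by simp
 qed
 obtain d where d: "0 < d" "ereal d < endpoint E"
 proof -
  have "0 < endpoint E" using reg by (simp add: regular_diff_expr_def)
  from ereal_dense2[OF this] that show thesis by (auto simp: zero_ereal_def)
 qed
 obtain x1 where x1: "AE t in lebesgue. t \<in> {0..d} \<longrightarrow> g t = Y_zero E t (cnj z) x1" using ex[OF d] by blast
 have all: "AE t in lebesgue. t \<in> {0..c} \<longrightarrow> g t = Y_zero E t (cnj z) x1"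
  if c: "0 < c" "ereal c < endpoint E" for c
 proof -
  obtain x2 where x2: "AE t in lebesgue. t \<in> {0..c} \<longrightarrow> g t = Y_zero E t (cnj z) x2" using ex[OF c] by blast
  have m: "0 < min c d" "ereal (min c d) < endpoint E" using c d by (auto simp: min_def)
  have "x1 = x2"
  proof (rule uniq[OF m])
   show "AE t in lebesgue. t \<in> {0..min c d} \<longrightarrow> g t = Y_zero E t (cnj z) x1"
   using x1 by eventually_elim auto
   show "AE t in lebesgue. t \<in> {0..min c d} \<longrightarrow> g t = Y_zero E t (cnj z) x2"
   using x2 by eventually_elim auto
  qed
  with x2 show ?thesis by simp
 qed
 \<comment> \<open>Rational \<open>c\<close> exhaust the interval up to its right end point while
   keeping the union of the null sets countable.\<close>
 have "AE t in lebesgue. \<forall>c\<in>{c\<in>\<rat>. 0 < c \<and> ereal c < endpoint E}. t \<in> {0..c} \<longrightarrow> g t = Y_zero E t (cnj z) x1"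
 proof (subst AE_ball_countable)
  show "countable {c\<in>\<rat>. 0 < c \<and> ereal c < endpoint E}"
   by (rule countable_subset[OF _ countable_rat]) auto
  show "\<forall>c\<in>{c\<in>\<rat>. 0 < c \<and> ereal c < endpoint E}. AE t in lebesgue. t \<in> {0..c} \<longrightarrow> g t = Y_zero E t (cnj z) x1"
   using all by blast
 qed
 moreover have "AE t in lebesgue. t \<noteq> real_of_ereal (endpoint E)"
  by (rule AE_I'[of "{real_of_ereal (endpoint E)}"]) auto
 ultimately have "AE t in lebesgue. t \<in> I \<longrightarrow> g t = Y_zero E t (cnj z) x1"
 proof eventually_elim
  case (elim t)
  show ?case
  proof
   assume t: "t \<in> I"
   have "ereal t \<noteq> endpoint E" using elim(2) by (metis real_of_ereal.simps(1))
   then have "ereal t < endpoint E" "0 \<le> t" using I_bounds[OF t] by auto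
   from ereal_dense2[OF this(1)] obtain r where r: "ereal t < ereal r" "ereal r < endpoint E" by blast
   then obtain c where c: "c \<in> \<rat>" "t < c" "c < r" using Rats_dense_in_real[of t r] by auto
   then have "0 < c" "ereal c < endpoint E" using r(2) \<open>0 \<le> t\<close> by (auto intro: less_trans[of _ "ereal r"])
   then show "g t = Y_zero E t (cnj z) x1" using elim(1) c \<open>0 \<le> t\<close> by auto
  qed
 qed
 then have "AE t in lebesgue_on I. g t = Y_zero E t (cnj z) x1"
  using I_measurable by (simp add: AE_restrict_space_iff)
 then show ?thesis by (rule exI)
qed

section \<open>Elements of the maximal domain and of the defect spaces\<close>

lemma compact_solution_max_domain:
 assumes w: "compact_solution c w" and c: "c \<in> I"
 shows "w \<in> max_domain E"
proof -
 have sub: "{0..c} \<subseteq> I" by (rule I_subset[OF c])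
 have wl: "w \<in> loc_domain E" and lc: "continuous_on I (lexpr E w)" and off: "\<forall>t. t \<notin> I \<longrightarrow> w t = 0"
  and van: "\<And>t. t \<in> I \<Longrightarrow> c \<le> t \<Longrightarrow> state E w t = 0 \<and> lexpr E w t = 0"
  using w by (auto simp: compact_solution_def)
 have wc: "continuous_on {0..c} w"
 proof -
  have "continuous_on {0..c} (state E w)"
   by (rule abs_continuous_imp_continuous[OF loc_domain_state(1)[OF wl c]])
  then have "continuous_on {0..c} (\<lambda>t. cblinfun_apply (qcomp 0) (state E w t))"
   by (rule bounded_linear.continuous_on[OF bounded_linear_apply])
  then show ?thesis by (simp add: qcomp_0_state)
 qed
 have sq: "sq_integrable (lebesgue_on I) h" if hc: "continuous_on {0..c} h" and h0: "\<And>t. t \<in> I \<Longrightarrow> c \<le> t \<Longrightarrow> h t = 0"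
  for h :: "real \<Rightarrow> 'h"
 proof -
  have eq: "h t = indicator {0..c} t *\<^sub>R h t" if "t \<in> I" for t
   using h0[OF that] I_nonneg[OF that] by (auto simp: indicator_def)
  have "(\<lambda>t. indicator {0..c} t *\<^sub>R h t) \<in> borel_measurable lebesgue"
   using continuous_indicator_integrable[OF hc] by auto
  then have "(\<lambda>t. indicator {0..c} t *\<^sub>R h t) \<in> borel_measurable (lebesgue_on I)"
   by (rule measurable_restrict_space1)
  then have m: "h \<in> borel_measurable (lebesgue_on I)"
   by (rule measurable_cong[THEN iffD1, rotated]) (use eq in \<open>simp add: space_restrict_space\<close>)
  have "integrable lebesgue (\<lambda>t. indicator {0..c} t *\<^sub>R (norm (h t))\<^sup>2)"
   by (rule continuous_indicator_integrable) (intro continuous_intros hc)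
  also have "(\<lambda>t. indicator {0..c} t *\<^sub>R (norm (h t))\<^sup>2) = (\<lambda>t. indicator I t *\<^sub>R (norm (h t))\<^sup>2)"
  proof
   fix t show "indicator {0..c} t *\<^sub>R (norm (h t))\<^sup>2 = indicator I t *\<^sub>R (norm (h t))\<^sup>2"
   using sub h0[of t] initial_interval_nonneg[OF I, of t]
   by (cases "t \<in> I"; cases "t \<le> c") (auto simp: indicator_def)
  qed
  finally have "integrable (lebesgue_on I) (\<lambda>t. (norm (h t))\<^sup>2)"
   using I_measurable by (subst integrable_restrict_space) (auto simp: set_integrable_def)
  with m show ?thesis by (simp add: sq_integrable_def)
 qed
 show ?thesis
  unfolding max_domain_iff
 proof (intro conjI wl off sq wc continuous_on_subset[OF lc sub])
  show "lexpr E w t = 0" if "t \<in> I" "c \<le> t" for t using van[OF that] by simp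
  show "w t = 0" if "t \<in> I" "c \<le> t" for t using van[OF that] qcomp_0_state[of w t] by simp
 qed
qed

lemma Y_zero_defect:
 assumes "sq_integrable (lebesgue_on I) (\<lambda>t. Y_zero E t z a)"
 shows "(\<lambda>t. Y_zero E t z a) \<in> defect_space E z"
proof -
 have "sq_integrable (lebesgue_on I) (lexpr E (\<lambda>t. Y_zero E t z a))"
 proof -
  have "sq_integrable (lebesgue_on I) (\<lambda>t. z *\<^sub>C Y_zero E t z a)"
   by (rule sq_integrable_scaleC[OF assms])
  moreover have eq: "lexpr E (\<lambda>t. Y_zero E t z a) t = z *\<^sub>C Y_zero E t z a" if "t \<in> space (lebesgue_on I)" for t
   using that Y_zero_solution(3) by (simp add: space_restrict_space)
  moreover have "integrable (lebesgue_on I) (\<lambda>t. (norm (lexpr E (\<lambda>t. Y_zero E t z a) t))\<^sup>2) \<longleftrightarrow>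
   integrable (lebesgue_on I) (\<lambda>t. (norm (z *\<^sub>C Y_zero E t z a))\<^sup>2)"
   by (rule Bochner_Integration.integrable_cong) (simp_all only: eq)
  moreover have "lexpr E (\<lambda>t. Y_zero E t z a) \<in> borel_measurable (lebesgue_on I) \<longleftrightarrow>
   (\<lambda>t. z *\<^sub>C Y_zero E t z a) \<in> borel_measurable (lebesgue_on I)"
   by (rule measurable_cong) (rule eq)
  ultimately show ?thesis
   unfolding sq_integrable_def by (simp only:)
 qed
 moreover have "AE t in lebesgue_on I. lexpr E (\<lambda>t. Y_zero E t z a) t = z *\<^sub>C Y_zero E t z a"
  by (rule AE_I2) (use Y_zero_solution(3) in \<open>simp add: space_restrict_space\<close>)
 ultimately show ?thesis
  using assms Y_zero_solution(1)[of z a]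
  by (auto simp: defect_space_def max_domain_iff Y_zero_outside[OF reg])
qed

lemma defect_eq_Y_zero:
 assumes "y \<in> defect_space E z"
 shows "y = (\<lambda>t. Y_zero E t z (state E y 0))"
proof
 fix t
 have y: "y \<in> loc_domain E" "\<forall>t. t \<notin> I \<longrightarrow> y t = 0" "AE t in lebesgue_on I. lexpr E y t = z *\<^sub>C y t"
  using assms by (auto simp: defect_space_def max_domain_iff)
 show "y t = Y_zero E t z (state E y 0)"
  using homogeneous_eq_Y_zero(2)[OF y(1,3), of t] y(2) by (cases "t \<in> I") (auto simp: Y_zero_outside[OF reg])
qed

end

section \<open>The maximal operator\<close>

lemma measurable_lebesgue_on_AE_eq:
 fixes f g :: "real \<Rightarrow> 'v::topological_space"
 assumes f: "f \<in> borel_measurable (lebesgue_on S)" and S: "S \<in> sets lebesgue"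
  and ae: "AE t in lebesgue_on S. g t = f t"
 shows "g \<in> borel_measurable (lebesgue_on S)"
proof (rule borel_measurableI)
 fix U :: "'v set" assume U: "open U"
 obtain N where N: "negligible N" "\<And>t. t \<in> S - N \<Longrightarrow> g t = f t"
  using ae unfolding AE_lebesgue_on_iff_negligible[OF S] by blast
 have sp: "space (lebesgue_on S) = S" by (simp add: space_restrict_space)
 have "f -` U \<inter> space (lebesgue_on S) \<in> sets (lebesgue_on S)"
  by (rule measurable_sets[OF f]) (use U in simp)
 then have fU: "f -` U \<inter> S \<in> sets lebesgue" unfolding sp using S by (simp add: sets_restrict_space_iff)
 have "negligible (g -` U \<inter> S \<inter> N)" by (rule negligible_subset[OF N(1)]) auto
 then have "g -` U \<inter> S \<inter> N \<in> sets lebesgue" by (simp add: negligible_iff_null_sets null_setsD2)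
 moreover have "N \<in> sets lebesgue" using N(1) by (simp add: negligible_iff_null_sets null_setsD2)
 ultimately have "(f -` U \<inter> S - N) \<union> (g -` U \<inter> S \<inter> N) \<in> sets lebesgue"
  by (intro sets.Un sets.Diff fU)
 also have "(f -` U \<inter> S - N) \<union> (g -` U \<inter> S \<inter> N) = g -` U \<inter> S" using N(2) by auto
 finally have "g -` U \<inter> S \<in> sets lebesgue" .
 then show "g -` U \<inter> space (lebesgue_on S) \<in> sets (lebesgue_on S)"
  unfolding sp using S by (simp add: sets_restrict_space_iff)
qed

lemma sq_integrable_AE_eq:
 fixes f g :: "real \<Rightarrow> 'v::{complex_hilbert_space, second_countable_topology}"
 assumes f: "sq_integrable (lebesgue_on S) f" and S: "S \<in> sets lebesgue"
  and ae: "AE t in lebesgue_on S. g t = f t"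
 shows "sq_integrable (lebesgue_on S) g"
proof -
 have m: "g \<in> borel_measurable (lebesgue_on S)"
  by (rule measurable_lebesgue_on_AE_eq[OF _ S ae]) (use f in \<open>simp add: sq_integrable_def\<close>)
 have i: "integrable (lebesgue_on S) (\<lambda>t. (norm (f t))\<^sup>2)" using f by (simp add: sq_integrable_def)
 have "integrable (lebesgue_on S) (\<lambda>t. (norm (g t))\<^sup>2)"
 proof (rule Bochner_Integration.integrable_cong_AE_imp[OF i])
  show "(\<lambda>t. (norm (g t))\<^sup>2) \<in> borel_measurable (lebesgue_on S)" using m by measurable
  show "AE t in lebesgue_on S. (norm (f t))\<^sup>2 = (norm (g t))\<^sup>2" using ae by eventually_elim simp
 qed
 with m show ?thesis by (simp add: sq_integrable_def)
qed

lemma abs_continuous_cong: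
 assumes f: "abs_continuous_on a b f" and eq: "\<And>t. t \<in> {a..b} \<Longrightarrow> f t = g t"
 shows "abs_continuous_on a b g"
proof (rule abs_continuous_sum_bound[OF f f zero_le_one])
 fix u v assume "a \<le> u" "u \<le> v" "v \<le> b"
 then show "norm (g v - g u) \<le> 1 * (norm (f v - f u) + norm (f v - f u))" using eq[of u] eq[of v] by simp
qed

context regular_expr begin

text \<open>Replaces limits along \<open>to_endpoint\<close> by sequential ones, with finite and
  infinite b treated together, as dominated convergence requires.\<close>

lemma endpoint_sequence:
 obtains s :: "nat \<Rightarrow> real" where "\<And>m. 0 < s m" "\<And>m. ereal (s m) < endpoint E"
  "filterlim s (to_endpoint E) sequentially" "\<And>t. ereal t < endpoint E \<Longrightarrow> \<forall>\<^sub>F m in sequentially. t < s m"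
proof -
 have E0: "0 < endpoint E" using reg by (simp add: regular_diff_expr_def)
 show thesis
 proof (cases "endpoint E")
  case PInf
  have lim: "filterlim (\<lambda>m. real m + 1) at_top sequentially"
   by (rule filterlim_at_top_mono[OF filterlim_real_sequentially]) simp
  show thesis
  proof (rule that[of "\<lambda>m. real m + 1"])
   show "filterlim (\<lambda>m. real m + 1) (to_endpoint E) sequentially"
   using lim PInf by (simp add: to_endpoint_def)
   show "\<forall>\<^sub>F m in sequentially. t < real m + 1" for t
   using lim by (auto simp: filterlim_at_top_dense)
  qed (use PInf in auto)
 next
  case (real e)
  have e: "0 < e" using E0 real by simp
  define s where "s m = e - e / (real m + 2)" for m
  have lim: "s \<longlonglongrightarrow> e"
  proof -
   have "(\<lambda>m. e / (real m + 2)) \<longlonglongrightarrow> 0"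
   by (rule tendsto_divide_0[OF tendsto_const], rule filterlim_mono[OF _ at_top_le_at_infinity order_refl],
   rule filterlim_at_top_mono[OF filterlim_real_sequentially]) simp
   from tendsto_diff[OF tendsto_const[of e] this] show ?thesis by (simp add: s_def[abs_def])
  qed
  have less: "s m < e" for m using e by (simp add: s_def)
  have neq: "s m \<noteq> e" for m using less[of m] by simp
  show thesis
  proof (rule that[of s])
   show "0 < s m" for m
   proof -
   have "e / (real m + 2) < e" using e by (simp add: divide_less_eq)
   then show ?thesis by (simp add: s_def)
   qed
   show "ereal (s m) < endpoint E" for m using less real by simp
   show "filterlim s (to_endpoint E) sequentially"
   using lim less neq real by (simp add: to_endpoint_def filterlim_at)
   show "\<forall>\<^sub>F m in sequentially. t < s m" if "ereal t < endpoint E" for t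
   using order_tendstoD(1)[OF lim, of t] that real by simp
  qed
 qed (use E0 in auto)
qed

section \<open>Linearity of the differential expression up to null sets\<close>

lemma loc_domain_has_vector_derivative:
 assumes y: "y \<in> loc_domain E" and k: "k < 2 * n - 1" and t: "t \<in> I"
 shows "(qderiv E y k has_vector_derivative deriv_on I (qderiv E y k) t) (at t within I)"
proof -
 have "Ck_on 1 I (qderiv E y k)" using y k by (auto simp: loc_domain_def)
 then have "(deriv_on I ^^ 0) (qderiv E y k) differentiable_on I" unfolding Ck_on_def by blast
 then show ?thesis using t by (simp add: differentiable_on_def deriv_on_def vector_derivative_works)
qed

lemma deriv_on_state:
 assumes k: "k < 2 * n" and t: "t \<in> I"
 shows "deriv_on I (qderiv E y k) t = qcomp k (system_op E 0 t (state E y t) - src (lexpr E y t))"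
proof -
 have "system_rhs cblinfun_apply E t (lexpr E y t) (\<lambda>j. qderiv E y j t) k =
  system_rhs cblinfun_apply E t (lexpr E y t) (\<lambda>j. qcomp j (state E y t)) k"
  using k by (auto simp: system_rhs_def low_deriv_def top_deriv_def Let_def qcomp_state)
 then show ?thesis
  unfolding qcomp_system_src[OF k] apply_action.deriv_on_quasi_deriv[OF reg t k]
  by (simp add: lexpr_def)
qed

lemma lincomb_qcomp_deriv:
 assumes y: "(qderiv E y k has_vector_derivative deriv_on I (qderiv E y k) t) (at t within I)"
  and w: "(qderiv E w k has_vector_derivative deriv_on I (qderiv E w k) t) (at t within I)"
  and k: "k < 2 * n" and t: "t \<in> I"
 shows "((\<lambda>t. qcomp k (a *\<^sub>C state E y t + state E w t)) has_vector_derivative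
  system_rhs cblinfun_apply E t (a *\<^sub>C lexpr E y t + lexpr E w t)
   (\<lambda>j. qcomp j (a *\<^sub>C state E y t + state E w t)) k) (at t within I)"
proof -
 have "(\<lambda>t. cblinfun_apply (qcomp k) (a *\<^sub>C state E y t + state E w t)) = (\<lambda>t. a *\<^sub>C qderiv E y k t + qderiv E w k t)"
  by (simp add: qcomp_state[OF k] fun_eq_iff)
 moreover have "((\<lambda>t. a *\<^sub>C qderiv E y k t + qderiv E w k t) has_vector_derivative
   a *\<^sub>C deriv_on I (qderiv E y k) t + deriv_on I (qderiv E w k) t) (at t within I)"
  by (rule has_vector_derivative_add[OF bounded_linear.has_vector_derivative[OF bounded_linear_scaleC y] w])
 moreover have "a *\<^sub>C deriv_on I (qderiv E y k) t + deriv_on I (qderiv E w k) t =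
   qcomp k (system_op E 0 t (a *\<^sub>C state E y t + state E w t) - src (a *\<^sub>C lexpr E y t + lexpr E w t))"
  by (simp add: deriv_on_state[OF k t] scaleC_diff_right)
 ultimately show ?thesis
  using qcomp_system_src[OF k, of 0 t "a *\<^sub>C state E y t + state E w t" "a *\<^sub>C lexpr E y t + lexpr E w t"] by simp
qed

lemma lincomb_system:
 assumes y: "y \<in> loc_domain E" and w: "w \<in> loc_domain E" and k: "k < 2 * n - 1" and t: "t \<in> I"
 shows "((\<lambda>t. qcomp k (a *\<^sub>C state E y t + state E w t)) has_vector_derivative
  system_rhs cblinfun_apply E t (a *\<^sub>C lexpr E y t + lexpr E w t)
   (\<lambda>j. qcomp j (a *\<^sub>C state E y t + state E w t)) k) (at t within I)"
 by (rule lincomb_qcomp_deriv[OF loc_domain_has_vector_derivative[OF y k t]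
   loc_domain_has_vector_derivative[OF w k t] _ t]) (use k in linarith)

lemma state_lincomb:
 assumes y: "y \<in> loc_domain E" and w: "w \<in> loc_domain E" and t: "t \<in> I"
 shows "state E (\<lambda>t. a *\<^sub>C y t + w t) t = a *\<^sub>C state E y t + state E w t"
proof (rule qcomp_eqI)
 fix k assume "k < 2 * CARD('n)"
 then have k: "k < 2 * n" by (simp add: card_n)
 have "qderiv E (\<lambda>t. a *\<^sub>C y t + w t) k t = qcomp k (a *\<^sub>C state E y t + state E w t)"
  by (rule apply_action.quasi_deriv_of_system(1)[OF reg lincomb_system[OF y w] _ t k])
   (simp_all add: qcomp_0_state)
 then show "cblinfun_apply (qcomp k) (state E (\<lambda>t. a *\<^sub>C y t + w t) t) = qcomp k (a *\<^sub>C state E y t + state E w t)"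
  by (simp add: qcomp_state[OF k])
qed

lemma qderiv_lincomb:
 assumes y: "y \<in> loc_domain E" and w: "w \<in> loc_domain E" and t: "t \<in> I" and k: "k < 2 * n"
 shows "qderiv E (\<lambda>t. a *\<^sub>C y t + w t) k t = a *\<^sub>C qderiv E y k t + qderiv E w k t"
 using arg_cong[OF state_lincomb[OF y w t, of a], of "cblinfun_apply (qcomp k)"] by (simp add: qcomp_state[OF k])

lemma loc_domain_lincomb:
 assumes y: "y \<in> loc_domain E" and w: "w \<in> loc_domain E"
 shows "(\<lambda>t. a *\<^sub>C y t + w t) \<in> loc_domain E"
proof -
 let ?x = "\<lambda>t. a *\<^sub>C y t + w t"
 have C1: "Ck_on 1 I (qderiv E ?x k)" if k: "k < 2 * n - 1" for k
 proof -
  have k2: "k < 2 * n" using k by linarith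
  have d: "(qderiv E ?x k has_vector_derivative a *\<^sub>C deriv_on I (qderiv E y k) t + deriv_on I (qderiv E w k) t) (at t within I)"
   if t: "t \<in> I" for t
   by (rule has_vector_derivative_transform[OF t qderiv_lincomb[OF y w _ k2]
   has_vector_derivative_add[OF bounded_linear.has_vector_derivative[OF bounded_linear_scaleC] ]])
   (use loc_domain_has_vector_derivative[OF _ k t] y w in auto)
  have c: "continuous_on I (deriv_on I (qderiv E u k))" if "u \<in> loc_domain E" for u
  proof -
   have "Ck_on 1 I (qderiv E u k)" using that k by (auto simp: loc_domain_def)
   then have "continuous_on I ((deriv_on I ^^ 1) (qderiv E u k))" by (simp add: Ck_on_def)
   then show ?thesis by simp
  qed
  have "continuous_on I (\<lambda>t. a *\<^sub>C deriv_on I (qderiv E y k) t + deriv_on I (qderiv E w k) t)"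
   by (intro continuous_on_add bounded_linear.continuous_on[OF bounded_linear_scaleC] c y w)
  then have "continuous_on I (deriv_on I (qderiv E ?x k))"
   by (rule continuous_on_eq) (simp add: deriv_on_eqI[OF I _ d])
  moreover have "qderiv E ?x k differentiable_on I"
   using d by (auto simp: differentiable_on_def intro: differentiableI_vector)
  ultimately show ?thesis by (simp add: Ck_on_def)
 qed
 have ac: "abs_continuous_on 0 c (qderiv E ?x (2 * n - 1))" if c: "c \<in> I" for c
 proof (rule abs_continuous_cong)
  show "abs_continuous_on 0 c (\<lambda>t. a *\<^sub>C qderiv E y (2 * n - 1) t + qderiv E w (2 * n - 1) t)"
   using y w c
   by (intro abs_continuous_add abs_continuous_bounded_linear[OF bounded_linear_scaleC]) (auto simp: loc_domain_def)
  have k: "2 * n - 1 < 2 * n" using n_pos by linarith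
  show "a *\<^sub>C qderiv E y (2 * n - 1) t + qderiv E w (2 * n - 1) t = qderiv E ?x (2 * n - 1) t" if "t \<in> {0..c}" for t
   by (rule qderiv_lincomb[OF y w _ k, symmetric]) (use I_subset[OF c] that in auto)
 qed
 show ?thesis
  unfolding loc_domain_def
 proof (intro CollectI conjI allI impI ballI ac)
  fix k assume "k \<le> 2 * n - 2"
  then show "Ck_on 1 I (qderiv E ?x k)" by (intro C1) (use n_pos in linarith)
 qed
qed

lemma loc_domain_AE_differentiable:
 assumes y: "y \<in> loc_domain E"
 shows "AE t in lebesgue_on I. \<forall>k<2 * n. (qderiv E y k has_vector_derivative deriv_on I (qderiv E y k) t) (at t within I)"
proof -
 let ?q = "qderiv E y (2 * n - 1)"
 obtain s where s: "\<And>m. 0 < s m" "\<And>m. ereal (s m) < endpoint E"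
  "filterlim s (to_endpoint E) sequentially" "\<And>t. ereal t < endpoint E \<Longrightarrow> \<forall>\<^sub>F m in sequentially. t < s m"
  by (rule endpoint_sequence) blast
 have sI: "s m \<in> I" for m by (rule interior_in_I) (use s(1,2)[of m] in auto)
 have "\<exists>N. negligible N \<and> (\<forall>x\<in>{0<..<s m} - N. \<exists>d. (?q has_vector_derivative d) (at x))" for m
  by (rule abs_continuous_AE_differentiable) (use y sI s(1) in \<open>auto simp: loc_domain_def\<close>)
 then have "\<forall>m. \<exists>N. negligible N \<and> (\<forall>x\<in>{0<..<s m} - N. \<exists>d. (?q has_vector_derivative d) (at x))" by blast
 from choice[OF this] obtain N where N: "\<And>m. negligible (N m)"
  "\<And>m x. x \<in> {0<..<s m} - N m \<Longrightarrow> \<exists>d. (?q has_vector_derivative d) (at x)" by blast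
 define N' where "N' = (\<Union>m. N m) \<union> {0, real_of_ereal (endpoint E)}"
 have "negligible N'" unfolding N'_def using negligible_Union_nat[OF N(1)] by simp
 moreover have "(?q has_vector_derivative deriv_on I ?q t) (at t within I)" if t: "t \<in> I - N'" for t
 proof -
  have "ereal t \<noteq> endpoint E" using t by (metis DiffD2 N'_def UnI2 insert_iff real_of_ereal.simps(1))
  then have t': "ereal t < endpoint E" "0 < t" using I_bounds[of t] t by (auto simp: N'_def)
  from eventually_happens[OF s(4)[OF t'(1)]] obtain m where "t < s m" by auto
  then have "t \<in> {0<..<s m} - N m" using t t' by (auto simp: N'_def)
  from N(2)[OF this] obtain d where "(?q has_vector_derivative d) (at t)" by blast
  then have d: "(?q has_vector_derivative d) (at t within I)" by (rule has_vector_derivative_at_within)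
  then show ?thesis using deriv_on_eqI[OF I _ d] t by simp
 qed
 moreover have "(qderiv E y k has_vector_derivative deriv_on I (qderiv E y k) t) (at t within I)"
  if "k < 2 * n - 1" "t \<in> I" for k t
  by (rule loc_domain_has_vector_derivative[OF y that])
 ultimately have "\<forall>t\<in>I - N'. \<forall>k<2 * n. (qderiv E y k has_vector_derivative deriv_on I (qderiv E y k) t) (at t within I)"
  by (metis DiffD1 less_Suc_eq Suc_diff_1 n_pos nat_0_less_mult_iff zero_less_numeral)
 then show ?thesis
  using \<open>negligible N'\<close> unfolding AE_lebesgue_on_iff_negligible[OF I_measurable] by blast
qed

text \<open>Where y^[2n-1] is not differentiable, the total function
  \<open>vector_derivative\<close> has an arbitrary value, so linearity can be claimed only at
  common points of differentiability.\<close>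

lemma lexpr_lincomb:
 assumes y: "y \<in> loc_domain E" and w: "w \<in> loc_domain E"
 shows "AE t in lebesgue_on I. lexpr E (\<lambda>t. a *\<^sub>C y t + w t) t = a *\<^sub>C lexpr E y t + lexpr E w t"
proof -
 have "AE t in lebesgue_on I. t \<in> I" by (rule AE_I2) (simp add: space_restrict_space)
 with loc_domain_AE_differentiable[OF y] loc_domain_AE_differentiable[OF w]
 show ?thesis
 proof eventually_elim
  case (elim t)
  have k: "2 * n - 1 < 2 * n" using n_pos by linarith
  have "qderiv E (\<lambda>t. a *\<^sub>C y t + w t) (2 * n) t = a *\<^sub>C lexpr E y t + lexpr E w t"
   by (rule apply_action.quasi_deriv_of_system(2)[OF reg lincomb_system[OF y w] _ elim(3)
   lincomb_qcomp_deriv[OF elim(1)[rule_format, OF k] elim(2)[rule_format, OF k] k elim(3)]])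
   (simp_all add: qcomp_0_state)
  then show ?case by (simp add: lexpr_def)
 qed
qed

lemma max_domain_sq:
 assumes "y \<in> max_domain E"
 shows "sq_integrable (lebesgue_on I) y" "sq_integrable (lebesgue_on I) (lexpr E y)"
  "sq_integrable (lebesgue_on I) (\<lambda>t. lexpr E y t - z *\<^sub>C y t)" "y \<in> loc_domain E"
 using assms by (auto simp: max_domain_iff intro: sq_integrable_diff sq_integrable_scaleC)

lemma max_domain_lincomb:
 assumes y: "y \<in> max_domain E" and w: "w \<in> max_domain E"
 shows "(\<lambda>t. a *\<^sub>C y t + w t) \<in> max_domain E"
 unfolding max_domain_iff
proof (intro conjI loc_domain_lincomb sq_integrable_add sq_integrable_scaleC)
 show "y \<in> loc_domain E" "w \<in> loc_domain E" "sq_integrable (lebesgue_on I) y" "sq_integrable (lebesgue_on I) w"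
  using max_domain_sq y w by auto
 show "sq_integrable (lebesgue_on I) (lexpr E (\<lambda>t. a *\<^sub>C y t + w t))"
  by (rule sq_integrable_AE_eq[OF _ I_measurable lexpr_lincomb])
   (use max_domain_sq y w in \<open>auto intro!: sq_integrable_add sq_integrable_scaleC\<close>)
 show "\<forall>t. t \<notin> I \<longrightarrow> a *\<^sub>C y t + w t = 0" using y w by (auto simp: max_domain_iff)
qed

text \<open>Green's formula is available on compact subintervals in terms of the gauge integral;
  dominated convergence carries it to the Lebesgue integral over the whole interval.\<close>

lemma integral_truncation_tendsto:
 fixes k :: "real \<Rightarrow> complex"
 assumes k: "integrable (lebesgue_on I) k"
  and hk: "\<And>c. 0 < c \<Longrightarrow> ereal c < endpoint E \<Longrightarrow> (k has_integral \<Phi> c) {0..c}"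
  and lim: "(\<Phi> \<longlongrightarrow> l) (to_endpoint E)"
 shows "(\<integral>t. k t \<partial>lebesgue_on I) = l"
proof -
 obtain s where s: "\<And>m. 0 < s m" "\<And>m. ereal (s m) < endpoint E"
  "filterlim s (to_endpoint E) sequentially" "\<And>t. ereal t < endpoint E \<Longrightarrow> \<forall>\<^sub>F m in sequentially. t < s m"
  by (rule endpoint_sequence) blast
 have sub: "{0..s m} \<subseteq> I" for m
  by (rule I_subset[OF interior_in_I]) (use s(1,2)[of m] in auto)
 have ki: "integrable lebesgue (\<lambda>t. indicator I t *\<^sub>R k t)"
  using k I_measurable by (subst (asm) integrable_restrict_space) (auto simp: set_integrable_def)
 have "(\<lambda>m. \<integral>t. indicator {0..s m} t *\<^sub>R (indicator I t *\<^sub>R k t) \<partial>lebesgue) \<longlonglongrightarrow> (\<integral>t. indicator I t *\<^sub>R k t \<partial>lebesgue)"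
 proof (rule integral_dominated_convergence[where w = "\<lambda>t. norm (indicator I t *\<^sub>R k t)"])
  show "(\<lambda>t. indicator I t *\<^sub>R k t) \<in> borel_measurable lebesgue" using ki by (rule borel_measurable_integrable)
  then show "(\<lambda>t. indicator {0..s m} t *\<^sub>R (indicator I t *\<^sub>R k t)) \<in> borel_measurable lebesgue" for m
   by (rule borel_measurable_scaleR[rotated]) (rule borel_measurable_indicator, simp)
  show "integrable lebesgue (\<lambda>t. norm (indicator I t *\<^sub>R k t))" by (rule integrable_norm[OF ki])
  show "AE t in lebesgue. norm (indicator {0..s m} t *\<^sub>R (indicator I t *\<^sub>R k t)) \<le> norm (indicator I t *\<^sub>R k t)" for m
   by (rule AE_I2) (auto simp: indicator_def)
  have "AE t in lebesgue. t \<noteq> real_of_ereal (endpoint E)"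
   by (rule AE_I'[of "{real_of_ereal (endpoint E)}"]) auto
  then show "AE t in lebesgue. (\<lambda>m. indicator {0..s m} t *\<^sub>R (indicator I t *\<^sub>R k t)) \<longlonglongrightarrow> indicator I t *\<^sub>R k t"
  proof eventually_elim
   case (elim t)
   show ?case
   proof (cases "t \<in> I")
   case True
   have "ereal t \<noteq> endpoint E" using elim by (metis real_of_ereal.simps(1))
   then have "ereal t < endpoint E" "0 \<le> t" using I_bounds[OF True] by auto
   from s(4)[OF this(1)] have "\<forall>\<^sub>F m in sequentially. indicator {0..s m} t *\<^sub>R (indicator I t *\<^sub>R k t) = indicator I t *\<^sub>R k t"
   by eventually_elim (use \<open>0 \<le> t\<close> in auto)
   then show ?thesis by (rule tendsto_eventually)
   qed simp
  qed
 qed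
 moreover have "(\<integral>t. indicator {0..s m} t *\<^sub>R (indicator I t *\<^sub>R k t) \<partial>lebesgue) = \<Phi> (s m)" for m
 proof -
  have "integrable lebesgue (\<lambda>t. indicator {0..s m} t *\<^sub>R (indicator I t *\<^sub>R k t))"
   by (rule integrable_mult_indicator[OF _ ki]) simp
  also have eq: "(\<lambda>t. indicator {0..s m} t *\<^sub>R (indicator I t *\<^sub>R k t)) = (\<lambda>t. indicator {0..s m} t *\<^sub>R k t)"
   using sub[of m] by (auto simp: indicator_def fun_eq_iff)
  finally have "set_integrable lebesgue {0..s m} k" by (simp add: set_integrable_def)
  from set_lebesgue_integral_eq_integral(2)[OF this]
  have "(\<integral>t. indicator {0..s m} t *\<^sub>R k t \<partial>lebesgue) = integral {0..s m} k"
   by (simp add: set_lebesgue_integral_def)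
  then show ?thesis unfolding eq using hk[OF s(1,2)] by (simp add: has_integral_iff)
 qed
 ultimately have "(\<lambda>m. \<Phi> (s m)) \<longlonglongrightarrow> (\<integral>t. k t \<partial>lebesgue_on I)"
  by (simp add: integral_lebesgue_on_I)
 moreover have "(\<lambda>m. \<Phi> (s m)) \<longlonglongrightarrow> l" by (rule filterlim_compose[OF lim s(3)])
 ultimately show ?thesis by (rule LIMSEQ_unique)
qed

end

section \<open>Boundary triplets\<close>

subsection \<open>The boundary form\<close>

text \<open>The right side of Green's formula in terms of boundary values: with
  \<open>incl T\<close> it is the limit of the bracket at b, with \<open>incl_H E T\<close> it
  includes the contribution of the end point 0.\<close>

definition bform :: "('b::complex_hilbert_space \<Rightarrow>\<^sub>B 'a::complex_hilbert_space) \<Rightarrow> 'a \<Rightarrow> 'b \<Rightarrow> 'a \<Rightarrow> 'b \<Rightarrow> complex" where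
 "bform V a b a' b' = cinner (V b) a' - cinner a (V b') + \<i> * cinner (proj_compl V a) (proj_compl V a')"

text \<open>The condition on \<open>\<Gamma>\<^sub>0 y\<close> cutting out the domain of a maximal symmetric (\<open>Im z > 0\<close>) or
 maximal dissipative (\<open>Im z < 0\<close>) restriction of \<open>L\<close> that has \<open>z\<close> in its resolvent set.\<close>

definition bker :: "('b::complex_hilbert_space \<Rightarrow>\<^sub>B 'a::complex_hilbert_space) \<Rightarrow> complex \<Rightarrow> 'a \<Rightarrow> bool" where
 "bker V z a \<longleftrightarrow> (if 0 < Im z then a = 0 else adj V a = 0)"

lemma bker_lincomb: "bker V z a \<Longrightarrow> bker V z a' \<Longrightarrow> bker V z (c *\<^sub>C a + a')"
 by (auto simp: bker_def split: if_splits)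

lemma bform_lincomb: "bform V (c *\<^sub>C a + d) (c *\<^sub>C b + e) a' b' = c * bform V a b a' b' + bform V d e a' b'"
 by (simp add: bform_def cinner_linear_simps algebra_simps)

lemma bform_skew: "bform V a' b' a b = - cnj (bform V a b a' b')"
 by (simp add: bform_def flip: cinner_commute)

text \<open>With the second boundary value free, the conditions for z and for its conjugate are
  polar to each other, so the corresponding restrictions of L are adjoint to each other;
  \<open>bform_polarD\<close> and \<open>bform_polarD'\<close> are the converses.\<close>

lemma bform_polar:
 assumes "Im z \<noteq> 0" "bker V z a" "bker V (cnj z) a'"
 shows "bform V a b a' b' = 0"
 using assms cinner_adj[of V b a'] cinner_adj'[of V a b'] by (auto simp: bker_def bform_def split: if_splits)

context
 fixes V :: "'b::complex_hilbert_space \<Rightarrow>\<^sub>B 'a::complex_hilbert_space"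
 assumes V: "isometric_op V"
begin

text \<open>The test pair with first entry 0 and second entry \<open>adj V a'\<close> removes the
  part of \<open>a'\<close> in the range of \<open>V\<close>; in the lower half-plane
  \<open>proj_compl V a'\<close> is admissible too and removes the rest.\<close>

lemma bform_polarD:
 assumes z: "Im z \<noteq> 0" and orth: "\<And>a b. bker V z a \<Longrightarrow> bform V a b a' b' = 0"
 shows "bker V (cnj z) a'"
proof -
 have "bform V 0 (adj V a') a' b' = 0" by (rule orth) (simp add: bker_def)
 then have "cinner (adj V a') (adj V a') = 0" by (simp add: bform_def cinner_adj)
 then have a': "adj V a' = 0" by (simp add: cinner_self)
 show ?thesis
 proof (cases "0 < Im z")
  case False
  have "bform V (proj_compl V a') 0 a' b' = 0"
   by (rule orth) (use False V in \<open>simp add: bker_def proj_compl_isometry\<close>)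
  moreover have "cinner (proj_compl V a') (V b') = 0"
   using cinner_adj'[of V "proj_compl V a'" b'] by (simp add: proj_compl_isometry[OF V])
  ultimately have "cinner (proj_compl V a') (proj_compl V a') = 0"
   by (simp add: bform_def proj_compl_isometry[OF V])
  then have "proj_compl V a' = 0" by (simp add: cinner_self)
  then have "a' = 0" using norm_isometric_decomp[OF V, of a'] a' by simp
  then show ?thesis by (simp add: bker_def)
 qed (use a' in \<open>simp add: bker_def\<close>)
qed

lemma bform_polarD':
 assumes z: "Im z \<noteq> 0" and orth: "\<And>a' b'. bker V (cnj z) a' \<Longrightarrow> bform V a b a' b' = 0"
 shows "bker V z a"
 using bform_polarD[of "cnj z" a b] orth z by (simp add: bform_skew[of V _ _ a b])

lemma bform_nondegenerate:
 assumes "\<And>a b. bform V a b a' b' = 0"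
 shows "a' = 0" "b' = 0"
proof -
 show a': "a' = 0" using bform_polarD[of "- \<i>" a' b'] assms by (simp add: bker_def)
 have "cinner (V b') (V b') = 0" using assms[of "V b'" 0] by (simp add: bform_def a')
 then have "V b' = 0" by (simp add: cinner_self)
 then show "b' = 0" using isometric_op_adj_apply[OF V, of b'] by simp
qed

lemma bker_form:
 assumes "bker V z a"
 shows "\<exists>r\<ge>0. bform V a b a b = \<i> * of_real r \<and> (0 < Im z \<longrightarrow> r = 0)"
proof (cases "0 < Im z")
 case False
 then have a: "adj V a = 0" using assms by (simp add: bker_def)
 have "cinner (V b) a = 0" "cinner a (V b) = 0" using a cinner_adj[of V b a] cinner_adj'[of V a b] by simp_all
 then show ?thesis using False
  by (intro exI[of _ "(norm (proj_compl V a))\<^sup>2"]) (simp add: bform_def cinner_self)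
qed (use assms in \<open>auto simp: bker_def bform_def\<close>)

end

lemma clinear_fun_on_lincomb:
 assumes G: "clinear_fun_on S G" and "(\<lambda>t. a *\<^sub>C y t) \<in> S" "y \<in> S" "w \<in> S"
 shows "G (\<lambda>t. a *\<^sub>C y t + w t) = a *\<^sub>C G y + G w"
proof -
 have "G (\<lambda>t. a *\<^sub>C y t + w t) = G (\<lambda>t. a *\<^sub>C y t) + G w"
  by (rule bspec[OF bspec[OF conjunct1[OF G[unfolded clinear_fun_on_def]] assms(2)] assms(4)])
 also have "G (\<lambda>t. a *\<^sub>C y t) = a *\<^sub>C G y"
  by (rule bspec[OF spec[OF conjunct2[OF G[unfolded clinear_fun_on_def]]] assms(3)])
 finally show ?thesis .
qed

subsection \<open>Green's formula\<close>

locale regular_triplet = regular_expr E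
 for E :: "('h::{complex_hilbert_space,second_countable_topology}, 'n::{finite,linorder}) diff_expr" +
 fixes T :: "('h, 'k0::complex_hilbert_space, 'k1::complex_hilbert_space) triplet"
 assumes dec: "decomposing_D_triplet E T"
begin

abbreviation "V \<equiv> incl_H E T"
abbreviation "P \<equiv> proj_compl V"
abbreviation "\<Gamma>\<^sub>0 \<equiv> Gamma0 E T"
abbreviation "\<Gamma>\<^sub>1 \<equiv> Gamma1 E T"
abbreviation "\<D> \<equiv> max_domain E"
abbreviation "sq \<equiv> sq_integrable (lebesgue_on I)"

section \<open>Inner product, norm and residual on the interval\<close>

definition ip :: "(real \<Rightarrow> 'h) \<Rightarrow> (real \<Rightarrow> 'h) \<Rightarrow> complex" where
 "ip f g = (\<integral>t. cinner (f t) (g t) \<partial>lebesgue_on I)"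

definition nrm2 :: "(real \<Rightarrow> 'h) \<Rightarrow> real" where
 "nrm2 f = (\<integral>t. (norm (f t))\<^sup>2 \<partial>lebesgue_on I)"

definition res :: "complex \<Rightarrow> (real \<Rightarrow> 'h) \<Rightarrow> real \<Rightarrow> 'h" where
 "res z y t = lexpr E y t - z *\<^sub>C y t"

lemma iso_incl: "isometric_op (incl T)" using dec by (simp add: decomposing_D_triplet_def)

lemma V_apply: "cblinfun_apply V x = (fst x, incl T (snd x))"
 by (simp add: incl_H_def block_op_apply)

lemma V_iso: "isometric_op V"
 using iso_incl by (simp add: isometric_op_def V_apply cinner_prod_def)

lemma adj_V_apply: "cblinfun_apply (adj V) x = (fst x, adj (incl T) (snd x))"
 by (simp add: incl_H_def adj_block_op block_op_apply)

lemma P_apply: "cblinfun_apply P x = (0, proj_compl (incl T) (snd x))"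
 by (simp add: proj_compl_apply V_apply adj_V_apply prod_eq_iff)

lemma sq_D: "y \<in> \<D> \<Longrightarrow> sq y" "y \<in> \<D> \<Longrightarrow> sq (lexpr E y)" "y \<in> \<D> \<Longrightarrow> sq (res z y)" "y \<in> \<D> \<Longrightarrow> y \<in> loc_domain E"
 using max_domain_sq[of y] by (auto simp: res_def[abs_def])

lemma ip_lincomb_left: "sq f \<Longrightarrow> sq g \<Longrightarrow> sq h \<Longrightarrow> ip (\<lambda>t. a *\<^sub>C f t + g t) h = a * ip f h + ip g h"
 unfolding ip_def cinner_add_left cinner_scaleC_left
 by (subst Bochner_Integration.integral_add) (auto intro!: integrable_cinner integrable_mult_right)

lemma ip_cnj: "ip g f = cnj (ip f g)"
 unfolding ip_def by (subst Bochner_Integration.integral_cnj[symmetric]) (simp flip: cinner_commute)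

lemma ip_self: "ip f f = of_real (nrm2 f)"
 unfolding ip_def nrm2_def cinner_self by (rule integral_complex_of_real)

lemma ip_AE_left:
 assumes f: "sq f" and f': "sq f'" and g: "sq g" and ae: "AE t in lebesgue_on I. f t = f' t"
 shows "ip f g = ip f' g"
 unfolding ip_def
proof (rule integral_cong_AE)
 show "(\<lambda>t. cinner (f t) (g t)) \<in> borel_measurable (lebesgue_on I)" "(\<lambda>t. cinner (f' t) (g t)) \<in> borel_measurable (lebesgue_on I)"
  by (rule measurable_cinner[OF sq_integrable_measurable[OF f] sq_integrable_measurable[OF g]])
   (rule measurable_cinner[OF sq_integrable_measurable[OF f'] sq_integrable_measurable[OF g]])
 show "AE t in lebesgue_on I. cinner (f t) (g t) = cinner (f' t) (g t)" using ae by eventually_elim simp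
qed

lemma nrm2_AE:
 assumes f: "sq f" and f': "sq f'" and ae: "AE t in lebesgue_on I. f t = f' t"
 shows "nrm2 f = nrm2 f'"
proof -
 have "of_real (nrm2 f) = ip f' f" using ip_AE_left[OF f f' f ae] by (simp add: ip_self)
 also have "\<dots> = cnj (ip f f')" by (rule ip_cnj)
 also have "\<dots> = of_real (nrm2 f')" using ip_AE_left[OF f f' f' ae] by (simp add: ip_self)
 finally show ?thesis by (simp only: of_real_eq_iff)
qed

lemma nrm2_nonneg: "0 \<le> nrm2 f" unfolding nrm2_def by simp

lemma L2_dist_eq: "L2_dist (lebesgue_on I) f g = nrm2 (\<lambda>t. f t - g t)"
 by (simp add: L2_dist_def nrm2_def)

lemma nrm2_add_le: "sq f \<Longrightarrow> sq g \<Longrightarrow> nrm2 (\<lambda>t. a *\<^sub>C f t + g t) \<le> 2 * (cmod a)\<^sup>2 * nrm2 f + 2 * nrm2 g"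
proof -
 assume f: "sq f" and g: "sq g"
 have "sq (\<lambda>t. a *\<^sub>C f t + g t)" by (intro sq_integrable_add sq_integrable_scaleC f g)
 then have "nrm2 (\<lambda>t. a *\<^sub>C f t + g t) \<le> (\<integral>t. 2 * (cmod a)\<^sup>2 * (norm (f t))\<^sup>2 + 2 * (norm (g t))\<^sup>2 \<partial>lebesgue_on I)"
  unfolding nrm2_def
 proof (intro integral_mono)
  fix t
  have "norm (a *\<^sub>C f t + g t) \<le> cmod a * norm (f t) + norm (g t)"
   using norm_triangle_ineq[of "a *\<^sub>C f t" "g t"] by (simp add: norm_scaleC)
  then have "(norm (a *\<^sub>C f t + g t))\<^sup>2 \<le> (cmod a * norm (f t) + norm (g t))\<^sup>2" by (rule power_mono) simp
  also have "\<dots> \<le> 2 * (cmod a)\<^sup>2 * (norm (f t))\<^sup>2 + 2 * (norm (g t))\<^sup>2"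
   using sum_squares_bound[of "cmod a * norm (f t)" "norm (g t)"] by (simp add: power2_sum power_mult_distrib)
  finally show "(norm (a *\<^sub>C f t + g t))\<^sup>2 \<le> 2 * (cmod a)\<^sup>2 * (norm (f t))\<^sup>2 + 2 * (norm (g t))\<^sup>2" .
 qed (use f g in \<open>auto simp: sq_integrable_def\<close>)
 also have "\<dots> = 2 * (cmod a)\<^sup>2 * nrm2 f + 2 * nrm2 g"
  unfolding nrm2_def using f g by (subst Bochner_Integration.integral_add) (auto simp: sq_integrable_def)
 finally show ?thesis .
qed

lemma cmod_ip_le:
 assumes f: "sq f" and g: "sq g" and e: "0 < e"
 shows "cmod (ip f g) \<le> nrm2 f / (2 * e) + e / 2 * nrm2 g"
proof -
 have "cmod (ip f g) \<le> (\<integral>t. (norm (f t))\<^sup>2 / (2 * e) + e / 2 * (norm (g t))\<^sup>2 \<partial>lebesgue_on I)"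
  unfolding ip_def
 proof (rule Bochner_Integration.integral_norm_bound_integral[OF integrable_cinner[OF f g]])
  show "integrable (lebesgue_on I) (\<lambda>t. (norm (f t))\<^sup>2 / (2 * e) + e / 2 * (norm (g t))\<^sup>2)"
   using f g by (auto simp: sq_integrable_def)
  fix t
  define p q where "p = norm (f t)" and "q = norm (g t)"
  have "0 \<le> (p - e * q)\<^sup>2" by simp
  then have "2 * e * (p * q) \<le> p\<^sup>2 + e * e * q\<^sup>2" by (simp add: power2_eq_square algebra_simps)
  then have "p * q \<le> (p\<^sup>2 + e * e * q\<^sup>2) / (2 * e)" using e by (simp add: pos_le_divide_eq mult.commute)
  also have "\<dots> = p\<^sup>2 / (2 * e) + e / 2 * q\<^sup>2" using e by (simp add: add_divide_distrib)
  finally show "norm (cinner (f t) (g t)) \<le> (norm (f t))\<^sup>2 / (2 * e) + e / 2 * (norm (g t))\<^sup>2"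
   using order_trans[OF cmod_cinner_le] by (auto simp: p_def q_def)
 qed
 also have "\<dots> = nrm2 f / (2 * e) + e / 2 * nrm2 g"
  unfolding nrm2_def using f g by (subst Bochner_Integration.integral_add) (auto simp: sq_integrable_def)
 finally show ?thesis .
qed

lemma zero_in_D: "(\<lambda>t. 0) \<in> \<D>"
proof -
 obtain y where "y \<in> \<D>" using dec unfolding decomposing_D_triplet_def by blast
 from max_domain_lincomb[OF this this, of "-1"] show ?thesis by (simp add: scaleC_minus_left)
qed

lemma res_lincomb:
 assumes "y \<in> \<D>" "w \<in> \<D>"
 shows "AE t in lebesgue_on I. res z (\<lambda>t. a *\<^sub>C y t + w t) t = a *\<^sub>C res z y t + res z w t"
 using lexpr_lincomb[OF sq_D(4)[OF assms(1)] sq_D(4)[OF assms(2)], of a]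
 by eventually_elim (simp add: res_def scaleC_add_right scaleC_diff_right scaleC_scaleC mult.commute)

lemma res_zero: "AE t in lebesgue_on I. res z (\<lambda>t. 0) t = 0"
 using res_lincomb[OF zero_in_D zero_in_D, of z "-1"] by eventually_elim (simp add: scaleC_minus_left)

lemma \<Gamma>'_lincomb:
 assumes y: "y \<in> \<D>" and w: "w \<in> \<D>"
 shows "Gamma0' T (\<lambda>t. a *\<^sub>C y t + w t) = a *\<^sub>C Gamma0' T y + Gamma0' T w"
  "Gamma1' T (\<lambda>t. a *\<^sub>C y t + w t) = a *\<^sub>C Gamma1' T y + Gamma1' T w"
proof -
 have ay: "(\<lambda>t. a *\<^sub>C y t) \<in> \<D>" using max_domain_lincomb[OF y zero_in_D, of a] by simp
 have G: "clinear_fun_on \<D> (Gamma0' T)" "clinear_fun_on \<D> (Gamma1' T)"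
  using dec by (auto simp: decomposing_D_triplet_def)
 show "Gamma0' T (\<lambda>t. a *\<^sub>C y t + w t) = a *\<^sub>C Gamma0' T y + Gamma0' T w"
  "Gamma1' T (\<lambda>t. a *\<^sub>C y t + w t) = a *\<^sub>C Gamma1' T y + Gamma1' T w"
  by (rule clinear_fun_on_lincomb[OF G(1) ay y w], rule clinear_fun_on_lincomb[OF G(2) ay y w])
qed

lemma \<Gamma>_lincomb:
 assumes y: "y \<in> \<D>" and w: "w \<in> \<D>"
 shows "\<Gamma>\<^sub>0 (\<lambda>t. a *\<^sub>C y t + w t) = a *\<^sub>C \<Gamma>\<^sub>0 y + \<Gamma>\<^sub>0 w"
  "\<Gamma>\<^sub>1 (\<lambda>t. a *\<^sub>C y t + w t) = a *\<^sub>C \<Gamma>\<^sub>1 y + \<Gamma>\<^sub>1 w"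
 using state_lincomb[OF sq_D(4)[OF y] sq_D(4)[OF w] initial_interval_zero[OF I], of a]
 by (simp_all add: \<Gamma>'_lincomb[OF y w] Gamma0_def Gamma1_def state_def scaleC_minus_right)

text \<open>The triplet gives the bracket at b; the components of \<Gamma>_0 and \<Gamma>_1 in H^n,
  with the sign put on y^(1)(0), contribute exactly minus the bracket at 0.\<close>

lemma green:
 assumes y: "y \<in> \<D>" and w: "w \<in> \<D>"
 shows "ip (res z y) w - ip y (res (cnj z) w) = bform V (\<Gamma>\<^sub>0 y) (\<Gamma>\<^sub>1 y) (\<Gamma>\<^sub>0 w) (\<Gamma>\<^sub>1 w)"
proof -
 let ?k = "\<lambda>t. cinner (lexpr E y t) (w t) - cinner (y t) (lexpr E w t)"
 let ?l = "cinner (incl T (Gamma1' T y)) (Gamma0' T w) - cinner (Gamma0' T y) (incl T (Gamma1' T w))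
  + \<i> * cinner (proj_compl (incl T) (Gamma0' T y)) (proj_compl (incl T) (Gamma0' T w))"
 have lim: "(bracket E y w \<longlongrightarrow> ?l) (to_endpoint E)"
  using dec y w by (simp add: decomposing_D_triplet_def)
 have "ip (res z y) w - ip y (res (cnj z) w) = (\<integral>t. cinner (res z y t) (w t) - cinner (y t) (res (cnj z) w t) \<partial>lebesgue_on I)"
  unfolding ip_def
  by (rule Bochner_Integration.integral_diff[symmetric]) (intro integrable_cinner sq_D y w)+
 also have "\<dots> = (\<integral>t. ?k t \<partial>lebesgue_on I)"
  by (simp add: res_def cinner_linear_simps)
 also have "\<dots> = ?l - bracket E y w 0"
 proof (rule integral_truncation_tendsto)
  show "integrable (lebesgue_on I) ?k"
   by (intro Bochner_Integration.integrable_diff integrable_cinner sq_D y w)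
  show "(?k has_integral bracket E y w c - bracket E y w 0) {0..c}" if "0 < c" "ereal c < endpoint E" for c
   by (rule local_green[OF sq_D(4)[OF y] sq_D(4)[OF w] interior_in_I]) (use that in auto)
  show "((\<lambda>c. bracket E y w c - bracket E y w 0) \<longlongrightarrow> ?l - bracket E y w 0) (to_endpoint E)"
   by (intro tendsto_diff lim tendsto_const)
 qed
 also have "\<dots> = bform V (\<Gamma>\<^sub>0 y) (\<Gamma>\<^sub>1 y) (\<Gamma>\<^sub>0 w) (\<Gamma>\<^sub>1 w)"
  by (simp add: bform_def V_apply P_apply Gamma0_def Gamma1_def bracket_def cinner_prod_def cinner_linear_simps)
 finally show ?thesis .
qed

text \<open>The bracket with any domain element vanishes near b, and the boundary values of domain
  elements are arbitrary; so nondegeneracy of the form applies.\<close>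

lemma compact_solution_boundary:
 assumes w: "compact_solution c w" and c: "0 < c" "ereal c < endpoint E"
 shows "Gamma0' T w = 0" "Gamma1' T w = 0"
proof -
 have wD: "w \<in> \<D>" by (rule compact_solution_max_domain[OF w interior_in_I]) (use c in auto)
 obtain s where s: "\<And>m. 0 < s m" "\<And>m. ereal (s m) < endpoint E"
  "filterlim s (to_endpoint E) sequentially" "\<And>t. ereal t < endpoint E \<Longrightarrow> \<forall>\<^sub>F m in sequentially. t < s m"
  by (rule endpoint_sequence) blast
 have "bform (incl T) a b (Gamma0' T w) (Gamma1' T w) = 0" for a b
 proof -
  have "(a, b) \<in> (\<lambda>y. (Gamma0' T y, Gamma1' T y)) ` \<D>"
   using dec by (simp add: decomposing_D_triplet_def)
  then obtain y where y: "y \<in> \<D>" "Gamma0' T y = a" "Gamma1' T y = b" by auto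
  have "(bracket E y w \<longlongrightarrow> bform (incl T) a b (Gamma0' T w) (Gamma1' T w)) (to_endpoint E)"
   using dec y wD by (auto simp: decomposing_D_triplet_def bform_def)
  then have l: "(\<lambda>m. bracket E y w (s m)) \<longlonglongrightarrow> bform (incl T) a b (Gamma0' T w) (Gamma1' T w)"
   by (rule filterlim_compose[OF _ s(3)])
  have "\<forall>\<^sub>F m in sequentially. bracket E y w (s m) = 0"
   using s(4)[OF c(2)]
  proof eventually_elim
   case (elim m)
   have "s m \<in> I" by (rule interior_in_I) (use s(1,2)[of m] in auto)
   then have "state E w (s m) = 0" using w elim by (auto simp: compact_solution_def)
   then show ?case by (simp add: bracket_eq_br br_def)
  qed
  then have "(\<lambda>m. bracket E y w (s m)) \<longlonglongrightarrow> 0" by (rule tendsto_eventually)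
  with l show ?thesis by (rule LIMSEQ_unique)
 qed
 from bform_nondegenerate[OF iso_incl this] show "Gamma0' T w = 0" "Gamma1' T w = 0" by auto
qed

text \<open>The initial values of an element with the right boundary values at b are corrected by a
  compactly supported solution, which leaves those at b unchanged.\<close>

lemma \<Gamma>_surj: "\<exists>y\<in>\<D>. \<Gamma>\<^sub>0 y = a \<and> \<Gamma>\<^sub>1 y = b"
proof -
 have "(snd a, snd b) \<in> (\<lambda>y. (Gamma0' T y, Gamma1' T y)) ` \<D>"
  using dec by (simp add: decomposing_D_triplet_def)
 then obtain y where y: "y \<in> \<D>" "Gamma0' T y = snd a" "Gamma1' T y = snd b" by auto
 obtain s where "\<And>m. 0 < s m" "\<And>m. ereal (s m) < endpoint E" by (rule endpoint_sequence) blast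
 then obtain c where c: "0 < c" "ereal c < endpoint E" by blast
 have cI: "c \<in> I" by (rule interior_in_I) (use c in auto)
 obtain x0 w where w: "compact_solution c w" "state E w 0 = (- fst b, fst a) - state E y 0"
  using compact_solution_exists[OF cI c(1) continuous_on_const refl, of "(- fst b, fst a) - state E y 0" 0] by blast
 have wD: "w \<in> \<D>" by (rule compact_solution_max_domain[OF w(1) cI])
 have v: "vec1 E w 0 = - fst b - vec1 E y 0" "vec2 E w 0 = fst a - vec2 E y 0"
  using w(2) by (simp_all add: state_def)
 show ?thesis
 proof (intro bexI conjI)
  show "(\<lambda>t. 1 *\<^sub>C y t + w t) \<in> \<D>" by (rule max_domain_lincomb[OF y(1) wD])
  show "\<Gamma>\<^sub>0 (\<lambda>t. 1 *\<^sub>C y t + w t) = a" "\<Gamma>\<^sub>1 (\<lambda>t. 1 *\<^sub>C y t + w t) = b"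
   unfolding \<Gamma>_lincomb[OF y(1) wD]
   by (simp_all add: Gamma0_def Gamma1_def v y compact_solution_boundary[OF w(1) c] prod_eq_iff)
 qed
qed

lemma green_self:
 assumes y: "y \<in> \<D>"
 shows "bform V (\<Gamma>\<^sub>0 y) (\<Gamma>\<^sub>1 y) (\<Gamma>\<^sub>0 y) (\<Gamma>\<^sub>1 y) = \<i> * of_real (2 * Im (ip (res z y) y) + 2 * Im z * nrm2 y)"
proof -
 have "res (cnj z) y = (\<lambda>t. (z - cnj z) *\<^sub>C y t + res z y t)"
  by (simp add: res_def fun_eq_iff scaleC_diff_left)
 then have "ip (res (cnj z) y) y = (z - cnj z) * of_real (nrm2 y) + ip (res z y) y"
  using ip_lincomb_left[of y "res z y" y "z - cnj z"] sq_D[OF y] by (simp add: ip_self)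
 then have "ip y (res (cnj z) y) = cnj ((z - cnj z) * of_real (nrm2 y) + ip (res z y) y)"
  using ip_cnj[of y "res (cnj z) y"] by simp
 then show ?thesis
  unfolding green[OF y y, of z, symmetric] by (simp add: complex_eq_iff algebra_simps)
qed

text \<open>Green's formula for \<open>y\<close> with itself expresses Im z times the squared norm
  through the imaginary part of (res z y, y) and a boundary term of known sign.\<close>

lemma coercive:
 assumes y: "y \<in> \<D>" and k: "bker V z (\<Gamma>\<^sub>0 y)" and z: "Im z \<noteq> 0"
 shows "\<bar>Im z\<bar> * nrm2 y \<le> cmod (ip (res z y) y)" and "(Im z)\<^sup>2 * nrm2 y \<le> nrm2 (res z y)"
proof -
 obtain r where r: "r \<ge> 0" "bform V (\<Gamma>\<^sub>0 y) (\<Gamma>\<^sub>1 y) (\<Gamma>\<^sub>0 y) (\<Gamma>\<^sub>1 y) = \<i> * of_real r" "0 < Im z \<longrightarrow> r = 0"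
  using bker_form[OF V_iso k] by blast
 have "of_real r = (of_real (2 * Im (ip (res z y) y) + 2 * Im z * nrm2 y) :: complex)"
  using r(2) unfolding green_self[OF y, of z] by simp
 then have eq: "r = 2 * Im (ip (res z y) y) + 2 * Im z * nrm2 y" by (simp only: of_real_eq_iff)
 have "\<bar>Im z\<bar> * nrm2 y \<le> \<bar>Im (ip (res z y) y)\<bar>"
  using r(1,3) eq by (cases "0 < Im z") (auto simp: abs_if)
 also have "\<dots> \<le> cmod (ip (res z y) y)" by (rule abs_Im_le_cmod)
 finally show 1: "\<bar>Im z\<bar> * nrm2 y \<le> cmod (ip (res z y) y)" .
 \<comment> \<open>With this parameter exactly half of the left side reappears on the right and can
   be absorbed.\<close>
 define e where "e = \<bar>Im z\<bar>"
 have e: "0 < e" using z by (simp add: e_def)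
 have "e * nrm2 y \<le> nrm2 (res z y) / (2 * e) + e / 2 * nrm2 y"
  using 1 cmod_ip_le[OF sq_D(3)[OF y] sq_D(1)[OF y] e, of z] unfolding e_def[symmetric] by linarith
 then have "e / 2 * nrm2 y \<le> nrm2 (res z y) / (2 * e)" by (simp add: field_simps)
 then have "(e / 2 * nrm2 y) * (2 * e) \<le> nrm2 (res z y)" using e by (simp add: pos_le_divide_eq)
 then show "(Im z)\<^sup>2 * nrm2 y \<le> nrm2 (res z y)" by (simp add: e_def power2_eq_square mult_ac)
qed

lemma defectD:
 assumes "y \<in> defect_space E z"
 shows "y \<in> \<D>" "AE t in lebesgue_on I. res z y t = 0" "sq g \<Longrightarrow> ip (res z y) g = 0" "sq g \<Longrightarrow> ip g (res z y) = 0"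
proof -
 show y: "y \<in> \<D>" and ae: "AE t in lebesgue_on I. res z y t = 0"
  using assms by (auto simp: defect_space_def res_def)
 show *: "ip (res z y) g = 0" if "sq g"
  unfolding ip_def by (rule integral_eq_zero_AE) (use ae in eventually_elim, simp)
 show "ip g (res z y) = 0" if "sq g" using *[OF that] ip_cnj[of g "res z y"] by simp
qed

text \<open>Elements are functions rather than classes: zero norm gives vanishing almost everywhere
  only. Through the representation by Y_0, observability makes the initial value zero and hence the
  function itself.\<close>

lemma defect_nrm2_zero:
 assumes y: "y \<in> defect_space E z" and 0: "nrm2 y \<le> 0"
 shows "y = (\<lambda>t. 0)"
proof -
 obtain s where "\<And>m. 0 < s m" "\<And>m. ereal (s m) < endpoint E" by (rule endpoint_sequence) blast
 then obtain c where c: "0 < c" "ereal c < endpoint E" by blast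
 have cI: "c \<in> I" by (rule interior_in_I) (use c in auto)
 define a where "a = state E y 0"
 have ya: "y = (\<lambda>t. Y_zero E t z a)" unfolding a_def by (rule defect_eq_Y_zero[OF y])
 obtain \<delta> where \<delta>: "\<delta> > 0" "\<delta> * (norm a)\<^sup>2 \<le> integral {0..c} (\<lambda>t. (norm (Y_zero E t z a))\<^sup>2)"
  using observability[OF cI c(1), of z] by blast
 have int: "integrable (lebesgue_on I) (\<lambda>t. (norm (y t))\<^sup>2)"
  using sq_D(1)[OF defectD(1)[OF y]] by (simp add: sq_integrable_def)
 have "nrm2 y = 0" using 0 nrm2_nonneg[of y] by simp
 then have "AE t in lebesgue_on I. (norm (y t))\<^sup>2 = 0"
  unfolding nrm2_def using integral_nonneg_eq_0_iff_AE[OF int] by simp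
 then obtain N where N: "negligible N" "\<And>t. t \<in> I - N \<Longrightarrow> (norm (y t))\<^sup>2 = 0"
  unfolding AE_lebesgue_on_iff_negligible[OF I_measurable] by blast
 have "integral {0..c} (\<lambda>t. (norm (Y_zero E t z a))\<^sup>2) = integral {0..c} (\<lambda>t. 0)"
  by (rule integral_spike[OF N(1)]) (use N(2) I_subset[OF cI] in \<open>auto simp: ya\<close>)
 then have "\<delta> * (norm a)\<^sup>2 \<le> 0" using \<delta>(2) by simp
 then have "norm a = 0" using \<delta>(1) by (simp add: mult_le_0_iff)
 then show ?thesis using ya by simp
qed

lemma defect_bker_zero:
 assumes y: "y \<in> defect_space E z" and k: "bker V z (\<Gamma>\<^sub>0 y)" and z: "Im z \<noteq> 0"
 shows "y = (\<lambda>t. 0)"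
proof (rule defect_nrm2_zero[OF y])
 have "\<bar>Im z\<bar> * nrm2 y \<le> 0"
  using coercive(1)[OF defectD(1)[OF y] k z] defectD(3)[OF y sq_D(1)[OF defectD(1)[OF y]]] by simp
 then show "nrm2 y \<le> 0" using z by (simp add: mult_le_0_iff)
qed

end

context regular_triplet begin

text \<open>The boundary values of \<open>y\<^sub>0\<close> modulo the kernel of \<open>bker\<close> are attained on the defect space: subtract
 from \<open>y\<^sub>0\<close> approximate solutions \<open>y\<close> of \<open>(L - z) y = (L - z) y\<^sub>0\<close>, which converge by coercivity.\<close>

lemma defect_exists:
 assumes y0: "y0 \<in> \<D>" and z: "Im z \<noteq> 0"
 shows "\<exists>y\<in>defect_space E z. bker V z (\<Gamma>\<^sub>0 y - \<Gamma>\<^sub>0 y0)"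
proof -
 define K where "K = {y\<in>\<D>. bker V z (\<Gamma>\<^sub>0 y)}"
 have KD: "y \<in> \<D>" "bker V z (\<Gamma>\<^sub>0 y)" if "y \<in> K" for y using that by (auto simp: K_def)
 have K_lin: "(\<lambda>t. a *\<^sub>C y t + w t) \<in> K" if "y \<in> K" "w \<in> K" for a y w
  using max_domain_lincomb[OF KD(1)[OF that(1)] KD(1)[OF that(2)]] \<Gamma>_lincomb(1)[OF KD(1)[OF that(1)] KD(1)[OF that(2)]]
   bker_lincomb[OF KD(2)[OF that(1)] KD(2)[OF that(2)]] by (simp add: K_def)
 have \<Gamma>0: "\<Gamma>\<^sub>0 (\<lambda>t. 0) = 0" using \<Gamma>_lincomb(1)[OF zero_in_D zero_in_D, of "-1"] by (simp add: scaleC_minus_left)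
 have K0: "(\<lambda>t. 0) \<in> K" using zero_in_D \<Gamma>0 by (simp add: K_def bker_def)
 \<comment> \<open>The range of the restricted operator is closed under equality almost everywhere,
   since \<open>res\<close> is linear only in that sense and S has to be a subspace.\<close>
 define S where "S = {h. sq h \<and> (\<exists>y\<in>K. AE t in lebesgue_on I. h t = res z y t)}"
 have res_S: "res z y \<in> S" if "y \<in> K" for y using that sq_D(3)[OF KD(1)[OF that]] by (auto simp: S_def)
 have "\<exists>k g. (\<forall>m::nat. k m \<in> S) \<and> sq g \<and>
  (\<lambda>m. L2_dist (lebesgue_on I) (\<lambda>x. res z y0 x + k m x) g) \<longlonglongrightarrow> 0 \<and>
  (\<forall>h\<in>S. (\<integral>x. cinner (h x) (g x) \<partial>lebesgue_on I) = 0)"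
 proof (rule L2_projection)
  show "sq g" if "g \<in> S" for g using that by (simp add: S_def)
  show "sq (res z y0)" by (rule sq_D(3)[OF y0])
  have "AE t in lebesgue_on I. 0 = res z (\<lambda>t. 0) t" using res_zero by eventually_elim simp
  moreover have "sq (\<lambda>t. 0 :: 'h)" by (rule sq_D(1)[OF zero_in_D])
  ultimately show S0: "(\<lambda>x. 0) \<in> S" unfolding S_def using K0 by blast
  have lin: "(\<lambda>x. a *\<^sub>C g x + h x) \<in> S" if gh: "g \<in> S" "h \<in> S" for a g h
  proof -
   obtain y w where y: "y \<in> K" "AE t in lebesgue_on I. g t = res z y t"
   and w: "w \<in> K" "AE t in lebesgue_on I. h t = res z w t"
   using gh by (auto simp: S_def)
   from y(2) w(2) res_lincomb[OF KD(1)[OF y(1)] KD(1)[OF w(1)], of z a]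
   have "AE t in lebesgue_on I. a *\<^sub>C g t + h t = res z (\<lambda>t. a *\<^sub>C y t + w t) t"
   by eventually_elim simp
   moreover have "sq (\<lambda>x. a *\<^sub>C g x + h x)"
   using that by (intro sq_integrable_add sq_integrable_scaleC) (auto simp: S_def)
   ultimately show ?thesis unfolding S_def using K_lin[OF y(1) w(1), of a] by blast
  qed
  show "(\<lambda>x. g x + h x) \<in> S" if "g \<in> S" "h \<in> S" for g h using lin[OF that, of 1] by simp
  show "(\<lambda>x. a *\<^sub>C g x) \<in> S" if "g \<in> S" for a g using lin[OF that S0, of a] by simp
 qed
 then obtain k g where k: "\<And>m::nat. k m \<in> S" and g: "sq g"
  and kg: "(\<lambda>m. L2_dist (lebesgue_on I) (\<lambda>x. res z y0 x + k m x) g) \<longlonglongrightarrow> 0"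
  and orth: "\<And>h. h \<in> S \<Longrightarrow> ip h g = 0" unfolding ip_def by blast
 have "\<forall>m. \<exists>y. y \<in> K \<and> (AE t in lebesgue_on I. k m t = res z y t)" using k by (auto simp: S_def)
 from choice[OF this] obtain ys where ys: "\<And>m. ys m \<in> K" "\<And>m. AE t in lebesgue_on I. k m t = res z (ys m) t" by blast
 have compact: "w \<in> \<D> \<and> \<Gamma>\<^sub>0 w = 0 \<and> \<Gamma>\<^sub>1 w = 0"
  if "0 < c" "ereal c < endpoint E" "compact_solution c w" "state E w 0 = 0" for c w
 proof -
  have "w \<in> \<D>" by (rule compact_solution_max_domain[OF that(3) interior_in_I]) (use that in auto)
  then show ?thesis
   using compact_solution_boundary[OF that(3,1,2)] that(4)
   by (simp add: Gamma0_def Gamma1_def state_def prod_eq_iff)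
 qed
 have g0: "AE t in lebesgue_on I. g t = 0"
 proof -
  have "\<exists>x1. AE t in lebesgue_on I. g t = Y_zero E t (cnj z) x1"
  proof (rule weak_solution[OF g])
   fix c w assume "0 < c" "ereal c < endpoint E" "compact_solution c w" "state E w 0 = 0"
   from compact[OF this] have "w \<in> K" by (simp add: K_def bker_def)
   from orth[OF res_S[OF this]]
   show "(\<integral>t. cinner (lexpr E w t - z *\<^sub>C w t) (g t) \<partial>lebesgue_on I) = 0"
   by (simp add: ip_def res_def)
  qed
  then obtain x1 where x1: "AE t in lebesgue_on I. g t = Y_zero E t (cnj z) x1" by blast
  define g' where "g' = (\<lambda>t. Y_zero E t (cnj z) x1)"
  have gg: "AE t in lebesgue_on I. g t = g' t" "AE t in lebesgue_on I. g' t = g t"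
   using x1 by (auto simp: g'_def elim: eventually_mono)
  have sg': "sq g'" by (rule sq_integrable_AE_eq[OF g I_measurable gg(2)])
  have g'd: "g' \<in> defect_space E (cnj z)"
   using Y_zero_defect[of "cnj z" x1] sg' by (simp add: g'_def)
  \<comment> \<open>Orthogonality to the whole range, and not only to its compactly supported part,
    puts \<open>g'\<close> into the adjoint restriction, where coercivity at the conjugate point
    annihilates it.\<close>
  have "bker V (cnj z) (\<Gamma>\<^sub>0 g')"
  proof (rule bform_polarD[OF V_iso z, of _ "\<Gamma>\<^sub>1 g'"])
   fix a b assume "bker V z a"
   obtain y where y: "y \<in> \<D>" "\<Gamma>\<^sub>0 y = a" "\<Gamma>\<^sub>1 y = b" using \<Gamma>_surj by blast
   then have yK: "y \<in> K" using \<open>bker V z a\<close> by (simp add: K_def)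
   have "ip (res z y) g' = cnj (ip g' (res z y))" by (rule ip_cnj)
   also have "ip g' (res z y) = ip g (res z y)" by (rule ip_AE_left[OF sg' g sq_D(3)[OF y(1)] gg(2)])
   also have "cnj (ip g (res z y)) = ip (res z y) g" by (rule ip_cnj[symmetric])
   also have "\<dots> = 0" by (rule orth[OF res_S[OF yK]])
   finally show "bform V a b (\<Gamma>\<^sub>0 g') (\<Gamma>\<^sub>1 g') = 0"
   using green[OF y(1) defectD(1)[OF g'd], of z] defectD(4)[OF g'd sq_D(1)[OF y(1)]] y by simp
  qed
  then have "g' = (\<lambda>t. 0)" using defect_bker_zero[OF g'd] z by simp
  with gg(1) show ?thesis by simp
 qed
 \<comment> \<open>These have the boundary values of \<open>y0\<close> up to \<open>bker\<close>,
   and their residuals tend to zero.\<close>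
 define u where "u m = (\<lambda>t. 1 *\<^sub>C ys m t + y0 t)" for m
 have uD: "u m \<in> \<D>" for m unfolding u_def by (rule max_domain_lincomb[OF KD(1)[OF ys(1)] y0])
 have ru: "AE t in lebesgue_on I. res z y0 t + k m t - g t = res z (u m) t" for m
  using g0 ys(2)[of m] res_lincomb[OF KD(1)[OF ys(1)] y0, of z 1 m]
  unfolding u_def by eventually_elim simp
 have rlim: "(\<lambda>m. nrm2 (res z (u m))) \<longlonglongrightarrow> 0"
 proof -
  have "nrm2 (\<lambda>t. res z y0 t + k m t - g t) = nrm2 (res z (u m))" for m
  proof (rule nrm2_AE[OF _ sq_D(3)[OF uD] ru])
   show "sq (\<lambda>t. res z y0 t + k m t - g t)"
   using k[of m] by (intro sq_integrable_diff sq_integrable_add g sq_D(3) y0) (simp add: S_def)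
  qed
  with kg show ?thesis by (simp add: L2_dist_eq)
 qed
 have diff: "nrm2 (\<lambda>t. u m t - u j t) \<le> (2 * nrm2 (res z (u j)) + 2 * nrm2 (res z (u m))) / (Im z)\<^sup>2" for m j
 proof -
  let ?d = "\<lambda>t. (-1) *\<^sub>C u j t + u m t"
  have dD: "?d \<in> \<D>" by (rule max_domain_lincomb[OF uD uD])
  have "\<Gamma>\<^sub>0 ?d = (-1) *\<^sub>C \<Gamma>\<^sub>0 (ys j) + \<Gamma>\<^sub>0 (ys m)"
   unfolding \<Gamma>_lincomb(1)[OF uD uD] unfolding u_def \<Gamma>_lincomb(1)[OF KD(1)[OF ys(1)] y0]
   by (simp add: scaleC_minus_left)
  then have bk: "bker V z (\<Gamma>\<^sub>0 ?d)" using bker_lincomb[OF KD(2)[OF ys(1)] KD(2)[OF ys(1)]] by simp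
  have "(Im z)\<^sup>2 * nrm2 ?d \<le> nrm2 (res z ?d)" by (rule coercive(2)[OF dD bk z])
  also have "\<dots> = nrm2 (\<lambda>t. (-1) *\<^sub>C res z (u j) t + res z (u m) t)"
   by (rule nrm2_AE[OF sq_D(3)[OF dD] _ res_lincomb[OF uD uD]])
   (intro sq_integrable_add sq_integrable_scaleC sq_D(3) uD)
  also have "\<dots> \<le> 2 * nrm2 (res z (u j)) + 2 * nrm2 (res z (u m))"
   using nrm2_add_le[OF sq_D(3)[OF uD] sq_D(3)[OF uD], of "-1" z j z m] by simp
  finally have "(Im z)\<^sup>2 * nrm2 ?d \<le> 2 * nrm2 (res z (u j)) + 2 * nrm2 (res z (u m))" .
  moreover have "?d = (\<lambda>t. u m t - u j t)" by (simp add: scaleC_minus_left fun_eq_iff)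
  ultimately show ?thesis using z by (simp add: pos_le_divide_eq mult.commute)
 qed
 have "\<exists>v. sq v \<and> (\<lambda>m. L2_dist (lebesgue_on I) (u m) v) \<longlonglongrightarrow> 0"
 proof (rule L2_complete)
  show "sq (u m)" for m by (rule sq_D(1)[OF uD])
  fix e :: real assume e: "0 < e"
  define e' where "e' = e * (Im z)\<^sup>2 / 4"
  have e': "0 < e'" using e z by (simp add: e'_def)
  from order_tendstoD(2)[OF rlim e'] obtain N where N: "\<And>m. m \<ge> N \<Longrightarrow> nrm2 (res z (u m)) < e'"
   unfolding eventually_sequentially by blast
  show "\<exists>N. \<forall>m\<ge>N. \<forall>j\<ge>N. L2_dist (lebesgue_on I) (u m) (u j) \<le> e"
  proof (intro exI[of _ N] allI impI)
   fix m j assume mj: "N \<le> m" "N \<le> j"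
   have "nrm2 (\<lambda>t. u m t - u j t) \<le> (2 * nrm2 (res z (u j)) + 2 * nrm2 (res z (u m))) / (Im z)\<^sup>2"
   by (rule diff)
   also have "\<dots> \<le> (4 * e') / (Im z)\<^sup>2"
   using N[OF mj(1)] N[OF mj(2)] by (intro divide_right_mono) auto
   also have "\<dots> = e" using z by (simp add: e'_def)
   finally show "L2_dist (lebesgue_on I) (u m) (u j) \<le> e" by (simp add: L2_dist_eq)
  qed
 qed
 then obtain v where v: "sq v" "(\<lambda>m. L2_dist (lebesgue_on I) (u m) v) \<longlonglongrightarrow> 0" by blast
 have lim1: "(\<lambda>m. ip (res z (u m)) w) \<longlonglongrightarrow> 0" if w: "sq w" for w
 proof -
  have "(\<lambda>m. \<integral>x. cinner (res z (u m) x) (w x) \<partial>lebesgue_on I) \<longlonglongrightarrow> (\<integral>x. cinner ((\<lambda>x. 0) x) (w x) \<partial>lebesgue_on I)"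
   by (rule L2_converges_cinner(1)[OF sq_D(3)[OF uD] sq_D(1)[OF zero_in_D] w])
   (use rlim in \<open>simp add: L2_dist_eq\<close>)
  then show ?thesis by (simp add: ip_def)
 qed
 have lim2: "(\<lambda>m. ip (u m) w) \<longlonglongrightarrow> ip v w" if w: "sq w" for w
  unfolding ip_def by (rule L2_converges_cinner(1)[OF sq_D(1)[OF uD] v(1) w v(2)])
 have form_lim: "(\<lambda>m. bform V (\<Gamma>\<^sub>0 (u m)) (\<Gamma>\<^sub>1 (u m)) (\<Gamma>\<^sub>0 w) (\<Gamma>\<^sub>1 w)) \<longlonglongrightarrow> - ip v (res (cnj z) w)" if w: "w \<in> \<D>" for w
  using tendsto_diff[OF lim1[OF sq_D(1)[OF w]] lim2[OF sq_D(3)[OF w]], of "cnj z"]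
  by (simp add: green[OF uD w])
 have "\<exists>x1. AE t in lebesgue_on I. v t = Y_zero E t (cnj (cnj z)) x1"
 proof (rule weak_solution[OF v(1)])
  fix c w assume "0 < c" "ereal c < endpoint E" "compact_solution c w" "state E w 0 = 0"
  from compact[OF this] have w: "w \<in> \<D>" "\<Gamma>\<^sub>0 w = 0" "\<Gamma>\<^sub>1 w = 0" by auto
  have "(\<lambda>m. 0) \<longlonglongrightarrow> - ip v (res (cnj z) w)"
   using form_lim[OF w(1)] by (simp add: w bform_def)
  then have "ip v (res (cnj z) w) = 0" by (simp add: LIMSEQ_const_iff)
  then have "ip (res (cnj z) w) v = 0" using ip_cnj[of "res (cnj z) w" v] by simp
  then show "(\<integral>t. cinner (lexpr E w t - cnj z *\<^sub>C w t) (v t) \<partial>lebesgue_on I) = 0"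
   by (simp add: ip_def res_def)
 qed
 then obtain x1 where x1: "AE t in lebesgue_on I. v t = Y_zero E t z x1" by auto
 define y where "y = (\<lambda>t. Y_zero E t z x1)"
 have vy: "AE t in lebesgue_on I. y t = v t" using x1 by (auto simp: y_def elim: eventually_mono)
 have sy: "sq y" by (rule sq_integrable_AE_eq[OF v(1) I_measurable vy])
 have yd: "y \<in> defect_space E z" using Y_zero_defect[of z x1] sy by (simp add: y_def)
 have yD: "y \<in> \<D>" by (rule defectD(1)[OF yd])
 \<comment> \<open>Tested with \<open>bker\<close> at the conjugate point, the form does not see
   \<open>ys m\<close>, so the boundary forms of \<open>u m\<close> are constant in
   \<open>m\<close>.\<close>
 have form_eq: "bform V (\<Gamma>\<^sub>0 y) (\<Gamma>\<^sub>1 y) (\<Gamma>\<^sub>0 w) (\<Gamma>\<^sub>1 w) = bform V (\<Gamma>\<^sub>0 y0) (\<Gamma>\<^sub>1 y0) (\<Gamma>\<^sub>0 w) (\<Gamma>\<^sub>1 w)"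
  if w: "w \<in> \<D>" and bw: "bker V (cnj z) (\<Gamma>\<^sub>0 w)" for w
 proof -
  have "bform V (\<Gamma>\<^sub>0 (u m)) (\<Gamma>\<^sub>1 (u m)) (\<Gamma>\<^sub>0 w) (\<Gamma>\<^sub>1 w) = bform V (\<Gamma>\<^sub>0 y0) (\<Gamma>\<^sub>1 y0) (\<Gamma>\<^sub>0 w) (\<Gamma>\<^sub>1 w)" for m
   unfolding u_def \<Gamma>_lincomb[OF KD(1)[OF ys(1)] y0] bform_lincomb bform_polar[OF z KD(2)[OF ys(1)] bw] by simp
  then have "bform V (\<Gamma>\<^sub>0 y0) (\<Gamma>\<^sub>1 y0) (\<Gamma>\<^sub>0 w) (\<Gamma>\<^sub>1 w) = - ip v (res (cnj z) w)"
   using form_lim[OF w] by (simp add: LIMSEQ_const_iff)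
  moreover have "ip v (res (cnj z) w) = ip y (res (cnj z) w)"
   by (rule ip_AE_left[OF sy v(1) sq_D(3)[OF w] vy, symmetric])
  ultimately show ?thesis using green[OF yD w, of z] defectD(3)[OF yd sq_D(1)[OF w]] by simp
 qed
 have "bker V z (\<Gamma>\<^sub>0 y - \<Gamma>\<^sub>0 y0)"
 proof (rule bform_polarD'[OF V_iso z, of _ "\<Gamma>\<^sub>1 y - \<Gamma>\<^sub>1 y0"])
  fix a' b' assume a': "bker V (cnj z) a'"
  obtain w where w: "w \<in> \<D>" "\<Gamma>\<^sub>0 w = a'" "\<Gamma>\<^sub>1 w = b'" using \<Gamma>_surj by blast
  have "bform V (\<Gamma>\<^sub>0 y - \<Gamma>\<^sub>0 y0) (\<Gamma>\<^sub>1 y - \<Gamma>\<^sub>1 y0) a' b' =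
   bform V (\<Gamma>\<^sub>0 y) (\<Gamma>\<^sub>1 y) a' b' - bform V (\<Gamma>\<^sub>0 y0) (\<Gamma>\<^sub>1 y0) a' b'"
   using bform_lincomb[of V "-1" "\<Gamma>\<^sub>0 y0" "\<Gamma>\<^sub>0 y" "\<Gamma>\<^sub>1 y0" "\<Gamma>\<^sub>1 y" a' b'] by (simp add: scaleC_minus_left)
  then show "bform V (\<Gamma>\<^sub>0 y - \<Gamma>\<^sub>0 y0) (\<Gamma>\<^sub>1 y - \<Gamma>\<^sub>1 y0) a' b' = 0"
   using form_eq[OF w(1)] a' w by simp
 qed
 with yd show ?thesis by blast
qed

text \<open>\<open>\<Gamma>\<^sub>0\<close> is bounded on the defect spaces, by the uniform boundedness principle: every functional
 \<open>y \<mapsto> (\<Gamma>\<^sub>0 y, k)\<close> is given there by the inner product with some \<open>(L - z\<^sup>*) w\<close>.\<close>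

lemma defect_boundary_bounded: "\<exists>B>0. \<forall>y\<in>defect_space E z. (norm (\<Gamma>\<^sub>0 y))\<^sup>2 \<le> B * nrm2 y"
proof -
 define S where "S = {\<Gamma>\<^sub>0 y |y. y \<in> defect_space E z \<and> nrm2 y \<le> 1}"
 have "bounded S"
 proof (rule weakly_bounded_imp_bounded)
  fix k
  \<comment> \<open>With these boundary values the form of \<open>y\<close> and \<open>w\<close> is
    (\<Gamma>_0 y, k): \<open>adj V k\<close> accounts for the part of \<open>k\<close> in \<H>_1
    and \<open>P k\<close> for the part in \<H>_2, while \<Gamma>_1 y drops out.\<close>
  obtain w where w: "w \<in> \<D>" "\<Gamma>\<^sub>0 w = \<i> *\<^sub>C P k" "\<Gamma>\<^sub>1 w = - adj V k" using \<Gamma>_surj by blast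
  have "cmod (cinner x k) \<le> nrm2 (res (cnj z) w) / 2 + 1 / 2" if xS: "x \<in> S" for x
  proof -
   obtain y where y: "y \<in> defect_space E z" "nrm2 y \<le> 1" "x = \<Gamma>\<^sub>0 y" using xS by (auto simp: S_def)
   have a: "cinner (V b) (P k) = 0" for b
   using cinner_adj[of V b "P k"] by (simp add: proj_compl_isometry[OF V_iso])
   have "bform V (\<Gamma>\<^sub>0 y) (\<Gamma>\<^sub>1 y) (\<Gamma>\<^sub>0 w) (\<Gamma>\<^sub>1 w) = cinner (\<Gamma>\<^sub>0 y) (V (adj V k)) + cinner (\<Gamma>\<^sub>0 y) (P (P k))"
   by (simp add: bform_def w cinner_linear_simps a cinner_proj_compl proj_compl_isometry[OF V_iso])
   also have "\<dots> = cinner (\<Gamma>\<^sub>0 y) k"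
   by (simp add: proj_compl_isometry[OF V_iso]) (simp add: proj_compl_apply cinner_diff_right)
   finally have "cinner x k = - ip y (res (cnj z) w)"
   using green[OF defectD(1)[OF y(1)] w(1), of z] defectD(3)[OF y(1) sq_D(1)[OF w(1)]] y(3) by simp
   then have "cmod (cinner x k) = cmod (ip y (res (cnj z) w))" by simp
   also have "\<dots> \<le> nrm2 y / (2 * 1) + 1 / 2 * nrm2 (res (cnj z) w)"
   by (rule cmod_ip_le[OF sq_D(1)[OF defectD(1)[OF y(1)]] sq_D(3)[OF w(1)]]) simp
   finally show ?thesis using y(2) by simp
  qed
  then show "\<exists>B. \<forall>x\<in>S. cmod (cinner x k) \<le> B" by blast
 qed
 then obtain B where B: "0 < B" "\<And>x. x \<in> S \<Longrightarrow> norm x \<le> B" unfolding bounded_pos by blast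
 have "(norm (\<Gamma>\<^sub>0 y))\<^sup>2 \<le> B\<^sup>2 * nrm2 y" if y: "y \<in> defect_space E z" for y
 proof (cases "nrm2 y \<le> 0")
  case True
  then have "y = (\<lambda>t. 0)" by (rule defect_nrm2_zero[OF y])
  then have "\<Gamma>\<^sub>0 y = 0" using \<Gamma>_lincomb(1)[OF zero_in_D zero_in_D, of "-1"] by (simp add: scaleC_minus_left)
  then show ?thesis by (simp add: nrm2_nonneg)
 next
  case False
  define r where "r = sqrt (nrm2 y)"
  have r: "0 < r" "r\<^sup>2 = nrm2 y" using False by (auto simp: r_def)
  let ?a = "complex_of_real (1 / r)"
  let ?y = "\<lambda>t. ?a *\<^sub>C y t + 0"
  have yD: "y \<in> \<D>" by (rule defectD(1)[OF y])
  have y'D: "?y \<in> \<D>" by (rule max_domain_lincomb[OF yD zero_in_D])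
  have "AE t in lebesgue_on I. lexpr E ?y t = z *\<^sub>C ?y t"
   using defectD(2)[OF y] res_zero[of z] res_lincomb[OF yD zero_in_D, of z ?a]
   by eventually_elim (simp add: res_def)
  then have "?y \<in> defect_space E z" using y'D by (simp add: defect_space_def)
  moreover have "nrm2 ?y = (1 / r)\<^sup>2 * nrm2 y"
   using r(1) by (simp add: nrm2_def norm_scaleC norm_divide power_divide)
  then have "nrm2 ?y = (1 / r)\<^sup>2 * r\<^sup>2" by (simp only: r(2))
  then have "nrm2 ?y \<le> 1" using r(1) by (simp add: power_divide)
  ultimately have "norm (\<Gamma>\<^sub>0 ?y) \<le> B" by (intro B(2)) (auto simp: S_def)
  moreover have "\<Gamma>\<^sub>0 ?y = ?a *\<^sub>C \<Gamma>\<^sub>0 y"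
   using \<Gamma>_lincomb(1)[OF yD zero_in_D, of ?a] \<Gamma>_lincomb(1)[OF zero_in_D zero_in_D, of "-1"] by (simp add: scaleC_minus_left)
  ultimately have "norm (\<Gamma>\<^sub>0 y) \<le> B * r" using r(1) by (simp add: norm_scaleC norm_divide pos_divide_le_eq)
  then have "(norm (\<Gamma>\<^sub>0 y))\<^sup>2 \<le> (B * r)\<^sup>2" by (rule power_mono) simp
  then show ?thesis by (simp add: power_mult_distrib r(2))
 qed
 then show ?thesis using B(1) by (intro exI[of _ "B\<^sup>2"]) auto
qed

end

section \<open>The Weyl function\<close>

lemma bform_self: "bform V a b a b = \<i> * of_real (2 * Im (cinner (V b) a) + (norm (proj_compl V a))\<^sup>2)"
proof -
 have "cinner a (V b) = cnj (cinner (V b) a)" by (rule cinner_commute)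
 then show ?thesis by (simp add: bform_def cinner_self complex_eq_iff)
qed

lemma cinner_Im_op: "cinner (Im_op A a) a = of_real (Im (cinner (A a) a))"
proof -
 have "cinner (adj A a) a = cnj (cinner (A a) a)"
  using cinner_commute[of a "A a"] by (simp add: cinner_adj')
 then show ?thesis by (simp add: Im_op_def cinner_linear_simps complex_eq_iff Re_divide Im_divide)
qed

text \<open>The adjoint relation makes \<open>m\<close> linear and bounds the pairing of each
  \<open>k\<close> with the image of the unit ball by the norm of \<open>m' k\<close>; uniform
  boundedness does the rest.\<close>

lemma mutually_adjoint_bounded:
 fixes m :: "'a::complex_hilbert_space \<Rightarrow> 'b::complex_hilbert_space"
 assumes adj: "\<And>h k. cinner (m h) k = cinner h (m' k)"
 shows "\<exists>M. (\<forall>h. cblinfun_apply M h = m h) \<and> (\<forall>k. adj M k = m' k)"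
proof -
 define S where "S = {m h |h. norm h \<le> 1}"
 have "bounded S"
 proof (rule weakly_bounded_imp_bounded)
  fix k
  have "cmod (cinner y k) \<le> norm (m' k)" if "y \<in> S" for y
  proof -
   from that obtain h where h: "y = m h" "norm h \<le> 1" unfolding S_def by blast
   have "cmod (cinner y k) \<le> norm h * norm (m' k)" unfolding h(1) adj by (rule cmod_cinner_le)
   also have "\<dots> \<le> 1 * norm (m' k)" by (rule mult_right_mono[OF h(2)]) simp
   finally show ?thesis by simp
  qed
  then show "\<exists>B. \<forall>y\<in>S. cmod (cinner y k) \<le> B" by blast
 qed
 then obtain B where B: "0 < B" "\<And>y. y \<in> S \<Longrightarrow> norm y \<le> B" unfolding bounded_pos by blast
 have scale: "m (c *\<^sub>C x) = c *\<^sub>C m x" for c x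
  by (rule cinner_eqI) (simp add: adj cinner_linear_simps)
 have m: "bounded_clinear m"
 proof (rule bounded_linear_cblinfunI)
  show "m (x + y) = m x + m y" for x y
   by (rule cinner_eqI) (simp add: adj cinner_linear_simps)
  show "m (c *\<^sub>C x) = c *\<^sub>C m x" for c x by (rule scale)
  show "norm (m h) \<le> B * norm h" for h
  proof (cases "h = 0")
   case True
   then show ?thesis using scale[of 0 0] by simp
  next
   case False
   have "m (of_real (1 / norm h) *\<^sub>C h) \<in> S" using False by (auto simp: S_def norm_scaleC norm_divide)
   from B(2)[OF this] have "norm (m h) / norm h \<le> B" by (simp add: scale norm_scaleC norm_divide)
   then show ?thesis using False by (simp add: divide_le_eq)
  qed
 qed
 have M: "cblinfun_apply (CBlinfun m) h = m h" for h using m by (simp add: CBlinfun_inverse)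
 have "adj (CBlinfun m) k = m' k" for k
  by (rule cinner_eqI_right) (simp add: M adj flip: cinner_adj)
 with M show ?thesis by blast
qed

context regular_triplet begin

section \<open>Boundary maps on the defect spaces\<close>

lemma defect_lincomb:
 assumes "y \<in> defect_space E z" "w \<in> defect_space E z"
 shows "(\<lambda>t. a *\<^sub>C y t + w t) \<in> defect_space E z"
proof -
 note y = defectD(1,2)[OF assms(1)] and w = defectD(1,2)[OF assms(2)]
 have "AE t in lebesgue_on I. lexpr E (\<lambda>t. a *\<^sub>C y t + w t) t = z *\<^sub>C (a *\<^sub>C y t + w t)"
  using y(2) w(2) res_lincomb[OF y(1) w(1), of z a] by eventually_elim (simp add: res_def)
 then show ?thesis using max_domain_lincomb[OF y(1) w(1)] by (simp add: defect_space_def)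
qed

lemma defect_unique:
 assumes y: "y \<in> defect_space E z" and w: "w \<in> defect_space E z" and z: "Im z \<noteq> 0"
  and k: "bker V z (\<Gamma>\<^sub>0 w - \<Gamma>\<^sub>0 y)"
 shows "w = y"
proof -
 let ?d = "\<lambda>t. (-1) *\<^sub>C y t + w t"
 have "\<Gamma>\<^sub>0 ?d = \<Gamma>\<^sub>0 w - \<Gamma>\<^sub>0 y"
  unfolding \<Gamma>_lincomb(1)[OF defectD(1)[OF y] defectD(1)[OF w]] by (simp add: scaleC_minus_left)
 then have "?d = (\<lambda>t. 0)"
  using defect_bker_zero[OF defect_lincomb[OF y w] _ z] k by metis
 from fun_cong[OF this] show ?thesis by (auto simp: fun_eq_iff scaleC_minus_left)
qed

lemma defect_pos_ex: "0 < Im z \<Longrightarrow> \<exists>y\<in>defect_space E z. \<Gamma>\<^sub>0 y = h"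
proof -
 assume z: "0 < Im z"
 obtain y0 where y0: "y0 \<in> \<D>" "\<Gamma>\<^sub>0 y0 = h" using \<Gamma>_surj by blast
 from defect_exists[OF y0(1), of z] z y0(2) show ?thesis by (auto simp: bker_def)
qed

lemma defect_neg_ex: "Im z < 0 \<Longrightarrow> \<exists>y\<in>defect_space E z. adj V (\<Gamma>\<^sub>0 y) = k"
proof -
 assume z: "Im z < 0"
 obtain y0 where y0: "y0 \<in> \<D>" "\<Gamma>\<^sub>0 y0 = V k" using \<Gamma>_surj by blast
 from defect_exists[OF y0(1), of z] z y0(2) show ?thesis
  by (auto simp: bker_def isometric_op_adj_apply[OF V_iso])
qed

lemma gamma_plus_eq: "0 < Im z \<Longrightarrow> y \<in> defect_space E z \<Longrightarrow> gamma_plus E T z (\<Gamma>\<^sub>0 y) = y"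
 unfolding gamma_plus_def
 by (rule inv_into_f_f) (auto intro!: inj_onI defect_unique[where z = z] simp: bker_def)

lemma gamma_minus_eq: "Im z < 0 \<Longrightarrow> y \<in> defect_space E z \<Longrightarrow> gamma_minus E T z (adj V (\<Gamma>\<^sub>0 y)) = y"
 unfolding gamma_minus_def
 by (rule inv_into_f_f[where f = "\<lambda>y. adj V (\<Gamma>\<^sub>0 y)"])
  (auto intro!: inj_onI defect_unique[where z = z] simp: bker_def)

text \<open>Between the defect spaces at z and at its conjugate the integral terms of Green's
  formula vanish. What remains says that the maps defining M_+ and M_- are adjoint to each other,
  which yields existence, boundedness and the relation between the two at once.\<close>

lemma weyl_exists:
 assumes z: "0 < Im z"
 shows "\<exists>M. (\<forall>y\<in>defect_space E z. \<Gamma>\<^sub>1 y = cblinfun_apply M (\<Gamma>\<^sub>0 y)) \<and>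
  (\<forall>w\<in>defect_space E (cnj z). V (\<Gamma>\<^sub>1 w) + \<i> *\<^sub>C P (\<Gamma>\<^sub>0 w) = adj M (adj V (\<Gamma>\<^sub>0 w)))"
proof -
 have z': "Im (cnj z) < 0" using z by simp
 define yp where "yp = gamma_plus E T z"
 define ym where "ym = gamma_minus E T (cnj z)"
 have yp: "yp h \<in> defect_space E z \<and> \<Gamma>\<^sub>0 (yp h) = h" for h
  using defect_pos_ex[OF z, of h] gamma_plus_eq[OF z] by (auto simp: yp_def)
 have ym: "ym k \<in> defect_space E (cnj z) \<and> adj V (\<Gamma>\<^sub>0 (ym k)) = k" for k
 proof -
  obtain y where y: "y \<in> defect_space E (cnj z)" "adj V (\<Gamma>\<^sub>0 y) = k" using defect_neg_ex[OF z'] by blast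
  have "ym k = y" unfolding ym_def y(2)[symmetric] by (rule gamma_minus_eq[OF z' y(1)])
  with y show ?thesis by simp
 qed
 have rel: "cinner (\<Gamma>\<^sub>1 y) (adj V (\<Gamma>\<^sub>0 w)) = cinner (\<Gamma>\<^sub>0 y) (V (\<Gamma>\<^sub>1 w) + \<i> *\<^sub>C P (\<Gamma>\<^sub>0 w))"
  if y: "y \<in> defect_space E z" and w: "w \<in> defect_space E (cnj z)" for y w
 proof -
  have "bform V (\<Gamma>\<^sub>0 y) (\<Gamma>\<^sub>1 y) (\<Gamma>\<^sub>0 w) (\<Gamma>\<^sub>1 w) = 0"
   using green[OF defectD(1)[OF y] defectD(1)[OF w], of z]
   defectD(3)[OF y sq_D(1)[OF defectD(1)[OF w]]] defectD(4)[OF w sq_D(1)[OF defectD(1)[OF y]]] by simp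
  then show ?thesis
   by (simp add: bform_def cinner_linear_simps cinner_proj_compl proj_compl_isometry[OF V_iso] algebra_simps flip: cinner_adj)
 qed
 obtain M where M: "\<And>h. cblinfun_apply M h = \<Gamma>\<^sub>1 (yp h)"
  "\<And>k. adj M k = V (\<Gamma>\<^sub>1 (ym k)) + \<i> *\<^sub>C P (\<Gamma>\<^sub>0 (ym k))"
 proof -
  have "cinner (\<Gamma>\<^sub>1 (yp h)) k = cinner h (V (\<Gamma>\<^sub>1 (ym k)) + \<i> *\<^sub>C P (\<Gamma>\<^sub>0 (ym k)))" for h k
   using rel[of "yp h" "ym k"] yp[of h] ym[of k] by simp
  from mutually_adjoint_bounded[OF this] that show thesis by blast
 qed
 have "\<Gamma>\<^sub>1 y = M (\<Gamma>\<^sub>0 y)" if "y \<in> defect_space E z" for y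
  using gamma_plus_eq[OF z that] by (simp add: M yp_def)
 moreover have "V (\<Gamma>\<^sub>1 w) + \<i> *\<^sub>C P (\<Gamma>\<^sub>0 w) = adj M (adj V (\<Gamma>\<^sub>0 w))" if "w \<in> defect_space E (cnj z)" for w
  using gamma_minus_eq[OF z' that] by (simp add: M ym_def)
 ultimately show ?thesis by blast
qed

lemma weyl:
 assumes z: "0 < Im z"
 shows "y \<in> defect_space E z \<Longrightarrow> \<Gamma>\<^sub>1 y = M_plus E T z (\<Gamma>\<^sub>0 y)"
  and "w \<in> defect_space E (cnj z) \<Longrightarrow> V (\<Gamma>\<^sub>1 w) + \<i> *\<^sub>C P (\<Gamma>\<^sub>0 w) = adj (M_plus E T z) (adj V (\<Gamma>\<^sub>0 w))"
  and "M_minus E T (cnj z) = adj (M_plus E T z)"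
proof -
 have z': "Im (cnj z) < 0" using z by simp
 obtain M where M: "\<forall>y\<in>defect_space E z. \<Gamma>\<^sub>1 y = cblinfun_apply M (\<Gamma>\<^sub>0 y)"
  and M': "\<forall>w\<in>defect_space E (cnj z). V (\<Gamma>\<^sub>1 w) + \<i> *\<^sub>C P (\<Gamma>\<^sub>0 w) = adj M (adj V (\<Gamma>\<^sub>0 w))"
  using weyl_exists[OF z] by blast
 have eq: "M_plus E T z = M"
  unfolding M_plus_def
 proof (rule the_equality[where P = "\<lambda>M. \<forall>y\<in>defect_space E z. \<Gamma>\<^sub>1 y = cblinfun_apply M (\<Gamma>\<^sub>0 y)", OF M])
  fix N assume N: "\<forall>y\<in>defect_space E z. \<Gamma>\<^sub>1 y = cblinfun_apply N (\<Gamma>\<^sub>0 y)"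
  show "N = M"
  proof (rule cblinfun_eqI)
   fix h
   obtain y where y: "y \<in> defect_space E z" "\<Gamma>\<^sub>0 y = h" using defect_pos_ex[OF z] by blast
   show "cblinfun_apply N h = cblinfun_apply M h"
   using bspec[OF M y(1)] bspec[OF N y(1)] y(2) by simp
  qed
 qed
 have eq': "M_minus E T (cnj z) = adj M"
  unfolding M_minus_def
 proof (rule the_equality[where P = "\<lambda>M. \<forall>w\<in>defect_space E (cnj z). V (\<Gamma>\<^sub>1 w) + \<i> *\<^sub>C P (\<Gamma>\<^sub>0 w) = cblinfun_apply M (adj V (\<Gamma>\<^sub>0 w))", OF M'])
  fix N assume N: "\<forall>w\<in>defect_space E (cnj z). V (\<Gamma>\<^sub>1 w) + \<i> *\<^sub>C P (\<Gamma>\<^sub>0 w) = cblinfun_apply N (adj V (\<Gamma>\<^sub>0 w))"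
  show "N = adj M"
  proof (rule cblinfun_eqI)
   fix k
   obtain y where y: "y \<in> defect_space E (cnj z)" "adj V (\<Gamma>\<^sub>0 y) = k" using defect_neg_ex[OF z'] by blast
   show "cblinfun_apply N k = adj M k"
   using bspec[OF M' y(1)] bspec[OF N y(1)] y(2) by simp
  qed
 qed
 show "\<Gamma>\<^sub>1 y = M_plus E T z (\<Gamma>\<^sub>0 y)" if "y \<in> defect_space E z" unfolding eq by (rule bspec[OF M that])
 show "V (\<Gamma>\<^sub>1 w) + \<i> *\<^sub>C P (\<Gamma>\<^sub>0 w) = adj (M_plus E T z) (adj V (\<Gamma>\<^sub>0 w))" if "w \<in> defect_space E (cnj z)"
  unfolding eq by (rule bspec[OF M' that])
 show "M_minus E T (cnj z) = adj (M_plus E T z)" unfolding eq eq' ..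
qed

text \<open>The H^n components of \<Gamma>_1 y and \<Gamma>_0 y are, up to sign, the initial values
  of y, and these determine y through Y_0. As evaluation at \<open>t\<close> is thereby seen to be a
  bounded operator, \<open>CBlinfun\<close> returns that operator.\<close>

lemma Z_plus_eq:
 assumes z: "0 < Im z"
 shows "Z_plus E T t z = Y_zero E t z o\<^sub>C col_op (- (fst_op o\<^sub>C M_plus E T z)) fst_op"
proof -
 have "gamma_plus E T z h t = (Y_zero E t z o\<^sub>C col_op (- (fst_op o\<^sub>C M_plus E T z)) fst_op) h" for h
 proof -
  obtain y where y: "y \<in> defect_space E z" "\<Gamma>\<^sub>0 y = h" using defect_pos_ex[OF z] by blast
  have "fst (M_plus E T z h) = - vec1 E y 0" "fst h = vec2 E y 0"
   using weyl(1)[OF z y(1)] y(2) by (simp_all add: Gamma0_def Gamma1_def prod_eq_iff)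
  then have "(- fst (M_plus E T z h), fst h) = state E y 0" by (simp add: state_def)
  then show ?thesis
   using gamma_plus_eq[OF z y(1)] fun_cong[OF defect_eq_Y_zero[OF y(1)], of t] y(2) by simp
 qed
 then show ?thesis unfolding Z_plus_def by (simp only: cblinfun_apply_inverse)
qed

lemma Z_minus_eq:
 assumes z: "0 < Im z"
 shows "Z_minus E T t (cnj z) = Y_zero E t (cnj z) o\<^sub>C col_op (- (fst_op o\<^sub>C adj (M_plus E T z))) fst_op"
proof -
 have z': "Im (cnj z) < 0" using z by simp
 have "gamma_minus E T (cnj z) k t = (Y_zero E t (cnj z) o\<^sub>C col_op (- (fst_op o\<^sub>C adj (M_plus E T z))) fst_op) k" for k
 proof -
  obtain y where y: "y \<in> defect_space E (cnj z)" "adj V (\<Gamma>\<^sub>0 y) = k" using defect_neg_ex[OF z'] by blast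
  have "fst (adj (M_plus E T z) k) = - vec1 E y 0" "fst k = vec2 E y 0"
   using weyl(2)[OF z y(1)] y(2)
   by (auto simp: Gamma0_def Gamma1_def V_apply adj_V_apply P_apply prod_eq_iff)
  then have "(- fst (adj (M_plus E T z) k), fst k) = state E y 0" by (simp add: state_def)
  then show ?thesis
   using gamma_minus_eq[OF z' y(1)] fun_cong[OF defect_eq_Y_zero[OF y(1)], of t] y(2) by simp
 qed
 then show ?thesis unfolding Z_minus_def by (simp only: cblinfun_apply_inverse)
qed

lemma defect_form:
 assumes y: "y \<in> defect_space E z"
 shows "2 * Im (cinner (V (\<Gamma>\<^sub>1 y)) (\<Gamma>\<^sub>0 y)) + (norm (P (\<Gamma>\<^sub>0 y)))\<^sup>2 = 2 * Im z * nrm2 y"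
proof -
 have "\<i> * complex_of_real (2 * Im (cinner (V (\<Gamma>\<^sub>1 y)) (\<Gamma>\<^sub>0 y)) + (norm (P (\<Gamma>\<^sub>0 y)))\<^sup>2) = \<i> * of_real (2 * Im z * nrm2 y)"
  using green_self[OF defectD(1)[OF y], of z] defectD(3)[OF y sq_D(1)[OF defectD(1)[OF y]]]
  unfolding bform_self by simp
 then show ?thesis by (simp only: mult_cancel_left of_real_eq_iff complex_i_not_zero simp_thms)
qed

text \<open>On a defect space the boundary form equals 2 Im z times the squared norm, which
  dominates the squared norm of \<Gamma>_0 y by \<open>defect_boundary_bounded\<close>.\<close>

lemma weyl_estimates:
 assumes z: "0 < Im z"
 shows "\<exists>\<epsilon>>0. (\<forall>h. \<epsilon> * (norm h)\<^sup>2 \<le> 2 * Im (cinner (M_plus E T z h) (adj V h)) + (norm (P h))\<^sup>2) \<and>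
  (\<forall>b. 2 * Im (cinner (adj V (adj (M_plus E T z) b)) b) + (norm (P (adj (M_plus E T z) b)))\<^sup>2 \<le> - \<epsilon> * (norm b)\<^sup>2)"
proof -
 have z': "Im (cnj z) < 0" using z by simp
 obtain B1 where B1: "B1 > 0" "\<And>y. y \<in> defect_space E z \<Longrightarrow> (norm (\<Gamma>\<^sub>0 y))\<^sup>2 \<le> B1 * nrm2 y"
  using defect_boundary_bounded[of z] by blast
 obtain B2 where B2: "B2 > 0" "\<And>y. y \<in> defect_space E (cnj z) \<Longrightarrow> (norm (\<Gamma>\<^sub>0 y))\<^sup>2 \<le> B2 * nrm2 y"
  using defect_boundary_bounded[of "cnj z"] by blast
 define B where "B = B1 + B2"
 have B: "0 < B" using B1 B2 by (simp add: B_def)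
 \<comment> \<open>\<open>B\<close> is the sum of the bounds for z and for its conjugate, so that
   one constant serves both estimates.\<close>
 define \<epsilon> where "\<epsilon> = 2 * Im z / B"
 have \<epsilon>: "0 < \<epsilon>" using z B by (simp add: \<epsilon>_def)
 have le: "\<epsilon> * x \<le> 2 * Im z * nrm2 y" if "x \<le> B1 * nrm2 y \<or> x \<le> B2 * nrm2 y" for x y
 proof -
  have "x \<le> B * nrm2 y"
   using that nrm2_nonneg[of y] B1(1) B2(1) by (auto simp: B_def distrib_right intro: order_trans)
  then have "\<epsilon> * x \<le> \<epsilon> * (B * nrm2 y)" using \<epsilon> by (intro mult_left_mono) auto
  also have "\<dots> = 2 * Im z * nrm2 y" using B by (simp add: \<epsilon>_def)
  finally show ?thesis .
 qed
 show ?thesis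
 proof (intro exI[of _ \<epsilon>] conjI allI \<epsilon>)
  fix h
  obtain y where y: "y \<in> defect_space E z" "\<Gamma>\<^sub>0 y = h" using defect_pos_ex[OF z] by blast
  have "cinner (M_plus E T z h) (adj V h) = cinner (V (\<Gamma>\<^sub>1 y)) (\<Gamma>\<^sub>0 y)"
   using weyl(1)[OF z y(1)] y(2) cinner_adj[of V "\<Gamma>\<^sub>1 y" h] by simp
  then show "\<epsilon> * (norm h)\<^sup>2 \<le> 2 * Im (cinner (M_plus E T z h) (adj V h)) + (norm (P h))\<^sup>2"
   using le[of "(norm h)\<^sup>2" y] B1(2)[OF y(1)] defect_form[OF y(1)] y(2) by simp
 next
  fix k
  obtain y where y: "y \<in> defect_space E (cnj z)" "adj V (\<Gamma>\<^sub>0 y) = k" using defect_neg_ex[OF z'] by blast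
  have w: "adj (M_plus E T z) k = V (\<Gamma>\<^sub>1 y) + \<i> *\<^sub>C P (\<Gamma>\<^sub>0 y)" using weyl(2)[OF z y(1)] y(2) by simp
  have 1: "adj V (adj (M_plus E T z) k) = \<Gamma>\<^sub>1 y"
   unfolding w by (simp add: isometric_op_adj_apply[OF V_iso] proj_compl_isometry[OF V_iso])
  have 2: "P (adj (M_plus E T z) k) = \<i> *\<^sub>C P (\<Gamma>\<^sub>0 y)"
   unfolding w by (simp add: proj_compl_isometry[OF V_iso])
  have 3: "cinner (\<Gamma>\<^sub>1 y) k = cinner (V (\<Gamma>\<^sub>1 y)) (\<Gamma>\<^sub>0 y)"
   using cinner_adj[of V "\<Gamma>\<^sub>1 y" "\<Gamma>\<^sub>0 y"] y(2) by simp
  have "norm k \<le> norm (\<Gamma>\<^sub>0 y)" using norm_adj_isometric_le[OF V_iso, of "\<Gamma>\<^sub>0 y"] y(2) by simp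
  then have "(norm k)\<^sup>2 \<le> B2 * nrm2 y" using B2(2)[OF y(1)] by (meson norm_ge_zero order_trans power_mono)
  then have "\<epsilon> * (norm k)\<^sup>2 \<le> 2 * Im z * nrm2 y" by (intro le) simp
  then show "2 * Im (cinner (adj V (adj (M_plus E T z) k)) k) + (norm (P (adj (M_plus E T z) k)))\<^sup>2 \<le> - \<epsilon> * (norm k)\<^sup>2"
   unfolding 1 2 3 using defect_form[OF y(1)] by (simp add: norm_scaleC)
 qed
qed

section \<open>The Green function\<close>

text \<open>Both factors are Y_0 times an initial value, so the claim reduces to the factorisations
  of \<Omega> minus and plus half of J, for t < x and x < t respectively; the pair (D_0, D_1) enters
  at the conjugate point.\<close>

lemma green_function_upper:
 fixes \<tau> :: "(('h, 'n) vec \<times> 'k0, ('h, 'n) vec \<times> 'k1, 'kp::complex_hilbert_space, 'km::complex_hilbert_space) pair_collection"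
 assumes \<tau>: "\<tau> \<in> R_tilde V" and z: "0 < Im z" and xt: "x \<noteq> t"
 shows "green_function E T \<tau> x t z =
  Y_zero E x z o\<^sub>C (Omega E T \<tau> z + (1 / 2 * sgn (t - x)) *\<^sub>R J_op) o\<^sub>C adj (Y_zero E t (cnj z))"
proof -
 have z': "Im (cnj z) < 0" using z by simp
 obtain \<epsilon> where \<epsilon>: "\<epsilon> > 0"
  "\<And>h. \<epsilon> * (norm h)\<^sup>2 \<le> 2 * Im (cinner (M_plus E T z h) (adj V h)) + (norm (P h))\<^sup>2"
  "\<And>b. 2 * Im (cinner (adj V (adj (M_plus E T z) b)) b) + (norm (P (adj (M_plus E T z) b)))\<^sup>2 \<le> - \<epsilon> * (norm b)\<^sup>2"
  using weyl_estimates[OF z] by blast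
 have C: "nonneg_op (2 *\<^sub>R Im_op (C1 \<tau> z o\<^sub>C adj (C0 \<tau> z o\<^sub>C V)) + (C0 \<tau> z o\<^sub>C P) o\<^sub>C adj (C0 \<tau> z o\<^sub>C P))"
  "boundedly_invertible (C0 \<tau> z - \<i> *\<^sub>C (C1 \<tau> z o\<^sub>C adj V))"
  and D: "nonneg_op (- (2 *\<^sub>R Im_op (D1 \<tau> (cnj z) o\<^sub>C adj (D0 \<tau> (cnj z) o\<^sub>C V)) +
   (D0 \<tau> (cnj z) o\<^sub>C P) o\<^sub>C adj (D0 \<tau> (cnj z) o\<^sub>C P)))"
  "boundedly_invertible (D0 \<tau> (cnj z) o\<^sub>C V + \<i> *\<^sub>C D1 \<tau> (cnj z))"
  and CD: "C1 \<tau> z o\<^sub>C adj (D0 \<tau> (cnj z) o\<^sub>C V) - C0 \<tau> z o\<^sub>C V o\<^sub>C adj (D1 \<tau> (cnj z)) +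
   \<i> *\<^sub>C ((C0 \<tau> z o\<^sub>C P) o\<^sub>C adj (D0 \<tau> (cnj z) o\<^sub>C P)) = 0"
  using \<tau> z z' unfolding R_tilde_def Let_def by simp_all
 have PP: "cinner (P (P a)) a = of_real ((norm (P a))\<^sup>2)" for a
  by (simp add: cinner_proj_compl[of V "P a"] cinner_self)
 interpret W: weyl_pair_prod V "M_plus E T z" "C0 \<tau> z" "C1 \<tau> z" "D0 \<tau> (cnj z)" "D1 \<tau> (cnj z)" \<epsilon> "incl T"
 proof
  show "isometric_op V" by (rule V_iso)
  show "0 \<le> 2 * Im (cinner (adj V (adj (C0 \<tau> z) a)) (adj (C1 \<tau> z) a)) + (norm (P (adj (C0 \<tau> z) a)))\<^sup>2" for a
  proof -
   have "cinner ((C0 \<tau> z) (P (P (adj (C0 \<tau> z) a)))) a = of_real ((norm (P (adj (C0 \<tau> z) a)))\<^sup>2)"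
   unfolding PP[symmetric] by (rule cinner_adj)
   then have "Re (cinner ((C0 \<tau> z) (P (P (adj (C0 \<tau> z) a)))) a) = (norm (P (adj (C0 \<tau> z) a)))\<^sup>2"
   by (simp only: Re_complex_of_real)
   moreover have "cinner ((C1 \<tau> z) (adj V (adj (C0 \<tau> z) a))) a = cinner (adj V (adj (C0 \<tau> z) a)) (adj (C1 \<tau> z) a)"
   by (rule cinner_adj)
   ultimately show ?thesis
   using conjunct2[OF spec[OF C(1)[unfolded nonneg_op_def], of a]]
   by (simp add: cinner_add_left cinner_scaleR_left cinner_Im_op adj_comp)
  qed
  show "2 * Im (cinner (adj V (adj (D0 \<tau> (cnj z)) a)) (adj (D1 \<tau> (cnj z)) a)) + (norm (P (adj (D0 \<tau> (cnj z)) a)))\<^sup>2 \<le> 0" for a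
  proof -
   have "cinner ((D0 \<tau> (cnj z)) (P (P (adj (D0 \<tau> (cnj z)) a)))) a = of_real ((norm (P (adj (D0 \<tau> (cnj z)) a)))\<^sup>2)"
   unfolding PP[symmetric] by (rule cinner_adj)
   then have "Re (cinner ((D0 \<tau> (cnj z)) (P (P (adj (D0 \<tau> (cnj z)) a)))) a) = (norm (P (adj (D0 \<tau> (cnj z)) a)))\<^sup>2"
   by (simp only: Re_complex_of_real)
   moreover have "cinner ((D1 \<tau> (cnj z)) (adj V (adj (D0 \<tau> (cnj z)) a))) a = cinner (adj V (adj (D0 \<tau> (cnj z)) a)) (adj (D1 \<tau> (cnj z)) a)"
   by (rule cinner_adj)
   ultimately show ?thesis
   using conjunct2[OF spec[OF D(1)[unfolded nonneg_op_def], of a]]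
   by (simp add: cinner_add_left cinner_diff_left cinner_minus_left cinner_scaleR_left cinner_Im_op adj_comp)
  qed
  show "C1 \<tau> z (adj V (adj (D0 \<tau> (cnj z)) a)) - C0 \<tau> z (V (adj (D1 \<tau> (cnj z)) a)) +
   \<i> *\<^sub>C C0 \<tau> z (P (adj (D0 \<tau> (cnj z)) a)) = 0" for a
   using arg_cong[OF CD, of "\<lambda>A. cblinfun_apply A a"]
   by (simp add: adj_comp proj_compl_isometry[OF V_iso])
 qed (use \<epsilon> C D in \<open>simp_all add: incl_H_def\<close>)
 have \<Omega>: "Omega E T \<tau> z = compress W.Omega_op"
  using z W.op_of_relation_eq
  by (simp add: Omega_def Omega_tilde_plus_def Let_def tau_plus_def W.Omega_op_def)
 show ?thesis
 proof (cases "t < x")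
  case True
  have "Y_tau_minus E T \<tau> t (cnj z) = Y_zero E t (cnj z) o\<^sub>C
   (col_op (- adj (C0 \<tau> z o\<^sub>C emb_fst)) (adj (C1 \<tau> z o\<^sub>C emb_fst)) o\<^sub>C
   inverse_op (adj (C0 \<tau> z) - adj (M_plus E T z) o\<^sub>C adj (C1 \<tau> z)))"
   by (simp add: Y_tau_minus_def Let_def op_solution_with_init_eq[OF reg] weyl(3)[OF z])
  moreover have "Omega E T \<tau> z + (1 / 2 * sgn (t - x)) *\<^sub>R J_op = compress W.Omega_op - (1 / 2) *\<^sub>R J_op"
   using True by (simp add: \<Omega>)
  ultimately show ?thesis
   using True z unfolding W.Omega_minus_J
   by (simp add: green_function_def Z_plus_eq adj_comp comp_op_assoc)
 next
  case False
  then have xt': "x < t" using xt by simp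
  have "Y_tau_plus E T \<tau> x z = Y_zero E x z o\<^sub>C
   (col_op (- adj (D0 \<tau> (cnj z) o\<^sub>C emb_fst)) (adj (D1 \<tau> (cnj z) o\<^sub>C emb_fst)) o\<^sub>C
   inverse_op (adj (D0 \<tau> (cnj z) o\<^sub>C V) - M_plus E T z o\<^sub>C
   adj (D1 \<tau> (cnj z) o\<^sub>C adj V + \<i> *\<^sub>C (D0 \<tau> (cnj z) o\<^sub>C P))))"
   by (simp add: Y_tau_plus_def Let_def op_solution_with_init_eq[OF reg])
  moreover have "Omega E T \<tau> z + (1 / 2 * sgn (t - x)) *\<^sub>R J_op = compress W.Omega_op + (1 / 2) *\<^sub>R J_op"
   using xt' by (simp add: \<Omega>)
  ultimately show ?thesis
   using xt' z unfolding W.Omega_plus_J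
   by (simp add: green_function_def Z_minus_eq adj_comp comp_op_assoc)
 qed
qed

end

lemma adj_J_op: "adj J_op = - J_op"
 by (rule adj_eqI) (simp add: J_op_def block_op_apply cinner_prod_def cinner_linear_simps)

lemma adj_compress: "adj (compress A) = compress (adj A)"
 by (simp add: compress_def adj_comp adj_block_op adj_fst_op adj_emb_fst comp_op_assoc)

text \<open>Taking adjoints exchanges the two factors, hence the two variables and the two
  half-planes in the definition.\<close>

lemma green_function_adj:
 assumes "Im z < 0" "x \<noteq> t"
 shows "green_function E T \<tau> x t z = adj (green_function E T \<tau> t x (cnj z))"
 using assms by (auto simp: green_function_def adj_comp)

theorem theorem5p4:
  fixes E :: "('h::{complex_hilbert_space,second_countable_topology}, 'n::{finite,linorder}) diff_expr"
    and T :: "('h, 'k0::complex_hilbert_space, 'k1::complex_hilbert_space) triplet"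
    and \<tau> :: "(('h, 'n) vec \<times> 'k0, ('h, 'n) vec \<times> 'k1,
               'kp::complex_hilbert_space, 'km::complex_hilbert_space) pair_collection"
    and x t :: real and z :: complex
  assumes "regular_diff_expr E"
    and "decomposing_D_triplet E T"
    and "\<tau> \<in> R_tilde (incl_H E T)"
    and "x \<in> interval E" and "t \<in> interval E" and "x \<noteq> t"
    and "Im z \<noteq> 0"
  shows "green_function E T \<tau> x t z =
    Y_zero E x z o\<^sub>C (Omega E T \<tau> z + (1 / 2 * sgn (t - x)) *\<^sub>R J_op) o\<^sub>C adj (Y_zero E t (cnj z))"
proof (cases "0 < Im z")
  case True
  interpret regular_triplet E T by standard (rule assms)+
  show ?thesis using assms True by (intro green_function_upper)
next
  case False
  interpret regular_triplet E T by standard (rule assms)+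
  have z: "Im z < 0" using False assms by simp
  have "green_function E T \<tau> x t z = adj (green_function E T \<tau> t x (cnj z))"
    by (rule green_function_adj[OF z assms(6)])
  also have "green_function E T \<tau> t x (cnj z) =
    Y_zero E t (cnj z) o\<^sub>C (Omega E T \<tau> (cnj z) + (1 / 2 * sgn (x - t)) *\<^sub>R J_op) o\<^sub>C adj (Y_zero E x (cnj (cnj z)))"
    by (rule green_function_upper) (use z assms in auto)
  also have "adj \<dots> = Y_zero E x z o\<^sub>C (adj (Omega E T \<tau> (cnj z)) + (1 / 2 * sgn (x - t)) *\<^sub>R adj J_op) o\<^sub>C adj (Y_zero E t (cnj z))"
    by (simp add: adj_comp adj_add adj_scaleR comp_op_assoc)
  also have "adj (Omega E T \<tau> (cnj z)) = Omega E T \<tau> z"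
    using z by (simp add: Omega_def Omega_tilde_minus_def adj_compress)
  \<comment> \<open>The sign change of J under the adjoint compensates the exchange of
    \<open>x\<close> and \<open>t\<close> in \<open>sgn\<close>.\<close>
  also have "(1 / 2 * sgn (x - t)) *\<^sub>R adj J_op = (1 / 2 * sgn (t - x)) *\<^sub>R (J_op :: ('h, 'n) vec \<times> ('h, 'n) vec \<Rightarrow>\<^sub>B ('h, 'n) vec \<times> ('h, 'n) vec)"
    using assms(6) by (simp add: adj_J_op sgn_if)
  finally show ?thesis .
qed

end
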